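(* Let $M$ be a Noetherian graded $S$-module of Krull dimension $d$, and let $\theta_1,\dots,\theta_d$ be a linear system of parameters (l.s.o.p.) for $M$. For $C\subseteq[d]=\{1,\dots,d\}$ put $\theta^C=\prod_{i\in C}\theta_i$. If $M$ is Buchsbaum, then $$\operatorname{Soc}\bigl(M/(\theta_1,\dots,\theta_d)M\bigr)\;\cong\;\left(\bigoplus_{C\subsetneq[d]} H^{|C|}(\theta^C M)\right)\oplus\mathcal{S},$$ where $\mathcal{S}$ is a graded submodule of $\operatorname{Soc} H^d(\theta^{[d]}M)$.
   Context: Let $\mathbf{k}$ be an infinite field of arbitrary characteristic, $S=\mathbf{k}[x_1,\dots,x_n]$ the polynomial ring with its standard $\mathbb{Z}$-grading ($\deg x_i=1$), $\mathfrak{M}=(x_1,\dots,x_n)$ its irrelevant ideal. All modules are Noetherian $\mathbb{Z}$-graded $S$-modules (local cohomology modules are graded but need not be Noetherian); the isomorphism is of graded modules. $H^i(M)$ is the $i$th local cohomology module of $M$ with respect to $\mathfrak{M}$, with its natural grading. The socle is $\operatorname{Soc} M=\{y\in M : \mathfrak{M}\cdot y=0\}$. $\theta^C M$ is viewed as a graded submodule of $M$ (with $\theta^\emptyset=1$). A homogeneous system of parameters (h.s.o.p.) of $M$ with $\dim M=d$ is a sequence $\theta_1,\dots,\theta_d$ of homogeneous elements of $\mathfrak{M}$ such that $\dim M/(\theta_1,\dots,\theta_d)M=0$; it is a linear system of parameters (l.s.o.p.) if all $\theta_i$ have degree 1. A sequence $\theta_1,\dots,\theta_r\in\mathfrak{M}$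 is a weak $M$-sequence if $(\theta_1,\dots,\theta_{i-1})M:\theta_i=(\theta_1,\dots,\theta_{i-1})M:\mathfrak{M}$ for $i=1,\dots,r$ (colons taken in $M$). $M$ is Buchsbaum if every h.s.o.p. of $M$ is a weak $M$-sequence. *)

theory Defs
  imports
    "HOL-Library.Poly_Mapping"
    "HOL-Library.Extended_Real"
    "HOL-Algebra.Ideal"
    "HOL-Algebra.Module"
begin

section \<open>The polynomial ring and its standard grading\<close>

text \<open>
  A polynomial is a finitely supported function from exponent vectors to coefficients; the
  exponent vectors are finitely supported functions on variable indices. The ring in the
  variables \<open>x\<^sub>1, \<dots>, x\<^sub>n\<close> consists of the polynomials that only involve indices in \<open>{1..n}\<close>.
\<close>

type_synonym 'k mpoly = "(nat \<Rightarrow>\<^sub>0 nat) \<Rightarrow>\<^sub>0 'k"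

definition mpoly_ring :: "nat \<Rightarrow> ('k::field) mpoly ring" where
  "mpoly_ring n =
    \<lparr>carrier = {p. \<forall>e\<in>Poly_Mapping.keys p. Poly_Mapping.keys e \<subseteq> {1..n}},
     mult = (*), one = 1, zero = 0, add = (+)\<rparr>"

definition mvar :: "nat \<Rightarrow> ('k::field) mpoly" where
  "mvar i = Poly_Mapping.single (Poly_Mapping.single i 1) 1"

definition exp_deg :: "(nat \<Rightarrow>\<^sub>0 nat) \<Rightarrow> nat" where
  "exp_deg e = (\<Sum>i\<in>Poly_Mapping.keys e. Poly_Mapping.lookup e i)"

definition mpoly_grade :: "nat \<Rightarrow> int \<Rightarrow> ('k::field) mpoly set" where
  "mpoly_grade n j =
    {p \<in> carrier (mpoly_ring n). \<forall>e\<in>Poly_Mapping.keys p. int (exp_deg e) = j}"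

definition irrelevant_ideal :: "nat \<Rightarrow> ('k::field) mpoly set" where
  "irrelevant_ideal n = Idl\<^bsub>mpoly_ring n\<^esub> (mvar ` {1..n})"


section \<open>Graded modules\<close>

text \<open>
  The fields \<^const>\<open>mult\<close> and \<^const>\<open>one\<close>, which the record of modules inherits from the record
  of rings, carry no meaning for a module and are left undefined in the constructions below.
\<close>

record ('a, 'b) gmodule = "('a, 'b) module" +
  grade :: "int \<Rightarrow> 'b set"

locale graded_module =
  module "mpoly_ring n :: ('k::field) mpoly ring" M
  for n :: nat and M :: "(('k::field) mpoly, 'b) gmodule" (structure) +
  assumes grade_subgroup: "subgroup (grade M j) (add_monoid M)"
    and grade_smult:
      "a \<in> mpoly_grade n i \<Longrightarrow> y \<in> grade M j \<Longrightarrow> a \<odot>\<^bsub>M\<^esub> y \<in> grade M (i + j)"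
    and grade_direct_sum:
      "y \<in> carrier M \<Longrightarrow>
        \<exists>!c. (\<forall>j. c j \<in> grade M j) \<and> finite {j. c j \<noteq> \<zero>\<^bsub>M\<^esub>} \<and>
             y = (\<Oplus>\<^bsub>M\<^esub>j\<in>{j. c j \<noteq> \<zero>\<^bsub>M\<^esub>}. c j)"

definition sub_gmodule :: "('a, 'b) gmodule \<Rightarrow> 'b set \<Rightarrow> ('a, 'b) gmodule" where
  "sub_gmodule M N = M\<lparr>carrier := N, grade := (\<lambda>j. grade M j \<inter> N)\<rparr>"

text \<open>
  A submodule is graded if it is the direct sum of its intersections with the graded pieces.
\<close>

definition graded_submodule :: "nat \<Rightarrow> 'b set \<Rightarrow> (('k::field) mpoly, 'b) gmodule \<Rightarrow> bool" where
  "graded_submodule n N M \<longleftrightarrow>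
    submodule N (mpoly_ring n) M \<and> graded_module n (sub_gmodule M N)"

definition quot_gmodule :: "('a, 'b) gmodule \<Rightarrow> 'b set \<Rightarrow> ('a, 'b set) gmodule" where
  "quot_gmodule M N =
    \<lparr>carrier = a_rcosets\<^bsub>M\<^esub> N, mult = undefined, one = undefined,
     zero = N, add = set_add M,
     smult = (\<lambda>a X. \<Union>x\<in>X. N +>\<^bsub>M\<^esub> (a \<odot>\<^bsub>M\<^esub> x)),
     grade = (\<lambda>j. (\<lambda>x. N +>\<^bsub>M\<^esub> x) ` grade M j)\<rparr>"

definition dsum_gmodule :: "'i set \<Rightarrow> ('i \<Rightarrow> ('a, 'b) gmodule) \<Rightarrow> ('a, 'i \<Rightarrow> 'b) gmodule" where
  "dsum_gmodule I M =
    \<lparr>carrier = {f \<in> \<Pi>\<^sub>E i\<in>I. carrier (M i). finite {i \<in> I. f i \<noteq> \<zero>\<^bsub>M i\<^esub>}},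
     mult = undefined, one = undefined,
     zero = (\<lambda>i\<in>I. \<zero>\<^bsub>M i\<^esub>),
     add = (\<lambda>f g. \<lambda>i\<in>I. f i \<oplus>\<^bsub>M i\<^esub> g i),
     smult = (\<lambda>a f. \<lambda>i\<in>I. a \<odot>\<^bsub>M i\<^esub> f i),
     grade = (\<lambda>j. {f \<in> \<Pi>\<^sub>E i\<in>I. grade (M i) j. finite {i \<in> I. f i \<noteq> \<zero>\<^bsub>M i\<^esub>}})\<rparr>"

definition prod_gmodule ::
  "('a, 'b) gmodule \<Rightarrow> ('a, 'c) gmodule \<Rightarrow> ('a, 'b \<times> 'c) gmodule" where
  "prod_gmodule M N =
    \<lparr>carrier = carrier M \<times> carrier N,
     mult = undefined, one = undefined,
     zero = (\<zero>\<^bsub>M\<^esub>, \<zero>\<^bsub>N\<^esub>),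
     add = (\<lambda>(x, y) (x', y'). (x \<oplus>\<^bsub>M\<^esub> x', y \<oplus>\<^bsub>N\<^esub> y')),
     smult = (\<lambda>a (x, y). (a \<odot>\<^bsub>M\<^esub> x, a \<odot>\<^bsub>N\<^esub> y)),
     grade = (\<lambda>j. grade M j \<times> grade N j)\<rparr>"

definition gmodule_iso ::
  "nat \<Rightarrow> (('k::field) mpoly, 'b) gmodule \<Rightarrow> ('k mpoly, 'c) gmodule \<Rightarrow> bool" where
  "gmodule_iso n M N \<longleftrightarrow>
    (\<exists>f. bij_betw f (carrier M) (carrier N) \<and>
         (\<forall>x\<in>carrier M. \<forall>y\<in>carrier M. f (x \<oplus>\<^bsub>M\<^esub> y) = f x \<oplus>\<^bsub>N\<^esub> f y) \<and>
         (\<forall>a\<in>carrier (mpoly_ring n). \<forall>x\<in>carrier M. f (a \<odot>\<^bsub>M\<^esub> x) = a \<odot>\<^bsub>N\<^esub> f x) \<and>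
         (\<forall>j. f ` grade M j = grade N j))"

definition module_span :: "('a, 'c) ring_scheme \<Rightarrow> ('a, 'b, 'd) module_scheme \<Rightarrow> 'b set \<Rightarrow> 'b set"
  where "module_span R M X = \<Inter>{N. submodule N R M \<and> X \<subseteq> N}"

definition noetherian_module :: "('a, 'c) ring_scheme \<Rightarrow> ('a, 'b, 'd) module_scheme \<Rightarrow> bool" where
  "noetherian_module R M \<longleftrightarrow>
    (\<forall>N. submodule N R M \<longrightarrow>
      (\<exists>X. finite X \<and> X \<subseteq> carrier M \<and> N = module_span R M X))"

definition ideal_smult ::
  "('a, 'c) ring_scheme \<Rightarrow> 'a set \<Rightarrow> ('a, 'b, 'd) module_scheme \<Rightarrow> 'b set" where
  "ideal_smult R I M = module_span R M {a \<odot>\<^bsub>M\<^esub> y | a y. a \<in> I \<and> y \<in> carrier M}"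

definition elem_smult :: "'a \<Rightarrow> ('a, 'b) gmodule \<Rightarrow> ('a, 'b) gmodule" where
  "elem_smult a M = sub_gmodule M ((\<lambda>y. a \<odot>\<^bsub>M\<^esub> y) ` carrier M)"

definition socle :: "nat \<Rightarrow> (('k::field) mpoly, 'b) gmodule \<Rightarrow> ('k mpoly, 'b) gmodule" where
  "socle n M =
    sub_gmodule M {y \<in> carrier M. \<forall>a\<in>irrelevant_ideal n. a \<odot>\<^bsub>M\<^esub> y = \<zero>\<^bsub>M\<^esub>}"


section \<open>Krull dimension, parameters, Buchsbaum modules\<close>

definition annihilator :: "('a, 'c) ring_scheme \<Rightarrow> ('a, 'b, 'd) module_scheme \<Rightarrow> 'a set" where
  "annihilator R M = {a \<in> carrier R. \<forall>y\<in>carrier M. a \<odot>\<^bsub>M\<^esub> y = \<zero>\<^bsub>M\<^esub>}"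

text \<open>
  The Krull dimension of a finitely generated module \<open>M\<close> is that of \<open>R / Ann M\<close>, i.e. the
  supremum of the lengths of chains of primes of \<open>R\<close> containing \<open>Ann M\<close>. The zero module has
  dimension \<open>-\<infinity>\<close> (the supremum of the empty set).
\<close>

definition krull_dim :: "('a, 'c) ring_scheme \<Rightarrow> ('a, 'b, 'd) module_scheme \<Rightarrow> ereal" where
  "krull_dim R M =
    Sup {ereal (real r) | r. \<exists>P :: nat \<Rightarrow> 'a set.
      (\<forall>i\<le>r. primeideal (P i) R \<and> annihilator R M \<subseteq> P i) \<and> (\<forall>i<r. P i \<subset> P (Suc i))}"

text \<open>Sequences \<open>\<theta>\<^sub>1, \<dots>, \<theta>\<^sub>r\<close> are functions on \<open>nat\<close> of which only the values on \<open>{1..r}\<close> matter.\<close>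

definition seq_smult ::
  "nat \<Rightarrow> nat \<Rightarrow> (nat \<Rightarrow> ('k::field) mpoly) \<Rightarrow> ('k mpoly, 'b) gmodule \<Rightarrow> 'b set" where
  "seq_smult n r \<theta> M = ideal_smult (mpoly_ring n) (Idl\<^bsub>mpoly_ring n\<^esub> (\<theta> ` {1..r})) M"

definition hsop ::
  "nat \<Rightarrow> (('k::field) mpoly, 'b) gmodule \<Rightarrow> nat \<Rightarrow> (nat \<Rightarrow> 'k mpoly) \<Rightarrow> bool" where
  "hsop n M d \<theta> \<longleftrightarrow>
    krull_dim (mpoly_ring n) M = ereal (real d) \<and>
    (\<forall>i\<in>{1..d}. \<theta> i \<in> irrelevant_ideal n \<and> (\<exists>j. \<theta> i \<in> mpoly_grade n j)) \<and>
    krull_dim (mpoly_ring n) (quot_gmodule M (seq_smult n d \<theta> M)) = 0"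

definition lsop ::
  "nat \<Rightarrow> (('k::field) mpoly, 'b) gmodule \<Rightarrow> nat \<Rightarrow> (nat \<Rightarrow> 'k mpoly) \<Rightarrow> bool" where
  "lsop n M d \<theta> \<longleftrightarrow> hsop n M d \<theta> \<and> (\<forall>i\<in>{1..d}. \<theta> i \<in> mpoly_grade n 1)"

definition module_colon :: "('a, 'b, 'd) module_scheme \<Rightarrow> 'b set \<Rightarrow> 'a set \<Rightarrow> 'b set" where
  "module_colon M N A = {y \<in> carrier M. \<forall>a\<in>A. a \<odot>\<^bsub>M\<^esub> y \<in> N}"

definition weak_sequence ::
  "nat \<Rightarrow> (('k::field) mpoly, 'b) gmodule \<Rightarrow> nat \<Rightarrow> (nat \<Rightarrow> 'k mpoly) \<Rightarrow> bool" where
  "weak_sequence n M r \<theta> \<longleftrightarrow>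
    (\<forall>i\<in>{1..r}. \<theta> i \<in> irrelevant_ideal n) \<and>
    (\<forall>i\<in>{1..r}. module_colon M (seq_smult n (i - 1) \<theta> M) {\<theta> i} =
                 module_colon M (seq_smult n (i - 1) \<theta> M) (irrelevant_ideal n))"

definition buchsbaum :: "nat \<Rightarrow> (('k::field) mpoly, 'b) gmodule \<Rightarrow> bool" where
  "buchsbaum n M \<longleftrightarrow> (\<forall>d \<theta>. hsop n M d \<theta> \<longrightarrow> weak_sequence n M d \<theta>)"


section \<open>Local cohomology\<close>

text \<open>
  Local cohomology with respect to the irrelevant ideal is the cohomology of the Cech complex
  \<open>0 \<rightarrow> M \<rightarrow> \<Oplus>\<^sub>i M\<^bsub>x\<^sub>i\<^esub> \<rightarrow> \<Oplus>\<^bsub>i<j\<^esub> M\<^bsub>x\<^sub>i x\<^sub>j\<^esub> \<rightarrow> \<dots> \<rightarrow> M\<^bsub>x\<^sub>1 \<cdots> x\<^sub>n\<^esub> \<rightarrow> 0\<close>.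

  \<open>mfrac M W m s\<close> is the fraction \<open>m/s\<close> with \<open>m \<in> M\<close> and denominator \<open>s\<close> in the
  multiplicatively closed set \<open>W\<close>, represented as an equivalence class of pairs.
\<close>

definition mfrac ::
  "(('k::field) mpoly, 'b) gmodule \<Rightarrow> 'k mpoly set \<Rightarrow> 'b \<Rightarrow> 'k mpoly \<Rightarrow> ('b \<times> 'k mpoly) set" where
  "mfrac M W m s =
    {(m', s'). m' \<in> carrier M \<and> s' \<in> W \<and>
      (\<exists>t\<in>W. t \<odot>\<^bsub>M\<^esub> (s' \<odot>\<^bsub>M\<^esub> m) = t \<odot>\<^bsub>M\<^esub> (s \<odot>\<^bsub>M\<^esub> m'))}"

text \<open>The degree of \<open>m/s\<close> is \<open>deg m - deg s\<close>.\<close>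

definition localization ::
  "nat \<Rightarrow> (('k::field) mpoly, 'b) gmodule \<Rightarrow> 'k mpoly set
    \<Rightarrow> ('k mpoly, ('b \<times> 'k mpoly) set) gmodule" where
  "localization n M W =
    \<lparr>carrier = {mfrac M W m s | m s. m \<in> carrier M \<and> s \<in> W},
     mult = undefined, one = undefined,
     zero = mfrac M W \<zero>\<^bsub>M\<^esub> 1,
     add = (\<lambda>X Y. \<Union>(m, s)\<in>X. \<Union>(m', s')\<in>Y.
              mfrac M W ((s' \<odot>\<^bsub>M\<^esub> m) \<oplus>\<^bsub>M\<^esub> (s \<odot>\<^bsub>M\<^esub> m')) (s * s')),
     smult = (\<lambda>a X. \<Union>(m, s)\<in>X. mfrac M W (a \<odot>\<^bsub>M\<^esub> m) s),
     grade = (\<lambda>j. {mfrac M W m s | m s i k.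
                m \<in> grade M i \<and> s \<in> W \<inter> mpoly_grade n k \<and> j = i - k})\<rparr>"

text \<open>
  Inverting all monomials in the variables \<open>x\<^sub>i\<close>, \<open>i \<in> F\<close>, is the same as inverting the product
  of these variables; with these denominator sets the localization maps of the Cech complex
  are simply \<open>m/s \<mapsto> m/s\<close>.
\<close>

definition monomials_in :: "nat set \<Rightarrow> ('k::field) mpoly set" where
  "monomials_in F = {Poly_Mapping.single e 1 | e. Poly_Mapping.keys e \<subseteq> F}"

definition cech_loc ::
  "nat \<Rightarrow> (('k::field) mpoly, 'b) gmodule \<Rightarrow> nat set
    \<Rightarrow> ('k mpoly, ('b \<times> 'k mpoly) set) gmodule" where
  "cech_loc n M F = localization n M (monomials_in F)"

definition cech_restrict ::
  "(('k::field) mpoly, 'b) gmodule \<Rightarrow> nat set \<Rightarrow> ('b \<times> 'k mpoly) set \<Rightarrow> ('b \<times> 'k mpoly) set" where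
  "cech_restrict M F X = (\<Union>(m, s)\<in>X. mfrac M (monomials_in F) m s)"

definition cech_module ::
  "nat \<Rightarrow> (('k::field) mpoly, 'b) gmodule \<Rightarrow> nat
    \<Rightarrow> ('k mpoly, nat set \<Rightarrow> ('b \<times> 'k mpoly) set) gmodule" where
  "cech_module n M i = dsum_gmodule {F. F \<subseteq> {1..n} \<and> card F = i} (cech_loc n M)"

definition cech_diff ::
  "nat \<Rightarrow> (('k::field) mpoly, 'b) gmodule \<Rightarrow> nat
    \<Rightarrow> (nat set \<Rightarrow> ('b \<times> 'k mpoly) set) \<Rightarrow> (nat set \<Rightarrow> ('b \<times> 'k mpoly) set)" where
  "cech_diff n M i c =
    (\<lambda>F\<in>{F. F \<subseteq> {1..n} \<and> card F = Suc i}.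
      \<Oplus>\<^bsub>cech_loc n M F\<^esub>j\<in>F.
        ((- 1) ^ card {k \<in> F. k < j}) \<odot>\<^bsub>cech_loc n M F\<^esub> cech_restrict M F (c (F - {j})))"

definition cech_cocycles ::
  "nat \<Rightarrow> (('k::field) mpoly, 'b) gmodule \<Rightarrow> nat
    \<Rightarrow> (nat set \<Rightarrow> ('b \<times> 'k mpoly) set) set" where
  "cech_cocycles n M i =
    {c \<in> carrier (cech_module n M i). cech_diff n M i c = \<zero>\<^bsub>cech_module n M (Suc i)\<^esub>}"

definition cech_coboundaries ::
  "nat \<Rightarrow> (('k::field) mpoly, 'b) gmodule \<Rightarrow> nat
    \<Rightarrow> (nat set \<Rightarrow> ('b \<times> 'k mpoly) set) set" where
  "cech_coboundaries n M i =
    (case i of 0 \<Rightarrow> {\<zero>\<^bsub>cech_module n M 0\<^esub>}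
     | Suc k \<Rightarrow> cech_diff n M k ` carrier (cech_module n M k))"

definition local_cohomology ::
  "nat \<Rightarrow> nat \<Rightarrow> (('k::field) mpoly, 'b) gmodule
    \<Rightarrow> ('k mpoly, (nat set \<Rightarrow> ('b \<times> 'k mpoly) set) set) gmodule" where
  "local_cohomology n i M =
    quot_gmodule (sub_gmodule (cech_module n M i) (cech_cocycles n M i)) (cech_coboundaries n M i)"

end

theory Submission
  imports Defs "HOL-Library.Function_Algebras"
begin

text \<open>
  Write \<open>M\<close> as \<open>T / B0\<close>, where \<open>T\<close> is the polynomial part of a free Laurent module, so that localizations
  become submodules and the Cech cohomology of a subquotient \<open>A / B\<close> is a quotient of two submodules of a single
  space of families indexed by sets of variables. Put \<open>\<Theta>\<^sub>C M = \<Sum>\<^bsub>i\<in>C\<^esub> \<theta>\<^sub>i M\<close> and let \<open>\<mm>\<close> be the irrelevant ideal.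

  The weak-sequence property, applied to powers of the parameters, shows that \<open>\<mm>\<close> kills \<open>H\<^sup>i(M / \<Theta>\<^sub>C M)\<close> for
  \<open>i < d - |C|\<close>; as \<open>\<theta>\<^sub>e\<close> then acts as zero, the long exact sequence of multiplication by \<open>\<theta>\<^sub>e\<close> breaks up into
  \<open>0 \<rightarrow> H\<^sup>i(M / \<Theta>\<^sub>C M) \<rightarrow> H\<^sup>i(M / \<Theta>\<^bsub>C\<union>{e}\<^esub> M) \<rightarrow> H\<^sup>i\<^sup>+\<^sup>1(M / \<Theta>\<^sub>C M)(-1) \<rightarrow> 0\<close> for \<open>i + 1 < d - |C|\<close>.
  On all these modules \<open>\<mm>\<close> acts as zero, so homogeneous bases simply add up along the sequences. Iterating the
  connecting homomorphisms from \<open>H\<^sup>0(M / \<Theta>\<^bsub>[d]\<^esub> M)\<close> to \<open>H\<^sup>d(M)(-d)\<close>, one finds that the kernel is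
  killed by \<open>\<mm>\<close> and has a basis made of one copy of a basis of \<open>H\<^bsup>|C|\<^esup>(M)(-|C|)\<close> for every proper subset \<open>C\<close> of \<open>[d]\<close>;
  the rest of the socle embeds into \<open>Soc H\<^sup>d(M)(-d)\<close>. Finally, multiplication by \<open>\<theta>\<^sup>C\<close> identifies
  \<open>H\<^bsup>|C|\<^esup>(M)(-|C|)\<close> with \<open>H\<^bsup>|C|\<^esup>(\<theta>\<^sup>C M)\<close>.
\<close>

text \<open>Over the field \<open>'k\<close> every exact sequence of graded spaces splits, so where
  \<mm> acts as zero an isomorphism is only a matching of homogeneous bases. These may be infinite,
  hence Zorn's lemma and index sets in place of dimensions. The obstacle is the diagonal i + |C| =
  d, where \<mm> need not kill H^i(M / \<Theta>_C M): there only a graded subspace killed by \<mm>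
  is followed, starting from the socle, and what remains of it in H^d(M) becomes the last summand.
  Powers of the parameters are unavoidable, since a class of local cohomology is killed by some
  power of \<theta>_e that is not known beforehand; hence an exponent function \<open>t\<close>
  accompanies the submodules. The weak-sequence condition turns into cancellation of \<theta>_e as
  soon as one variable is inverted, because variables lie in \<mm>; so only degree 0 of the Cech
  complex is exceptional.\<close>

declare lookup_eq_zero_in_keys_contradict [rule del]

section \<open>Finitely supported functions, graded spaces and homogeneous bases\<close>

abbreviation cpoly :: "'k \<Rightarrow> ('k::field) mpoly" where
  "cpoly k \<equiv> Poly_Mapping.single 0 k"

definition pmap_restrict :: "'i set \<Rightarrow> ('i \<Rightarrow>\<^sub>0 'k::zero) \<Rightarrow> 'i \<Rightarrow>\<^sub>0 'k" where
  "pmap_restrict I f = Abs_poly_mapping (\<lambda>i. if i \<in> I then Poly_Mapping.lookup f i else 0)"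

lemma lookup_pmap_restrict:
  "Poly_Mapping.lookup (pmap_restrict I f) i = (if i \<in> I then Poly_Mapping.lookup f i else 0)"
proof -
  have "finite {i. (if i \<in> I then Poly_Mapping.lookup f i else 0) \<noteq> 0}"
    by (rule finite_subset[OF _ finite_keys[of f]]) (auto simp: in_keys_iff split: if_splits)
  then show ?thesis
    unfolding pmap_restrict_def by (simp add: Abs_poly_mapping_inverse)
qed

lemma keys_pmap_restrict: "Poly_Mapping.keys (pmap_restrict I f) = Poly_Mapping.keys f \<inter> I"
  by (auto simp: in_keys_iff lookup_pmap_restrict split: if_splits)

lemma pmap_restrict_split: "pmap_restrict I f + pmap_restrict (- I) f = f"
  by (rule poly_mapping_eqI) (simp add: lookup_add lookup_pmap_restrict)

lemma pmap_restrict_add: "pmap_restrict I (f + g) = pmap_restrict I f + pmap_restrict I g"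
  for f g :: "'i \<Rightarrow>\<^sub>0 'k::monoid_add"
  by (rule poly_mapping_eqI) (simp add: lookup_add lookup_pmap_restrict)

lemma pmap_restrict_id: "Poly_Mapping.keys f \<subseteq> I \<Longrightarrow> pmap_restrict I f = f"
  by (rule poly_mapping_eqI) (auto simp: lookup_pmap_restrict in_keys_iff)

lemma pmap_restrict_0: "Poly_Mapping.keys f \<inter> I = {} \<Longrightarrow> pmap_restrict I f = 0"
  by (rule poly_mapping_eqI) (auto simp: lookup_pmap_restrict in_keys_iff)

lemma keys_minus_pm: "Poly_Mapping.keys (- f) = Poly_Mapping.keys (f :: 'i \<Rightarrow>\<^sub>0 'k::ab_group_add)"
  by (auto simp: in_keys_iff)

lemma keys_diff_pm:
  "Poly_Mapping.keys (f - g) \<subseteq> Poly_Mapping.keys f \<union> Poly_Mapping.keys (g :: 'i \<Rightarrow>\<^sub>0 'k::ab_group_add)"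
  by (auto simp: in_keys_iff lookup_minus)

lemma cpoly_in_grade: "cpoly k \<in> mpoly_grade n 0"
  by (auto simp: mpoly_grade_def mpoly_ring_def exp_deg_def)

lemma cpoly_in_carrier: "cpoly k \<in> carrier (mpoly_ring n)"
  by (auto simp: mpoly_ring_def)

text \<open>\<open>hc j\<close> projects onto the component of degree \<open>j\<close>. Components
  must separate elements, but finiteness of their number is left to \<open>gsub\<close>: the ambient
  space of the Cech complex consists of functions on all sets of numbers, which may have infinitely
  many components. Scalars range over the whole type of polynomials.\<close>

locale graded_scale = Modules.module scale
  for scale :: "('k::field) mpoly \<Rightarrow> 'w::ab_group_add \<Rightarrow> 'w" +
  fixes n :: nat and hc :: "int \<Rightarrow> 'w \<Rightarrow> 'w"
  assumes hc_add: "hc j (x + y) = hc j x + hc j y"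
    and hc_hc: "hc i (hc j x) = (if i = j then hc j x else 0)"
    and hc_scale: "p \<in> mpoly_grade n i \<Longrightarrow> hc (i + j) (scale p x) = scale p (hc j x)"
    and hc_sep: "(\<And>j. hc j x = 0) \<Longrightarrow> x = 0"
begin

lemma hc_0 [simp]: "hc j 0 = 0"
  using hc_add[of j 0 0] by simp

lemma hc_minus: "hc j (- x) = - hc j x"
  using hc_add[of j x "- x"] by (simp add: eq_neg_iff_add_eq_0 add.commute)

lemma hc_diff: "hc j (x - y) = hc j x - hc j y"
  using hc_add[of j x "- y"] by (simp add: hc_minus)

lemma hc_sum: "hc j (sum f A) = (\<Sum>a\<in>A. hc j (f a))"
  by (induction A rule: infinite_finite_induct) (auto simp: hc_add)

lemma hc_hom: "hc j x = x \<Longrightarrow> hc i x = (if i = j then x else 0)"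
  by (metis hc_hc)

lemma hc_cpoly: "hc j (scale (cpoly k) x) = scale (cpoly k) (hc j x)"
  using hc_scale[OF cpoly_in_grade, of j k x] by simp

definition gsub :: "'w set \<Rightarrow> bool" where
  "gsub Z \<longleftrightarrow> subspace Z \<and> (\<forall>z\<in>Z. finite {j. hc j z \<noteq> 0} \<and> (\<forall>j. hc j z \<in> Z))"

lemma gsub_subspace: "gsub Z \<Longrightarrow> subspace Z"
  and gsub_finite: "gsub Z \<Longrightarrow> z \<in> Z \<Longrightarrow> finite {j. hc j z \<noteq> 0}"
  and gsub_hc: "gsub Z \<Longrightarrow> z \<in> Z \<Longrightarrow> hc j z \<in> Z"
  by (auto simp: gsub_def)

lemma gsubI:
  "subspace Z \<Longrightarrow> (\<And>z. z \<in> Z \<Longrightarrow> finite {j. hc j z \<noteq> 0}) \<Longrightarrow> (\<And>z j. z \<in> Z \<Longrightarrow> hc j z \<in> Z) \<Longrightarrow> gsub Z"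
  by (auto simp: gsub_def)

lemma gsub_subset:
  "gsub Z' \<Longrightarrow> Z \<subseteq> Z' \<Longrightarrow> subspace Z \<Longrightarrow> (\<And>z j. z \<in> Z \<Longrightarrow> hc j z \<in> Z) \<Longrightarrow> gsub Z"
  by (auto simp: gsub_def)

lemma sum_hc:
  assumes "finite J" "{j. hc j x \<noteq> 0} \<subseteq> J"
  shows "(\<Sum>j\<in>J. hc j x) = x"
proof -
  have "hc i (x - (\<Sum>j\<in>J. hc j x)) = 0" for i
    using assms by (auto simp: hc_diff hc_sum hc_hc)
  from hc_sep[OF this] show ?thesis by simp
qed

lemma gsub_sum_hc: "gsub Z \<Longrightarrow> z \<in> Z \<Longrightarrow> (\<Sum>j\<in>{j. hc j z \<noteq> 0}. hc j z) = z"
  by (rule sum_hc) (auto simp: gsub_finite)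

lemma finite_hc_add:
  "finite {j. hc j x \<noteq> 0} \<Longrightarrow> finite {j. hc j y \<noteq> 0} \<Longrightarrow> finite {j. hc j (x + y) \<noteq> 0}"
  by (rule finite_subset[of _ "{j. hc j x \<noteq> 0} \<union> {j. hc j y \<noteq> 0}"]) (auto simp: hc_add)

lemma subspace_plus:
  assumes "subspace A" "subspace B" shows "subspace {x + y | x y. x \<in> A \<and> y \<in> B}"
proof (rule subspaceI)
  show "0 \<in> {x + y | x y. x \<in> A \<and> y \<in> B}"
    using subspace_0[OF assms(1)] subspace_0[OF assms(2)] by force
next
  fix u v assume "u \<in> {x + y | x y. x \<in> A \<and> y \<in> B}" "v \<in> {x + y | x y. x \<in> A \<and> y \<in> B}"
  then obtain x y x' y' where "u = x + y" "v = x' + y'" "x \<in> A" "x' \<in> A" "y \<in> B" "y' \<in> B"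
    by blast
  moreover from this have "x + x' \<in> A" "y + y' \<in> B" using assms subspace_add by auto
  moreover have "u + v = (x + x') + (y + y')" using calculation by (simp add: algebra_simps)
  ultimately show "u + v \<in> {x + y | x y. x \<in> A \<and> y \<in> B}" by blast
next
  fix c u assume "u \<in> {x + y | x y. x \<in> A \<and> y \<in> B}"
  then obtain x y where "u = x + y" "x \<in> A" "y \<in> B" by blast
  moreover from this have "scale c x \<in> A" "scale c y \<in> B" using assms subspace_scale by auto
  ultimately show "scale c u \<in> {x + y | x y. x \<in> A \<and> y \<in> B}"
    using scale_right_distrib[of c x y] by blast
qed

lemma gsub_plus:
  assumes "gsub A" "gsub B" shows "gsub {x + y | x y. x \<in> A \<and> y \<in> B}"
proof (rule gsubI)
  show "subspace {x + y | x y. x \<in> A \<and> y \<in> B}"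
    using assms by (intro subspace_plus gsub_subspace)
next
  fix z assume "z \<in> {x + y | x y. x \<in> A \<and> y \<in> B}"
  then obtain x y where "z = x + y" "x \<in> A" "y \<in> B" by blast
  with assms show "finite {j. hc j z \<noteq> 0}" "hc j z \<in> {x + y | x y. x \<in> A \<and> y \<in> B}" for j
    using gsub_hc[of A x j] gsub_hc[of B y j] finite_hc_add[OF gsub_finite gsub_finite, of A x B y]
    by (simp, auto simp: hc_add)
qed

text \<open>The coefficients are constants, so this is a combination over the field
  \<open>'k\<close>. It is meant for quotients on which \<mm> acts as zero, where no further
  structure is left.\<close>

definition comb :: "('i \<Rightarrow> 'w) \<Rightarrow> ('i \<Rightarrow>\<^sub>0 'k) \<Rightarrow> 'w" where
  "comb b f = (\<Sum>i\<in>Poly_Mapping.keys f. scale (cpoly (Poly_Mapping.lookup f i)) (b i))"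

lemma comb_superset:
  assumes "finite S" "Poly_Mapping.keys f \<subseteq> S"
  shows "comb b f = (\<Sum>i\<in>S. scale (cpoly (Poly_Mapping.lookup f i)) (b i))"
  unfolding comb_def
  by (rule sum.mono_neutral_left) (use assms in \<open>simp_all add: in_keys_iff\<close>)

lemma comb_0 [simp]: "comb b 0 = 0"
  by (simp add: comb_def)

lemma comb_add: "comb b (f + g) = comb b f + comb b g"
proof -
  let ?S = "Poly_Mapping.keys f \<union> Poly_Mapping.keys g"
  have "comb b (f + g) = (\<Sum>i\<in>?S. scale (cpoly (Poly_Mapping.lookup (f + g) i)) (b i))"
    by (rule comb_superset) (auto simp: Poly_Mapping.keys_add)
  moreover have "comb b f = (\<Sum>i\<in>?S. scale (cpoly (Poly_Mapping.lookup f i)) (b i))"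
    by (rule comb_superset) auto
  moreover have "comb b g = (\<Sum>i\<in>?S. scale (cpoly (Poly_Mapping.lookup g i)) (b i))"
    by (rule comb_superset) auto
  ultimately show ?thesis
    by (simp only: lookup_add single_add scale_left_distrib sum.distrib)
qed

lemma comb_minus: "comb b (- f) = - comb b f"
  using comb_add[of b f "- f"] by (metis add.right_inverse comb_0 add_eq_0_iff)

lemma comb_diff: "comb b (f - g) = comb b f - comb b g"
  using comb_add[of b f "- g"] by (simp add: comb_minus)

lemma comb_single: "comb b (Poly_Mapping.single i k) = scale (cpoly k) (b i)"
  by (cases "k = 0") (simp_all add: comb_def)

lemma comb_cpoly: "comb b (Poly_Mapping.map ((*) k) f) = scale (cpoly k) (comb b f)"
proof -
  have "comb b (Poly_Mapping.map ((*) k) f)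
      = (\<Sum>i\<in>Poly_Mapping.keys f. scale (cpoly (Poly_Mapping.lookup (Poly_Mapping.map ((*) k) f) i)) (b i))"
    by (rule comb_superset) (auto simp: in_keys_iff Poly_Mapping.map.rep_eq when_def split: if_splits)
  also have "\<dots> = (\<Sum>i\<in>Poly_Mapping.keys f. scale (cpoly k) (scale (cpoly (Poly_Mapping.lookup f i)) (b i)))"
    by (rule sum.cong) (auto simp: Poly_Mapping.map.rep_eq mult_single when_def in_keys_iff)
  finally show ?thesis
    by (simp add: comb_def scale_sum_right)
qed

lemma comb_in:
  assumes "subspace Z" "Poly_Mapping.keys f \<subseteq> I" "\<And>i. i \<in> I \<Longrightarrow> b i \<in> Z"
  shows "comb b f \<in> Z"
  unfolding comb_def using assms by (intro subspace_sum subspace_scale) auto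

lemma comb_hc:
  assumes "\<And>i. i \<in> Poly_Mapping.keys f \<Longrightarrow> hc (dg i) (b i) = b i"
  shows "hc j (comb b f) = comb b (pmap_restrict {i. dg i = j} f)"
proof -
  have "comb b (pmap_restrict {i. dg i = j} f) = (\<Sum>i\<in>Poly_Mapping.keys f.
     scale (cpoly (Poly_Mapping.lookup (pmap_restrict {i. dg i = j} f) i)) (b i))"
    by (rule comb_superset) (auto simp: keys_pmap_restrict)
  also have "\<dots> = hc j (comb b f)"
    unfolding comb_def hc_sum
    by (rule sum.cong) (auto simp: hc_cpoly lookup_pmap_restrict hc_hom[OF assms])
  finally show ?thesis ..
qed

lemma comb_cong: "(\<And>i. i \<in> Poly_Mapping.keys f \<Longrightarrow> b i = b' i) \<Longrightarrow> comb b f = comb b' f"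
  by (auto simp: comb_def intro: sum.cong)

text \<open>The \<open>b i\<close> are homogeneous representatives of a \<open>'k\<close>-basis of
  \<open>Z / B\<close>: the second clause is independence modulo \<open>B\<close>, the third is
  spanning. Since \<open>b\<close> is an indexed family, spaces with trivial action can be compared
  through \<open>I\<close> and \<open>dg\<close> alone.\<close>

definition gbasis :: "'i set \<Rightarrow> ('i \<Rightarrow> 'w) \<Rightarrow> ('i \<Rightarrow> int) \<Rightarrow> 'w set \<Rightarrow> 'w set \<Rightarrow> bool" where
  "gbasis I b dg Z B \<longleftrightarrow>
     (\<forall>i\<in>I. b i \<in> Z \<and> hc (dg i) (b i) = b i) \<and>
     (\<forall>f. Poly_Mapping.keys f \<subseteq> I \<and> comb b f \<in> B \<longrightarrow> f = 0) \<and>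
     (\<forall>z\<in>Z. \<exists>f. Poly_Mapping.keys f \<subseteq> I \<and> z - comb b f \<in> B)"

text \<open>A maximal set of homogeneous elements that is independent modulo \<open>B\<close> spans
  all homogeneous elements of \<open>Z\<close>, hence \<open>Z\<close> itself, because elements of a
  \<open>gsub\<close> are finite sums of their components.\<close>

lemma gbasis_exists:
  assumes Z: "gsub Z" and B: "subspace B"
  shows "\<exists>I dg. gbasis I (\<lambda>x. x) dg Z B"
proof -
  let ?b = "\<lambda>x::'w. x"
  define ok where "ok I \<longleftrightarrow> (\<forall>x\<in>I. x \<in> Z \<and> (\<exists>j. hc j x = x)) \<and>
     (\<forall>f. Poly_Mapping.keys f \<subseteq> I \<and> comb ?b f \<in> B \<longrightarrow> f = 0)" for I
  have "\<exists>M\<in>Collect ok. \<forall>X\<in>Collect ok. M \<subseteq> X \<longrightarrow> X = M"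
  proof (rule subset_Zorn_nonempty)
    have "ok {}" by (auto simp: ok_def)
    then show "Collect ok \<noteq> {}" by blast
  next
    fix \<C> assume ne: "\<C> \<noteq> {}" and ch: "subset.chain (Collect ok) \<C>"
    \<comment> \<open>A relation involves finitely many vectors, and these all lie in one member of
      the chain.\<close>
    have "\<exists>X\<in>\<C>. F \<subseteq> X" if "finite F" "F \<subseteq> \<Union>\<C>" for F
      using finite_subset_Union_chain[OF that ne ch] by blast
    moreover have "ok X" if "X \<in> \<C>" for X
      using that ch by (auto simp: subset_chain_def)
    ultimately show "\<Union>\<C> \<in> Collect ok"
      unfolding ok_def mem_Collect_eq by (meson Union_iff finite_keys)
  qed
  then obtain I where I: "ok I" and max: "\<And>X. ok X \<Longrightarrow> I \<subseteq> X \<Longrightarrow> X = I" by auto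
  define S where "S = {z. \<exists>f. Poly_Mapping.keys f \<subseteq> I \<and> z - comb ?b f \<in> B}"
  have hom: "z \<in> S" if z: "z \<in> Z" "hc j z = z" for z j
  proof (rule ccontr)
    assume nS: "z \<notin> S"
    have zI: "z \<notin> I"
    proof
      assume "z \<in> I"
      then have "z \<in> S" unfolding S_def
        by (auto intro!: exI[of _ "Poly_Mapping.single z 1"] simp: comb_single subspace_0[OF B])
      with nS show False by simp
    qed
    have "ok (insert z I)"
      unfolding ok_def
    proof (intro conjI allI impI, goal_cases)
      case 1 then show ?case using I z by (auto simp: ok_def)
    next
      case (2 f)
      let ?k = "Poly_Mapping.lookup f z"
      let ?g = "pmap_restrict I f"
      have f: "f = ?g + Poly_Mapping.single z ?k"
        using 2 zI by (auto intro!: poly_mapping_eqI simp: lookup_add lookup_pmap_restrict lookup_single when_def in_keys_iff)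
      have g: "Poly_Mapping.keys ?g \<subseteq> I" by (simp add: keys_pmap_restrict)
      have mem: "comb ?b ?g + scale (cpoly ?k) z \<in> B"
        using 2 f comb_add[of ?b ?g "Poly_Mapping.single z ?k"] by (simp add: comb_single)
      show ?case
      proof (cases "?k = 0")
        case True
        then have "comb ?b ?g \<in> B" using mem by simp
        then have "?g = 0" using I g by (auto simp: ok_def)
        then show ?thesis using f True by simp
      next
        case False
        \<comment> \<open>Dividing the relation by its coefficient at \<open>z\<close> would put
          \<open>z\<close> into the span \<open>S\<close> of \<open>I\<close>.\<close>
        have "scale (cpoly (inverse ?k)) (comb ?b ?g + scale (cpoly ?k) z) \<in> B"
          by (rule subspace_scale[OF B mem])
        then have "z - comb ?b (- Poly_Mapping.map ((*) (inverse ?k)) ?g) \<in> B"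
          using False by (simp add: scale_right_distrib mult_single comb_cpoly comb_minus add.commute)
        moreover have "Poly_Mapping.keys (- Poly_Mapping.map ((*) (inverse ?k)) ?g) \<subseteq> I"
          using g by (auto simp: in_keys_iff Poly_Mapping.map.rep_eq when_def split: if_splits)
        ultimately show ?thesis using nS by (auto simp: S_def)
      qed
    qed
    with max zI show False by blast
  qed
  have S_add: "x + y \<in> S" if "x \<in> S" "y \<in> S" for x y
  proof -
    from that obtain f g where "Poly_Mapping.keys f \<subseteq> I" "x - comb ?b f \<in> B"
      "Poly_Mapping.keys g \<subseteq> I" "y - comb ?b g \<in> B" unfolding S_def by blast
    moreover from this have "(x - comb ?b f) + (y - comb ?b g) \<in> B" using B subspace_add by blast
    ultimately show ?thesis unfolding S_def
      using Poly_Mapping.keys_add[of f g]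
      by (auto intro!: exI[of _ "f + g"] simp: comb_add algebra_simps)
  qed
  have S0: "0 \<in> S" unfolding S_def using subspace_0[OF B] by (auto intro!: exI[of _ 0])
  have "z \<in> S" if z: "z \<in> Z" for z
  proof -
    have "hc j z \<in> S" for j
      by (rule hom[OF gsub_hc[OF Z z], of j]) (simp add: hc_hc)
    then have "sum (\<lambda>j. hc j z) J \<in> S" for J
      by (induction J rule: infinite_finite_induct)
        (simp_all add: S0 S_add)
    then show ?thesis using gsub_sum_hc[OF Z z] by metis
  qed
  then have "gbasis I ?b (\<lambda>x. SOME j. hc j x = x) Z B"
    using I unfolding gbasis_def ok_def S_def by (auto intro: someI_ex)
  then show ?thesis by blast
qed

text \<open>Used to turn index sets into sets of pairs \<open>(C, x)\<close> and to replace
  \<open>C\<close> by \<open>insert e C\<close>, which makes the index sets of kernel and image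
  disjoint. Coefficient families travel both ways: \<open>push\<close> for spanning,
  \<open>pull\<close> for independence.\<close>

lemma gbasis_reindex:
  assumes gb: "gbasis I b dg Z B" and h: "inj_on h I"
    and b': "\<And>i. i \<in> I \<Longrightarrow> b' (h i) = b i" and dg': "\<And>i. i \<in> I \<Longrightarrow> dg' (h i) = dg i"
  shows "gbasis (h ` I) b' dg' Z B"
proof -
  define push where "push f = (\<Sum>i\<in>Poly_Mapping.keys f. Poly_Mapping.single (h i) (Poly_Mapping.lookup f i))"
    for f :: "_ \<Rightarrow>\<^sub>0 'k"
  define pull where "pull f = (\<Sum>i\<in>{i\<in>I. h i \<in> Poly_Mapping.keys f}. Poly_Mapping.single i (Poly_Mapping.lookup f (h i)))"
    for f :: "_ \<Rightarrow>\<^sub>0 'k"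
  have keys_single_sum: "Poly_Mapping.keys (\<Sum>i\<in>A. Poly_Mapping.single (u i) (v i)) \<subseteq> u ` A"
    for A and u :: "'c \<Rightarrow> 'd" and v :: "'c \<Rightarrow> 'k"
    by (induction A rule: infinite_finite_induct)
      (auto dest!: subsetD[OF Poly_Mapping.keys_add] split: if_splits)
  have combsum: "comb c (\<Sum>i\<in>A. Poly_Mapping.single (u i) (v i)) = (\<Sum>i\<in>A. scale (cpoly (v i)) (c (u i)))"
    for A and u :: "'c \<Rightarrow> 'd" and v :: "'c \<Rightarrow> 'k" and c
    by (induction A rule: infinite_finite_induct) (auto simp: comb_add comb_single)
  have push: "Poly_Mapping.keys (push f) \<subseteq> h ` I" "comb b' (push f) = comb b f"
    if f: "Poly_Mapping.keys f \<subseteq> I" for f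
  proof -
    show "Poly_Mapping.keys (push f) \<subseteq> h ` I"
      using f keys_single_sum[of h "\<lambda>i. Poly_Mapping.lookup f i" "Poly_Mapping.keys f"]
      unfolding push_def by blast
    show "comb b' (push f) = comb b f"
      unfolding push_def combsum unfolding comb_def using f
      by (intro sum.cong) (auto simp: b' subset_iff)
  qed
  have pull: "Poly_Mapping.keys (pull f) \<subseteq> I" "comb b (pull f) = comb b' f" "pull f = 0 \<Longrightarrow> f = 0"
    if f: "Poly_Mapping.keys f \<subseteq> h ` I" for f
  proof -
    let ?A = "{i\<in>I. h i \<in> Poly_Mapping.keys f}"
    have inj: "inj_on h ?A" using h by (auto intro: inj_on_subset)
    have img: "h ` ?A = Poly_Mapping.keys f" using f by auto
    have fin: "finite ?A" using inj img finite_imageD finite_keys by metis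
    show "Poly_Mapping.keys (pull f) \<subseteq> I"
      using keys_single_sum[of "\<lambda>i. i" "\<lambda>i. Poly_Mapping.lookup f (h i)" ?A] by (auto simp: pull_def)
    have "comb b' f = (\<Sum>k\<in>h ` ?A. scale (cpoly (Poly_Mapping.lookup f k)) (b' k))"
      unfolding img comb_def ..
    then show "comb b (pull f) = comb b' f"
      unfolding pull_def combsum sum.reindex[OF inj]
      by (simp add: b')
    show "f = 0" if "pull f = 0"
    proof (rule ccontr)
      assume "f \<noteq> 0"
      then obtain k where k: "k \<in> Poly_Mapping.keys f"
        by (metis in_keys_iff lookup_zero poly_mapping_eqI)
      with img obtain i where i: "i \<in> ?A" "k = h i" by blast
      then have "Poly_Mapping.lookup (pull f) i = Poly_Mapping.lookup f k"
        using fin by (simp add: pull_def lookup_sum lookup_single when_def)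
      then show False using that k by (simp add: in_keys_iff)
    qed
  qed
  show ?thesis
    unfolding gbasis_def
  proof (intro conjI ballI allI impI)
    fix i assume "i \<in> h ` I"
    then show "b' i \<in> Z" "hc (dg' i) (b' i) = b' i"
      using gb by (auto simp: gbasis_def b' dg')
  next
    fix f assume f: "Poly_Mapping.keys f \<subseteq> h ` I \<and> comb b' f \<in> B"
    then have "pull f = 0" using gb pull(1,2)[of f] by (simp add: gbasis_def)
    then show "f = 0" using pull(3) f by blast
  next
    fix z assume "z \<in> Z"
    then obtain f where f: "Poly_Mapping.keys f \<subseteq> I" "z - comb b f \<in> B"
      using gb by (auto simp: gbasis_def)
    then show "\<exists>f. Poly_Mapping.keys f \<subseteq> h ` I \<and> z - comb b' f \<in> B"
      using push[OF f(1)] by (intro exI[of _ "push f"]) auto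
  qed
qed

text \<open>
  The relation \<open>R\<close> plays the role of a connecting homomorphism \<open>Z / B \<rightarrow> Z2 / B2\<close> of
  degree \<open>-1\<close> with kernel \<open>Z1 / B1\<close>.
\<close>

lemma gbasis_extension:
  assumes Z1: "gsub Z1" and B1: "subspace B1" and Z: "gsub Z" and B: "subspace B"
    and Z2: "gsub Z2" and B2: "subspace B2" "B2 \<subseteq> Z2"
    and sub: "Z1 \<subseteq> Z" "B1 \<subseteq> B" "Z1 \<inter> B \<subseteq> B1"
    and R_add: "\<And>x y u v. R x u \<Longrightarrow> R y v \<Longrightarrow> R (x + y) (u + v)"
    and R_scale: "\<And>x u k. R x u \<Longrightarrow> R (scale (cpoly k) x) (scale (cpoly k) u)"
    and R_hc: "\<And>x u j. R x u \<Longrightarrow> R (hc (j + 1) x) (hc j u)"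
    and R_1: "\<And>x. x \<in> Z1 \<Longrightarrow> R x 0"
    and R_total: "\<And>x. x \<in> Z \<Longrightarrow> \<exists>u\<in>Z2. R x u"
    and R_surj: "\<And>u. u \<in> Z2 \<Longrightarrow> \<exists>x\<in>Z. R x u"
    and R_ker: "\<And>x u. R x u \<Longrightarrow> x \<in> Z \<Longrightarrow> u \<in> B2 \<Longrightarrow> \<exists>y\<in>Z1. x - y \<in> B"
    and R_wd: "\<And>x u. R x u \<Longrightarrow> x \<in> B \<Longrightarrow> u \<in> Z2 \<Longrightarrow> u \<in> B2"
    and b1: "gbasis I1 b1 dg1 Z1 B1" and b2: "gbasis I2 b2 dg2 Z2 B2"
    and disj: "I1 \<inter> I2 = {}"
  shows "\<exists>b. gbasis (I1 \<union> I2) b (\<lambda>i. if i \<in> I1 then dg1 i else dg2 i + 1) Z B"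
proof -
  \<comment> \<open>An arbitrary preimage of \<open>b2 i\<close> need not be homogeneous, but its
    component of degree \<open>dg2 i + 1\<close> is a preimage too, since \<open>R\<close> lowers
    degrees by one.\<close>
  have "\<exists>x. x \<in> Z \<and> R x (b2 i) \<and> hc (dg2 i + 1) x = x" if "i \<in> I2" for i
  proof -
    from that b2 have "b2 i \<in> Z2" "hc (dg2 i) (b2 i) = b2 i" by (auto simp: gbasis_def)
    with R_surj obtain x where "x \<in> Z" "R x (b2 i)" by blast
    then show ?thesis using R_hc[of x "b2 i" "dg2 i"] \<open>hc (dg2 i) (b2 i) = b2 i\<close> gsub_hc[OF Z]
      by (auto intro!: exI[of _ "hc (dg2 i + 1) x"] simp: hc_hc)
  qed
  then obtain l where l: "\<And>i. i \<in> I2 \<Longrightarrow> l i \<in> Z \<and> R (l i) (b2 i) \<and> hc (dg2 i + 1) (l i) = l i"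
    by metis
  define b where "b i = (if i \<in> I1 then b1 i else l i)" for i
  have R0: "R 0 0" using R_1 subspace_0[OF gsub_subspace[OF Z1]] by blast
  have R_sum: "R (sum u A) (sum v A)" if "\<And>i. i \<in> A \<Longrightarrow> R (u i) (v i)" for u v and A :: "'a set"
    using that by (induction A rule: infinite_finite_induct) (auto intro: R_add R0)
  have R_comb: "R (comb l f) (comb b2 f)" if "Poly_Mapping.keys f \<subseteq> I2" for f
    unfolding comb_def using that l by (intro R_sum R_scale) auto
  have R_minus: "R (- x) (- u)" if "R x u" for x u
  proof -
    have "scale (cpoly (- 1)) y = - y" for y
      by (metis scale_minus_left scale_one single_one single_uminus)
    with R_scale[OF that, of "- 1"] show ?thesis by simp
  qed
  have comb_b: "comb b f = comb b1 (pmap_restrict I1 f) + comb l (pmap_restrict (- I1) f)" for f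
  proof -
    have "comb b f = comb b (pmap_restrict I1 f) + comb b (pmap_restrict (- I1) f)"
      by (metis comb_add pmap_restrict_split)
    also have "comb b (pmap_restrict I1 f) = comb b1 (pmap_restrict I1 f)"
      by (rule comb_cong) (auto simp: b_def keys_pmap_restrict)
    also have "comb b (pmap_restrict (- I1) f) = comb l (pmap_restrict (- I1) f)"
      by (rule comb_cong) (auto simp: b_def keys_pmap_restrict)
    finally show ?thesis .
  qed
  have sZ: "subspace Z" "subspace Z1" "subspace Z2" using Z Z1 Z2 gsub_subspace by auto
  have "gbasis (I1 \<union> I2) b (\<lambda>i. if i \<in> I1 then dg1 i else dg2 i + 1) Z B"
    unfolding gbasis_def
  proof (intro conjI ballI allI impI)
    fix i assume "i \<in> I1 \<union> I2"
    then show "b i \<in> Z" "hc (if i \<in> I1 then dg1 i else dg2 i + 1) (b i) = b i"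
      using l b1 sub by (auto simp: b_def gbasis_def)
  next
    fix f assume f: "Poly_Mapping.keys f \<subseteq> I1 \<union> I2 \<and> comb b f \<in> B"
    let ?f1 = "pmap_restrict I1 f" and ?f2 = "pmap_restrict (- I1) f"
    have k: "Poly_Mapping.keys ?f1 \<subseteq> I1" "Poly_Mapping.keys ?f2 \<subseteq> I2"
      using f by (auto simp: keys_pmap_restrict)
    have z1: "comb b1 ?f1 \<in> Z1"
      by (rule comb_in[OF sZ(2) k(1)]) (use b1 in \<open>auto simp: gbasis_def\<close>)
    have z2: "comb b2 ?f2 \<in> Z2"
      by (rule comb_in[OF sZ(3) k(2)]) (use b2 in \<open>auto simp: gbasis_def\<close>)
    \<comment> \<open>The connecting map forgets the part over \<open>I1\<close>, so the
      coefficients over \<open>I2\<close> vanish first and those over \<open>I1\<close>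
      afterwards.\<close>
    have "R (comb b f) (comb b2 ?f2)"
      unfolding comb_b using R_add[OF R_1[OF z1] R_comb[OF k(2)]] by simp
    with f z2 have "comb b2 ?f2 \<in> B2" using R_wd by blast
    then have f2: "?f2 = 0" using b2 k(2) by (auto simp: gbasis_def)
    then have "comb b1 ?f1 \<in> B" using f comb_b by simp
    then have "?f1 = 0" using b1 k(1) z1 sub by (auto simp: gbasis_def)
    then show "f = 0" using f2 pmap_restrict_split[of I1 f] by simp
  next
    fix z assume z: "z \<in> Z"
    then obtain w where w: "w \<in> Z2" "R z w" using R_total by blast
    with b2 obtain f2 where f2: "Poly_Mapping.keys f2 \<subseteq> I2" "w - comb b2 f2 \<in> B2"
      by (auto simp: gbasis_def)
    \<comment> \<open>Subtracting the lifted combination moves \<open>z\<close> into the kernel,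
      that is, into \<open>Z1\<close> up to \<open>B\<close>.\<close>
    have "R (z - comb l f2) (w - comb b2 f2)"
      using R_add[OF w(2) R_minus[OF R_comb[OF f2(1)]]] by simp
    moreover have "z - comb l f2 \<in> Z"
      by (intro subspace_diff[OF sZ(1) z] comb_in[OF sZ(1) f2(1)]) (use l in auto)
    ultimately obtain y where y: "y \<in> Z1" "z - comb l f2 - y \<in> B"
      using R_ker f2 by blast
    with b1 obtain f1 where f1: "Poly_Mapping.keys f1 \<subseteq> I1" "y - comb b1 f1 \<in> B1"
      by (auto simp: gbasis_def)
    have "z - comb l f2 - y + (y - comb b1 f1) \<in> B"
      using y f1 sub subspace_add[OF B] by blast
    moreover have "comb b (f1 + f2) = comb b1 f1 + comb l f2"
      proof -
      have "pmap_restrict I1 f1 = f1" "pmap_restrict (- I1) f2 = f2"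
        "pmap_restrict I1 f2 = 0" "pmap_restrict (- I1) f1 = 0"
        using f1 f2 disj by (auto intro!: pmap_restrict_id pmap_restrict_0)
      then show ?thesis by (simp add: comb_b pmap_restrict_add)
    qed
    ultimately have "z - comb b (f1 + f2) \<in> B" by (simp add: algebra_simps)
    then show "\<exists>f. Poly_Mapping.keys f \<subseteq> I1 \<union> I2 \<and> z - comb b f \<in> B"
      using f1 f2 Poly_Mapping.keys_add[of f1 f2] by (intro exI[of _ "f1 + f2"]) auto
  qed
  then show ?thesis by blast
qed

end

section \<open>Abstract complexes with a system of parameters\<close>

lemma inj_on_insert_fst:
  assumes "\<And>C x. (C, x) \<in> A \<Longrightarrow> e \<notin> C"
  shows "inj_on (\<lambda>(C, x). (insert e C, x)) A"
proof (rule inj_onI)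
  fix p q assume *: "p \<in> A" "q \<in> A" "(\<lambda>(C, x). (insert e C, x)) p = (\<lambda>(C, x). (insert e C, x)) q"
  obtain C x C' x' where pq: "p = (C, x)" "q = (C', x')" by (metis surj_pair)
  with * have "insert e C = insert e C'" "x = x'" "e \<notin> C" "e \<notin> C'" using assms by auto
  then show "p = q" unfolding pq by (metis insert_ident)
qed

text \<open>An axiomatic form of the Cech complex. \<open>Ct i\<close> are the cochains of a module
  covering \<open>M\<close>, and \<open>CA i C t\<close> those of the submodule to be divided out:
  the relations of \<open>M\<close> together with the multiples of \<theta>_e^(t e) for
  \<open>e \<in> C\<close>. \<open>regular\<close> concerns positive degrees only, where cochains
  live in localizations; \<open>weak\<close> is its substitute in degree 0. \<open>torsion\<close>
  gives no control over the exponent \<open>s\<close>, which is why \<open>t\<close> is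
  arbitrary.\<close>

locale parameter_complex = graded_scale scale n hc
  for scale :: "('k::field) mpoly \<Rightarrow> 'w::ab_group_add \<Rightarrow> 'w" and n hc +
  fixes d :: nat and \<theta> :: "nat \<Rightarrow> 'k mpoly"
    and Ct :: "nat \<Rightarrow> 'w set" and CA :: "nat \<Rightarrow> nat set \<Rightarrow> (nat \<Rightarrow> nat) \<Rightarrow> 'w set" and D :: "'w \<Rightarrow> 'w"
  assumes theta_grade: "i \<in> {1..d} \<Longrightarrow> \<theta> i \<in> mpoly_grade n 1"
    and theta_irrelevant: "i \<in> {1..d} \<Longrightarrow> \<theta> i \<in> irrelevant_ideal n"
    and Ct_gsub: "gsub (Ct i)"
    and CA_gsub: "C \<subseteq> {1..d} \<Longrightarrow> gsub (CA i C t)"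
    and CA_Ct: "C \<subseteq> {1..d} \<Longrightarrow> CA i C t \<subseteq> Ct i"
    and CA_insert: "C \<subseteq> {1..d} \<Longrightarrow> e \<in> {1..d} - C \<Longrightarrow>
      CA i (insert e C) t = {a + scale (\<theta> e ^ t e) c | a c. a \<in> CA i C t \<and> c \<in> Ct i}"
    and CA_cong: "(\<And>i. i \<in> C \<Longrightarrow> t i = t' i) \<Longrightarrow> CA i C t = CA i C t'"
    and D_add: "D (x + y) = D x + D y"
    and D_scale: "D (scale p x) = scale p (D x)"
    and D_hc: "D (hc j x) = hc j (D x)"
    and D_Ct: "x \<in> Ct i \<Longrightarrow> D x \<in> Ct (Suc i)"
    and D_CA: "C \<subseteq> {1..d} \<Longrightarrow> x \<in> CA i C t \<Longrightarrow> D x \<in> CA (Suc i) C t"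
    and D_D: "x \<in> Ct i \<Longrightarrow> D (D x) = 0"
    and regular: "C \<subseteq> {1..d} \<Longrightarrow> e \<in> {1..d} - C \<Longrightarrow> \<forall>i. 1 \<le> t i \<Longrightarrow> 1 \<le> s \<Longrightarrow> c \<in> Ct (Suc i) \<Longrightarrow>
      scale (\<theta> e ^ s) c \<in> CA (Suc i) C t \<Longrightarrow> c \<in> CA (Suc i) C t"
    and weak: "C \<subseteq> {1..d} \<Longrightarrow> e \<in> {1..d} - C \<Longrightarrow> \<forall>i. 1 \<le> t i \<Longrightarrow> 1 \<le> s \<Longrightarrow> y \<in> Ct 0 \<Longrightarrow>
      scale (\<theta> e ^ s) y \<in> CA 0 C t \<Longrightarrow> p \<in> irrelevant_ideal n \<Longrightarrow> scale p y \<in> CA 0 C t"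
    and torsion: "C \<subseteq> {1..d} \<Longrightarrow> e \<in> {1..d} \<Longrightarrow> \<forall>i. 1 \<le> t i \<Longrightarrow> c \<in> Ct i \<Longrightarrow>
      D c \<in> CA (Suc i) C t \<Longrightarrow>
      \<exists>s\<ge>1. \<exists>b\<in>(case i of 0 \<Rightarrow> {0} | Suc k \<Rightarrow> Ct k). scale (\<theta> e ^ s) c - D b \<in> CA i C t"
begin

lemma D_0 [simp]: "D 0 = 0" using D_add[of 0 0] by simp
lemma D_minus: "D (- x) = - D x"
  using D_add[of x "- x"] by (simp add: eq_neg_iff_add_eq_0 add.commute)
lemma D_diff: "D (x - y) = D x - D y"
  using D_add[of x "- y"] by (simp add: D_minus)

definition Cm :: "nat \<Rightarrow> 'w set" where
  "Cm i = (case i of 0 \<Rightarrow> {0} | Suc k \<Rightarrow> Ct k)"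

text \<open>Elements of \<open>Ct i\<close> that represent cocycles of the quotient complex;
  likewise \<open>Bd\<close> contains all of \<open>CA\<close>. In this way \<open>Zc / Bd\<close>
  is the cohomology of the quotient complex without any quotient type or coset.\<close>

definition Zc :: "nat \<Rightarrow> nat set \<Rightarrow> (nat \<Rightarrow> nat) \<Rightarrow> 'w set" where
  "Zc i C t = {c \<in> Ct i. D c \<in> CA (Suc i) C t}"

definition Bd :: "nat \<Rightarrow> nat set \<Rightarrow> (nat \<Rightarrow> nat) \<Rightarrow> 'w set" where
  "Bd i C t = {D b + a | b a. b \<in> Cm i \<and> a \<in> CA i C t}"

lemma BdI: "a \<in> CA i C t \<Longrightarrow> b \<in> Cm i \<Longrightarrow> D b + a \<in> Bd i C t"
  by (auto simp: Bd_def)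

lemma sCt: "subspace (Ct i)" and sCA: "C \<subseteq> {1..d} \<Longrightarrow> subspace (CA i C t)"
  using Ct_gsub CA_gsub gsub_subspace by auto

lemma gsub_0: "gsub {0}"
  by (auto intro: gsubI)

lemma gsub_Cm: "gsub (Cm i)"
  by (cases i) (auto simp: Cm_def Ct_gsub gsub_0)

lemma D_D_Cm: "x \<in> Cm i \<Longrightarrow> D (D x) = 0"
  by (cases i) (auto simp: Cm_def D_D)

lemma D_Cm: "x \<in> Cm i \<Longrightarrow> D x \<in> Ct i"
  by (cases i) (auto simp: Cm_def D_Ct subspace_0[OF sCt])

lemma finite_hc_D: "finite {j. hc j x \<noteq> 0} \<Longrightarrow> finite {j. hc j (D x) \<noteq> 0}"
  by (rule finite_subset[of _ "{j. hc j x \<noteq> 0}"]) (auto simp: D_hc[symmetric])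

lemma gsub_D_image: assumes "gsub Z" shows "gsub (D ` Z)"
proof (rule gsubI)
  note s = gsub_subspace[OF assms]
  show "subspace (D ` Z)"
  proof (rule subspaceI)
    show "0 \<in> D ` Z" using subspace_0[OF s] D_0 by (metis image_eqI)
  next
    fix x y assume "x \<in> D ` Z" "y \<in> D ` Z"
    then show "x + y \<in> D ` Z" by (auto simp: D_add[symmetric] subspace_add[OF s])
  next
    fix p x assume "x \<in> D ` Z"
    then show "scale p x \<in> D ` Z" by (auto simp: D_scale[symmetric] subspace_scale[OF s])
  qed
next
  fix z j assume "z \<in> D ` Z"
  then obtain x where "x \<in> Z" "z = D x" by blast
  then show "finite {j. hc j z \<noteq> 0}" "hc j z \<in> D ` Z"
    using finite_hc_D[OF gsub_finite[OF assms]] gsub_hc[OF assms] by (auto simp: D_hc[symmetric])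
qed

lemma gsub_Bd: assumes "C \<subseteq> {1..d}" shows "gsub (Bd i C t)"
proof -
  have "Bd i C t = {x + a | x a. x \<in> D ` Cm i \<and> a \<in> CA i C t}"
    unfolding Bd_def by blast
  then show ?thesis using gsub_plus[OF gsub_D_image[OF gsub_Cm] CA_gsub[OF assms]] by simp
qed

lemma gsub_Zc: assumes "C \<subseteq> {1..d}" shows "gsub (Zc i C t)"
proof (rule gsub_subset[OF Ct_gsub])
  show "Zc i C t \<subseteq> Ct i" by (auto simp: Zc_def)
  show "subspace (Zc i C t)"
    by (rule subspaceI) (auto simp: Zc_def D_add D_scale subspace_0 subspace_add subspace_scale sCt sCA[OF assms])
  show "hc j z \<in> Zc i C t" if "z \<in> Zc i C t" for z j
    using that by (auto simp: Zc_def D_hc gsub_hc[OF Ct_gsub] gsub_hc[OF CA_gsub[OF assms]])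
qed

lemma CA_Bd: "CA i C t \<subseteq> Bd i C t"
  using subspace_0[OF gsub_subspace[OF gsub_Cm[of i]]] by (force simp: Bd_def)

lemma Bd_Zc: assumes "C \<subseteq> {1..d}" shows "Bd i C t \<subseteq> Zc i C t"
  using CA_Ct[OF assms] D_CA[OF assms] D_Cm subspace_add[OF sCt]
  by (fastforce simp: Bd_def Zc_def D_add D_D_Cm)

lemma CA_mono_insert:
  assumes "C \<subseteq> {1..d}" "e \<in> {1..d}" shows "CA i C t \<subseteq> CA i (insert e C) t"
proof (cases "e \<in> C")
  case False
  then have e: "e \<in> {1..d} - C" using assms by simp
  have "a = a + scale (\<theta> e ^ t e) 0" for a by simp
  then show ?thesis
    using CA_insert[OF assms(1) e, of i t] subspace_0[OF sCt[of i]] by blast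
qed (simp add: insert_absorb)

lemma CA_insertD:
  assumes "C \<subseteq> {1..d}" "e \<in> {1..d} - C" "x \<in> CA i (insert e C) t"
  obtains a c where "x = a + scale (\<theta> e ^ t e) c" "a \<in> CA i C t" "c \<in> Ct i"
  using CA_insert[OF assms(1,2), of i t] assms(3) by blast

lemma parameter_left: assumes "C \<subseteq> {1..d}" "card C < d" shows "\<exists>e. e \<in> {1..d} - C"
proof -
  have "C \<noteq> {1..d}" using assms(2) by auto
  then show ?thesis using assms(1) by blast
qed

text \<open>Some power \<theta>_e^s with \<open>e\<close> outside \<open>C\<close> turns
  \<open>c\<close> into a coboundary \<open>D b\<close>, and \<open>b\<close> is then a cocycle of
  degree one less for the quotient in which \<theta>_e^s is divided out too. The sum of degree and
  number of parameters has not grown, so by induction \<open>p\<close> kills the class of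
  \<open>b\<close>; cancelling \<theta>_e^s gives the claim for \<open>c\<close>.\<close>

lemma irrelevant_kills_Zc:
  assumes "C \<subseteq> {1..d}" "\<forall>i. 1 \<le> t i" "i + card C < d" "c \<in> Zc i C t" "p \<in> irrelevant_ideal n"
  shows "scale p c \<in> Bd i C t"
  using assms
proof (induction i arbitrary: C t c)
  case 0
  then obtain e where e: "e \<in> {1..d} - C" using parameter_left[of C] by auto
  then have ed: "e \<in> {1..d}" by simp
  have c: "c \<in> Ct 0" "D c \<in> CA (Suc 0) C t" using 0 by (auto simp: Zc_def)
  from torsion[OF 0(1) ed 0(2) c] obtain s where s: "s \<ge> 1" "scale (\<theta> e ^ s) c \<in> CA 0 C t"
    by auto
  from weak[OF 0(1) e 0(2) s(1) c(1) s(2) 0(5)] show ?case using CA_Bd by blast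
next
  case (Suc i)
  note C = Suc.prems(1)
  have "card C < d" using Suc.prems(3) by simp
  then obtain e where e: "e \<in> {1..d} - C" using parameter_left[OF C] by blast
  have c: "c \<in> Ct (Suc i)" "D c \<in> CA (Suc (Suc i)) C t" using Suc.prems by (auto simp: Zc_def)
  from e have ed: "e \<in> {1..d}" by simp
  from torsion[OF C ed Suc.prems(2) c] obtain s b
    where s: "s \<ge> 1" and b: "b \<in> Ct i" "scale (\<theta> e ^ s) c - D b \<in> CA (Suc i) C t"
    by (simp, blast)
  \<comment> \<open>As \<open>e\<close> is outside \<open>C\<close>, its exponent may be set to
    \<open>s\<close> without changing the submodules for \<open>C\<close>.\<close>
  define t' where "t' = t(e := s)"
  have t': "\<forall>i. 1 \<le> t' i" using Suc.prems s by (auto simp: t'_def)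
  have CAt: "CA j C t' = CA j C t" for j by (rule CA_cong) (use e in \<open>auto simp: t'_def\<close>)
  have C': "insert e C \<subseteq> {1..d}" using C e by auto
  have t'e: "t' e = s" by (simp add: t'_def)
  have "D b = (- (scale (\<theta> e ^ s) c - D b)) + scale (\<theta> e ^ s) c" by simp
  also have "\<dots> \<in> CA (Suc i) (insert e C) t'"
    unfolding CA_insert[OF C e, of "Suc i" t'] t'e CAt
    using c(1) subspace_neg[OF sCA[OF C] b(2)] by blast
  finally have "b \<in> Zc i (insert e C) t'" using b by (simp add: Zc_def)
  moreover have "i + card (insert e C) < d" using Suc.prems(3) e finite_subset[OF C] by simp
  ultimately have "scale p b \<in> Bd i (insert e C) t'"
    using Suc.IH[OF C' t' _ _ Suc.prems(5)] by blast
  then obtain b' x where b': "b' \<in> Cm i" "x \<in> CA i (insert e C) t'" "scale p b = D b' + x"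
    by (auto simp: Bd_def)
  obtain a' c' where a': "x = a' + scale (\<theta> e ^ s) c'" "a' \<in> CA i C t" "c' \<in> Ct i"
    by (rule CA_insertD[OF C e b'(2)]) (simp only: t'e CAt)
  have "D (scale p b) = D a' + scale (\<theta> e ^ s) (D c')"
    using b' a' by (simp add: D_add D_D_Cm D_scale)
  \<comment> \<open>Applying \<open>D\<close> to \<open>p b = D b' + a' + \<theta>_e^s c'\<close>
    removes \<open>b'\<close>; comparison with the relation between \<open>c\<close> and
    \<open>D b\<close> leaves a multiple of \<theta>_e^s.\<close>
  then have "scale (\<theta> e ^ s) (scale p c - D c') = D a' + scale p (scale (\<theta> e ^ s) c - D b)"
    by (simp add: scale_right_diff_distrib D_scale mult.commute)
  also have "\<dots> \<in> CA (Suc i) C t"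
    by (intro subspace_add[OF sCA[OF C]] subspace_scale[OF sCA[OF C]] D_CA[OF C a'(2)] b(2))
  finally have "scale p c - D c' \<in> CA (Suc i) C t"
    by (rule regular[OF C e Suc.prems(2) s, rotated])
      (intro subspace_diff[OF sCt] subspace_scale[OF sCt] c(1) D_Ct[OF a'(3)])
  then have "D c' + (scale p c - D c') \<in> Bd (Suc i) C t"
    by (rule BdI) (simp add: Cm_def a'(3))
  then show ?case by simp
qed

section \<open>Exactness for one more parameter\<close>

definition t1 :: "nat \<Rightarrow> nat" where "t1 = (\<lambda>_. 1)"

lemma t1_apply: "t1 e = 1" and t1_ge: "\<forall>i. 1 \<le> t1 i"
  by (auto simp: t1_def)

text \<open>The connecting homomorphism \<open>H\<^sup>i(M / \<Theta>\<^bsub>C \<union> {e}\<^esub> M) \<rightarrow> H\<^sup>i\<^sup>+\<^sup>1(M / \<Theta>\<^sub>C M)(-1)\<close> as a relation.\<close>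

definition conn :: "nat \<Rightarrow> nat set \<Rightarrow> nat \<Rightarrow> 'w \<Rightarrow> 'w \<Rightarrow> bool" where
  "conn i C e b c \<longleftrightarrow> b \<in> Ct i \<and> c \<in> Ct (Suc i) \<and> D b - scale (\<theta> e) c \<in> CA (Suc i) C t1"

context
  fixes C e assumes C: "C \<subseteq> {1..d}" and e: "e \<in> {1..d} - C"
begin

lemma C': "insert e C \<subseteq> {1..d}" using C e by auto

lemma theta_regular:
  "c \<in> Ct (Suc i) \<Longrightarrow> scale (\<theta> e) c \<in> CA (Suc i) C t1 \<Longrightarrow> c \<in> CA (Suc i) C t1"
  using regular[OF C e t1_ge order.refl, of c i] by simp

lemma insertD:
  assumes "x \<in> CA i (insert e C) t1"
  obtains a c where "x = a + scale (\<theta> e) c" "a \<in> CA i C t1" "c \<in> Ct i"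
  using CA_insertD[OF C e assms] by (auto simp: t1_apply)

lemma insertI':
  "a \<in> CA i C t1 \<Longrightarrow> c \<in> Ct i \<Longrightarrow> a + scale (\<theta> e) c \<in> CA i (insert e C) t1"
  using CA_insert[OF C e, of i t1] by (auto simp: t1_apply)

lemma Bd_insertD:
  assumes "x \<in> Bd i (insert e C) t1"
  obtains b a c where "x = D b + (a + scale (\<theta> e) c)" "b \<in> Cm i" "a \<in> CA i C t1" "c \<in> Ct i"
  using assms insertD unfolding Bd_def by (smt (verit) mem_Collect_eq)

lemma Bd_mono: "Bd i C t1 \<subseteq> Bd i (insert e C) t1"
  using CA_mono_insert[OF C, of e] e unfolding Bd_def by blast

lemma Zc_mono: "Zc i C t1 \<subseteq> Zc i (insert e C) t1"
  using CA_mono_insert[OF C, of e] e unfolding Zc_def by blast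

text \<open>Injectivity of H^i(M / \<Theta>_C M) \<rightarrow> H^i(M / \<Theta>_(C \<union> {e}) M).
  A class in the kernel has the form \<theta>_e c, where \<open>c\<close> is a cocycle by
  cancellation in degree \<open>i + 1\<close>. It is zero because \<theta>_e belongs to \<mm>, which
  kills the cohomology in this range.\<close>

lemma Zc_Int_Bd:
  assumes i: "i + card C < d" shows "Zc i C t1 \<inter> Bd i (insert e C) t1 \<subseteq> Bd i C t1"
proof
  fix x assume x: "x \<in> Zc i C t1 \<inter> Bd i (insert e C) t1"
  then obtain b a c where bac: "x = D b + (a + scale (\<theta> e) c)" "b \<in> Cm i" "a \<in> CA i C t1" "c \<in> Ct i"
    using Bd_insertD by blast
  then have "scale (\<theta> e) (D c) = D x - D a" by (simp add: D_add D_scale D_D_Cm)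
  also have "\<dots> \<in> CA (Suc i) C t1"
    using x D_CA[OF C bac(3)] subspace_diff[OF sCA[OF C]] by (auto simp: Zc_def)
  finally have "c \<in> Zc i C t1" using bac(4) D_Ct theta_regular by (simp add: Zc_def)
  then have "scale (\<theta> e) c \<in> Bd i C t1"
    using irrelevant_kills_Zc[OF C t1_ge i, of c "\<theta> e"] i theta_irrelevant e by auto
  moreover have "D b + a \<in> Bd i C t1" using bac by (auto simp: Bd_def)
  ultimately show "x \<in> Bd i C t1"
    using subspace_add[OF gsub_subspace[OF gsub_Bd[OF C]]] bac(1) by (metis add.assoc)
qed

lemma conn_add: "conn i C e x u \<Longrightarrow> conn i C e y v \<Longrightarrow> conn i C e (x + y) (u + v)"
  using subspace_add[OF sCA[OF C], of "D x - scale (\<theta> e) u" "Suc i" t1 "D y - scale (\<theta> e) v"]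
  by (simp add: conn_def subspace_add[OF sCt] D_add algebra_simps)

lemma conn_scale: "conn i C e x u \<Longrightarrow> conn i C e (scale p x) (scale p u)"
  using subspace_scale[OF sCA[OF C], of "D x - scale (\<theta> e) u" "Suc i" t1 p]
  by (simp add: conn_def subspace_scale[OF sCt] D_scale scale_right_diff_distrib mult.commute)

lemma conn_hc: assumes "conn i C e x u" shows "conn i C e (hc (j + 1) x) (hc j u)"
proof -
  have "hc (j + 1) (D x - scale (\<theta> e) u) \<in> CA (Suc i) C t1"
    using assms gsub_hc[OF CA_gsub[OF C]] by (simp add: conn_def)
  moreover have "hc (j + 1) (scale (\<theta> e) u) = scale (\<theta> e) (hc j u)"
    using hc_scale[OF theta_grade, of e j u] e by (simp add: add.commute)
  ultimately show ?thesis
    using assms by (simp add: conn_def hc_diff D_hc gsub_hc[OF Ct_gsub])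
qed

lemma conn_0: "x \<in> Zc i C t1 \<Longrightarrow> conn i C e x 0"
  by (auto simp: conn_def Zc_def subspace_0[OF sCt])

text \<open>From \<open>D (D x) = 0\<close> it follows that \<theta>_e times \<open>D u\<close> lies
  in the cochains for \<open>C\<close>, and \<theta>_e cancels in positive degree.\<close>

lemma conn_Zc:
  assumes "conn i C e x u" "x \<in> Zc i (insert e C) t1" shows "u \<in> Zc (Suc i) C t1"
proof -
  have "- D (D x - scale (\<theta> e) u) \<in> CA (Suc (Suc i)) C t1"
    using assms D_CA[OF C] subspace_neg[OF sCA[OF C]] by (auto simp: conn_def)
  moreover have "D (D x) = 0" using assms D_D by (auto simp: conn_def)
  ultimately have "scale (\<theta> e) (D u) \<in> CA (Suc (Suc i)) C t1"
    by (simp add: D_diff D_scale)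
  then show ?thesis using assms D_Ct theta_regular by (simp add: conn_def Zc_def)
qed

lemma conn_total:
  assumes "x \<in> Zc i (insert e C) t1" obtains u where "conn i C e x u"
proof -
  from assms have "D x \<in> CA (Suc i) (insert e C) t1" by (simp add: Zc_def)
  then obtain a c where "D x = a + scale (\<theta> e) c" "a \<in> CA (Suc i) C t1" "c \<in> Ct (Suc i)"
    by (rule insertD)
  then have "conn i C e x c" using assms by (simp add: conn_def Zc_def)
  then show ?thesis by (rule that)
qed

text \<open>The image of the connecting map is the kernel of multiplication by \<theta>_e: a cochain
  that exhibits \<theta>_e u as a coboundary is itself a preimage of \<open>u\<close>.\<close>

lemma conn_surj:
  assumes "u \<in> Zc (Suc i) C t1" "scale (\<theta> e) u \<in> Bd (Suc i) C t1"
  obtains x where "conn i C e x u" "x \<in> Zc i (insert e C) t1"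
proof -
  from assms(2) obtain b a where ba: "scale (\<theta> e) u = D b + a" "b \<in> Ct i" "a \<in> CA (Suc i) C t1"
    by (auto simp: Bd_def Cm_def)
  have u: "u \<in> Ct (Suc i)" using assms by (simp add: Zc_def)
  have "D b = - a + scale (\<theta> e) u" "- a \<in> CA (Suc i) C t1"
    using ba subspace_neg[OF sCA[OF C]] by auto
  then have "conn i C e b u" "b \<in> Zc i (insert e C) t1"
    using ba u insertI'[of "- a" "Suc i" u] by (auto simp: conn_def Zc_def)
  then show ?thesis by (rule that)
qed

text \<open>If \<open>u\<close> is the coboundary of \<open>b\<close>, then \<theta>_e b is zero
  modulo \<Theta>_(C \<union> {e}), and subtracting it makes \<open>x\<close> a cocycle already
  modulo \<Theta>_C.\<close>

lemma conn_ker: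
  assumes "conn i C e x u" "u \<in> Bd (Suc i) C t1"
  shows "\<exists>y\<in>Zc i C t1. x - y \<in> Bd i (insert e C) t1"
proof -
  from assms(2) obtain b a where ba: "u = D b + a" "b \<in> Ct i" "a \<in> CA (Suc i) C t1"
    by (auto simp: Bd_def Cm_def)
  have "D (x - scale (\<theta> e) b) = (D x - scale (\<theta> e) u) + scale (\<theta> e) a"
    by (simp add: ba D_diff D_scale algebra_simps)
  also have "\<dots> \<in> CA (Suc i) C t1"
    using assms ba subspace_add[OF sCA[OF C]] subspace_scale[OF sCA[OF C]] by (auto simp: conn_def)
  finally have "x - scale (\<theta> e) b \<in> Zc i C t1"
    using assms ba subspace_diff[OF sCt] subspace_scale[OF sCt] by (auto simp: conn_def Zc_def)
  moreover have "scale (\<theta> e) b \<in> Bd i (insert e C) t1"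
    using insertI'[OF subspace_0[OF sCA[OF C]] ba(2)] CA_Bd by auto
  ultimately show ?thesis by (intro bexI[of _ "x - scale (\<theta> e) b"]) auto
qed

text \<open>A coboundary modulo \<Theta>_(C \<union> {e}) has a part \<theta>_e c, and by
  cancellation its image can only be \<open>D c\<close> up to \<open>CA\<close>.\<close>

lemma conn_wd:
  assumes "conn i C e x u" "x \<in> Bd i (insert e C) t1" shows "u \<in> Bd (Suc i) C t1"
proof -
  obtain b a c where bac: "x = D b + (a + scale (\<theta> e) c)" "b \<in> Cm i" "a \<in> CA i C t1" "c \<in> Ct i"
    using assms(2) by (rule Bd_insertD)
  have "scale (\<theta> e) (u - D c) = D a - (D x - scale (\<theta> e) u)"
    by (simp add: bac(1) D_add D_scale D_D_Cm[OF bac(2)] scale_right_diff_distrib)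
  also have "\<dots> \<in> CA (Suc i) C t1"
    by (rule subspace_diff[OF sCA[OF C] D_CA[OF C bac(3)]]) (use assms(1) in \<open>simp add: conn_def\<close>)
  finally have mem: "scale (\<theta> e) (u - D c) \<in> CA (Suc i) C t1" .
  have "u - D c \<in> Ct (Suc i)"
    by (rule subspace_diff[OF sCt _ D_Ct[OF bac(4)]]) (use assms(1) in \<open>simp add: conn_def\<close>)
  then have "u - D c \<in> CA (Suc i) C t1"
    using mem by (rule theta_regular)
  then have "D c + (u - D c) \<in> Bd (Suc i) C t1"
    by (rule BdI) (simp add: Cm_def bac(4))
  then show ?thesis by simp
qed

text \<open>With \<open>Y\<close> and \<open>Y'\<close> all cocycles this is the full short exact
  sequence. Proper subspaces are used on the diagonal \<open>i + 1 + card C = d\<close>, where only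
  classes killed by \<mm> are followed.\<close>

lemma gbasis_conn:
  assumes i: "i + card C < d"
    and Y: "gsub Y" "Bd i (insert e C) t1 \<subseteq> Y" "Y \<subseteq> Zc i (insert e C) t1" "Zc i C t1 \<subseteq> Y"
    and Y': "gsub Y'" "Bd (Suc i) C t1 \<subseteq> Y'" "Y' \<subseteq> Zc (Suc i) C t1"
    and tot: "\<And>x u. x \<in> Y \<Longrightarrow> conn i C e x u \<Longrightarrow> u \<in> Y'"
    and surj: "\<And>u. u \<in> Y' \<Longrightarrow> \<exists>x\<in>Y. conn i C e x u"
    and b1: "gbasis I1 b1 dg1 (Zc i C t1) (Bd i C t1)"
    and b2: "gbasis I2 b2 dg2 Y' (Bd (Suc i) C t1)" and disj: "I1 \<inter> I2 = {}"
  shows "\<exists>b. gbasis (I1 \<union> I2) b (\<lambda>i. if i \<in> I1 then dg1 i else dg2 i + 1) Y (Bd i (insert e C) t1)"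
proof (rule gbasis_extension[OF gsub_Zc[OF C] _ Y(1) _ Y'(1) _ Y'(2) Y(4) Bd_mono Zc_Int_Bd[OF i],
      where R = "conn i C e"])
  show "subspace (Bd i C t1)" "subspace (Bd i (insert e C) t1)" "subspace (Bd (Suc i) C t1)"
    using gsub_Bd C C' gsub_subspace by auto
  show "\<exists>u\<in>Y'. conn i C e x u" if "x \<in> Y" for x
    using conn_total tot[OF that] Y(3) that by (metis subsetD)
qed (use conn_add conn_scale conn_hc conn_0 surj conn_ker conn_wd b1 b2 disj in auto)

end

lemma gbasis_cong:
  assumes "gbasis I b dg Z B" "I = I'" "\<And>i. i \<in> I \<Longrightarrow> dg i = dg' i"
  shows "gbasis I' b dg' Z B"
  using assms by (auto simp: gbasis_def)

section \<open>Bases for quotients by several parameters\<close>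

context
  fixes I :: "nat \<Rightarrow> 'x set" and b0 :: "nat \<Rightarrow> 'x \<Rightarrow> 'w" and dg :: "nat \<Rightarrow> 'x \<Rightarrow> int"
  assumes b0: "\<And>j. j < d \<Longrightarrow> gbasis (I j) (b0 j) (dg j) (Zc j {} t1) (Bd j {} t1)"
begin

text \<open>In the step from \<open>r\<close> to \<open>r + 1\<close>, H^i(M / \<Theta>_r M)
  contributes the sets without \<open>r + 1\<close> and H^(i+1)(M / \<Theta>_r M)(-1) the sets with
  \<open>r + 1\<close>. Every element of \<open>C\<close> therefore raises both the cohomological
  degree and the shift by one, which explains \<open>i + card C\<close> and
  \<open>int (card C)\<close>.\<close>

lemma gbasis_quotient:
  "i + r < d \<Longrightarrow> \<exists>b. gbasis {(C, x). C \<subseteq> {1..r} \<and> x \<in> I (i + card C)} b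
     (\<lambda>(C, x). dg (i + card C) x + int (card C)) (Zc i {1..r} t1) (Bd i {1..r} t1)"
proof (induction r arbitrary: i)
  case 0
  have gb: "gbasis (Pair ({} :: nat set) ` I i) (\<lambda>(C, x). b0 i x) (\<lambda>(C, x). dg (i + card C) x + int (card C))
      (Zc i {} t1) (Bd i {} t1)"
    by (rule gbasis_reindex[OF b0]) (use 0 in \<open>auto intro: inj_onI\<close>)
  have eq: "Pair {} ` I i = {(C :: nat set, x). C \<subseteq> {} \<and> x \<in> I (i + card C)}" by auto
  have z: "{1..0::nat} = {}" by simp
  show ?case unfolding z by (rule exI, rule gb[unfolded eq])
next
  case (Suc r)
  let ?C = "{1..r}" and ?e = "Suc r"
  let ?I1 = "{(C, x). C \<subseteq> {1..r} \<and> x \<in> I (i + card C)}"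
  let ?J = "{(C, x). C \<subseteq> {1..r} \<and> x \<in> I (Suc i + card C)}"
  let ?dg = "\<lambda>(C :: nat set, x). dg (i + card C) x + int (card C)"
  let ?h = "\<lambda>(C, x :: 'x). (insert ?e C, x)"
  have C: "?C \<subseteq> {1..d}" and e: "?e \<in> {1..d} - ?C" and ins: "insert ?e ?C = {1..Suc r}"
    using Suc.prems by auto
  have C': "{1..Suc r} \<subseteq> {1..d}" using Suc.prems by auto
  from Suc obtain b1 where b1: "gbasis ?I1 b1 ?dg (Zc i ?C t1) (Bd i ?C t1)"
    by (metis (no_types, lifting) Suc_lessD add_Suc_right)
  from Suc.IH[of "Suc i"] Suc.prems obtain b2
    where b2: "gbasis ?J b2 (\<lambda>(C, x). dg (Suc i + card C) x + int (card C)) (Zc (Suc i) ?C t1) (Bd (Suc i) ?C t1)"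
    by auto
  have fin: "finite C" if "C \<subseteq> {1..r}" for C using that finite_subset by blast
  have nin: "?e \<notin> C" if "C \<subseteq> {1..r}" for C using that by auto
  \<comment> \<open>The extension lemma adds one to the degrees coming from the image, while
    \<open>?dg\<close> at \<open>insert ?e C\<close> already counts \<open>?e\<close>; so one is
    taken off in advance.\<close>
  have b2': "gbasis (?h ` ?J) (\<lambda>(C, x). b2 (C - {?e}, x)) (\<lambda>p. ?dg p - 1) (Zc (Suc i) ?C t1) (Bd (Suc i) ?C t1)"
  proof (rule gbasis_reindex[OF b2])
    show "inj_on ?h ?J" by (rule inj_on_insert_fst) (use nin in auto)
  qed (use nin fin in auto)
  have "\<exists>b. gbasis (?I1 \<union> ?h ` ?J) b (\<lambda>p. if p \<in> ?I1 then ?dg p else ?dg p - 1 + 1)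
    (Zc i (insert ?e ?C) t1) (Bd i (insert ?e ?C) t1)"
  proof (rule gbasis_conn[OF C e _ _ _ _ _ _ _ _ _ _ b1 b2'])
    show "i + card ?C < d" using Suc.prems by simp
    show "gsub (Zc i (insert ?e ?C) t1)" using gsub_Zc C' ins by simp
    show "Bd i (insert ?e ?C) t1 \<subseteq> Zc i (insert ?e ?C) t1" using Bd_Zc C' ins by simp
    show "Zc i ?C t1 \<subseteq> Zc i (insert ?e ?C) t1" by (rule Zc_mono[OF C e])
    show "gsub (Zc (Suc i) ?C t1)" by (rule gsub_Zc[OF C])
    show "Bd (Suc i) ?C t1 \<subseteq> Zc (Suc i) ?C t1" by (rule Bd_Zc[OF C])
    show "u \<in> Zc (Suc i) ?C t1" if "x \<in> Zc i (insert ?e ?C) t1" "conn i ?C ?e x u" for x u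
      using conn_Zc[OF C e] that by blast
    show "\<exists>x\<in>Zc i (insert ?e ?C) t1. conn i ?C ?e x u" if u: "u \<in> Zc (Suc i) ?C t1" for u
    proof -
      have "scale (\<theta> ?e) u \<in> Bd (Suc i) ?C t1"
        by (rule irrelevant_kills_Zc[OF C t1_ge _ u]) (use Suc.prems theta_irrelevant in auto)
      then show ?thesis using conn_surj[OF C e u] by metis
    qed
    show "?I1 \<inter> ?h ` ?J = {}" using nin by auto
  qed auto
  then obtain b where "gbasis (?I1 \<union> ?h ` ?J) b (\<lambda>p. if p \<in> ?I1 then ?dg p else ?dg p - 1 + 1)
    (Zc i {1..Suc r} t1) (Bd i {1..Suc r} t1)" unfolding ins by blast
  then have "gbasis {(C, x). C \<subseteq> {1..Suc r} \<and> x \<in> I (i + card C)} b ?dg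
    (Zc i {1..Suc r} t1) (Bd i {1..Suc r} t1)"
  proof (rule gbasis_cong)
    show "?I1 \<union> ?h ` ?J = {(C, x). C \<subseteq> {1..Suc r} \<and> x \<in> I (i + card C)}" (is "_ = ?K")
    proof
      show "?I1 \<union> ?h ` ?J \<subseteq> ?K" using fin nin by fastforce
      show "?K \<subseteq> ?I1 \<union> ?h ` ?J"
      proof (rule subsetI, rule ccontr)
        fix p assume pK: "p \<in> ?K" and notin: "p \<notin> ?I1 \<union> ?h ` ?J"
        obtain C x where p: "p = (C, x)" by (cases p)
        from pK have h: "C \<subseteq> {1..Suc r}" "x \<in> I (i + card C)" unfolding p by auto
        have h3: "p \<notin> ?I1" "p \<notin> ?h ` ?J"
          using notin unfolding Un_iff de_Morgan_disj by (rule conjunct1, rule conjunct2)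
        have "?e \<notin> C"
        proof
          assume ec: "?e \<in> C"
          have "card C = Suc (card (C - {?e}))"
            using card_Suc_Diff1[OF finite_subset[OF h(1) finite_atLeastAtMost] ec] by (rule sym)
          then have "i + card C = Suc i + card (C - {?e})" by simp
          with h have "(C - {?e}, x) \<in> ?J" by auto
          then have "?h (C - {?e}, x) \<in> ?h ` ?J" by blast
          with h3(2) p ec show False by (simp only: prod.case insert_Diff_single insert_absorb)
        qed
        then have "C \<subseteq> {1..r}" using h(1)[folded ins] by blast
        then have "(C, x) \<in> ?I1" using h(2) by simp
        then show False using h3(1) p by simp
      qed
    qed
  qed auto
  then show ?case by blast
qed

text \<open>Runs along the diagonal from \<open>M / \<Theta>_r M\<close> in degree
  \<open>d - r\<close> to \<open>M\<close> in degree \<open>d\<close>, with a space \<open>Y\<close>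
  of classes killed by \<mm> in the place of all cocycles. That \<open>Y\<close> contains the image
  from \<open>{1..r} - {e}\<close> makes the kernel of the connecting map complete; it is required
  for every \<open>e\<close>, not only the last one, so that it survives the recursion. Among the
  subsets only \<open>{1..r}\<close> itself reaches degree \<open>d\<close>, and it is indexed by
  \<open>J\<close>. The conclusion speaks of every basis of \<open>Y0\<close> because
  \<open>Y0\<close> is known only at the end of the recursion.\<close>

lemma gbasis_socle:
  assumes "r \<le> d" "gsub Y" "Bd (d - r) {1..r} t1 \<subseteq> Y" "Y \<subseteq> Zc (d - r) {1..r} t1"
    and "\<And>e. e \<in> {1..r} \<Longrightarrow> Zc (d - r) ({1..r} - {e}) t1 \<subseteq> Y"
    and "\<And>p y. p \<in> irrelevant_ideal n \<Longrightarrow> y \<in> Y \<Longrightarrow> scale p y \<in> Bd (d - r) {1..r} t1"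
  shows "\<exists>Y0. gsub Y0 \<and> Bd d {} t1 \<subseteq> Y0 \<and> Y0 \<subseteq> Zc d {} t1 \<and>
     (\<forall>p\<in>irrelevant_ideal n. \<forall>y\<in>Y0. scale p y \<in> Bd d {} t1) \<and>
     (\<forall>J bJ dgJ. gbasis J bJ dgJ Y0 (Bd d {} t1) \<longrightarrow>
       (\<exists>b. gbasis {(C, x). C \<subseteq> {1..r} \<and> x \<in> (if C = {1..r} then J else I (d - r + card C))} b
       (\<lambda>(C, x). (if C = {1..r} then dgJ x else dg (d - r + card C) x) + int (card C)) Y (Bd (d - r) {1..r} t1)))"
  using assms
proof (induction r arbitrary: Y)
  case 0
  have z: "{1..0::nat} = {}" by simp
  have J: "\<exists>b. gbasis {(C, x). C \<subseteq> {} \<and> x \<in> (if C = {} then J else I (d - 0 + card C))} b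
       (\<lambda>(C :: nat set, x). (if C = {} then dgJ x else dg (d - 0 + card C) x) + int (card C)) Y (Bd d {} t1)"
    if gb: "gbasis J bJ dgJ Y (Bd d {} t1)" for J :: "'x set" and bJ dgJ
  proof
    show "gbasis {(C, x). C \<subseteq> {} \<and> x \<in> (if C = {} then J else I (d - 0 + card C))} (\<lambda>(C, x). bJ x)
       (\<lambda>(C :: nat set, x). (if C = {} then dgJ x else dg (d - 0 + card C) x) + int (card C)) Y (Bd d {} t1)"
      by (rule gbasis_cong[OF gbasis_reindex[OF gb, of "Pair {}" _ "\<lambda>(C, x). dgJ x"]])
        (auto intro: inj_onI)
  qed
  show ?case
    by (rule exI[of _ Y]) (use 0 J in \<open>unfold z, auto\<close>)
next
  case (Suc r)
  let ?C = "{1..r}" and ?e = "Suc r" and ?i = "d - Suc r"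
  have C: "?C \<subseteq> {1..d}" and e: "?e \<in> {1..d} - ?C" and ins: "insert ?e ?C = {1..Suc r}"
    and i: "Suc ?i = d - r" and diff: "{1..Suc r} - {?e} = ?C"
    using Suc.prems by auto
  note C' = C'[OF C e]
  note Y = Suc.prems(2-6)[folded ins]
  have YC: "Zc ?i ?C t1 \<subseteq> Y" using Suc.prems(5)[of ?e] diff by simp
  \<comment> \<open>The image of \<open>Y\<close> under the connecting map: one degree higher, one
    parameter fewer.\<close>
  define Y' where "Y' = {c \<in> Zc (Suc ?i) ?C t1. \<exists>b\<in>Y. conn ?i ?C ?e b c}"
  have sY: "subspace Y" using Y gsub_subspace by blast
  have "gsub Y'"
  proof (rule gsub_subset[OF gsub_Zc[OF C]])
    show "Y' \<subseteq> Zc (Suc ?i) ?C t1" by (auto simp: Y'_def)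
    note sZ = gsub_subspace[OF gsub_Zc[OF C]]
    show "subspace Y'"
    proof (rule subspaceI)
      show "0 \<in> Y'" unfolding Y'_def
        using conn_0[OF C e subspace_0[OF sZ]] subspace_0[OF sY] subspace_0[OF sZ] by blast
    next
      fix x y assume "x \<in> Y'" "y \<in> Y'"
      then show "x + y \<in> Y'" unfolding Y'_def
        using conn_add[OF C e] subspace_add[OF sY] subspace_add[OF sZ] by blast
    next
      fix p x assume "x \<in> Y'"
      then show "scale p x \<in> Y'" unfolding Y'_def
        using conn_scale[OF C e] subspace_scale[OF sY] subspace_scale[OF sZ] by blast
    qed
    show "hc j z \<in> Y'" if "z \<in> Y'" for z j
      using that conn_hc[OF C e] gsub_hc[OF Y(1)] gsub_hc[OF gsub_Zc[OF C]] unfolding Y'_def by blast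
  qed
  moreover have "Bd (Suc ?i) ?C t1 \<subseteq> Y'"
  proof
    fix c assume c: "c \<in> Bd (Suc ?i) ?C t1"
    then obtain b a where ba: "c = D b + a" "b \<in> Ct ?i" "a \<in> CA (Suc ?i) ?C t1"
      by (auto simp: Bd_def Cm_def)
    \<comment> \<open>The coboundary of \<open>b\<close> is the image of \<theta>_e b, which
      represents zero modulo \<Theta>_(r+1) and therefore belongs to \<open>Y\<close>.\<close>
    have "0 + scale (\<theta> ?e) b \<in> Y"
      using insertI'[OF C e subspace_0[OF sCA[OF C]] ba(2)] CA_Bd Y(2) by blast
    then have "scale (\<theta> ?e) b \<in> Y" by simp
    moreover have "D (scale (\<theta> ?e) b) - scale (\<theta> ?e) c = - scale (\<theta> ?e) a"
      by (simp add: ba D_scale scale_right_distrib)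
    then have "conn ?i ?C ?e (scale (\<theta> ?e) b) c"
      using ba(2,3) Bd_Zc[OF C] c subspace_scale[OF sCt] subspace_scale[OF sCA[OF C]] subspace_neg[OF sCA[OF C]]
      by (auto simp: conn_def Zc_def)
    ultimately show "c \<in> Y'" using c Bd_Zc[OF C] unfolding Y'_def by blast
  qed
  moreover have Y'Z: "Y' \<subseteq> Zc (Suc ?i) ?C t1" by (auto simp: Y'_def)
  moreover have "Zc (Suc ?i) (?C - {e'}) t1 \<subseteq> Y'" if e': "e' \<in> ?C" for e'
  proof
    fix c assume c: "c \<in> Zc (Suc ?i) (?C - {e'}) t1"
    have D: "?C - {e'} \<subseteq> {1..d}" "?e \<in> {1..d} - (?C - {e'})" using C e by auto
    have "card (?C - {e'}) = r - 1" "r \<ge> 1" using e' by auto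
    \<comment> \<open>With \<open>e'\<close> left out the degree is below the diagonal, so
      \<open>c\<close> has a preimage under the connecting map. This preimage is a cocycle for
      \<open>{1..Suc r} - {e'}\<close> and lies in \<open>Y\<close> by assumption.\<close>
    then have "Suc ?i + card (?C - {e'}) < d" using i Suc.prems by simp
    then have "scale (\<theta> ?e) c \<in> Bd (Suc ?i) (?C - {e'}) t1"
      using irrelevant_kills_Zc[OF D(1) t1_ge _ c] theta_irrelevant e by blast
    then obtain x where x: "conn ?i (?C - {e'}) ?e x c" "x \<in> Zc ?i (insert ?e (?C - {e'})) t1"
      using conn_surj[OF D c] by metis
    have "insert ?e (?C - {e'}) = insert ?e ?C - {e'}" using e' by auto
    then have "x \<in> Y" using x Y(4)[of e'] e' by auto
    have e'd: "e' \<in> {1..d}" and ins': "insert e' (?C - {e'}) = ?C" using e' C by auto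
    from CA_mono_insert[OF D(1) e'd] ins' have mono: "CA j (?C - {e'}) t1 \<subseteq> CA j ?C t1" for j by metis
    have "conn ?i ?C ?e x c" using x(1) mono unfolding conn_def by blast
    moreover have "c \<in> Zc (Suc ?i) ?C t1" using c mono unfolding Zc_def by blast
    ultimately show "c \<in> Y'" using \<open>x \<in> Y\<close> unfolding Y'_def by blast
  qed
  moreover have "scale p c \<in> Bd (Suc ?i) ?C t1" if p: "p \<in> irrelevant_ideal n" and c: "c \<in> Y'" for p c
  proof -
    from c obtain b where "b \<in> Y" "conn ?i ?C ?e b c" by (auto simp: Y'_def)
    \<comment> \<open>The connecting map commutes with \<open>p\<close>, so the zero class of
      \<open>p b\<close> goes to the class of \<open>p c\<close>, which is therefore zero.\<close>
    then show ?thesis using conn_wd[OF C e conn_scale[OF C e]] Y(5)[OF p] by blast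
  qed
  ultimately obtain Y0 where Y0: "gsub Y0" "Bd d {} t1 \<subseteq> Y0" "Y0 \<subseteq> Zc d {} t1"
     "\<forall>p\<in>irrelevant_ideal n. \<forall>y\<in>Y0. scale p y \<in> Bd d {} t1"
     and J: "\<And>J bJ dgJ. gbasis J bJ dgJ Y0 (Bd d {} t1) \<Longrightarrow>
       \<exists>b. gbasis {(C, x). C \<subseteq> {1..r} \<and> x \<in> (if C = {1..r} then J else I (d - r + card C))} b
       (\<lambda>(C, x). (if C = {1..r} then dgJ x else dg (d - r + card C) x) + int (card C)) Y' (Bd (d - r) {1..r} t1)"
    using Suc.IH[of Y'] Suc.prems(1) unfolding i by (smt (verit) Suc_leD)
  show ?case
  proof (intro exI[of _ Y0] conjI allI impI)
    fix J :: "'x set" and bJ dgJ assume "gbasis J bJ dgJ Y0 (Bd d {} t1)"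
    from J[OF this] obtain b2 where
      b2: "gbasis {(C, x). C \<subseteq> {1..r} \<and> x \<in> (if C = {1..r} then J else I (d - r + card C))} b2
       (\<lambda>(C, x). (if C = {1..r} then dgJ x else dg (d - r + card C) x) + int (card C)) Y' (Bd (Suc ?i) ?C t1)"
      (is "gbasis ?J b2 _ _ _") unfolding i by blast
    let ?I1 = "{(C, x). C \<subseteq> {1..r} \<and> x \<in> I (?i + card C)}"
    let ?dg1 = "\<lambda>(C :: nat set, x). dg (?i + card C) x + int (card C)"
    let ?dg = "\<lambda>(C, x). (if C = {1..Suc r} then dgJ x else dg (?i + card C) x) + int (card C)"
    let ?h = "\<lambda>(C, x :: 'x). (insert ?e C, x)"
    have ir: "?i + r < d" using Suc.prems by simp
    from gbasis_quotient[OF ir] obtain b1 where b1: "gbasis ?I1 b1 ?dg1 (Zc ?i ?C t1) (Bd ?i ?C t1)"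
      by blast
    have fin: "finite C" if "C \<subseteq> {1..r}" for C using that finite_subset by blast
    have nin: "?e \<notin> C" if "C \<subseteq> {1..r}" for C using that by auto
    have eq: "insert ?e C = {1..Suc r} \<longleftrightarrow> C = {1..r}" if "C \<subseteq> {1..r}" for C
      using nin[OF that] nin[OF order.refl] ins insert_ident by metis
    have b2': "gbasis (?h ` ?J) (\<lambda>(C, x). b2 (C - {?e}, x)) (\<lambda>p. ?dg p - 1) Y' (Bd (Suc ?i) ?C t1)"
    proof (rule gbasis_reindex[OF b2])
      show "inj_on ?h ?J" by (rule inj_on_insert_fst) (use nin in auto)
      fix p assume "p \<in> ?J"
      then obtain C x where p: "p = (C, x)" "C \<subseteq> {1..r}" by auto
      then show "(\<lambda>(C, x). b2 (C - {?e}, x)) (?h p) = b2 p" using nin by auto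
      have "card (insert ?e C) = Suc (card C)" using p fin nin by simp
      then show "?dg (?h p) - 1 = (\<lambda>(C, x). (if C = {1..r} then dgJ x else dg (d - r + card C) x) + int (card C)) p"
        using p(2) i by (simp only: p prod.case eq) (auto simp: i[symmetric])
    qed
    have "\<exists>b. gbasis (?I1 \<union> ?h ` ?J) b (\<lambda>p. if p \<in> ?I1 then ?dg1 p else ?dg p - 1 + 1)
      Y (Bd ?i (insert ?e ?C) t1)"
    proof (rule gbasis_conn[OF C e _ Y(1) Y(2) Y(3) YC _ _ _ _ _ b1 b2'])
      show "gsub Y'" "Bd (Suc ?i) ?C t1 \<subseteq> Y'" "Y' \<subseteq> Zc (Suc ?i) ?C t1" by fact+
      show "u \<in> Y'" if "x \<in> Y" "conn ?i ?C ?e x u" for x u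
        using conn_Zc[OF C e that(2)] Y(3) that unfolding Y'_def by blast
      show "?I1 \<inter> ?h ` ?J = {}" using nin by auto
    qed (use ir in \<open>auto simp: Y'_def\<close>)
    then obtain b where b: "gbasis (?I1 \<union> ?h ` ?J) b (\<lambda>p. if p \<in> ?I1 then ?dg1 p else ?dg p - 1 + 1)
      Y (Bd ?i {1..Suc r} t1)" unfolding ins by blast
    have "gbasis {(C, x). C \<subseteq> {1..Suc r} \<and> x \<in> (if C = {1..Suc r} then J else I (?i + card C))} b ?dg
      Y (Bd ?i {1..Suc r} t1)"
    proof (rule gbasis_cong[OF b])
      show "?I1 \<union> ?h ` ?J = {(C, x). C \<subseteq> {1..Suc r} \<and> x \<in> (if C = {1..Suc r} then J else I (?i + card C))}" (is "_ = ?K")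
      proof (rule Set.set_eqI)
        fix p :: "nat set \<times> 'x"
        obtain C x where p: "p = (C, x)" by (cases p)
        show "p \<in> ?I1 \<union> ?h ` ?J \<longleftrightarrow> p \<in> ?K"
        proof (cases "?e \<in> C")
          case False
          then have "p \<notin> ?h ` ?J" "C \<noteq> {1..Suc r}" using p by auto
          moreover have "C \<subseteq> {1..r} \<longleftrightarrow> C \<subseteq> {1..Suc r}" using False ins by auto
          ultimately show ?thesis using p by auto
        next
          case True
          let ?C' = "C - {?e}"
          have CC: "insert ?e ?C' = C" using True by auto
          have sub: "C \<subseteq> {1..Suc r} \<longleftrightarrow> ?C' \<subseteq> {1..r}" using ins by auto
          have "p \<in> ?h ` ?J \<longleftrightarrow> (?C', x) \<in> ?J"
          proof
            assume "p \<in> ?h ` ?J"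
            then obtain C1 where "(C1, x) \<in> ?J" "C = insert ?e C1" using p by auto
            then show "(?C', x) \<in> ?J" using nin[of C1] by auto
          next
            assume "(?C', x) \<in> ?J"
            then have "?h (?C', x) \<in> ?h ` ?J" by blast
            then show "p \<in> ?h ` ?J" using CC p by simp
          qed
          moreover have "p \<notin> ?I1" using True nin p by auto
          moreover have "(?C', x) \<in> ?J \<longleftrightarrow> p \<in> ?K"
          proof (cases "?C' \<subseteq> {1..r}")
            case sub': True
            have "card C = Suc (card ?C')"
              using CC fin[OF sub'] card_insert_disjoint[of ?C' ?e] by auto
            then have "?i + card C = d - r + card ?C'" using i by linarith
            moreover have "C = {1..Suc r} \<longleftrightarrow> ?C' = {1..r}" using eq[OF sub'] CC by simp
            ultimately show ?thesis unfolding p using sub sub' by simp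
          qed (use sub p in simp)
          ultimately show ?thesis by blast
        qed
      qed
      fix p assume "p \<in> ?I1 \<union> ?h ` ?J"
      show "(if p \<in> ?I1 then ?dg1 p else ?dg p - 1 + 1) = ?dg p"
        using nin by (cases p) auto
    qed
    then show "\<exists>b. gbasis {(C, x). C \<subseteq> {1..Suc r} \<and> x \<in> (if C = {1..Suc r} then J else I (d - Suc r + card C))} b
      (\<lambda>(C, x). (if C = {1..Suc r} then dgJ x else dg (d - Suc r + card C) x) + int (card C))
      Y (Bd (d - Suc r) {1..Suc r} t1)" by blast
  qed (use Y0 in auto)
qed

end

end

section \<open>The polynomial ring\<close>

lemma mpoly_ring_simps [simp]:
  "mult (mpoly_ring n) = (*)" "one (mpoly_ring n) = 1" "zero (mpoly_ring n) = 0" "add (mpoly_ring n) = (+)"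
  by (simp_all add: mpoly_ring_def)

lemma mem_mpoly_ring:
  "p \<in> carrier (mpoly_ring n) \<longleftrightarrow> (\<forall>e\<in>Poly_Mapping.keys p. Poly_Mapping.keys e \<subseteq> {1..n})"
  by (simp add: mpoly_ring_def)

lemma keys_add_exp: "Poly_Mapping.keys (a + b) = Poly_Mapping.keys a \<union> Poly_Mapping.keys (b :: nat \<Rightarrow>\<^sub>0 nat)"
  by (auto simp: in_keys_iff lookup_add)

lemma mpoly_ring_add: "p \<in> carrier (mpoly_ring n) \<Longrightarrow> q \<in> carrier (mpoly_ring n) \<Longrightarrow> p + q \<in> carrier (mpoly_ring n)"
  unfolding mem_mpoly_ring using Poly_Mapping.keys_add[of p q] by blast

lemma mpoly_ring_minus: "p \<in> carrier (mpoly_ring n) \<Longrightarrow> - p \<in> carrier (mpoly_ring n)"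
  unfolding mem_mpoly_ring by (simp add: keys_minus_pm)

lemma mpoly_ring_mult:
  assumes "p \<in> carrier (mpoly_ring n)" "q \<in> carrier (mpoly_ring n)"
  shows "p * q \<in> carrier (mpoly_ring n)"
  unfolding mem_mpoly_ring
proof
  fix e assume "e \<in> Poly_Mapping.keys (p * q)"
  then obtain a b where "e = a + b" "a \<in> Poly_Mapping.keys p" "b \<in> Poly_Mapping.keys q"
    using keys_mult[of p q] by blast
  then show "Poly_Mapping.keys e \<subseteq> {1..n}"
    using assms keys_add_exp[of a b] unfolding mem_mpoly_ring by auto
qed

lemma mpoly_ring_0: "0 \<in> carrier (mpoly_ring n)" and mpoly_ring_1: "1 \<in> carrier (mpoly_ring n)"
  by (auto simp: mem_mpoly_ring)

lemma mpoly_ring_power: "p \<in> carrier (mpoly_ring n) \<Longrightarrow> p ^ k \<in> carrier (mpoly_ring n)"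
  by (induction k) (auto intro: mpoly_ring_1 mpoly_ring_mult)

lemma mpoly_ring_mvar: "i \<in> {1..n} \<Longrightarrow> mvar i \<in> carrier (mpoly_ring n)"
  by (auto simp: mem_mpoly_ring mvar_def)

lemma cring_mpoly_ring: "cring (mpoly_ring n :: ('k::field) mpoly ring)"
proof (rule cringI)
  show "abelian_group (mpoly_ring n :: 'k mpoly ring)"
  proof (rule abelian_groupI)
    fix x :: "'k mpoly" assume "x \<in> carrier (mpoly_ring n)"
    then show "\<exists>y\<in>carrier (mpoly_ring n). y \<oplus>\<^bsub>mpoly_ring n\<^esub> x = \<zero>\<^bsub>mpoly_ring n\<^esub>"
      by (intro bexI[of _ "- x"]) (auto intro: mpoly_ring_minus)
  qed (auto intro: mpoly_ring_add mpoly_ring_0 simp: add.assoc add.commute)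
  show "comm_monoid (mpoly_ring n :: 'k mpoly ring)"
    by (rule comm_monoidI) (auto intro: mpoly_ring_mult mpoly_ring_1 simp: mult.assoc mult.commute)
qed (auto simp: distrib_right)

lemma a_inv_mpoly_ring: "p \<in> carrier (mpoly_ring n) \<Longrightarrow> \<ominus>\<^bsub>mpoly_ring n\<^esub> p = - p"
  by (rule abelian_group.minus_equality[OF ring.is_abelian_group[OF cring.axioms(1)[OF cring_mpoly_ring]]])
    (simp_all add: mpoly_ring_minus)

lemma mpoly_idealI:
  assumes "I \<subseteq> carrier (mpoly_ring n)" "0 \<in> I" "\<And>p q. p \<in> I \<Longrightarrow> q \<in> I \<Longrightarrow> p + q \<in> I"
    "\<And>p q. p \<in> I \<Longrightarrow> q \<in> carrier (mpoly_ring n) \<Longrightarrow> q * p \<in> I"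
  shows "ideal I (mpoly_ring n :: ('k::field) mpoly ring)"
proof (rule idealI)
  show "ring (mpoly_ring n :: 'k mpoly ring)" using cring_mpoly_ring cring.axioms(1) by blast
  show "subgroup I (add_monoid (mpoly_ring n))"
  proof (rule group.subgroupI)
    show "group (add_monoid (mpoly_ring n :: 'k mpoly ring))"
      using cring_mpoly_ring cring.axioms(1) ring.is_abelian_group abelian_group.a_group by blast
    fix p assume p: "p \<in> I"
    then have "(- 1) * p \<in> I" using assms(4)[OF p mpoly_ring_minus[OF mpoly_ring_1]] by simp
    then show "inv\<^bsub>add_monoid (mpoly_ring n)\<^esub> p \<in> I"
      using a_inv_mpoly_ring[of p n] p assms(1) by (auto simp: a_inv_def)
  qed (use assms in auto)
qed (use assms(4) in \<open>auto simp: mult.commute\<close>)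

text \<open>Minimality of the generated ideal in the form used below: a property that is closed
  under the ideal operations has to be checked on the variables only.\<close>

lemma irrelevant_ideal_subset:
  assumes "I \<subseteq> carrier (mpoly_ring n)" "0 \<in> I" "\<And>p q. p \<in> I \<Longrightarrow> q \<in> I \<Longrightarrow> p + q \<in> I"
    "\<And>p q. p \<in> I \<Longrightarrow> q \<in> carrier (mpoly_ring n) \<Longrightarrow> q * p \<in> I" "\<And>i. i \<in> {1..n} \<Longrightarrow> mvar i \<in> I"
  shows "irrelevant_ideal n \<subseteq> (I :: ('k::field) mpoly set)"
  unfolding irrelevant_ideal_def
  by (rule ring.genideal_minimal[OF cring.axioms(1)[OF cring_mpoly_ring] mpoly_idealI[OF assms(1-4)]])
    (use assms(5) in auto)

lemma mvar_irrelevant: "i \<in> {1..n} \<Longrightarrow> mvar i \<in> irrelevant_ideal n"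
  unfolding irrelevant_ideal_def
  using ring.genideal_self[OF cring.axioms(1)[OF cring_mpoly_ring], of "mvar ` {1..n}" n] mpoly_ring_mvar by blast

lemma irrelevant_ideal_carrier: "irrelevant_ideal n \<subseteq> carrier (mpoly_ring n)"
  by (rule irrelevant_ideal_subset)
    (auto intro: mpoly_ring_0 mpoly_ring_add mpoly_ring_mult mpoly_ring_mvar)

lemma exp_deg_superset:
  "finite S \<Longrightarrow> Poly_Mapping.keys e \<subseteq> S \<Longrightarrow> exp_deg e = (\<Sum>i\<in>S. Poly_Mapping.lookup e i)"
  unfolding exp_deg_def by (rule sum.mono_neutral_left) (auto simp: in_keys_iff)

lemma exp_deg_add: "exp_deg (a + b) = exp_deg a + exp_deg b"
  using exp_deg_superset[of "Poly_Mapping.keys a \<union> Poly_Mapping.keys b" "a + b"]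
    exp_deg_superset[of "Poly_Mapping.keys a \<union> Poly_Mapping.keys b" a]
    exp_deg_superset[of "Poly_Mapping.keys a \<union> Poly_Mapping.keys b" b]
  by (simp add: keys_add_exp lookup_add sum.distrib)

lemma exp_deg_0 [simp]: "exp_deg 0 = 0" by (simp add: exp_deg_def)

lemma mpoly_grade_mult:
  assumes "p \<in> mpoly_grade n i" "q \<in> mpoly_grade n j" shows "p * q \<in> mpoly_grade n (i + j)"
proof -
  have "int (exp_deg e) = i + j" if "e \<in> Poly_Mapping.keys (p * q)" for e
  proof -
    from that obtain a b where "e = a + b" "a \<in> Poly_Mapping.keys p" "b \<in> Poly_Mapping.keys q"
      using keys_mult[of p q] by blast
    then show ?thesis using assms by (simp add: mpoly_grade_def exp_deg_add)
  qed
  then show ?thesis using assms mpoly_ring_mult by (auto simp: mpoly_grade_def)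
qed

lemma one_mpoly_grade: "1 \<in> mpoly_grade n 0"
  using cpoly_in_grade[of 1 n] by simp

lemma mpoly_grade_power: "p \<in> mpoly_grade n i \<Longrightarrow> p ^ k \<in> mpoly_grade n (int k * i)"
  by (induction k) (auto simp: one_mpoly_grade algebra_simps intro: mpoly_grade_mult[of p n i, simplified add.commute])

lemma mpoly_grade_prod:
  "(\<And>i. i \<in> A \<Longrightarrow> f i \<in> mpoly_grade n 1) \<Longrightarrow> finite A \<Longrightarrow> prod f A \<in> mpoly_grade n (int (card A))"
proof (induction A rule: infinite_finite_induct)
  case (insert x F)
  then show ?case using mpoly_grade_mult[of "f x" n 1 "prod f F" "int (card F)"] by simp
qed (auto simp: one_mpoly_grade)

lemma mpoly_grade_carrier: "p \<in> mpoly_grade n i \<Longrightarrow> p \<in> carrier (mpoly_ring n)"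
  by (simp add: mpoly_grade_def)

lemma monomials_in_1: "1 \<in> monomials_in F"
  unfolding monomials_in_def mem_Collect_eq by (rule exI[of _ 0]) simp

lemma monomials_in_mult: "s \<in> monomials_in F \<Longrightarrow> s' \<in> monomials_in F \<Longrightarrow> s * s' \<in> monomials_in F"
proof -
  assume "s \<in> monomials_in F" "s' \<in> monomials_in F"
  then obtain e e' where "s = Poly_Mapping.single e 1" "s' = Poly_Mapping.single e' 1"
    "Poly_Mapping.keys e \<subseteq> F" "Poly_Mapping.keys e' \<subseteq> F" by (auto simp: monomials_in_def)
  then show ?thesis unfolding monomials_in_def mem_Collect_eq
    by (intro exI[of _ "e + e'"]) (simp add: mult_single keys_add_exp)
qed

lemma monomials_in_mono: "F \<subseteq> G \<Longrightarrow> monomials_in F \<subseteq> monomials_in G"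
  unfolding monomials_in_def by blast

lemma monomials_in_grade:
  assumes "s \<in> monomials_in F" "F \<subseteq> {1..n}" shows "\<exists>k. s \<in> mpoly_grade n k"
proof -
  from assms obtain e where "s = Poly_Mapping.single e 1" "Poly_Mapping.keys e \<subseteq> F" by (auto simp: monomials_in_def)
  with assms(2) show ?thesis by (intro exI[of _ "int (exp_deg e)"]) (auto simp: mpoly_grade_def mem_mpoly_ring)
qed

lemma mvar_in_monomials: "j \<in> F \<Longrightarrow> mvar j \<in> monomials_in F"
  by (auto simp: monomials_in_def mvar_def intro!: exI[of _ "Poly_Mapping.single j 1"])

lemma mvar_power: "(mvar j :: ('k::field) mpoly) ^ k = Poly_Mapping.single (Poly_Mapping.single j k) 1"
  by (induction k) (simp_all add: mvar_def mult_single single_add[symmetric])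

lemma monomials_in_insertD:
  assumes "s \<in> monomials_in (insert j F)"
  obtains s' k where "s' \<in> monomials_in F" "s = mvar j ^ k * (s' :: ('k::field) mpoly)"
proof -
  from assms obtain e where e: "s = Poly_Mapping.single e 1" "Poly_Mapping.keys e \<subseteq> insert j F"
    by (auto simp: monomials_in_def)
  let ?e' = "pmap_restrict (- {j}) e"
  have "e = Poly_Mapping.single j (Poly_Mapping.lookup e j) + ?e'"
    by (rule poly_mapping_eqI) (auto simp: lookup_add lookup_single lookup_pmap_restrict when_def)
  then have "s = mvar j ^ Poly_Mapping.lookup e j * Poly_Mapping.single ?e' 1"
    by (simp add: e mvar_power mult_single)
  moreover have "Poly_Mapping.single ?e' 1 \<in> monomials_in F"
    using e(2) unfolding monomials_in_def mem_Collect_eq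
    by (intro exI[of _ ?e']) (auto simp: keys_pmap_restrict)
  ultimately show ?thesis using that by blast
qed

section \<open>The Cech complex of a submodule\<close>

text \<open>A polynomial, so that it acts through \<open>scale\<close> like every other
  coefficient.\<close>

definition cech_sign :: "nat set \<Rightarrow> nat \<Rightarrow> ('k::field) mpoly" where
  "cech_sign F j = (- 1) ^ card {k \<in> F. k < j}"

lemma cech_sign_square: "cech_sign F j * cech_sign F j = (1 :: ('k::field) mpoly)"
  by (simp add: cech_sign_def power_add[symmetric] mult_2[symmetric])

text \<open>Removing \<open>j\<close> lowers the position of the larger index \<open>l\<close> by
  one, whereas removing \<open>l\<close> does not affect the position of \<open>j\<close>.\<close>

lemma cech_sign_swap_less:
  assumes "finite F" "j \<in> F" "l \<in> F" "j < l"
  shows "cech_sign F j * cech_sign (F - {j}) l = (- (cech_sign F l * cech_sign (F - {l}) j) :: ('k::field) mpoly)"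
proof -
  have 1: "{k \<in> F - {l}. k < j} = {k \<in> F. k < j}" using assms by auto
  have 2: "{k \<in> F. k < l} = insert j {k \<in> F - {j}. k < l}" using assms by auto
  have "card {k \<in> F. k < l} = Suc (card {k \<in> F - {j}. k < l})"
    unfolding 2 using assms(1) by simp
  then show ?thesis unfolding cech_sign_def 1 by simp
qed

lemma cech_sign_swap:
  assumes "finite F" "j \<in> F" "l \<in> F" "j \<noteq> l"
  shows "cech_sign F j * cech_sign (F - {j}) l = (- (cech_sign F l * cech_sign (F - {l}) j) :: ('k::field) mpoly)"
proof (cases "j < l")
  case False
  with assms have "l < j" by simp
  from cech_sign_swap_less[OF assms(1,3,2) this] show ?thesis by (metis minus_minus)
qed (use cech_sign_swap_less assms in blast)

lemma sum_antisymmetric: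
  fixes g :: "'a \<Rightarrow> 'a \<Rightarrow> 'b::ab_group_add"
  assumes "finite F" "\<And>j l. j \<in> F \<Longrightarrow> l \<in> F \<Longrightarrow> j \<noteq> l \<Longrightarrow> g j l = - g l j"
  shows "(\<Sum>j\<in>F. \<Sum>l\<in>F - {j}. g j l) = 0"
  using assms
proof (induction F)
  case (insert x F)
  have "(\<Sum>l\<in>insert x F - {j}. g j l) = g j x + (\<Sum>l\<in>F - {j}. g j l)" if "j \<in> F" for j
  proof -
    have "insert x F - {j} = insert x (F - {j})" using that insert.hyps by auto
    then show ?thesis using insert.hyps by simp
  qed
  then have "(\<Sum>j\<in>insert x F. \<Sum>l\<in>insert x F - {j}. g j l)
      = (\<Sum>l\<in>F. g x l) + (\<Sum>j\<in>F. g j x + (\<Sum>l\<in>F - {j}. g j l))"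
    using insert(1,2) by (simp add: insert_Diff_if)
  also have "\<dots> = (\<Sum>l\<in>F. g x l) + (\<Sum>j\<in>F. g j x) + (\<Sum>j\<in>F. \<Sum>l\<in>F - {j}. g j l)"
    by (simp add: sum.distrib add.assoc)
  also have "(\<Sum>j\<in>F. \<Sum>l\<in>F - {j}. g j l) = 0" by (rule insert.IH) (rule insert.prems, auto)
  also have "(\<Sum>j\<in>F. g j x) = - (\<Sum>l\<in>F. g x l)"
    unfolding sum_negf[symmetric]
    by (rule sum.cong[OF refl], rule insert.prems) (use insert.hyps in auto)
  finally show ?case by simp
qed simp

text \<open>Modelled on Laurent families, where monomials are invertible. Fractions are then
  elements of \<open>'u\<close> itself, and equivalence classes occur only when the result is
  compared with \<open>localization\<close>.\<close>

locale cech_space = graded_scale scale n hc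
  for scale :: "('k::field) mpoly \<Rightarrow> 'u::ab_group_add \<Rightarrow> 'u" and n hc +
  assumes monomial_bij: "s \<in> monomials_in {1..n} \<Longrightarrow> bij (scale s)"
begin

text \<open>The localization of \<open>A\<close> at the variables in \<open>F\<close>, as a subset
  of the ambient space; for \<open>F\<close> inside \<open>{1..n}\<close> division by a monomial is
  unambiguous there.\<close>

definition loc :: "nat set \<Rightarrow> 'u set \<Rightarrow> 'u set" where
  "loc F A = {u. \<exists>s\<in>monomials_in F. scale s u \<in> A}"

definition cscale :: "'k mpoly \<Rightarrow> (nat set \<Rightarrow> 'u) \<Rightarrow> nat set \<Rightarrow> 'u" where
  "cscale p c = (\<lambda>F. scale p (c F))"

definition chc :: "int \<Rightarrow> (nat set \<Rightarrow> 'u) \<Rightarrow> nat set \<Rightarrow> 'u" where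
  "chc j c = (\<lambda>F. hc j (c F))"

text \<open>Families are defined on all sets and vanish off the subsets of size \<open>i\<close>.
  Thus all degrees share one type, equality is equality of functions, and the single operator
  \<open>cdiff\<close> serves every degree.\<close>

definition chain :: "nat \<Rightarrow> 'u set \<Rightarrow> (nat set \<Rightarrow> 'u) set" where
  "chain i A = {c. \<forall>F. if F \<subseteq> {1..n} \<and> card F = i then c F \<in> loc F A else c F = 0}"

definition cdiff :: "(nat set \<Rightarrow> 'u) \<Rightarrow> nat set \<Rightarrow> 'u" where
  "cdiff c = (\<lambda>F. if F \<subseteq> {1..n} then \<Sum>j\<in>F. scale (cech_sign F j) (c (F - {j})) else 0)"

lemma monomial_bij': "s \<in> monomials_in F \<Longrightarrow> F \<subseteq> {1..n} \<Longrightarrow> bij (scale s)"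
  using monomial_bij monomials_in_mono by blast

lemma locI: "s \<in> monomials_in F \<Longrightarrow> scale s u \<in> A \<Longrightarrow> u \<in> loc F A"
  by (auto simp: loc_def)

lemma loc_base: "A \<subseteq> loc F A"
  using monomials_in_1 by (auto intro!: locI[of 1])

lemma loc_mono: "A \<subseteq> A' \<Longrightarrow> F \<subseteq> F' \<Longrightarrow> loc F A \<subseteq> loc F' A'"
  using monomials_in_mono[of F F'] unfolding loc_def by blast

lemma loc_empty: "loc {} A = A"
proof
  show "loc {} A \<subseteq> A" by (auto simp: loc_def monomials_in_def)
qed (rule loc_base)

lemma loc_common:
  assumes "u \<in> loc F A" "v \<in> loc F A'" "subspace A" "subspace A'"
  obtains s where "s \<in> monomials_in F" "scale s u \<in> A" "scale s v \<in> A'"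
proof -
  from assms obtain s s' where s: "s \<in> monomials_in F" "scale s u \<in> A" "s' \<in> monomials_in F" "scale s' v \<in> A'"
    by (auto simp: loc_def)
  have "scale (s * s') u = scale s' (scale s u)" "scale (s * s') v = scale s (scale s' v)"
    by (simp_all add: mult.commute)
  with s assms show ?thesis
    by (intro that[of "s * s'"]) (auto intro: monomials_in_mult subspace_scale simp del: scale_scale)
qed

lemma subspace_loc: assumes "subspace A" shows "subspace (loc F A)"
proof (rule subspaceI)
  show "0 \<in> loc F A" using subspace_0[OF assms] loc_base by blast
next
  fix u v assume uv: "u \<in> loc F A" "v \<in> loc F A"
  obtain s where "s \<in> monomials_in F" "scale s u \<in> A" "scale s v \<in> A"
    by (rule loc_common[OF uv assms assms])
  then show "u + v \<in> loc F A"
    using subspace_add[OF assms] by (intro locI[of s]) (auto simp: scale_right_distrib)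
next
  fix p u assume "u \<in> loc F A"
  then obtain s where s: "s \<in> monomials_in F" "scale s u \<in> A" by (auto simp: loc_def)
  have "scale s (scale p u) = scale p (scale s u)" by (simp add: mult.commute)
  then show "scale p u \<in> loc F A"
    using subspace_scale[OF assms s(2), of p] by (intro locI[OF s(1)]) (simp only:)
qed

lemma scale_inj: "s \<in> monomials_in F \<Longrightarrow> F \<subseteq> {1..n} \<Longrightarrow> scale s u = 0 \<Longrightarrow> u = 0"
  using monomial_bij'[of s F] bij_is_inj injD[of "scale s" u 0] by fastforce

text \<open>A monomial of degree \<open>k\<close> acts injectively and shifts components by
  \<open>k\<close>, so \<open>u\<close> has as many components as the element
  \<open>scale s u\<close> of \<open>A\<close>.\<close>

lemma gsub_loc:
  assumes A: "gsub A" and F: "F \<subseteq> {1..n}" shows "gsub (loc F A)"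
proof (rule gsubI)
  show "subspace (loc F A)" by (rule subspace_loc[OF gsub_subspace[OF A]])
next
  fix u assume "u \<in> loc F A"
  then obtain s where s: "s \<in> monomials_in F" "scale s u \<in> A" by (auto simp: loc_def)
  then obtain k where k: "s \<in> mpoly_grade n k" using monomials_in_grade F by blast
  have eq: "hc (k + j) (scale s u) = scale s (hc j u)" for j by (rule hc_scale[OF k])
  show "hc j u \<in> loc F A" for j
    using s gsub_hc[OF A, of "scale s u" "k + j"] by (intro locI[of s]) (simp_all only: eq)
  have "hc j u \<noteq> 0 \<Longrightarrow> hc (k + j) (scale s u) \<noteq> 0" for j
    unfolding eq using scale_inj[OF s(1) F] by blast
  then have "(\<lambda>j. k + j) ` {j. hc j u \<noteq> 0} \<subseteq> {j. hc j (scale s u) \<noteq> 0}" by auto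
  then have "finite ((\<lambda>j. k + j) ` {j. hc j u \<noteq> 0})"
    using gsub_finite[OF A s(2)] finite_subset by blast
  then show "finite {j. hc j u \<noteq> 0}" by (rule finite_imageD) (auto intro: inj_onI)
qed

text \<open>The denominator \<open>s\<close> of the sum can be divided out of both summands
  separately, because it acts bijectively.\<close>

lemma loc_plus_scale:
  assumes F: "F \<subseteq> {1..n}"
  shows "loc F {a + scale p c | a c. a \<in> A \<and> c \<in> T} \<subseteq> {a + scale p c | a c. a \<in> loc F A \<and> c \<in> loc F T}"
proof
  fix u assume "u \<in> loc F {a + scale p c | a c. a \<in> A \<and> c \<in> T}"
  then obtain s a c where s: "s \<in> monomials_in F" "scale s u = a + scale p c" "a \<in> A" "c \<in> T"
    by (auto simp: loc_def)
  note bij = monomial_bij'[OF s(1) F]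
  obtain a' c' where ac: "a = scale s a'" "c = scale s c'" using bij by (metis bij_pointE)
  have "scale s u = scale s (a' + scale p c')"
    unfolding s(2) ac by (simp add: scale_right_distrib mult.commute)
  then have "u = a' + scale p c'" using bij bij_is_inj injD by metis
  moreover have "a' \<in> loc F A" "c' \<in> loc F T" using s ac by (auto intro: locI[of s])
  ultimately show "u \<in> {a + scale p c | a c. a \<in> loc F A \<and> c \<in> loc F T}" by blast
qed

text \<open>Asking for all large exponents, and not just one, allows finitely many such bounds to be
  replaced by their maximum.\<close>

lemma loc_insert_reduce:
  assumes "u \<in> loc (insert j F) A" "subspace A"
  shows "\<exists>N. \<forall>N'\<ge>N. scale (mvar j ^ N') u \<in> loc F A"
proof -
  from assms obtain s where s: "s \<in> monomials_in (insert j F)" "scale s u \<in> A" by (auto simp: loc_def)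
  obtain s' k where s': "s' \<in> monomials_in F" "s = mvar j ^ k * s'" by (rule monomials_in_insertD[OF s(1)])
  have "scale (mvar j ^ N') u \<in> loc F A" if "N' \<ge> k" for N'
  proof (rule locI[OF s'(1)])
    have "s' * mvar j ^ N' = mvar j ^ (N' - k) * s"
      using that by (simp add: s' mult.assoc[symmetric] power_add[symmetric] mult.commute)
    then have "scale s' (scale (mvar j ^ N') u) = scale (mvar j ^ (N' - k)) (scale s u)" by simp
    then show "scale s' (scale (mvar j ^ N') u) \<in> A" using subspace_scale[OF assms(2) s(2)] by (simp only:)
  qed
  then show ?thesis by blast
qed

lemma chain_mem: "c \<in> chain i A \<Longrightarrow> F \<subseteq> {1..n} \<Longrightarrow> card F = i \<Longrightarrow> c F \<in> loc F A"
  and chain_0: "c \<in> chain i A \<Longrightarrow> \<not> (F \<subseteq> {1..n} \<and> card F = i) \<Longrightarrow> c F = 0"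
  unfolding chain_def mem_Collect_eq by (drule spec[of _ F], simp)+

lemma chainI:
  "(\<And>F. F \<subseteq> {1..n} \<Longrightarrow> card F = i \<Longrightarrow> c F \<in> loc F A) \<Longrightarrow>
   (\<And>F. \<not> (F \<subseteq> {1..n} \<and> card F = i) \<Longrightarrow> c F = 0) \<Longrightarrow> c \<in> chain i A"
  unfolding chain_def by simp

sublocale W: graded_scale cscale n chc
proof
  show "(\<And>j. chc j c = 0) \<Longrightarrow> c = 0" for c
  proof
    fix F assume "\<And>j. chc j c = 0"
    then have "hc j (c F) = 0" for j by (metis chc_def zero_fun_def)
    then show "c F = 0 F" using hc_sep by simp
  qed
qed (auto simp: cscale_def chc_def fun_eq_iff scale_right_distrib scale_left_distrib hc_add hc_hc hc_scale)

lemma gsub_chain: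
  assumes A: "gsub A" shows "W.gsub (chain i A)"
proof (rule W.gsubI)
  note s = gsub_subspace[OF A]
  show "W.subspace (chain i A)"
  proof (rule W.subspaceI)
    show "0 \<in> chain i A" by (rule chainI) (auto simp: subspace_0[OF subspace_loc[OF s]])
  next
    fix x y assume "x \<in> chain i A" "y \<in> chain i A"
    then show "x + y \<in> chain i A"
      by (intro chainI) (auto simp: chain_0 intro!: subspace_add[OF subspace_loc[OF s]] chain_mem)
  next
    fix p x assume "x \<in> chain i A"
    then show "cscale p x \<in> chain i A"
      by (intro chainI) (auto simp: cscale_def chain_0 intro!: subspace_scale[OF subspace_loc[OF s]] chain_mem)
  qed
next
  fix c assume c: "c \<in> chain i A"
  show "chc j c \<in> chain i A" for j
    using c by (intro chainI) (auto simp: chc_def chain_0 intro!: gsub_hc[OF gsub_loc[OF A]] chain_mem)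
  have "{j. chc j c \<noteq> 0} \<subseteq> (\<Union>F\<in>Pow {1..n}. {j. hc j (c F) \<noteq> 0})"
  proof
    fix j assume "j \<in> {j. chc j c \<noteq> 0}"
    then obtain F where F: "hc j (c F) \<noteq> 0" by (auto simp: chc_def fun_eq_iff)
    then have "c F \<noteq> 0" by auto
    then have "F \<subseteq> {1..n}" using chain_0[OF c] by blast
    then show "j \<in> (\<Union>F\<in>Pow {1..n}. {j. hc j (c F) \<noteq> 0})" using F by blast
  qed
  moreover have "finite {j. hc j (c F) \<noteq> 0}" if "F \<in> Pow {1..n}" for F
  proof (cases "card F = i")
    case True
    then show ?thesis using gsub_finite[OF gsub_loc[OF A] chain_mem[OF c]] that by blast
  next
    case False
    then show ?thesis using chain_0[OF c] by simp
  qed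
  ultimately show "finite {j. chc j c \<noteq> 0}" by (meson finite_UN finite_Pow_iff finite_atLeastAtMost finite_subset)
qed

lemma subspace_chain: "subspace A \<Longrightarrow> W.subspace (chain i A)"
proof (rule W.subspaceI)
  assume s: "subspace A"
  show "0 \<in> chain i A" by (rule chainI) (auto simp: subspace_0[OF subspace_loc[OF s]])
  fix x y p assume "x \<in> chain i A"
  then show "cscale p x \<in> chain i A"
    by (intro chainI) (auto simp: cscale_def chain_0 intro!: subspace_scale[OF subspace_loc[OF s]] chain_mem)
  assume "y \<in> chain i A"
  then show "x + y \<in> chain i A"
    using \<open>x \<in> chain i A\<close>
    by (intro chainI) (auto simp: chain_0 intro!: subspace_add[OF subspace_loc[OF s]] chain_mem)
qed

lemma chain_mono: assumes "A \<subseteq> A'" shows "chain i A \<subseteq> chain i A'"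
proof
  fix c assume c: "c \<in> chain i A"
  show "c \<in> chain i A'"
    by (rule chainI) (use chain_mem[OF c] loc_mono[OF assms order.refl] chain_0[OF c] in blast)+
qed

lemma cdiff_add: "cdiff (x + y) = cdiff x + cdiff y"
  by (auto simp: cdiff_def fun_eq_iff scale_right_distrib sum.distrib)

lemma cdiff_scale: "cdiff (cscale p x) = cscale p (cdiff x)"
  by (auto simp: cdiff_def cscale_def fun_eq_iff scale_sum_right mult.commute)

lemma cech_sign_grade: "(cech_sign F j :: 'k mpoly) \<in> mpoly_grade n 0"
proof -
  have "(- 1 :: 'k mpoly) \<in> mpoly_grade n 0"
    using cpoly_in_grade[of "- 1 :: 'k" n] by (simp add: single_uminus)
  from mpoly_grade_power[OF this] show ?thesis by (simp add: cech_sign_def)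
qed

lemma cdiff_hc: "cdiff (chc j x) = chc j (cdiff x)"
proof -
  have "hc j (scale (cech_sign F l) u) = scale (cech_sign F l) (hc j u)" for F l u
    using hc_scale[OF cech_sign_grade, of j F l u] by simp
  then show ?thesis by (auto simp: cdiff_def chc_def fun_eq_iff hc_sum)
qed

lemma cdiff_chain:
  assumes c: "c \<in> chain i A" and A: "subspace A" shows "cdiff c \<in> chain (Suc i) A"
proof (rule chainI)
  fix F assume F: "F \<subseteq> {1..n}" "card F = Suc i"
  have "c (F - {j}) \<in> loc F A" if "j \<in> F" for j
  proof -
    have "card (F - {j}) = i" using F that by simp
    then have "c (F - {j}) \<in> loc (F - {j}) A" using chain_mem[OF c, of "F - {j}"] F(1) by blast
    then show ?thesis using loc_mono[OF order.refl, of "F - {j}" F A] by blast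
  qed
  then show "cdiff c F \<in> loc F A"
    using F by (auto simp: cdiff_def intro!: subspace_sum[OF subspace_loc[OF A]] subspace_scale[OF subspace_loc[OF A]])
next
  fix F assume F: "\<not> (F \<subseteq> {1..n} \<and> card F = Suc i)"
  show "cdiff c F = 0"
  proof (cases "F \<subseteq> {1..n}")
    case True
    then have "finite F" by (rule finite_subset) simp
    then have "card (F - {j}) \<noteq> i" if "j \<in> F" for j
      using F True that card_Suc_Diff1[of F j] by auto
    then have "c (F - {j}) = 0" if "j \<in> F" for j using chain_0[OF c] that by blast
    then show ?thesis using True by (simp add: cdiff_def)
  qed (simp add: cdiff_def)
qed

lemma cdiff_cdiff: "cdiff (cdiff c) = 0"
proof
  fix F show "cdiff (cdiff c) F = 0 F"
  proof (cases "F \<subseteq> {1..n}")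
    case True
    then have fin: "finite F" by (rule finite_subset) simp
    define g where "g j l = scale (cech_sign F j * cech_sign (F - {j}) l) (c (F - {j} - {l}))" for j l
    have "cdiff (cdiff c) F = (\<Sum>j\<in>F. \<Sum>l\<in>F - {j}. g j l)"
    proof -
      have "F - {j} \<subseteq> {1..n}" for j using True by auto
      then show ?thesis using True by (simp add: cdiff_def g_def scale_sum_right)
    qed
    also have "\<dots> = 0"
    proof (rule sum_antisymmetric[OF fin])
      fix j l assume jl: "j \<in> F" "l \<in> F" "j \<noteq> l"
      have "F - {j} - {l} = F - {l} - {j}" by auto
      then show "g j l = - g l j"
        unfolding g_def cech_sign_swap[OF fin jl] by simp
    qed
    finally show ?thesis by simp
  qed (simp add: cdiff_def)
qed

lemma chain_plus_scale:
  assumes A: "subspace A" and T: "subspace T"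
  shows "chain i {a + scale p c | a c. a \<in> A \<and> c \<in> T} = {a + cscale p c | a c. a \<in> chain i A \<and> c \<in> chain i T}"
    (is "chain i ?P = ?Q")
proof
  show "chain i ?P \<subseteq> ?Q"
  proof
    fix x assume x: "x \<in> chain i ?P"
    have "\<exists>a c. (F \<subseteq> {1..n} \<and> card F = i \<longrightarrow> x F = a + scale p c \<and> a \<in> loc F A \<and> c \<in> loc F T)" for F
      using chain_mem[OF x, of F] loc_plus_scale[of F p A T] by blast
    then obtain a c where ac: "\<And>F. F \<subseteq> {1..n} \<Longrightarrow> card F = i \<Longrightarrow>
        x F = a F + scale p (c F) \<and> a F \<in> loc F A \<and> c F \<in> loc F T" by metis
    let ?r = "\<lambda>f F. if F \<subseteq> {1..n} \<and> card F = i then f F else 0"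
    have "?r a \<in> chain i A" "?r c \<in> chain i T" using ac by (simp_all add: chain_def)
    moreover have "x = ?r a + cscale p (?r c)"
      using ac chain_0[OF x] by (auto simp: fun_eq_iff cscale_def)
    ultimately show "x \<in> ?Q" by blast
  qed
  show "?Q \<subseteq> chain i ?P"
  proof
    fix x assume "x \<in> ?Q"
    then obtain a c where x: "x = a + cscale p c" "a \<in> chain i A" "c \<in> chain i T" by blast
    show "x \<in> chain i ?P"
    proof (rule chainI)
      fix F assume F: "F \<subseteq> {1..n}" "card F = i"
      obtain s where s: "s \<in> monomials_in F" "scale s (a F) \<in> A" "scale s (c F) \<in> T"
        by (rule loc_common[OF chain_mem[OF x(2) F] chain_mem[OF x(3) F] A T])
      have "scale s (x F) = scale s (a F) + scale p (scale s (c F))"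
        by (simp add: x cscale_def scale_right_distrib mult.commute)
      then show "x F \<in> loc F ?P" using s by (intro locI[of s]) blast+
    next
      fix F assume F: "\<not> (F \<subseteq> {1..n} \<and> card F = i)"
      show "x F = 0" unfolding x(1) using chain_0[OF x(2) F] chain_0[OF x(3) F] by (simp add: cscale_def)
    qed
  qed
qed

text \<open>The idea is that the Cech complex becomes contractible after inverting any of the variables.\<close>

lemma chain_var_torsion:
  assumes T: "subspace T" and A: "subspace A" and j: "j \<in> {1..n}"
    and c: "c \<in> chain i T" "cdiff c \<in> chain (Suc i) A"
  shows "\<exists>N\<ge>1. \<exists>b\<in>(case i of 0 \<Rightarrow> {0} | Suc k \<Rightarrow> chain k T). cscale (mvar j ^ N) c - cdiff b \<in> chain i A"
proof -
  let ?S = "{F. F \<subseteq> {1..n} \<and> card F = i}"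
  have finS: "finite ?S" by (rule finite_subset[of _ "Pow {1..n}"]) auto
  \<comment> \<open>A power of x_j removes x_j from the denominators of the entries of
    \<open>c\<close> at sets containing \<open>j\<close>, and of the entries of
    \<open>cdiff c\<close> at sets to which \<open>j\<close> is added.\<close>
  have "\<exists>N. \<forall>N'\<ge>N. (j \<in> F \<longrightarrow> scale (mvar j ^ N') (c F) \<in> loc (F - {j}) T) \<and>
      (j \<notin> F \<longrightarrow> scale (mvar j ^ N') (cdiff c (insert j F)) \<in> loc F A)" if "F \<in> ?S" for F
  proof (cases "j \<in> F")
    case True
    then have "c F \<in> loc (insert j (F - {j})) T" using chain_mem[OF c(1), of F] that by (simp add: insert_absorb)
    from loc_insert_reduce[OF this T] True show ?thesis by blast
  next
    case False
    have "finite F" using that finite_subset by auto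
    then have "cdiff c (insert j F) \<in> loc (insert j F) A"
      using that False j by (intro chain_mem[OF c(2)]) auto
    from loc_insert_reduce[OF this A] False show ?thesis by blast
  qed
  then obtain N where N: "\<And>F N'. F \<in> ?S \<Longrightarrow> N' \<ge> N F \<Longrightarrow>
      (j \<in> F \<longrightarrow> scale (mvar j ^ N') (c F) \<in> loc (F - {j}) T) \<and>
      (j \<notin> F \<longrightarrow> scale (mvar j ^ N') (cdiff c (insert j F)) \<in> loc F A)" by metis
  \<comment> \<open>The successor ensures \<open>K \<ge> 1\<close>; inserting 0 keeps
    \<open>Max\<close> meaningful when no set of size \<open>i\<close> exists.\<close>
  define K where "K = Suc (Max (insert 0 (N ` ?S)))"
  have K: "N F \<le> K" if "F \<in> ?S" for F
    unfolding K_def using finS that by (intro le_SucI Max_ge) auto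
  let ?x = "mvar j ^ K :: 'k mpoly"
  \<comment> \<open>The contracting homotopy at x_j: it adds \<open>j\<close> to the set. The factor
    \<open>?x\<close> clears denominators, so that the entry at \<open>G\<close> lies in the
    localization at \<open>G\<close> without \<open>j\<close>.\<close>
  define b where "b G = (if G \<subseteq> {1..n} \<and> Suc (card G) = i \<and> j \<notin> G
      then scale (cech_sign (insert j G) j * ?x) (c (insert j G)) else 0)" for G
  have b: "b \<in> (case i of 0 \<Rightarrow> {0} | Suc k \<Rightarrow> chain k T)"
  proof (cases i)
    case 0
    then show ?thesis by (auto simp: b_def)
  next
    case (Suc k)
    have "b \<in> chain k T"
    proof (rule chainI)
      fix G assume G: "G \<subseteq> {1..n}" "card G = k"
      show "b G \<in> loc G T"
      proof (cases "j \<in> G")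
        case True
        then show ?thesis by (simp add: b_def subspace_0[OF subspace_loc[OF T]])
      next
        case False
        have "finite G" using G finite_subset by auto
        then have "insert j G \<in> ?S" using G False j Suc by auto
        then have "scale ?x (c (insert j G)) \<in> loc G T"
          using N[of "insert j G" K] K[of "insert j G"] False by simp
        then have "scale (cech_sign (insert j G) j) (scale ?x (c (insert j G))) \<in> loc G T"
          by (rule subspace_scale[OF subspace_loc[OF T]])
        then show ?thesis using G False Suc by (simp add: b_def)
      qed
    qed (use Suc in \<open>auto simp: b_def\<close>)
    then show ?thesis using Suc by simp
  qed
  \<comment> \<open>The homotopy formula, with all entries multiplied by x_j^K. At sets containing
    \<open>j\<close> the difference is zero, since in \<open>cdiff b\<close> only the term omitting
    \<open>j\<close> survives. At other sets it is, up to sign, x_j^K times the entry of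
    \<open>cdiff c\<close> at \<open>insert j F\<close>, which comes from \<open>A\<close>.\<close>
  have key: "scale ?x (c F) - cdiff b F \<in> loc F A" if F: "F \<in> ?S" for F
  proof (cases "j \<in> F")
    case True
    have finF: "finite F" using F finite_subset by auto
    have "scale (cech_sign F l) (b (F - {l})) = (if l = j then scale ?x (c F) else 0)" if "l \<in> F" for l
    proof (cases "l = j")
      case l: True
      have "card F = Suc (card (F - {j}))" using card_Suc_Diff1[OF finF True] by simp
      then have "b (F - {l}) = scale (cech_sign F j * ?x) (c F)"
        using l F True by (auto simp: b_def insert_absorb)
      then show ?thesis using l by (simp add: mult.assoc[symmetric] cech_sign_square)
    next
      case False
      then show ?thesis using True by (simp add: b_def)
    qed
    then have "cdiff b F = (\<Sum>l\<in>F. if l = j then scale ?x (c F) else 0)"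
      using F by (simp add: cdiff_def)
    also have "\<dots> = scale ?x (c F)" using finF True by simp
    finally show ?thesis using subspace_0[OF subspace_loc[OF A]] by simp
  next
    case False
    have finF: "finite F" using F finite_subset by auto
    let ?F' = "insert j F"
    have F': "?F' \<subseteq> {1..n}" "finite ?F'" "?F' - {j} = F" using F j finF False by auto
    have 1: "scale (cech_sign F l) (b (F - {l}))
        = - scale (cech_sign ?F' j * ?x) (scale (cech_sign ?F' l) (c (?F' - {l})))" if l: "l \<in> F" for l
    proof -
      have lj: "l \<noteq> j" using l False by auto
      have ins: "insert j (F - {l}) = ?F' - {l}" and jF': "j \<in> ?F'" and lF': "l \<in> ?F'" using lj l by auto
      have "Suc (card (F - {l})) = i" using card_Suc_Diff1[OF finF l] F by simp
      then have bl: "b (F - {l}) = scale (cech_sign (?F' - {l}) j * ?x) (c (?F' - {l}))"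
        using F False by (auto simp: b_def ins)
      have "cech_sign F l * cech_sign (?F' - {l}) j
          = (cech_sign ?F' j * cech_sign ?F' j) * cech_sign (?F' - {j}) l * cech_sign (?F' - {l}) j"
        unfolding F'(3) cech_sign_square by simp
      also have "\<dots> = cech_sign ?F' j * (cech_sign ?F' j * cech_sign (?F' - {j}) l) * cech_sign (?F' - {l}) j"
        by (simp only: mult.assoc)
      also have "\<dots> = - (cech_sign ?F' j * cech_sign ?F' l * (cech_sign (?F' - {l}) j * cech_sign (?F' - {l}) j))"
        unfolding cech_sign_swap[OF F'(2) jF' lF' lj[symmetric]] by (simp add: mult.assoc)
      also have "\<dots> = - (cech_sign ?F' j * cech_sign ?F' l)" unfolding cech_sign_square by simp
      finally have sg: "cech_sign F l * cech_sign (?F' - {l}) j = (- (cech_sign ?F' j * cech_sign ?F' l) :: 'k mpoly)" .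
      have "scale (cech_sign F l) (b (F - {l})) = scale ((cech_sign F l * cech_sign (?F' - {l}) j) * ?x) (c (?F' - {l}))"
        unfolding bl by (simp add: mult.assoc)
      also have "\<dots> = - scale (cech_sign ?F' j * ?x) (scale (cech_sign ?F' l) (c (?F' - {l})))"
        unfolding sg by (simp add: mult_ac)
      finally show ?thesis .
    qed
    have "cdiff b F = (\<Sum>l\<in>F. - scale (cech_sign ?F' j * ?x) (scale (cech_sign ?F' l) (c (?F' - {l}))))"
      using F 1 by (simp add: cdiff_def)
    also have "\<dots> = - scale (cech_sign ?F' j * ?x) (\<Sum>l\<in>F. scale (cech_sign ?F' l) (c (?F' - {l})))"
      by (simp only: sum_negf scale_sum_right)
    also have "(\<Sum>l\<in>F. scale (cech_sign ?F' l) (c (?F' - {l}))) = cdiff c ?F' - scale (cech_sign ?F' j) (c F)"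
      using F' finF False by (simp add: cdiff_def)
    also have "- scale (cech_sign ?F' j * ?x) (cdiff c ?F' - scale (cech_sign ?F' j) (c F))
      = scale ((cech_sign ?F' j * cech_sign ?F' j) * ?x) (c F) - scale (cech_sign ?F' j) (scale ?x (cdiff c ?F'))"
      by (simp add: scale_right_diff_distrib mult_ac)
    finally have "scale ?x (c F) - cdiff b F = scale (cech_sign ?F' j) (scale ?x (cdiff c ?F'))"
      unfolding cech_sign_square by simp
    moreover have "scale ?x (cdiff c ?F') \<in> loc F A" using N[OF F K[OF F]] False by blast
    ultimately show ?thesis using subspace_scale[OF subspace_loc[OF A]] by (simp only:)
  qed
  have "cscale ?x c - cdiff b \<in> chain i A"
  proof (rule chainI)
    fix F assume "F \<subseteq> {1..n}" "card F = i"
    then show "(cscale ?x c - cdiff b) F \<in> loc F A" using key[of F] by (simp add: cscale_def)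
  next
    fix F assume F: "\<not> (F \<subseteq> {1..n} \<and> card F = i)"
    have "cdiff b F = 0"
    proof (cases i)
      case 0
      then show ?thesis using b by (auto simp: cdiff_def)
    next
      case (Suc k)
      then have "cdiff b \<in> chain i T" using b cdiff_chain[OF _ T, of b k] by simp
      then show ?thesis using F chain_0 by blast
    qed
    then show "(cscale ?x c - cdiff b) F = 0" using chain_0[OF c(1) F] by (simp add: cscale_def)
  qed
  then show ?thesis using b by (intro exI[of _ K] conjI bexI[of _ b]) (auto simp: K_def)
qed

lemma subspace_case: "subspace T \<Longrightarrow> W.subspace (case i of 0 \<Rightarrow> {0} | Suc k \<Rightarrow> chain k T)"
  by (cases i) (simp_all add: subspace_chain)

text \<open>The polynomials that turn \<open>c\<close> into a coboundary modulo \<open>A\<close>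
  form the ideal \<open>G\<close>. Those with a power in \<open>G\<close> form an ideal too, by the
  binomial theorem; it contains the variables and hence \<mm>.\<close>

lemma chain_torsion:
  assumes T: "subspace T" and A: "subspace A" and p: "p \<in> irrelevant_ideal n"
    and c: "c \<in> chain i T" "cdiff c \<in> chain (Suc i) A"
  shows "\<exists>N\<ge>1. \<exists>b\<in>(case i of 0 \<Rightarrow> {0} | Suc k \<Rightarrow> chain k T). cscale (p ^ N) c - cdiff b \<in> chain i A"
proof -
  let ?Cm = "case i of 0 \<Rightarrow> {0} | Suc k \<Rightarrow> chain k T"
  note sC = subspace_case[OF T, of i] and sA = subspace_chain[OF A, of i]
  define G where "G = {r. \<exists>b\<in>?Cm. cscale r c - cdiff b \<in> chain i A}"
  have cd0: "cdiff 0 = 0" using cdiff_add[of 0 0] by simp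
  have G0: "0 \<in> G" unfolding G_def using W.subspace_0[OF sC] W.subspace_0[OF sA] cd0 by force
  have Gadd: "r + r' \<in> G" if "r \<in> G" "r' \<in> G" for r r'
  proof -
    from that obtain b b' where "b \<in> ?Cm" "cscale r c - cdiff b \<in> chain i A"
      "b' \<in> ?Cm" "cscale r' c - cdiff b' \<in> chain i A" by (auto simp: G_def)
    moreover from this have "(cscale r c - cdiff b) + (cscale r' c - cdiff b') \<in> chain i A"
      using W.subspace_add[OF sA] by blast
    then have "cscale (r + r') c - cdiff (b + b') \<in> chain i A"
      by (simp add: W.scale_left_distrib cdiff_add add_diff_add)
    ultimately show ?thesis unfolding G_def using W.subspace_add[OF sC] by blast
  qed
  have Gmult: "q * r \<in> G" if "r \<in> G" for q r
  proof -
    from that obtain b where "b \<in> ?Cm" "cscale r c - cdiff b \<in> chain i A" by (auto simp: G_def)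
    moreover from this have "cscale q (cscale r c - cdiff b) \<in> chain i A"
      using W.subspace_scale[OF sA] by blast
    then have "cscale (q * r) c - cdiff (cscale q b) \<in> chain i A"
      by (simp add: W.scale_right_diff_distrib cdiff_scale)
    ultimately show ?thesis unfolding G_def using W.subspace_scale[OF sC] by blast
  qed
  have Gsum: "(\<And>x. x \<in> X \<Longrightarrow> f x \<in> G) \<Longrightarrow> sum f X \<in> G" for f and X :: "nat set"
    by (induction X rule: infinite_finite_induct) (auto intro: G0 Gadd)
  define R where "R = {p \<in> carrier (mpoly_ring n). \<exists>N\<ge>1. p ^ N \<in> G}"
  have "irrelevant_ideal n \<subseteq> R"
  proof (rule irrelevant_ideal_subset)
    show "R \<subseteq> carrier (mpoly_ring n)" by (auto simp: R_def)
    show "0 \<in> R" using G0 mpoly_ring_0 by (auto simp: R_def intro!: exI[of _ 1])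
    show "mvar j \<in> R" if "j \<in> {1..n}" for j
      using chain_var_torsion[OF T A that c] mpoly_ring_mvar[OF that] by (auto simp: R_def G_def)
    show "q * p \<in> R" if "p \<in> R" "q \<in> carrier (mpoly_ring n)" for p q
      using that Gmult[of "p ^ _" "q ^ _"] mpoly_ring_mult by (auto simp: R_def power_mult_distrib)
    fix p q assume pq: "p \<in> R" "q \<in> R"
    then obtain N N' where N: "N \<ge> 1" "p ^ N \<in> G" "N' \<ge> 1" "q ^ N' \<in> G" by (auto simp: R_def)
    \<comment> \<open>In each term of the binomial expansion one of the two exponents reaches its
      bound.\<close>
    have "of_nat ((N + N') choose k) * p ^ k * q ^ (N + N' - k) \<in> G" if "k \<le> N + N'" for k
    proof (cases "k \<ge> N")
      case True
      then have "p ^ k = p ^ (k - N) * p ^ N" by (simp flip: power_add)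
      then have eq: "of_nat ((N + N') choose k) * p ^ k * q ^ (N + N' - k)
        = (of_nat ((N + N') choose k) * p ^ (k - N) * q ^ (N + N' - k)) * p ^ N" by (simp add: mult_ac)
      show ?thesis unfolding eq by (rule Gmult[OF N(2)])
    next
      case False
      then have "q ^ (N + N' - k) = q ^ (N - k) * q ^ N'" by (simp flip: power_add)
      then have eq: "of_nat ((N + N') choose k) * p ^ k * q ^ (N + N' - k)
        = (of_nat ((N + N') choose k) * p ^ k * q ^ (N - k)) * q ^ N'" by (simp add: mult_ac)
      show ?thesis unfolding eq by (rule Gmult[OF N(4)])
    qed
    then have "(p + q) ^ (N + N') \<in> G" unfolding binomial_ring by (intro Gsum) simp
    then show "p + q \<in> R" using pq N mpoly_ring_add by (auto simp: R_def intro!: exI[of _ "N + N'"])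
  qed
  then show ?thesis using p by (auto simp: R_def G_def)
qed

end

section \<open>Submodules generated by powers of the parameters\<close>

declare One_nat_def [simp del]

context graded_scale
begin

lemma gsub_plus_scale:
  assumes A: "gsub A" and T: "gsub T" and p: "p \<in> mpoly_grade n i"
  shows "gsub {a + scale p c | a c. a \<in> A \<and> c \<in> T}"
proof -
  have "gsub (scale p ` T)"
  proof (rule gsubI)
    note sT = gsub_subspace[OF T]
    show "subspace (scale p ` T)"
    proof (rule subspaceI)
      show "0 \<in> scale p ` T" using subspace_0[OF sT] by (intro image_eqI[of _ _ 0]) auto
    next
      fix x y assume "x \<in> scale p ` T" "y \<in> scale p ` T"
      then obtain u v where "u \<in> T" "v \<in> T" "x = scale p u" "y = scale p v" by blast
      then show "x + y \<in> scale p ` T"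
        using subspace_add[OF sT] by (intro image_eqI[of _ _ "u + v"]) (simp_all add: scale_right_distrib)
    next
      fix q x assume "x \<in> scale p ` T"
      then obtain u where "u \<in> T" "x = scale p u" by blast
      then show "scale q x \<in> scale p ` T"
        using subspace_scale[OF sT] by (intro image_eqI[of _ _ "scale q u"]) (simp_all add: mult.commute)
    qed
    fix z assume "z \<in> scale p ` T"
    then obtain u where u: "u \<in> T" "z = scale p u" by blast
    have eq: "hc j z = scale p (hc (j - i) u)" for j
      using hc_scale[OF p, of "j - i" u] u by simp
    show "hc j z \<in> scale p ` T" for j unfolding eq using gsub_hc[OF T u(1)] by blast
    have "{j. hc j z \<noteq> 0} \<subseteq> (\<lambda>j. i + j) ` {j. hc j u \<noteq> 0}"
    proof
      fix j assume "j \<in> {j. hc j z \<noteq> 0}"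
      then have "hc (j - i) u \<noteq> 0" unfolding eq by auto
      then show "j \<in> (\<lambda>j. i + j) ` {j. hc j u \<noteq> 0}" by (intro image_eqI[of _ _ "j - i"]) simp_all
    qed
    then show "finite {j. hc j z \<noteq> 0}"
      using gsub_finite[OF T u(1)] finite_subset by blast
  qed
  moreover have "{a + scale p c | a c. a \<in> A \<and> c \<in> T} = {x + y | x y. x \<in> A \<and> y \<in> scale p ` T}" by blast
  ultimately show ?thesis using gsub_plus[OF A] by simp
qed

text \<open>With \<open>M = T / B0\<close>, this is the preimage in \<open>T\<close> of the sum of
  the submodules \<theta>_e^(t e) M for \<open>e \<in> C\<close>.\<close>

definition psub :: "'w set \<Rightarrow> 'w set \<Rightarrow> (nat \<Rightarrow> 'k mpoly) \<Rightarrow> nat set \<Rightarrow> (nat \<Rightarrow> nat) \<Rightarrow> 'w set" where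
  "psub T B0 \<theta> C t = {b + (\<Sum>e\<in>C. scale (\<theta> e ^ t e) (\<tau> e)) | b \<tau>. b \<in> B0 \<and> (\<forall>e. \<tau> e \<in> T)}"

lemma psub_empty: "0 \<in> T \<Longrightarrow> psub T B0 \<theta> {} t = B0"
  by (auto simp: psub_def)

lemma psub_insert:
  assumes "finite C" "e \<notin> C"
  shows "psub T B0 \<theta> (insert e C) t = {a + scale (\<theta> e ^ t e) c | a c. a \<in> psub T B0 \<theta> C t \<and> c \<in> T}"
    (is "?L = ?R")
proof
  show "?L \<subseteq> ?R"
  proof
    fix x assume "x \<in> ?L"
    then obtain b \<tau> where x: "x = b + (\<Sum>e\<in>insert e C. scale (\<theta> e ^ t e) (\<tau> e))" "b \<in> B0" "\<forall>e. \<tau> e \<in> T"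
      unfolding psub_def by blast
    then have "x = (b + (\<Sum>e\<in>C. scale (\<theta> e ^ t e) (\<tau> e))) + scale (\<theta> e ^ t e) (\<tau> e)"
      using assms by (simp add: add_ac)
    then show "x \<in> ?R" unfolding psub_def using x(2,3) by blast
  qed
  show "?R \<subseteq> ?L"
  proof
    fix x assume "x \<in> ?R"
    then obtain b \<tau> c where x: "x = (b + (\<Sum>e\<in>C. scale (\<theta> e ^ t e) (\<tau> e))) + scale (\<theta> e ^ t e) c"
      "b \<in> B0" "\<forall>e. \<tau> e \<in> T" "c \<in> T"
      unfolding psub_def by blast
    have "(\<Sum>e'\<in>C. scale (\<theta> e' ^ t e') ((\<tau>(e := c)) e')) = (\<Sum>e\<in>C. scale (\<theta> e ^ t e) (\<tau> e))"
      by (rule sum.cong) (use assms in auto)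
    then have "x = b + (\<Sum>e'\<in>insert e C. scale (\<theta> e' ^ t e') ((\<tau>(e := c)) e'))"
      using assms by (simp add: x(1) add_ac)
    moreover have "\<forall>e'. (\<tau>(e := c)) e' \<in> T" using x(3,4) by simp
    ultimately show "x \<in> ?L" unfolding psub_def using x(2) by blast
  qed
qed

lemma gsub_psub:
  assumes "gsub T" "gsub B0" "finite C" "\<And>e. e \<in> C \<Longrightarrow> \<exists>i. \<theta> e \<in> mpoly_grade n i"
  shows "gsub (psub T B0 \<theta> C t)"
  using assms(3,4)
proof (induction C)
  case empty
  then show ?case using psub_empty[OF subspace_0[OF gsub_subspace[OF assms(1)]]] assms(2) by simp
next
  case (insert e C)
  then obtain i where "\<theta> e \<in> mpoly_grade n i" by blast
  from mpoly_grade_power[OF this] gsub_plus_scale[OF _ assms(1)] insert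
  show ?case unfolding psub_insert[OF insert.hyps] by blast
qed

lemma psub_subset:
  assumes "subspace T" "B0 \<subseteq> T" shows "psub T B0 \<theta> C t \<subseteq> T"
  unfolding psub_def using assms(2)
  by (auto intro!: subspace_add[OF assms(1)] subspace_sum[OF assms(1)] subspace_scale[OF assms(1)])

lemma psub_cong: "(\<And>i. i \<in> C \<Longrightarrow> t i = t' i) \<Longrightarrow> psub T B0 \<theta> C t = psub T B0 \<theta> C t'"
  by (auto simp: psub_def cong: sum.cong)

end

section \<open>The Cech complex of T / B0 with its parameters\<close>

locale cech_params = cech_space scale n hc
  for scale :: "('k::field) mpoly \<Rightarrow> 'u::ab_group_add \<Rightarrow> 'u" and n hc +
  fixes d :: nat and \<theta> :: "nat \<Rightarrow> 'k mpoly" and T B0 :: "'u set"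
  assumes T: "gsub T" and B0: "gsub B0" "B0 \<subseteq> T"
    and th_grade: "i \<in> {1..d} \<Longrightarrow> \<theta> i \<in> mpoly_grade n 1"
    and th_irrelevant: "i \<in> {1..d} \<Longrightarrow> \<theta> i \<in> irrelevant_ideal n"
    and weakT: "C \<subseteq> {1..d} \<Longrightarrow> e \<in> {1..d} - C \<Longrightarrow> \<forall>i. 1 \<le> t i \<Longrightarrow> 1 \<le> s \<Longrightarrow> y \<in> T \<Longrightarrow>
      scale (\<theta> e ^ s) y \<in> psub T B0 \<theta> C t \<Longrightarrow> p \<in> irrelevant_ideal n \<Longrightarrow> scale p y \<in> psub T B0 \<theta> C t"
begin

abbreviation "PS \<equiv> psub T B0 \<theta>"

lemma sT: "subspace T" and sB0: "subspace B0" using T B0 gsub_subspace by auto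

lemma PS_gsub: assumes "C \<subseteq> {1..d}" shows "gsub (PS C t)"
  by (rule gsub_psub[OF T B0(1) finite_subset[OF assms]]) (use assms th_grade in blast)+

lemma chain_0_iff: "c \<in> chain 0 A \<longleftrightarrow> c {} \<in> A \<and> (\<forall>F. F \<noteq> {} \<longrightarrow> c F = 0)"
proof -
  have "F \<subseteq> {1..n} \<and> card F = 0 \<longleftrightarrow> F = {}" for F
    using finite_subset[of F "{1..n}"] by auto
  then show ?thesis unfolding chain_def mem_Collect_eq by (auto simp: loc_empty split: if_splits)
qed

text \<open>A nonempty \<open>F\<close> provides a variable that lies in \<mm> and is invertible in
  the localization. What is merely killed by \<mm> before localizing is zero afterwards, so a weak
  sequence becomes a regular one.\<close>

lemma loc_regular:
  assumes "C \<subseteq> {1..d}" "e \<in> {1..d} - C" "\<forall>i. 1 \<le> t i" "1 \<le> s"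
    and F: "F \<subseteq> {1..n}" "F \<noteq> {}" and u: "u \<in> loc F T" "scale (\<theta> e ^ s) u \<in> loc F (PS C t)"
  shows "u \<in> loc F (PS C t)"
proof -
  note sP = gsub_subspace[OF PS_gsub[OF assms(1)]]
  obtain r where r: "r \<in> monomials_in F" "scale r u \<in> T" "scale r (scale (\<theta> e ^ s) u) \<in> PS C t"
    by (rule loc_common[OF u sT sP])
  obtain j where j: "j \<in> F" using F by blast
  have "scale (\<theta> e ^ s) (scale r u) = scale r (scale (\<theta> e ^ s) u)" by (simp add: mult.commute)
  with r(3) have "scale (\<theta> e ^ s) (scale r u) \<in> PS C t" by (simp only:)
  then have "scale (mvar j) (scale r u) \<in> PS C t"
    by (rule weakT[OF assms(1-4) r(2)]) (rule mvar_irrelevant, use j F in blast)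
  then show ?thesis
    by (intro locI[OF monomials_in_mult[OF mvar_in_monomials[OF j] r(1)]]) simp
qed

sublocale PC: parameter_complex cscale n chc d \<theta> "\<lambda>i. chain i T" "\<lambda>i C t. chain i (PS C t)" cdiff
proof
  fix i C and t :: "nat \<Rightarrow> nat" assume "C \<subseteq> {1..d}"
  then show "W.gsub (chain i (PS C t))" by (intro gsub_chain PS_gsub)
  show "chain i (PS C t) \<subseteq> chain i T" by (intro chain_mono psub_subset sT B0)
next
  fix C e i and t :: "nat \<Rightarrow> nat" assume C: "C \<subseteq> {1..d}" "e \<in> {1..d} - C"
  then have fin: "finite C" "e \<notin> C" using finite_subset by auto
  show "chain i (PS (insert e C) t)
      = {a + cscale (\<theta> e ^ t e) c | a c. a \<in> chain i (PS C t) \<and> c \<in> chain i T}"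
    unfolding psub_insert[OF fin] by (rule chain_plus_scale[OF gsub_subspace[OF PS_gsub[OF C(1)]] sT])
next
  fix C :: "nat set" and t t' :: "nat \<Rightarrow> nat" and i assume "\<And>i. i \<in> C \<Longrightarrow> t i = t' i"
  then show "chain i (PS C t) = chain i (PS C t')" using psub_cong by metis
next
  fix C x i and t :: "nat \<Rightarrow> nat" assume "C \<subseteq> {1..d}" "x \<in> chain i (PS C t)"
  then show "cdiff x \<in> chain (Suc i) (PS C t)" using cdiff_chain gsub_subspace[OF PS_gsub] by blast
next
  fix C e s c i and t :: "nat \<Rightarrow> nat"
  assume a: "C \<subseteq> {1..d}" "e \<in> {1..d} - C" "\<forall>i. 1 \<le> t i" "1 \<le> s" "c \<in> chain (Suc i) T"
    "cscale (\<theta> e ^ s) c \<in> chain (Suc i) (PS C t)"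
  show "c \<in> chain (Suc i) (PS C t)"
  proof (rule chainI)
    fix F assume F: "F \<subseteq> {1..n}" "card F = Suc i"
    then have ne: "F \<noteq> {}" by auto
    have "scale (\<theta> e ^ s) (c F) \<in> loc F (PS C t)" using chain_mem[OF a(6) F] by (simp add: cscale_def)
    then show "c F \<in> loc F (PS C t)" by (rule loc_regular[OF a(1-4) F(1) ne chain_mem[OF a(5) F]])
  qed (rule chain_0[OF a(5)])
next
  fix C e s y and p :: "'k mpoly" and t :: "nat \<Rightarrow> nat"
  assume a: "C \<subseteq> {1..d}" "e \<in> {1..d} - C" "\<forall>i. 1 \<le> t i" "1 \<le> s" "y \<in> chain 0 T"
    "cscale (\<theta> e ^ s) y \<in> chain 0 (PS C t)" "p \<in> irrelevant_ideal n"
  from a(5,6) have "y {} \<in> T" "scale (\<theta> e ^ s) (y {}) \<in> PS C t" by (simp_all add: chain_0_iff cscale_def)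
  from weakT[OF a(1-4) this a(7)] a(5) show "cscale p y \<in> chain 0 (PS C t)"
    by (simp add: chain_0_iff cscale_def)
next
  fix C e c i and t :: "nat \<Rightarrow> nat"
  assume a: "C \<subseteq> {1..d}" "e \<in> {1..d}" "c \<in> chain i T" "cdiff c \<in> chain (Suc i) (PS C t)"
  show "\<exists>s\<ge>1. \<exists>b\<in>case i of 0 \<Rightarrow> {0} | Suc k \<Rightarrow> chain k T. cscale (\<theta> e ^ s) c - cdiff b \<in> chain i (PS C t)"
    by (rule chain_torsion[OF sT gsub_subspace[OF PS_gsub[OF a(1)]] th_irrelevant[OF a(2)] a(3,4)])
qed (use th_grade th_irrelevant gsub_chain[OF T] cdiff_chain sT in
      \<open>auto simp: cdiff_add cdiff_scale cdiff_hc cdiff_cdiff\<close>)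

text \<open>The socle of M / \<Theta>_[d] M, pulled back to \<open>T\<close> and placed in degree 0
  of the complex.\<close>

definition socle_chains :: "(nat set \<Rightarrow> 'u) set" where
  "socle_chains = {c \<in> chain 0 T. \<forall>p\<in>irrelevant_ideal n. cscale p c \<in> chain 0 (PS {1..d} PC.t1)}"

lemma Bd_0: "PC.Bd 0 C t = chain 0 (PS C t)"
proof -
  have "cdiff 0 = 0" using cdiff_add[of 0 0] by simp
  then show ?thesis by (simp add: PC.Bd_def PC.Cm_def)
qed

text \<open>If every element of \<open>T / A\<close> is killed by powers of the variables, its
  localizations vanish and every 0-cochain is a cocycle modulo \<open>A\<close>. For M /
  \<Theta>_[d] M this says that H^0 is the whole module.\<close>

lemma cdiff_torsion:
  assumes "\<And>u. u \<in> T \<Longrightarrow> \<exists>N. \<forall>j\<in>{1..n}. scale (mvar j ^ N) u \<in> A" and A: "subspace A" and c: "c \<in> chain 0 T"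
  shows "cdiff c \<in> chain (Suc 0) A"
proof (rule chainI)
  fix F assume F: "F \<subseteq> {1..n}" "card F = Suc 0"
  then obtain j where j: "F = {j}" by (metis card_1_singletonE One_nat_def)
  then have jn: "j \<in> {1..n}" using F by auto
  have "c {} \<in> T" using c by (simp add: chain_0_iff)
  then obtain N where "scale (mvar j ^ N) (c {}) \<in> A" using assms(1) jn by blast
  moreover have "mvar j ^ N \<in> monomials_in {j}"
    by (induction N) (auto intro: monomials_in_1 monomials_in_mult mvar_in_monomials)
  ultimately have "c {} \<in> loc F A" unfolding j by (intro locI)
  then show "cdiff c F \<in> loc F A"
    using j jn subspace_scale[OF subspace_loc[OF A]] by (simp add: cdiff_def)
next
  fix F assume "\<not> (F \<subseteq> {1..n} \<and> card F = Suc 0)"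
  then show "cdiff c F = 0" using chain_0[OF cdiff_chain[OF c sT]] by blast
qed

text \<open>The recursion along the diagonal, started at \<open>r = d\<close> with the socle as
  \<open>Y\<close>. The entries of \<open>I\<close> below \<open>d\<close> are bases of the full
  H^j(M), whereas the entry at \<open>d\<close> is a basis of the subspace given by
  \<open>Y0\<close>.\<close>

lemma socle_gbasis:
  assumes tors: "\<And>u. u \<in> T \<Longrightarrow> \<exists>N. \<forall>j\<in>{1..n}. scale (mvar j ^ N) u \<in> PS {1..d} PC.t1"
  obtains Y0 I dg b where "W.gsub Y0" "PC.Bd d {} PC.t1 \<subseteq> Y0" "Y0 \<subseteq> PC.Zc d {} PC.t1"
    "\<And>p y. p \<in> irrelevant_ideal n \<Longrightarrow> y \<in> Y0 \<Longrightarrow> cscale p y \<in> PC.Bd d {} PC.t1"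
    "\<And>j. j \<le> d \<Longrightarrow> W.gbasis (I j) (\<lambda>x. x) (dg j) (if j = d then Y0 else PC.Zc j {} PC.t1) (PC.Bd j {} PC.t1)"
    "W.gbasis {(C, x). C \<subseteq> {1..d} \<and> x \<in> I (card C)} b (\<lambda>(C, x). dg (card C) x + int (card C))
       socle_chains (chain 0 (PS {1..d} PC.t1))"
proof -
  let ?t = PC.t1 and ?D = "{1..d}"
  have sP: "subspace (PS ?D ?t)" by (rule gsub_subspace[OF PS_gsub[OF order.refl]])
  note sCP = subspace_chain[OF sP, of 0] and sCT = subspace_chain[OF sT, of 0]
  have "\<exists>I dg. W.gbasis I (\<lambda>x. x) dg (PC.Zc j {} ?t) (PC.Bd j {} ?t)" for j
    by (rule W.gbasis_exists) (auto intro: PC.gsub_Zc W.gsub_subspace PC.gsub_Bd)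
  then obtain I0 dg0 where I0: "\<And>j. W.gbasis (I0 j) (\<lambda>x. x) (dg0 j) (PC.Zc j {} ?t) (PC.Bd j {} ?t)"
    by metis
  have Y1: "W.gsub socle_chains"
  proof (rule W.gsub_subset[OF gsub_chain[OF T]])
    show "socle_chains \<subseteq> chain 0 T" by (auto simp: socle_chains_def)
    show "W.subspace socle_chains"
    proof (rule W.subspaceI)
      fix q x assume x: "x \<in> socle_chains"
      have "cscale p (cscale q x) = cscale q (cscale p x)" for p by (simp add: mult.commute)
      then show "cscale q x \<in> socle_chains"
        using x W.subspace_scale[OF sCP] W.subspace_scale[OF sCT] by (auto simp: socle_chains_def simp del: W.scale_scale)
    qed (auto simp: socle_chains_def W.scale_right_distrib
          intro: W.subspace_0[OF sCP] W.subspace_0[OF sCT] W.subspace_add[OF sCP] W.subspace_add[OF sCT])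
    fix z j assume z: "z \<in> socle_chains"
    \<comment> \<open>Components of a socle element stay in the socle, because \<mm> is generated by
      homogeneous elements.\<close>
    have irr: "irrelevant_ideal n \<subseteq> {p \<in> carrier (mpoly_ring n). cscale p (chc j z) \<in> chain 0 (PS ?D ?t)}"
    proof (rule irrelevant_ideal_subset)
      fix i assume i: "i \<in> {1..n}"
      have "mvar i \<in> mpoly_grade n 1"
        using i by (auto simp: mpoly_grade_def mpoly_ring_mvar) (simp add: mvar_def exp_deg_def)
      then have "cscale (mvar i) (chc j z) = chc (1 + j) (cscale (mvar i) z)" by (rule W.hc_scale[symmetric])
      moreover have "cscale (mvar i) z \<in> chain 0 (PS ?D ?t)"
        using z mvar_irrelevant[OF i] by (auto simp: socle_chains_def)
      ultimately show "mvar i \<in> {p \<in> carrier (mpoly_ring n). cscale p (chc j z) \<in> chain 0 (PS ?D ?t)}"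
        using W.gsub_hc[OF gsub_chain[OF PS_gsub[OF order.refl]]] mpoly_ring_mvar[OF i] by simp
    qed (auto simp: W.scale_left_distrib mpoly_ring_0 W.subspace_0[OF sCP] simp flip: W.scale_scale
          intro: mpoly_ring_add mpoly_ring_mult W.subspace_add[OF sCP] W.subspace_scale[OF sCP])
    show "chc j z \<in> socle_chains"
      using z irr W.gsub_hc[OF gsub_chain[OF T]] by (auto simp: socle_chains_def)
  qed
  have Y2: "PC.Bd (d - d) ?D ?t \<subseteq> socle_chains"
    using W.subspace_scale[OF sCP] chain_mono[OF psub_subset[OF sT B0(2)], of 0 \<theta> ?D ?t]
    by (auto simp: Bd_0 socle_chains_def)
  have Y3: "socle_chains \<subseteq> PC.Zc (d - d) ?D ?t"
    using cdiff_torsion[OF tors sP] by (auto simp: socle_chains_def PC.Zc_def)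
  \<comment> \<open>With one parameter missing, degree 0 is still below the diagonal. So \<mm> kills
    H^0 there, and its image consists of socle elements.\<close>
  have Y4: "PC.Zc (d - d) (?D - {e}) ?t \<subseteq> socle_chains" if e: "e \<in> ?D" for e
  proof
    fix c assume c: "c \<in> PC.Zc (d - d) (?D - {e}) ?t"
    have "cscale p c \<in> chain 0 (PS ?D ?t)" if p: "p \<in> irrelevant_ideal n" for p :: "'k mpoly"
    proof -
      have "cscale p c \<in> PC.Bd (d - d) (?D - {e}) ?t"
        by (rule PC.irrelevant_kills_Zc[OF _ PC.t1_ge _ c p]) (use e in auto)
      then have "cscale p c \<in> chain 0 (PS (?D - {e}) ?t)" using Bd_0 by simp
      moreover have "insert e (?D - {e}) = ?D" using e by auto
      ultimately show ?thesis
        using PC.CA_mono_insert[of "?D - {e}" e 0 ?t] e by auto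
    qed
    then show "c \<in> socle_chains" using c by (auto simp: socle_chains_def PC.Zc_def)
  qed
  have Y5: "cscale p y \<in> PC.Bd (d - d) ?D ?t" if "p \<in> irrelevant_ideal n" "y \<in> socle_chains" for p y
    using that by (simp add: Bd_0 socle_chains_def)
  obtain Y0 where Y0: "W.gsub Y0" "PC.Bd d {} ?t \<subseteq> Y0" "Y0 \<subseteq> PC.Zc d {} ?t"
    "\<forall>p\<in>irrelevant_ideal n. \<forall>y\<in>Y0. cscale p y \<in> PC.Bd d {} ?t"
    and J: "\<And>J bJ dgJ. W.gbasis J bJ dgJ Y0 (PC.Bd d {} ?t) \<Longrightarrow>
       (\<exists>b. W.gbasis {(C, x). C \<subseteq> ?D \<and> x \<in> (if C = ?D then J else I0 (d - d + card C))} b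
       (\<lambda>(C, x). (if C = ?D then dgJ x else dg0 (d - d + card C) x) + int (card C)) socle_chains (PC.Bd (d - d) ?D ?t))"
    using PC.gbasis_socle[OF I0 order.refl Y1 Y2 Y3 Y4 Y5] by blast
  obtain J dgJ where gJ: "W.gbasis J (\<lambda>x. x) dgJ Y0 (PC.Bd d {} ?t)"
    using W.gbasis_exists[OF Y0(1), of "PC.Bd d {} ?t"] PC.gsub_Bd[of "{}" d ?t] W.gsub_subspace by blast
  from J[OF this] obtain b where b: "W.gbasis {(C, x). C \<subseteq> ?D \<and> x \<in> (if C = ?D then J else I0 (d - d + card C))} b
       (\<lambda>(C, x). (if C = ?D then dgJ x else dg0 (d - d + card C) x) + int (card C)) socle_chains (PC.Bd (d - d) ?D ?t)"
    by blast
  \<comment> \<open>Only the full set has \<open>d\<close> elements, so the case distinction on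
    \<open>C\<close> can be absorbed into a family indexed by \<open>card C\<close>.\<close>
  have card: "card C = d \<longleftrightarrow> C = ?D" if "C \<subseteq> ?D" for C
    using that card_subset_eq[of ?D C] by auto
  show ?thesis
  proof (rule that[OF Y0(1-3)])
    show "cscale p y \<in> PC.Bd d {} ?t" if "p \<in> irrelevant_ideal n" "y \<in> Y0" for p y
      using Y0(4) that by blast
    show "W.gbasis ((I0(d := J)) j) (\<lambda>x. x) ((dg0(d := dgJ)) j) (if j = d then Y0 else PC.Zc j {} ?t) (PC.Bd j {} ?t)" for j
      using I0[of j] gJ by simp
    show "W.gbasis {(C, x). C \<subseteq> ?D \<and> x \<in> (I0(d := J)) (card C)} b
       (\<lambda>(C, x). (dg0(d := dgJ)) (card C) x + int (card C)) socle_chains (chain 0 (PS ?D ?t))"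
    proof (rule PC.gbasis_cong[OF b[unfolded diff_self_eq_0 Bd_0]])
      show "{(C, x). C \<subseteq> ?D \<and> x \<in> (if C = ?D then J else I0 (0 + card C))}
        = {(C, x). C \<subseteq> ?D \<and> x \<in> (I0(d := J)) (card C)}"
      proof (rule Collect_cong)
        fix p :: "nat set \<times> (nat set \<Rightarrow> 'u)"
        show "(case p of (C, x) \<Rightarrow> C \<subseteq> ?D \<and> x \<in> (if C = ?D then J else I0 (0 + card C)))
          = (case p of (C, x) \<Rightarrow> C \<subseteq> ?D \<and> x \<in> (I0(d := J)) (card C))"
          by (cases p) (simp add: card cong: conj_cong)
      qed
    qed (auto simp: card)
  qed
qed

section \<open>Multiplication by the product of the parameters in C\<close>

definition msub :: "nat set \<Rightarrow> 'u set" where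
  "msub C = {a + scale (\<Prod>i\<in>C. \<theta> i) c | a c. a \<in> B0 \<and> c \<in> T}"

text \<open>For \<open>A = msub C\<close>, \<open>Zrel\<close> and \<open>Brel\<close> give the
  cohomology of \<theta>^C M. In contrast to \<open>Zc\<close> and \<open>Bd\<close>, it is the
  module on top that varies, while the relations \<open>B0\<close> stay fixed.\<close>

definition Zrel :: "nat \<Rightarrow> 'u set \<Rightarrow> (nat set \<Rightarrow> 'u) set" where
  "Zrel i A = {c \<in> chain i A. cdiff c \<in> chain (Suc i) B0}"

definition Brel :: "nat \<Rightarrow> 'u set \<Rightarrow> (nat set \<Rightarrow> 'u) set" where
  "Brel i A = {cdiff b + a | b a. b \<in> (case i of 0 \<Rightarrow> {0} | Suc k \<Rightarrow> chain k A) \<and> a \<in> chain i B0}"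

lemma prod_grade: "C \<subseteq> {1..d} \<Longrightarrow> (\<Prod>i\<in>C. \<theta> i) \<in> mpoly_grade n (int (card C))"
  by (rule mpoly_grade_prod) (use th_grade finite_subset[of C "{1..d}"] in auto)

lemma gsub_msub: "C \<subseteq> {1..d} \<Longrightarrow> gsub (msub C)"
  unfolding msub_def by (rule gsub_plus_scale[OF B0(1) T prod_grade])

lemma msub_bounds: "B0 \<subseteq> msub C" "msub C \<subseteq> T"
proof -
  have "b = b + scale p 0" for b p by simp
  then show "B0 \<subseteq> msub C" unfolding msub_def using subspace_0[OF sT] by blast
  show "msub C \<subseteq> T" unfolding msub_def
    using B0(2) by (auto intro!: subspace_add[OF sT] subspace_scale[OF sT])
qed

lemma chain_msub: "chain i (msub C) = {a + cscale (\<Prod>i\<in>C. \<theta> i) c | a c. a \<in> chain i B0 \<and> c \<in> chain i T}"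
  unfolding msub_def by (rule chain_plus_scale[OF sB0 sT])

lemma PS_empty: "PS {} t = B0" by (rule psub_empty[OF subspace_0[OF sT]])

text \<open>Each single parameter, not only the first, can be cancelled modulo \<open>B0\<close> in
  positive degree; the product is cancelled factor by factor.\<close>

lemma prod_regular:
  assumes "C \<subseteq> {1..d}" "c \<in> chain (Suc i) T" "cscale (\<Prod>i\<in>C. \<theta> i) c \<in> chain (Suc i) B0"
  shows "c \<in> chain (Suc i) B0"
proof -
  have "finite C" using assms(1) finite_subset by blast
  then show ?thesis using assms
  proof (induction C)
    case (insert e C)
    have "cscale (\<theta> e) (cscale (\<Prod>i\<in>C. \<theta> i) c) \<in> chain (Suc i) B0" using insert by simp
    moreover have "cscale (\<Prod>i\<in>C. \<theta> i) c \<in> chain (Suc i) T"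
      by (rule W.subspace_scale[OF subspace_chain[OF sT] insert.prems(2)])
    ultimately have "cscale (\<Prod>i\<in>C. \<theta> i) c \<in> chain (Suc i) B0"
      using PC.theta_regular[of "{}" e "cscale (\<Prod>i\<in>C. \<theta> i) c" i] insert.prems(1) by (simp add: PS_empty)
    then show ?case using insert by simp
  qed simp
qed

text \<open>Multiplication by \<theta>^C carries H^j(M)(-j) isomorphically to H^j(\<theta>^C M). In
  positive degree \<theta>^C can be cancelled on cochains; in degree 0 it cannot, but there
  \<open>card C = j\<close> forces \<open>C = {}\<close>. \<open>Z\<close> is variable because in
  degree \<open>d\<close> only \<open>Y0\<close> is transported.\<close>

lemma gbasis_mult:
  assumes C: "C \<subseteq> {1..d}" "card C = j"
    and Z: "PC.Bd j {} PC.t1 \<subseteq> Z" "Z \<subseteq> PC.Zc j {} PC.t1"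
    and gb: "W.gbasis I (\<lambda>x. x) dg Z (PC.Bd j {} PC.t1)"
  shows "W.gbasis I (cscale (\<Prod>i\<in>C. \<theta> i)) (\<lambda>x. dg x + int j)
      {a + cscale (\<Prod>i\<in>C. \<theta> i) z | a z. a \<in> chain j B0 \<and> z \<in> Z} (Brel j (msub C))"
proof -
  let ?p = "\<Prod>i\<in>C. \<theta> i"
  note sCB = subspace_chain[OF sB0] and sCT = subspace_chain[OF sT]
  have Bd: "PC.Bd j {} PC.t1 = {cdiff b + a | b a. b \<in> (case j of 0 \<Rightarrow> {0} | Suc k \<Rightarrow> chain k T) \<and> a \<in> chain j B0}"
    unfolding PC.Bd_def PC.Cm_def PS_empty ..
  have ZT: "Z \<subseteq> chain j T" using Z(2) by (auto simp: PC.Zc_def)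
  have inj: "z \<in> PC.Bd j {} PC.t1" if z: "z \<in> chain j T" "cscale ?p z \<in> Brel j (msub C)" for z
  proof (cases j)
    case 0
    then have "C = {}" using C finite_subset[of C "{1..d}"] by auto
    then show ?thesis using z 0 unfolding Bd Brel_def by simp
  next
    case (Suc k)
    with z obtain b a where "cscale ?p z = cdiff b + a" "b \<in> chain k (msub C)" "a \<in> chain j B0"
      by (auto simp: Brel_def)
    then obtain a1 b1 where ab: "cscale ?p z = cdiff (a1 + cscale ?p b1) + a" "a \<in> chain j B0"
      "a1 \<in> chain k B0" "b1 \<in> chain k T"
      unfolding chain_msub by blast
    \<comment> \<open>A cochain of \<open>msub C\<close> is \<theta>^C times a cochain of
      \<open>T\<close> up to \<open>B0\<close>, so \<theta>^C can be taken out of its coboundary and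
      cancelled.\<close>
    have "cscale ?p (z - cdiff b1) = cdiff a1 + a"
      by (simp add: W.scale_right_diff_distrib ab cdiff_add cdiff_scale)
    also have "\<dots> \<in> chain j B0"
      using ab(2) cdiff_chain[OF ab(3) sB0] Suc by (auto intro: W.subspace_add[OF sCB])
    finally have mem: "cscale ?p (z - cdiff b1) \<in> chain (Suc k) B0" unfolding Suc .
    have "z - cdiff b1 \<in> chain (Suc k) T"
      using z(1) cdiff_chain[OF ab(4) sT] unfolding Suc by (rule W.subspace_diff[OF sCT])
    from prod_regular[OF C(1) this mem] have
 "cdiff b1 + (z - cdiff b1) \<in> PC.Bd j {} PC.t1"
      unfolding Bd unfolding Suc nat.case using ab(4) by blast
    then show ?thesis by simp
  qed
  have incl: "cscale ?p z \<in> Brel j (msub C)" if zb: "z \<in> PC.Bd j {} PC.t1" for z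
  proof -
    from zb obtain b a where ba: "z = cdiff b + a" "b \<in> (case j of 0 \<Rightarrow> {0} | Suc k \<Rightarrow> chain k T)" "a \<in> chain j B0"
      unfolding Bd by blast
    have "cscale ?p z = cdiff (cscale ?p b) + cscale ?p a"
      by (simp add: ba(1) W.scale_right_distrib cdiff_scale)
    moreover have "cscale ?p a \<in> chain j B0" using ba(3) by (rule W.subspace_scale[OF sCB])
    moreover have "cscale ?p b \<in> (case j of 0 \<Rightarrow> {0} | Suc k \<Rightarrow> chain k (msub C))"
    proof (cases j)
      case (Suc k)
      have "cscale ?p b = 0 + cscale ?p b" by simp
      moreover have "b \<in> chain k T" using ba(2) unfolding Suc by simp
      ultimately show ?thesis using W.subspace_0[OF sCB] unfolding Suc nat.case chain_msub by blast
    qed (use ba in simp)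
    ultimately show ?thesis unfolding Brel_def by blast
  qed
  have comb: "W.comb (cscale ?p) f = cscale ?p (W.comb (\<lambda>x. x) f)" for f
    unfolding W.comb_def W.scale_sum_right by (simp add: mult.commute)
  have B_Brel: "chain j B0 \<subseteq> Brel j (msub C)"
  proof
    fix a assume "a \<in> chain j B0"
    then have "cdiff 0 + a \<in> Brel j (msub C)" unfolding Brel_def
      using W.subspace_0[OF subspace_case[OF gsub_subspace[OF gsub_msub[OF C(1)]]]] by blast
    moreover have "cdiff 0 = 0" using cdiff_add[of 0 0] by simp
    ultimately show "a \<in> Brel j (msub C)" by simp
  qed
  have sub: "W.subspace (Brel j (msub C))"
  proof -
    have "W.subspace {x + a | x a. x \<in> cdiff ` (case j of 0 \<Rightarrow> {0} | Suc k \<Rightarrow> chain k (msub C)) \<and> a \<in> chain j B0}"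
    proof (rule W.subspace_plus[OF W.gsub_subspace[OF PC.gsub_D_image] sCB])
      show "W.gsub (case j of 0 \<Rightarrow> {0} | Suc k \<Rightarrow> chain k (msub C))"
        using gsub_chain[OF gsub_msub[OF C(1)]] by (cases j) (auto simp: PC.gsub_0)
    qed
    also have "{x + a | x a. x \<in> cdiff ` (case j of 0 \<Rightarrow> {0} | Suc k \<Rightarrow> chain k (msub C)) \<and> a \<in> chain j B0} = Brel j (msub C)"
      unfolding Brel_def by blast
    finally show ?thesis .
  qed
  show ?thesis
    unfolding W.gbasis_def
  proof (intro conjI ballI allI impI)
    fix i assume "i \<in> I"
    then have i: "i \<in> Z" "chc (dg i) i = i" using gb by (auto simp: W.gbasis_def)
    have "cscale ?p i = 0 + cscale ?p i" by simp
    then show "cscale ?p i \<in> {a + cscale ?p z | a z. a \<in> chain j B0 \<and> z \<in> Z}"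
      using i(1) W.subspace_0[OF sCB] by blast
    show "chc (dg i + int j) (cscale ?p i) = cscale ?p i"
      using W.hc_scale[OF prod_grade[OF C(1)], of "dg i" i] i(2) C(2) by (simp add: add.commute)
  next
    fix f assume f: "Poly_Mapping.keys f \<subseteq> I \<and> W.comb (cscale ?p) f \<in> Brel j (msub C)"
    have "W.comb (\<lambda>x. x) f \<in> chain j T"
      by (rule W.comb_in[OF sCT, where I = I]) (use f gb ZT in \<open>auto simp: W.gbasis_def\<close>)
    with f have "W.comb (\<lambda>x. x) f \<in> PC.Bd j {} PC.t1" unfolding comb by (intro inj) auto
    then show "f = 0" using gb f by (auto simp: W.gbasis_def)
  next
    fix w assume "w \<in> {a + cscale ?p z | a z. a \<in> chain j B0 \<and> z \<in> Z}"
    then obtain a z where az: "w = a + cscale ?p z" "a \<in> chain j B0" "z \<in> Z" by blast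
    with gb obtain f where f: "Poly_Mapping.keys f \<subseteq> I" "z - W.comb (\<lambda>x. x) f \<in> PC.Bd j {} PC.t1"
      by (auto simp: W.gbasis_def)
    have "w - W.comb (cscale ?p) f = a + cscale ?p (z - W.comb (\<lambda>x. x) f)"
      by (simp add: az(1) comb W.scale_right_diff_distrib)
    also have "\<dots> \<in> Brel j (msub C)"
      using az(2) B_Brel by (intro W.subspace_add[OF sub] incl f(2)) blast
    finally show "\<exists>f. Poly_Mapping.keys f \<subseteq> I \<and> w - W.comb (cscale ?p) f \<in> Brel j (msub C)"
      using f(1) by blast
  qed
qed

text \<open>The factor \<theta>^C is cancelled from \<open>cdiff c\<close>, which has the positive
  degree \<open>j + 1\<close> even when \<open>j = 0\<close>.\<close>

lemma Zrel_msub: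
  assumes C: "C \<subseteq> {1..d}" "card C = j"
  shows "Zrel j (msub C) = {a + cscale (\<Prod>i\<in>C. \<theta> i) z | a z. a \<in> chain j B0 \<and> z \<in> PC.Zc j {} PC.t1}"
    (is "_ = ?R")
proof -
  let ?p = "\<Prod>i\<in>C. \<theta> i"
  note sCB = subspace_chain[OF sB0] and sCT = subspace_chain[OF sT]
  have Zc: "PC.Zc j {} PC.t1 = {c \<in> chain j T. cdiff c \<in> chain (Suc j) B0}"
    unfolding PC.Zc_def PS_empty ..
  show ?thesis
  proof
    show "Zrel j (msub C) \<subseteq> ?R"
    proof
      fix x assume "x \<in> Zrel j (msub C)"
      then obtain a c where ac: "x = a + cscale ?p c" "a \<in> chain j B0" "c \<in> chain j T"
        "cdiff x \<in> chain (Suc j) B0" unfolding Zrel_def chain_msub by blast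
      have "cscale ?p (cdiff c) = cdiff x - cdiff a" by (simp add: ac(1) cdiff_add cdiff_scale)
      also have "\<dots> \<in> chain (Suc j) B0"
        by (rule W.subspace_diff[OF sCB ac(4) cdiff_chain[OF ac(2) sB0]])
      finally have "cdiff c \<in> chain (Suc j) B0" by (rule prod_regular[OF C(1) cdiff_chain[OF ac(3) sT]])
      then show "x \<in> ?R" using ac unfolding Zc by blast
    qed
    show "?R \<subseteq> Zrel j (msub C)"
    proof
      fix x assume "x \<in> ?R"
      then obtain a z where az: "x = a + cscale ?p z" "a \<in> chain j B0" "z \<in> chain j T"
        "cdiff z \<in> chain (Suc j) B0" unfolding Zc by blast
      have "cdiff x = cdiff a + cscale ?p (cdiff z)" by (simp add: az(1) cdiff_add cdiff_scale)
      also have "\<dots> \<in> chain (Suc j) B0"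
        by (intro W.subspace_add[OF sCB] cdiff_chain[OF az(2) sB0] W.subspace_scale[OF sCB] az(4))
      finally show "x \<in> Zrel j (msub C)" using az unfolding Zrel_def chain_msub by blast
    qed
  qed
qed

end

section \<open>Presentations of graded modules\<close>

lemma UN_pair_const:
  assumes "x \<in> X" "\<And>m s. (m, s) \<in> X \<Longrightarrow> f m s = c" shows "(\<Union>(m, s)\<in>X. f m s) = c"
proof -
  have "(\<Union>(m, s)\<in>X. f m s) = (\<Union>p\<in>X. c)" by (rule SUP_cong) (use assms(2) in auto)
  then show ?thesis using assms(1) by auto
qed

context graded_scale
begin

text \<open>\<open>N\<close> is the graded subquotient \<open>Z / B\<close>, by means of the map \<open>\<rho>\<close> defined on \<open>Z\<close>.\<close>

definition presents :: "('w \<Rightarrow> 'b) \<Rightarrow> 'w set \<Rightarrow> 'w set \<Rightarrow> ('k mpoly, 'b) gmodule \<Rightarrow> bool" where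
  "presents \<rho> Z B N \<longleftrightarrow>
     carrier N = \<rho> ` Z \<and> \<zero>\<^bsub>N\<^esub> = \<rho> 0 \<and>
     (\<forall>x\<in>Z. \<forall>y\<in>Z. \<rho> x \<oplus>\<^bsub>N\<^esub> \<rho> y = \<rho> (x + y)) \<and>
     (\<forall>p\<in>carrier (mpoly_ring n). \<forall>x\<in>Z. p \<odot>\<^bsub>N\<^esub> \<rho> x = \<rho> (scale p x)) \<and>
     (\<forall>x\<in>Z. \<forall>y\<in>Z. \<rho> x = \<rho> y \<longleftrightarrow> x - y \<in> B) \<and>
     (\<forall>j. grade N j = \<rho> ` {x \<in> Z. hc j x = x})"

lemma presentsI:
  assumes "carrier N = \<rho> ` Z" "\<zero>\<^bsub>N\<^esub> = \<rho> 0"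
    "\<And>x y. x \<in> Z \<Longrightarrow> y \<in> Z \<Longrightarrow> \<rho> x \<oplus>\<^bsub>N\<^esub> \<rho> y = \<rho> (x + y)"
    "\<And>p x. p \<in> carrier (mpoly_ring n) \<Longrightarrow> x \<in> Z \<Longrightarrow> p \<odot>\<^bsub>N\<^esub> \<rho> x = \<rho> (scale p x)"
    "\<And>x y. x \<in> Z \<Longrightarrow> y \<in> Z \<Longrightarrow> \<rho> x = \<rho> y \<longleftrightarrow> x - y \<in> B"
    "\<And>j. grade N j = \<rho> ` {x \<in> Z. hc j x = x}"
  shows "presents \<rho> Z B N"
  using assms by (simp add: presents_def)

lemma presents_carrier: "presents \<rho> Z B N \<Longrightarrow> carrier N = \<rho> ` Z"
  and presents_zero: "presents \<rho> Z B N \<Longrightarrow> \<zero>\<^bsub>N\<^esub> = \<rho> 0"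
  and presents_add: "presents \<rho> Z B N \<Longrightarrow> x \<in> Z \<Longrightarrow> y \<in> Z \<Longrightarrow> \<rho> x \<oplus>\<^bsub>N\<^esub> \<rho> y = \<rho> (x + y)"
  and presents_smult: "presents \<rho> Z B N \<Longrightarrow> p \<in> carrier (mpoly_ring n) \<Longrightarrow> x \<in> Z \<Longrightarrow> p \<odot>\<^bsub>N\<^esub> \<rho> x = \<rho> (scale p x)"
  and presents_eq: "presents \<rho> Z B N \<Longrightarrow> x \<in> Z \<Longrightarrow> y \<in> Z \<Longrightarrow> \<rho> x = \<rho> y \<longleftrightarrow> x - y \<in> B"
  and presents_grade: "presents \<rho> Z B N \<Longrightarrow> grade N j = \<rho> ` {x \<in> Z. hc j x = x}"
  by (simp_all add: presents_def)

lemma presents_eq_0: "presents \<rho> Z B N \<Longrightarrow> subspace Z \<Longrightarrow> x \<in> Z \<Longrightarrow> \<rho> x = \<zero>\<^bsub>N\<^esub> \<longleftrightarrow> x \<in> B"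
  using presents_eq[of \<rho> Z B N x 0] subspace_0[of Z] by (simp add: presents_zero)

lemma presents_abelian_group:
  assumes P: "presents \<rho> Z B N" and Z: "subspace Z" shows "abelian_group N"
proof (rule abelian_groupI)
  note [simp] = presents_carrier[OF P] presents_zero[OF P]
  show "\<zero>\<^bsub>N\<^esub> \<in> carrier N" using subspace_0[OF Z] by simp
  fix x assume "x \<in> carrier N"
  then obtain u where u: "x = \<rho> u" "u \<in> Z" by auto
  show "\<zero>\<^bsub>N\<^esub> \<oplus>\<^bsub>N\<^esub> x = x" using presents_add[OF P subspace_0[OF Z] u(2)] u by simp
  show "\<exists>y\<in>carrier N. y \<oplus>\<^bsub>N\<^esub> x = \<zero>\<^bsub>N\<^esub>"
    using presents_add[OF P subspace_neg[OF Z u(2)] u(2)] subspace_neg[OF Z u(2)] u by auto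
  fix y assume "y \<in> carrier N"
  then obtain v where v: "y = \<rho> v" "v \<in> Z" by auto
  show "x \<oplus>\<^bsub>N\<^esub> y \<in> carrier N"
    using presents_add[OF P u(2) v(2)] subspace_add[OF Z u(2) v(2)] u v by simp
  show "x \<oplus>\<^bsub>N\<^esub> y = y \<oplus>\<^bsub>N\<^esub> x"
    using presents_add[OF P u(2) v(2)] presents_add[OF P v(2) u(2)] u v by (simp add: add.commute)
  fix z assume "z \<in> carrier N"
  then obtain w where w: "z = \<rho> w" "w \<in> Z" by auto
  show "x \<oplus>\<^bsub>N\<^esub> y \<oplus>\<^bsub>N\<^esub> z = x \<oplus>\<^bsub>N\<^esub> (y \<oplus>\<^bsub>N\<^esub> z)"
    using u v w subspace_add[OF Z] by (simp add: presents_add[OF P] add.assoc)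
qed

lemma presents_module:
  assumes P: "presents \<rho> Z B N" and Z: "subspace Z" shows "Module.module (mpoly_ring n) N"
proof (rule moduleI)
  show "cring (mpoly_ring n :: 'k mpoly ring)" by (rule cring_mpoly_ring)
  show "abelian_group N" by (rule presents_abelian_group[OF P Z])
qed (auto simp: presents_carrier[OF P] presents_smult[OF P] presents_add[OF P] subspace_add[OF Z]
    subspace_scale[OF Z] mpoly_ring_add mpoly_ring_mult mpoly_ring_1 scale_left_distrib scale_right_distrib)

lemma presents_finsum:
  assumes P: "presents \<rho> Z B N" and Z: "subspace Z" and f: "\<And>j. j \<in> J \<Longrightarrow> f j \<in> Z"
  shows "(\<Oplus>\<^bsub>N\<^esub>j\<in>J. \<rho> (f j)) = \<rho> (sum f J)"
  using f
proof (induction J rule: infinite_finite_induct)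
  case (infinite J)
  interpret abelian_group N by (rule presents_abelian_group[OF P Z])
  show ?case using infinite by (simp add: presents_zero[OF P])
next
  case empty
  interpret abelian_group N by (rule presents_abelian_group[OF P Z])
  show ?case by (simp add: presents_zero[OF P])
next
  case (insert x F)
  interpret abelian_group N by (rule presents_abelian_group[OF P Z])
  have "(\<Oplus>\<^bsub>N\<^esub>j\<in>insert x F. \<rho> (f j)) = \<rho> (f x) \<oplus>\<^bsub>N\<^esub> (\<Oplus>\<^bsub>N\<^esub>j\<in>F. \<rho> (f j))"
    by (rule finsum_insert) (use insert in \<open>auto simp: presents_carrier[OF P]\<close>)
  also have "\<dots> = \<rho> (f x) \<oplus>\<^bsub>N\<^esub> \<rho> (sum f F)" using insert by simp
  also have "\<dots> = \<rho> (f x + sum f F)"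
    by (rule presents_add[OF P]) (use insert.prems in \<open>auto intro: subspace_sum[OF Z]\<close>)
  finally show ?case using insert by simp
qed

text \<open>The decomposition comes from the components in the ambient space. It is unique because
  \<open>B\<close> is graded: a congruence modulo \<open>B\<close> holds in each degree
  separately.\<close>

lemma presents_graded_module:
  assumes P: "presents \<rho> Z B N" and Z: "gsub Z" and B: "gsub B" shows "graded_module n N"
proof -
  note sZ = gsub_subspace[OF Z] and sB = gsub_subspace[OF B]
  interpret ab: abelian_group N by (rule presents_abelian_group[OF P sZ])
  have mem: "x \<in> Z \<Longrightarrow> hc j x = x \<Longrightarrow> \<rho> x \<in> grade N j" for x j
    by (auto simp: presents_grade[OF P])
  have gradeE: "\<exists>x. y = \<rho> x \<and> x \<in> Z \<and> hc j x = x" if "y \<in> grade N j" for y j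
    using that by (auto simp: presents_grade[OF P])
  show ?thesis
  proof (intro graded_module.intro presents_module[OF P sZ] graded_module_axioms.intro)
    fix j
    show "subgroup (grade N j) (add_monoid N)"
    proof (rule group.subgroupI[OF ab.a_group])
      show "grade N j \<subseteq> carrier (add_monoid N)"
        by (auto simp: presents_grade[OF P] presents_carrier[OF P])
      show "grade N j \<noteq> {}" using mem[OF subspace_0[OF sZ] hc_0] by blast
      fix a assume "a \<in> grade N j"
      then obtain x where x: "a = \<rho> x" "x \<in> Z" "hc j x = x" using gradeE by blast
      have "\<ominus>\<^bsub>N\<^esub> a = \<rho> (- x)"
        using x subspace_neg[OF sZ x(2)] presents_add[OF P subspace_neg[OF sZ x(2)] x(2)]
        by (intro ab.minus_equality) (auto simp: presents_carrier[OF P] presents_zero[OF P])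
      then show "inv\<^bsub>add_monoid N\<^esub> a \<in> grade N j"
        using mem[OF subspace_neg[OF sZ x(2)], of j] x(3) by (simp add: a_inv_def hc_minus)
      fix b assume "b \<in> grade N j"
      then obtain y where y: "b = \<rho> y" "y \<in> Z" "hc j y = y" using gradeE by blast
      show "a \<otimes>\<^bsub>add_monoid N\<^esub> b \<in> grade N j"
        using mem[OF subspace_add[OF sZ x(2) y(2)], of j] x y by (simp add: presents_add[OF P] hc_add)
    qed
  next
    fix a :: "'k mpoly" and i y j assume a: "a \<in> mpoly_grade n i" and "y \<in> grade N j"
    then obtain x where x: "y = \<rho> x" "x \<in> Z" "hc j x = x" using gradeE by blast
    show "a \<odot>\<^bsub>N\<^esub> y \<in> grade N (i + j)"
      using mem[OF subspace_scale[OF sZ x(2)], of "i + j" a] x mpoly_grade_carrier[OF a]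
      by (simp add: presents_smult[OF P] hc_scale[OF a])
  next
    fix y assume "y \<in> carrier N"
    then obtain z where z: "y = \<rho> z" "z \<in> Z" by (auto simp: presents_carrier[OF P])
    let ?c = "\<lambda>j. \<rho> (hc j z)"
    show "\<exists>!c. (\<forall>j. c j \<in> grade N j) \<and> finite {j. c j \<noteq> \<zero>\<^bsub>N\<^esub>} \<and> y = (\<Oplus>\<^bsub>N\<^esub>j\<in>{j. c j \<noteq> \<zero>\<^bsub>N\<^esub>}. c j)"
    proof (rule ex1I)
      let ?J = "{j. ?c j \<noteq> \<zero>\<^bsub>N\<^esub>}"
      have eq0: "?c j = \<zero>\<^bsub>N\<^esub> \<longleftrightarrow> hc j z \<in> B" for j by (rule presents_eq_0[OF P sZ gsub_hc[OF Z z(2)]])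
      have sub: "?J \<subseteq> {j. hc j z \<noteq> 0}" using subspace_0[OF sB] by (auto simp: eq0)
      have fin: "finite ?J" by (rule finite_subset[OF sub gsub_finite[OF Z z(2)]])
      have "z - (\<Sum>j\<in>?J. hc j z) = (\<Sum>j\<in>{j. hc j z \<noteq> 0} - ?J. hc j z)"
        using gsub_sum_hc[OF Z z(2)] sum_diff[OF gsub_finite[OF Z z(2)] sub, of "\<lambda>j. hc j z"] by simp
      also have "\<dots> \<in> B" by (rule subspace_sum[OF sB]) (auto simp: eq0)
      finally have inB: "z - (\<Sum>j\<in>?J. hc j z) \<in> B" .
      have "(\<Sum>j\<in>?J. hc j z) \<in> Z" by (rule subspace_sum[OF sZ gsub_hc[OF Z z(2)]])
      from presents_eq[OF P z(2) this] inB have "\<rho> z = \<rho> (\<Sum>j\<in>?J. hc j z)" by blast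
      moreover have "(\<Oplus>\<^bsub>N\<^esub>j\<in>?J. ?c j) = \<rho> (\<Sum>j\<in>?J. hc j z)"
        by (rule presents_finsum[OF P sZ]) (rule gsub_hc[OF Z z(2)])
      ultimately have "y = (\<Oplus>\<^bsub>N\<^esub>j\<in>?J. ?c j)" using z by simp
      moreover have "?c j \<in> grade N j" for j by (rule mem[OF gsub_hc[OF Z z(2)]]) (simp add: hc_hc)
      ultimately show "(\<forall>j. ?c j \<in> grade N j) \<and> finite ?J \<and> y = (\<Oplus>\<^bsub>N\<^esub>j\<in>?J. ?c j)"
        using fin by blast
    next
      fix c assume c: "(\<forall>j. c j \<in> grade N j) \<and> finite {j. c j \<noteq> \<zero>\<^bsub>N\<^esub>} \<and> y = (\<Oplus>\<^bsub>N\<^esub>j\<in>{j. c j \<noteq> \<zero>\<^bsub>N\<^esub>}. c j)"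
      then have "c j \<in> grade N j" for j by blast
      then have "\<forall>j. \<exists>x. c j = \<rho> x \<and> x \<in> Z \<and> hc j x = x" using gradeE by blast
      from choice[OF this] obtain x where "\<forall>j. c j = \<rho> (x j) \<and> x j \<in> Z \<and> hc j (x j) = x j" ..
      then have x: "c j = \<rho> (x j)" "x j \<in> Z" "hc j (x j) = x j" for j by auto
      let ?J = "{j. c j \<noteq> \<zero>\<^bsub>N\<^esub>}"
      have "(\<Oplus>\<^bsub>N\<^esub>j\<in>?J. c j) = \<rho> (sum x ?J)"
        unfolding x(1) by (rule presents_finsum[OF P sZ x(2)])
      with c z(1) have "\<rho> z = \<rho> (sum x ?J)" by simp
      moreover have "sum x ?J \<in> Z" by (rule subspace_sum[OF sZ x(2)])
      ultimately have d: "z - sum x ?J \<in> B"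
        using presents_eq[OF P z(2)] by blast
      show "c = ?c"
      proof
        fix j
        have "hc j (sum x ?J) = (\<Sum>i\<in>?J. if i = j then x j else 0)"
          unfolding hc_sum by (rule sum.cong) (use hc_hom[OF x(3)] in auto)
        also have "\<dots> = (if j \<in> ?J then x j else 0)" using c by simp
        finally have "hc j z - (if j \<in> ?J then x j else 0) \<in> B"
          using gsub_hc[OF B d, of j] by (simp add: hc_diff)
        moreover have "x j \<in> B" if "j \<notin> ?J"
          using that presents_eq_0[OF P sZ x(2)] x(1) by simp
        ultimately have "hc j z - x j \<in> B"
          using subspace_diff[OF sB, of "hc j z" "x j"] by (auto split: if_splits)
        then show "c j = ?c j"
          using presents_eq[OF P gsub_hc[OF Z z(2)] x(2), of j j] x(1)[of j] by simp
      qed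
    qed
  qed
qed

text \<open>A homogeneous representative in \<open>Z\<close> of an element of the submodule already
  lies in \<open>Z'\<close>, as it differs from a representative in \<open>Z'\<close> by an element
  of \<open>B\<close>.\<close>

lemma presents_sub:
  assumes P: "presents \<rho> Z B N" and sub: "B \<subseteq> Z'" "Z' \<subseteq> Z" and Z': "subspace Z'"
  shows "presents \<rho> Z' B (sub_gmodule N (\<rho> ` Z'))"
proof -
  have g: "grade N j \<inter> \<rho> ` Z' = \<rho> ` {x \<in> Z'. hc j x = x}" for j
  proof
    show "grade N j \<inter> \<rho> ` Z' \<subseteq> \<rho> ` {x \<in> Z'. hc j x = x}"
    proof
      fix y assume y: "y \<in> grade N j \<inter> \<rho> ` Z'"
      then obtain x where x: "y = \<rho> x" "x \<in> Z" "hc j x = x" by (auto simp: presents_grade[OF P])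
      from y obtain z where z: "y = \<rho> z" "z \<in> Z'" by blast
      with x have "x - z \<in> B" using presents_eq[OF P, of x z] sub by auto
      then have "(x - z) + z \<in> Z'" using sub z by (intro subspace_add[OF Z']) auto
      then show "y \<in> \<rho> ` {x \<in> Z'. hc j x = x}" using x by auto
    qed
  qed (use sub in \<open>auto simp: presents_grade[OF P]\<close>)
  show ?thesis
    unfolding presents_def sub_gmodule_def using P sub g
    by (auto simp: presents_def subset_iff)
qed

text \<open>Elements of \<open>quot_gmodule\<close> are cosets, hence sets of elements of
  \<open>N\<close>; the new map sends \<open>z\<close> to the image of
  \<open>B' + z\<close>.\<close>

lemma presents_quotient:
  assumes P: "presents \<rho> Z B N" and sub: "B \<subseteq> B'" "B' \<subseteq> Z" and Z: "subspace Z" and B': "subspace B'"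
  shows "presents (\<lambda>z. (\<lambda>b. \<rho> (b + z)) ` B') Z B' (quot_gmodule N (\<rho> ` B'))"
proof -
  define co where "co z = (\<lambda>b. \<rho> (b + z)) ` B'" for z
  have B'Z: "b \<in> B' \<Longrightarrow> b \<in> Z" for b using sub by blast
  have coset: "\<rho> ` B' +>\<^bsub>N\<^esub> \<rho> z = co z" if "z \<in> Z" for z
    unfolding a_r_coset_def r_coset_def co_def using presents_add[OF P _ that] B'Z
    by (auto simp: image_iff)
  have co_eq: "co x = co y \<longleftrightarrow> x - y \<in> B'" if xy: "x \<in> Z" "y \<in> Z" for x y
  proof
    assume "co x = co y"
    moreover have "\<rho> (0 + x) \<in> co x" unfolding co_def using subspace_0[OF B'] by blast
    ultimately obtain b where b: "b \<in> B'" "\<rho> x = \<rho> (b + y)" unfolding co_def by auto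
    then have "x - (b + y) \<in> B'"
      using presents_eq[OF P xy(1) subspace_add[OF Z B'Z[OF b(1)] xy(2)]] sub by blast
    then have "(x - (b + y)) + b \<in> B'" using b by (intro subspace_add[OF B'])
    then show "x - y \<in> B'" by (simp add: algebra_simps)
  next
    have one: "co x \<subseteq> co y" if "x - y \<in> B'" for x y
    proof
      fix v assume "v \<in> co x"
      then obtain b where b: "v = \<rho> (b + x)" "b \<in> B'" by (auto simp: co_def)
      show "v \<in> co y" unfolding co_def b(1)
        by (rule image_eqI[of _ _ "b + (x - y)"]) (simp_all add: subspace_add[OF B' b(2) that])
    qed
    assume d: "x - y \<in> B'"
    then have "y - x \<in> B'" using subspace_neg[OF B' d] by simp
    with d one show "co x = co y" by blast
  qed
  have "carrier (quot_gmodule N (\<rho> ` B')) = co ` Z"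
    unfolding quot_gmodule_def A_RCOSETS_def RCOSETS_def
    using coset by (auto simp: presents_carrier[OF P] a_r_coset_def image_iff)
  moreover have "\<zero>\<^bsub>quot_gmodule N (\<rho> ` B')\<^esub> = co 0" by (simp add: quot_gmodule_def co_def)
  moreover have "co x \<oplus>\<^bsub>quot_gmodule N (\<rho> ` B')\<^esub> co y = co (x + y)" if xy: "x \<in> Z" "y \<in> Z" for x y
  proof -
    have "co x \<oplus>\<^bsub>quot_gmodule N (\<rho> ` B')\<^esub> co y = {\<rho> (b + x) \<oplus>\<^bsub>N\<^esub> \<rho> (b' + y) | b b'. b \<in> B' \<and> b' \<in> B'}"
      unfolding quot_gmodule_def by (auto simp: set_add_def set_mult_def co_def)
    also have "\<dots> = {\<rho> ((b + b') + (x + y)) | b b'. b \<in> B' \<and> b' \<in> B'}"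
    proof -
      have "\<rho> (b + x) \<oplus>\<^bsub>N\<^esub> \<rho> (b' + y) = \<rho> ((b + b') + (x + y))" if "b \<in> B'" "b' \<in> B'" for b b'
        using presents_add[OF P subspace_add[OF Z B'Z[OF that(1)] xy(1)] subspace_add[OF Z B'Z[OF that(2)] xy(2)]]
        by (simp add: add_ac)
      then show ?thesis by (intro Collect_cong) metis
    qed
    also have "\<dots> = co (x + y)"
    proof
      show "{\<rho> ((b + b') + (x + y)) | b b'. b \<in> B' \<and> b' \<in> B'} \<subseteq> co (x + y)"
        unfolding co_def using subspace_add[OF B'] by blast
      show "co (x + y) \<subseteq> {\<rho> ((b + b') + (x + y)) | b b'. b \<in> B' \<and> b' \<in> B'}"
      proof
        fix v assume "v \<in> co (x + y)"
        then obtain b where "v = \<rho> ((b + 0) + (x + y))" "b \<in> B'" by (auto simp: co_def)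
        then show "v \<in> {\<rho> ((b + b') + (x + y)) | b b'. b \<in> B' \<and> b' \<in> B'}"
          using subspace_0[OF B'] by blast
      qed
    qed
    finally show ?thesis .
  qed
  moreover have "p \<odot>\<^bsub>quot_gmodule N (\<rho> ` B')\<^esub> co x = co (scale p x)"
    if p: "p \<in> carrier (mpoly_ring n)" and x: "x \<in> Z" for p x
  proof -
    have "\<rho> ` B' +>\<^bsub>N\<^esub> (p \<odot>\<^bsub>N\<^esub> \<rho> (b + x)) = co (scale p x)" if b: "b \<in> B'" for b
    proof -
      have bx: "b + x \<in> Z" by (rule subspace_add[OF Z B'Z[OF b] x])
      have "\<rho> ` B' +>\<^bsub>N\<^esub> (p \<odot>\<^bsub>N\<^esub> \<rho> (b + x)) = co (scale p (b + x))"
        unfolding presents_smult[OF P p bx] by (rule coset[OF subspace_scale[OF Z bx]])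
      also have "\<dots> = co (scale p x)"
        unfolding co_eq[OF subspace_scale[OF Z bx] subspace_scale[OF Z x]]
        using subspace_scale[OF B' b, of p] by (simp add: scale_right_distrib)
      finally show ?thesis .
    qed
    moreover have "B' \<noteq> {}" using subspace_0[OF B'] by blast
    ultimately show ?thesis by (simp add: quot_gmodule_def co_def[of x])
  qed
  moreover note co_eq
  moreover have "grade (quot_gmodule N (\<rho> ` B')) j = co ` {x \<in> Z. hc j x = x}" for j
    unfolding quot_gmodule_def using coset by (auto simp: presents_grade[OF P] image_iff)
  ultimately have "presents co Z B' (quot_gmodule N (\<rho> ` B'))" by (rule presentsI)
  then show ?thesis by (simp only: co_def[abs_def])
qed

lemma presents_socle:
  assumes P: "presents \<rho> Z B N" and Z: "subspace Z" and B: "subspace B" "B \<subseteq> Z"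
  shows "presents \<rho> {z \<in> Z. \<forall>p\<in>irrelevant_ideal n. scale p z \<in> B} B (socle n N)"
proof -
  let ?S = "{z \<in> Z. \<forall>p\<in>irrelevant_ideal n. scale p z \<in> B}"
  have "a \<odot>\<^bsub>N\<^esub> \<rho> z = \<zero>\<^bsub>N\<^esub> \<longleftrightarrow> scale a z \<in> B" if "z \<in> Z" "a \<in> irrelevant_ideal n" for a z
    using presents_smult[OF P _ that(1)] presents_eq_0[OF P Z subspace_scale[OF Z that(1)]]
      that(2) irrelevant_ideal_carrier[of n] by (metis subsetD)
  then have eq: "{y \<in> carrier N. \<forall>a\<in>irrelevant_ideal n. a \<odot>\<^bsub>N\<^esub> y = \<zero>\<^bsub>N\<^esub>} = \<rho> ` ?S"
    by (auto simp: presents_carrier[OF P])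
  have sub: "subspace ?S"
  proof (rule subspaceI)
    fix q x assume x: "x \<in> ?S"
    have "scale p (scale q x) = scale q (scale p x)" for p by (simp add: mult.commute)
    then show "scale q x \<in> ?S"
      using x subspace_scale[OF B(1)] subspace_scale[OF Z] by (auto simp del: scale_scale)
  qed (auto simp: scale_right_distrib subspace_0[OF Z] subspace_0[OF B(1)] subspace_add[OF Z] subspace_add[OF B(1)])
  show ?thesis
    unfolding socle_def eq by (rule presents_sub[OF P]) (use B subspace_scale[OF B(1)] sub in auto)
qed

end

section \<open>Local cohomology of a subquotient of the ambient space\<close>

context cech_space
begin

context
  fixes \<pi> :: "'u \<Rightarrow> 'b" and A B and N :: "('k mpoly, 'b) gmodule"
  assumes P: "presents \<pi> A B N" and A: "gsub A" and B: "gsub B" and BA: "B \<subseteq> A"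
begin

text \<open>The fractions represented by \<open>u\<close>: all pairs \<open>(\<pi> v, s)\<close>
  such that v / s is congruent to \<open>u\<close> modulo the localization of
  \<open>B\<close>.\<close>

definition frac :: "nat set \<Rightarrow> 'u \<Rightarrow> ('b \<times> 'k mpoly) set" where
  "frac F u = {(\<pi> v, s) | v s. v \<in> A \<and> s \<in> monomials_in F \<and> scale s u - v \<in> loc F B}"

lemma sA: "subspace A" and sB: "subspace B" using A B gsub_subspace by auto

lemma monomials_carrier: "F \<subseteq> {1..n} \<Longrightarrow> s \<in> monomials_in F \<Longrightarrow> s \<in> carrier (mpoly_ring n)"
  using monomials_in_grade mpoly_grade_carrier by blast

lemma loc_cancel: "s \<in> monomials_in F \<Longrightarrow> scale s u \<in> loc F B \<Longrightarrow> u \<in> loc F B"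
  unfolding loc_def using monomials_in_mult[of _ F s] by (auto simp: loc_def)

text \<open>Equality of fractions can be decided in the ambient space: v' / s' equals v / s over
  \<open>A / B\<close> exactly if \<open>scale s' u - v'\<close> lies in \<open>loc F B\<close>,
  because monomials of \<open>F\<close> can be cancelled there. Hence the class depends on
  \<open>u\<close> only.\<close>

lemma mfrac_eq:
  assumes F: "F \<subseteq> {1..n}" and s: "s \<in> monomials_in F" and v: "v \<in> A" and u: "scale s u - v \<in> loc F B"
  shows "mfrac N (monomials_in F) (\<pi> v) s = frac F u"
proof -
  note sL = subspace_loc[OF sB, of F] and car = monomials_carrier[OF F]
  have key: "(\<exists>t\<in>monomials_in F. t \<odot>\<^bsub>N\<^esub> (s' \<odot>\<^bsub>N\<^esub> \<pi> v) = t \<odot>\<^bsub>N\<^esub> (s \<odot>\<^bsub>N\<^esub> \<pi> v')) \<longleftrightarrow> scale s' u - v' \<in> loc F B"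
    if v': "v' \<in> A" and s': "s' \<in> monomials_in F" for v' s'
  proof -
    have "t \<odot>\<^bsub>N\<^esub> (s' \<odot>\<^bsub>N\<^esub> \<pi> v) = t \<odot>\<^bsub>N\<^esub> (s \<odot>\<^bsub>N\<^esub> \<pi> v') \<longleftrightarrow> scale t (scale s' v - scale s v') \<in> B"
      if t: "t \<in> monomials_in F" for t
    proof -
      have "t \<odot>\<^bsub>N\<^esub> (s' \<odot>\<^bsub>N\<^esub> \<pi> v) = \<pi> (scale t (scale s' v))"
        using presents_smult[OF P car[OF s'] v] presents_smult[OF P car[OF t] subspace_scale[OF sA v]] by simp
      moreover have "t \<odot>\<^bsub>N\<^esub> (s \<odot>\<^bsub>N\<^esub> \<pi> v') = \<pi> (scale t (scale s v'))"
        using presents_smult[OF P car[OF s] v'] presents_smult[OF P car[OF t] subspace_scale[OF sA v']] by simp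
      ultimately show ?thesis
        using presents_eq[OF P subspace_scale[OF sA subspace_scale[OF sA v]] subspace_scale[OF sA subspace_scale[OF sA v']]]
        by (metis scale_right_diff_distrib)
    qed
    then have "(\<exists>t\<in>monomials_in F. t \<odot>\<^bsub>N\<^esub> (s' \<odot>\<^bsub>N\<^esub> \<pi> v) = t \<odot>\<^bsub>N\<^esub> (s \<odot>\<^bsub>N\<^esub> \<pi> v'))
      \<longleftrightarrow> scale s' v - scale s v' \<in> loc F B" by (auto simp: loc_def)
    also have "\<dots> \<longleftrightarrow> scale s (scale s' u - v') \<in> loc F B"
    proof -
      have d: "scale s (scale s' u - v') = (scale s' v - scale s v') + scale s' (scale s u - v)"
        by (simp add: scale_right_diff_distrib mult.commute)
      have m: "scale s' (scale s u - v) \<in> loc F B" by (rule subspace_scale[OF sL u])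
      show ?thesis
        unfolding d using subspace_add[OF sL _ m] subspace_diff[OF sL _ m]
        by (metis add_diff_cancel_right')
    qed
    also have "\<dots> \<longleftrightarrow> scale s' u - v' \<in> loc F B"
      using loc_cancel[OF s] subspace_scale[OF sL] by blast
    finally show ?thesis .
  qed
  show ?thesis
  proof (rule Set.set_eqI)
    fix x :: "'b \<times> 'k mpoly"
    obtain m' s' where x: "x = (m', s')" by (cases x)
    show "x \<in> mfrac N (monomials_in F) (\<pi> v) s \<longleftrightarrow> x \<in> frac F u"
    proof
      assume "x \<in> mfrac N (monomials_in F) (\<pi> v) s"
      then obtain v' where "m' = \<pi> v'" "v' \<in> A" "s' \<in> monomials_in F"
        "\<exists>t\<in>monomials_in F. t \<odot>\<^bsub>N\<^esub> (s' \<odot>\<^bsub>N\<^esub> \<pi> v) = t \<odot>\<^bsub>N\<^esub> (s \<odot>\<^bsub>N\<^esub> \<pi> v')"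
        unfolding x mfrac_def presents_carrier[OF P] by blast
      then show "x \<in> frac F u" unfolding x frac_def using key by blast
    next
      assume "x \<in> frac F u"
      then obtain v' where "m' = \<pi> v'" "v' \<in> A" "s' \<in> monomials_in F" "scale s' u - v' \<in> loc F B"
        unfolding x frac_def by blast
      then show "x \<in> mfrac N (monomials_in F) (\<pi> v) s"
        unfolding x mfrac_def presents_carrier[OF P] using key by blast
    qed
  qed
qed

lemma frac_nonempty:
  assumes "u \<in> loc F A" obtains v s where "v \<in> A" "s \<in> monomials_in F" "scale s u = v" "(\<pi> v, s) \<in> frac F u"
proof -
  from assms obtain s where s: "s \<in> monomials_in F" "scale s u \<in> A" by (auto simp: loc_def)
  then have "(\<pi> (scale s u), s) \<in> frac F u"
    unfolding frac_def using subspace_0[OF subspace_loc[OF sB]] by force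
  with s that show ?thesis by blast
qed

lemma fracE:
  assumes "x \<in> frac F u" obtains v s where "x = (\<pi> v, s)" "v \<in> A" "s \<in> monomials_in F" "scale s u - v \<in> loc F B"
  using assms unfolding frac_def by blast

lemma presents_localization:
  assumes F: "F \<subseteq> {1..n}"
  shows "presents (frac F) (loc F A) (loc F B) (cech_loc n N F)"
proof -
  let ?L = "cech_loc n N F"
  note sL = subspace_loc[OF sB, of F] and car = monomials_carrier[OF F]
  have "carrier ?L = frac F ` loc F A"
  proof
    show "carrier ?L \<subseteq> frac F ` loc F A"
    proof
      fix x assume "x \<in> carrier ?L"
      then obtain v s where x: "x = mfrac N (monomials_in F) (\<pi> v) s" "v \<in> A" "s \<in> monomials_in F"
        unfolding cech_loc_def localization_def by (auto simp: presents_carrier[OF P])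
      \<comment> \<open>Bijectivity of \<open>s\<close> turns the fraction v / s into an element of
        the ambient space.\<close>
      obtain u where u: "v = scale s u" using monomial_bij'[OF x(3) F] by (metis bij_pointE)
      have "x = frac F u"
        unfolding x(1) by (rule mfrac_eq[OF F x(3,2)]) (simp add: u subspace_0[OF sL])
      then show "x \<in> frac F ` loc F A" using x u locI by blast
    qed
    show "frac F ` loc F A \<subseteq> carrier ?L"
    proof
      fix x assume "x \<in> frac F ` loc F A"
      then obtain u where u: "x = frac F u" "u \<in> loc F A" by blast
      from frac_nonempty[OF u(2)] obtain v s where v: "v \<in> A" "s \<in> monomials_in F" "scale s u = v" by blast
      then have "mfrac N (monomials_in F) (\<pi> v) s = x"
        unfolding u(1) by (intro mfrac_eq[OF F]) (simp_all add: subspace_0[OF sL])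
      then show "x \<in> carrier ?L"
        unfolding cech_loc_def localization_def using v by (auto simp: presents_carrier[OF P])
    qed
  qed
  moreover have "\<zero>\<^bsub>?L\<^esub> = frac F 0"
    using mfrac_eq[OF F monomials_in_1 subspace_0[OF sA], of 0] subspace_0[OF sL]
    by (simp add: cech_loc_def localization_def presents_zero[OF P])
  moreover have "frac F x \<oplus>\<^bsub>?L\<^esub> frac F y = frac F (x + y)" if xy: "x \<in> loc F A" "y \<in> loc F A" for x y
  proof -
    have one: "mfrac N (monomials_in F) ((s' \<odot>\<^bsub>N\<^esub> m) \<oplus>\<^bsub>N\<^esub> (s \<odot>\<^bsub>N\<^esub> m')) (s * s') = frac F (x + y)"
      if ms: "(m, s) \<in> frac F x" "(m', s') \<in> frac F y" for m s m' s'
    proof -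
      obtain v where v: "m = \<pi> v" "v \<in> A" "s \<in> monomials_in F" "scale s x - v \<in> loc F B"
        using ms(1) unfolding frac_def by blast
      obtain w where w: "m' = \<pi> w" "w \<in> A" "s' \<in> monomials_in F" "scale s' y - w \<in> loc F B"
        using ms(2) unfolding frac_def by blast
      have "(s' \<odot>\<^bsub>N\<^esub> m) \<oplus>\<^bsub>N\<^esub> (s \<odot>\<^bsub>N\<^esub> m') = \<pi> (scale s' v + scale s w)"
        using presents_smult[OF P car[OF v(3)] w(2)] presents_smult[OF P car[OF w(3)] v(2)]
          presents_add[OF P subspace_scale[OF sA v(2)] subspace_scale[OF sA w(2)]] v(1) w(1) by simp
      moreover have "mfrac N (monomials_in F) (\<pi> (scale s' v + scale s w)) (s * s') = frac F (x + y)"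
      proof (rule mfrac_eq[OF F monomials_in_mult[OF v(3) w(3)]])
        show "scale s' v + scale s w \<in> A" by (intro subspace_add[OF sA] subspace_scale[OF sA] v w)
        have "scale (s * s') (x + y) - (scale s' v + scale s w)
            = scale s' (scale s x - v) + scale s (scale s' y - w)"
          by (simp add: scale_right_distrib scale_right_diff_distrib mult.commute)
        also have "\<dots> \<in> loc F B" by (intro subspace_add[OF sL] subspace_scale[OF sL] v w)
        finally show "scale (s * s') (x + y) - (scale s' v + scale s w) \<in> loc F B" .
      qed
      ultimately show ?thesis by simp
    qed
    obtain a where "a \<in> frac F x" using frac_nonempty[OF xy(1)] by blast
    moreover obtain b where "b \<in> frac F y" using frac_nonempty[OF xy(2)] by blast
    ultimately have "(\<Union>(m, s)\<in>frac F x. \<Union>(m', s')\<in>frac F y.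
        mfrac N (monomials_in F) ((s' \<odot>\<^bsub>N\<^esub> m) \<oplus>\<^bsub>N\<^esub> (s \<odot>\<^bsub>N\<^esub> m')) (s * s')) = frac F (x + y)"
      by (intro UN_pair_const one)
    then show ?thesis by (simp add: cech_loc_def localization_def)
  qed
  moreover have "p \<odot>\<^bsub>?L\<^esub> frac F x = frac F (scale p x)" if p: "p \<in> carrier (mpoly_ring n)" and x: "x \<in> loc F A" for p x
  proof -
    have one: "mfrac N (monomials_in F) (p \<odot>\<^bsub>N\<^esub> m) s = frac F (scale p x)" if ms: "(m, s) \<in> frac F x" for m s
    proof -
      obtain v where v: "m = \<pi> v" "v \<in> A" "s \<in> monomials_in F" "scale s x - v \<in> loc F B"
        using ms unfolding frac_def by blast
      have "scale s (scale p x) - scale p v = scale p (scale s x - v)"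
        by (simp add: scale_right_diff_distrib mult.commute)
      then show ?thesis
        unfolding v(1) presents_smult[OF P p v(2)]
        using subspace_scale[OF sL v(4), of p] by (intro mfrac_eq[OF F v(3) subspace_scale[OF sA v(2)]]) (simp only:)
    qed
    obtain a where "a \<in> frac F x" using frac_nonempty[OF x] by blast
    from UN_pair_const[OF this one] show ?thesis by (simp add: cech_loc_def localization_def)
  qed
  moreover have "frac F x = frac F y \<longleftrightarrow> x - y \<in> loc F B" if xy: "x \<in> loc F A" "y \<in> loc F A" for x y
  proof
    assume eq: "frac F x = frac F y"
    from frac_nonempty[OF xy(1)] obtain v s where v: "v \<in> A" "s \<in> monomials_in F" "scale s x = v" "(\<pi> v, s) \<in> frac F x"
      by blast
    with eq obtain v' where v': "\<pi> v = \<pi> v'" "v' \<in> A" "scale s y - v' \<in> loc F B" by (auto elim: fracE)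
    have "v - v' \<in> loc F B" using presents_eq[OF P v(1) v'(2)] v'(1) loc_base by blast
    then have "(v - v') - (scale s y - v') \<in> loc F B" using v'(3) by (rule subspace_diff[OF sL])
    then have "scale s (x - y) \<in> loc F B" by (simp add: v(3)[symmetric] scale_right_diff_distrib)
    then show "x - y \<in> loc F B" by (rule loc_cancel[OF v(2)])
  next
    assume d: "x - y \<in> loc F B"
    from frac_nonempty[OF xy(1)] obtain v s where v: "v \<in> A" "s \<in> monomials_in F" "scale s x = v" by blast
    have "mfrac N (monomials_in F) (\<pi> v) s = frac F x"
      by (rule mfrac_eq[OF F v(2,1)]) (simp add: v(3) subspace_0[OF sL])
    moreover have "mfrac N (monomials_in F) (\<pi> v) s = frac F y"
    proof (rule mfrac_eq[OF F v(2,1)])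
      have "- scale s (x - y) \<in> loc F B" by (rule subspace_neg[OF sL subspace_scale[OF sL d]])
      then show "scale s y - v \<in> loc F B" by (simp add: v(3)[symmetric] scale_right_diff_distrib)
    qed
    ultimately show "frac F x = frac F y" by simp
  qed
  moreover have "grade ?L j = frac F ` {x \<in> loc F A. hc j x = x}" for j
  proof
    show "grade ?L j \<subseteq> frac F ` {x \<in> loc F A. hc j x = x}"
    proof
      fix x assume "x \<in> grade ?L j"
      then obtain v s i k where x: "x = mfrac N (monomials_in F) (\<pi> v) s" "v \<in> A" "hc i v = v"
        "s \<in> monomials_in F" "s \<in> mpoly_grade n k" "j = i - k"
        unfolding cech_loc_def localization_def by (auto simp: presents_grade[OF P])
      obtain u where u: "v = scale s u" using monomial_bij'[OF x(4) F] by (metis bij_pointE)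
      have "scale s (hc j u) = hc (k + j) (scale s u)" by (rule hc_scale[OF x(5), symmetric])
      also have "\<dots> = scale s u" using x(3,6) u by simp
      finally have "hc j u = u" using monomial_bij'[OF x(4) F] bij_is_inj injD by metis
      moreover have "x = frac F u"
        unfolding x(1) by (rule mfrac_eq[OF F x(4,2)]) (simp add: u subspace_0[OF sL])
      ultimately show "x \<in> frac F ` {x \<in> loc F A. hc j x = x}" using x u locI by blast
    qed
    show "frac F ` {x \<in> loc F A. hc j x = x} \<subseteq> grade ?L j"
    proof
      fix x assume "x \<in> frac F ` {x \<in> loc F A. hc j x = x}"
      then obtain u where u: "x = frac F u" "u \<in> loc F A" "hc j u = u" by blast
      from frac_nonempty[OF u(2)] obtain v s where v: "v \<in> A" "s \<in> monomials_in F" "scale s u = v" by blast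
      obtain k where k: "s \<in> mpoly_grade n k" using monomials_in_grade[OF v(2) F] by blast
      have "mfrac N (monomials_in F) (\<pi> v) s = x"
        unfolding u(1) by (rule mfrac_eq[OF F v(2,1)]) (simp add: v(3) subspace_0[OF sL])
      moreover have "hc (k + j) v = v" using hc_scale[OF k, of j u] u(3) v(3) by simp
      then have "\<pi> v \<in> grade N (k + j)" using v(1) by (auto simp: presents_grade[OF P])
      moreover have "j = (k + j) - k" by simp
      ultimately show "x \<in> grade ?L j"
        unfolding cech_loc_def localization_def using v(2) k by fastforce
    qed
  qed
  ultimately show ?thesis by (rule presentsI)
qed

lemma cech_restrict_frac:
  assumes "F \<subseteq> {1..n}" "G \<subseteq> F" "u \<in> loc G A"
  shows "cech_restrict N F (frac G u) = frac F u"
proof -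
  have one: "mfrac N (monomials_in F) m s = frac F u" if ms: "(m, s) \<in> frac G u" for m s
  proof -
    obtain v where v: "m = \<pi> v" "v \<in> A" "s \<in> monomials_in G" "scale s u - v \<in> loc G B"
      using ms unfolding frac_def by blast
    show ?thesis unfolding v(1)
      by (rule mfrac_eq[OF assms(1) _ v(2)])
        (use v monomials_in_mono[OF assms(2)] loc_mono[OF order.refl assms(2)] in blast)+
  qed
  obtain a where "a \<in> frac G u" using frac_nonempty[OF assms(3)] by blast
  from UN_pair_const[OF this one] show ?thesis unfolding cech_restrict_def by simp
qed

definition chain_map :: "nat \<Rightarrow> (nat set \<Rightarrow> 'u) \<Rightarrow> nat set \<Rightarrow> ('b \<times> 'k mpoly) set" where
  "chain_map i c = (\<lambda>F\<in>{F. F \<subseteq> {1..n} \<and> card F = i}. frac F (c F))"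

lemma presents_cech_module: "W.presents (chain_map i) (chain i A) (chain i B) (cech_module n N i)"
proof -
  let ?I = "{F. F \<subseteq> {1..n} \<and> card F = i}" and ?M = "cech_module n N i"
  note PL = presents_localization
  have app: "chain_map i c F = frac F (c F)" if "F \<in> ?I" for c F
    unfolding chain_map_def by (rule restrict_apply'[OF that])
  have PiE: "chain_map i c \<in> (\<Pi>\<^sub>E F\<in>?I. X F)" if "\<And>F. F \<in> ?I \<Longrightarrow> frac F (c F) \<in> X F" for c X
    unfolding chain_map_def by (rule PiE_I) (simp_all only: restrict_apply if_True if_False that)
  have Mc: "carrier ?M = (\<Pi>\<^sub>E F\<in>?I. carrier (cech_loc n N F))"
    and Mg: "grade ?M j = (\<Pi>\<^sub>E F\<in>?I. grade (cech_loc n N F) j)" for j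
    by (auto simp: cech_module_def dsum_gmodule_def)
  have ext: "f = chain_map i c" if "f \<in> extensional ?I" "\<And>F. F \<in> ?I \<Longrightarrow> f F = frac F (c F)" for f c
    by (rule extensionalityI[OF that(1)]) (auto simp: chain_map_def that(2))
  \<comment> \<open>The parameter \<open>X\<close> lets one choice argument serve both the carrier
    and the graded pieces.\<close>
  have car: "\<exists>c\<in>chain i A. f = chain_map i c \<and> (\<forall>F\<in>?I. c F \<in> X F)"
    if h: "f \<in> extensional ?I" "\<And>F. F \<in> ?I \<Longrightarrow> f F \<in> frac F ` (loc F A \<inter> X F)" for f X
  proof -
    have "\<forall>F\<in>?I. \<exists>u. f F = frac F u \<and> u \<in> loc F A \<and> u \<in> X F" using h(2) by blast
    from bchoice[OF this] obtain c where "\<forall>F\<in>?I. f F = frac F (c F) \<and> c F \<in> loc F A \<and> c F \<in> X F" ..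
    then have c: "f F = frac F (c F)" "c F \<in> loc F A" "c F \<in> X F" if "F \<in> ?I" for F
      using that by blast+
    let ?c = "\<lambda>F. if F \<in> ?I then c F else 0"
    have "?c \<in> chain i A" using c(2) by (simp add: chain_def)
    moreover have "f = chain_map i ?c" by (rule ext[OF h(1)]) (simp only: c(1) if_True)
    moreover have "\<forall>F\<in>?I. ?c F \<in> X F" using c(3) by simp
    ultimately show ?thesis by blast
  qed
  have "carrier ?M = chain_map i ` chain i A"
  proof
    show "carrier ?M \<subseteq> chain_map i ` chain i A"
    proof
      fix f assume "f \<in> carrier ?M"
      then have "f \<in> (\<Pi>\<^sub>E F\<in>?I. carrier (cech_loc n N F))" by (simp add: cech_module_def dsum_gmodule_def)
      then have "f \<in> extensional ?I" "\<And>F. F \<in> ?I \<Longrightarrow> f F \<in> frac F ` (loc F A \<inter> UNIV)"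
        using presents_carrier[OF PL] by (auto simp: PiE_iff)
      from car[OF this] show "f \<in> chain_map i ` chain i A" by blast
    qed
    show "chain_map i ` chain i A \<subseteq> carrier ?M"
    proof
      fix f assume "f \<in> chain_map i ` chain i A"
      then obtain c where c: "f = chain_map i c" "c \<in> chain i A" by blast
      show "f \<in> carrier ?M"
        unfolding c(1) Mc
      proof (rule PiE)
        fix F assume F: "F \<in> ?I"
        then show "frac F (c F) \<in> carrier (cech_loc n N F)"
          using chain_mem[OF c(2)] presents_carrier[OF PL] by auto
      qed
    qed
  qed
  moreover have "\<zero>\<^bsub>?M\<^esub> = chain_map i 0"
  proof -
    have "\<zero>\<^bsub>?M\<^esub> = (\<lambda>F\<in>?I. \<zero>\<^bsub>cech_loc n N F\<^esub>)" by (simp add: cech_module_def dsum_gmodule_def)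
    also have "\<dots> = chain_map i 0"
      unfolding chain_map_def by (rule restrict_ext) (simp add: presents_zero[OF PL])
    finally show ?thesis .
  qed
  moreover have "chain_map i x \<oplus>\<^bsub>?M\<^esub> chain_map i y = chain_map i (x + y)" if xy: "x \<in> chain i A" "y \<in> chain i A" for x y
  proof -
    have "chain_map i x \<oplus>\<^bsub>?M\<^esub> chain_map i y = (\<lambda>F\<in>?I. chain_map i x F \<oplus>\<^bsub>cech_loc n N F\<^esub> chain_map i y F)"
      by (simp add: cech_module_def dsum_gmodule_def)
    also have "\<dots> = chain_map i (x + y)"
      unfolding chain_map_def[of i "x + y"]
    proof (rule restrict_ext)
      fix F assume F: "F \<in> ?I"
      then show "chain_map i x F \<oplus>\<^bsub>cech_loc n N F\<^esub> chain_map i y F = frac F ((x + y) F)"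
        unfolding app[OF F] using presents_add[OF PL] chain_mem[OF xy(1)] chain_mem[OF xy(2)] by simp
    qed
    finally show ?thesis .
  qed
  moreover have "p \<odot>\<^bsub>?M\<^esub> chain_map i x = chain_map i (cscale p x)" if px: "p \<in> carrier (mpoly_ring n)" "x \<in> chain i A" for p x
  proof -
    have "p \<odot>\<^bsub>?M\<^esub> chain_map i x = (\<lambda>F\<in>?I. p \<odot>\<^bsub>cech_loc n N F\<^esub> chain_map i x F)"
      by (simp add: cech_module_def dsum_gmodule_def)
    also have "\<dots> = chain_map i (cscale p x)"
      unfolding chain_map_def[of i "cscale p x"]
    proof (rule restrict_ext)
      fix F assume F: "F \<in> ?I"
      then show "p \<odot>\<^bsub>cech_loc n N F\<^esub> chain_map i x F = frac F (cscale p x F)"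
        unfolding app[OF F] cscale_def using presents_smult[OF PL px(1)] chain_mem[OF px(2)] by simp
    qed
    finally show ?thesis .
  qed
  moreover have "chain_map i x = chain_map i y \<longleftrightarrow> x - y \<in> chain i B" if xy: "x \<in> chain i A" "y \<in> chain i A" for x y
  proof -
    have "chain_map i x = chain_map i y \<longleftrightarrow> (\<forall>F\<in>?I. frac F (x F) = frac F (y F))"
    proof
      assume eq: "chain_map i x = chain_map i y"
      show "\<forall>F\<in>?I. frac F (x F) = frac F (y F)"
        using app eq by metis
    next
      assume "\<forall>F\<in>?I. frac F (x F) = frac F (y F)"
      then show "chain_map i x = chain_map i y"
        unfolding chain_map_def by (intro restrict_ext) blast
    qed
    also have "\<dots> \<longleftrightarrow> (\<forall>F\<in>?I. (x - y) F \<in> loc F B)"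
    proof (rule ball_cong[OF refl])
      fix F assume "F \<in> ?I"
      then show "frac F (x F) = frac F (y F) \<longleftrightarrow> (x - y) F \<in> loc F B"
        using presents_eq[OF PL] chain_mem[OF xy(1)] chain_mem[OF xy(2)] by simp
    qed
    also have "\<dots> \<longleftrightarrow> x - y \<in> chain i B"
    proof
      assume "\<forall>F\<in>?I. (x - y) F \<in> loc F B"
      then show "x - y \<in> chain i B"
        by (intro chainI) (simp_all add: chain_0[OF xy(1)] chain_0[OF xy(2)])
    next
      assume "x - y \<in> chain i B"
      from chain_mem[OF this] show "\<forall>F\<in>?I. (x - y) F \<in> loc F B" by blast
    qed
    finally show ?thesis .
  qed
  moreover have "grade ?M j = chain_map i ` {x \<in> chain i A. chc j x = x}" for j
  proof
    show "grade ?M j \<subseteq> chain_map i ` {x \<in> chain i A. chc j x = x}"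
    proof
      fix f assume "f \<in> grade ?M j"
      then have "f \<in> (\<Pi>\<^sub>E F\<in>?I. grade (cech_loc n N F) j)" by (simp add: cech_module_def dsum_gmodule_def)
      then have "f \<in> extensional ?I" "\<And>F. F \<in> ?I \<Longrightarrow> f F \<in> frac F ` (loc F A \<inter> {x. hc j x = x})"
        using presents_grade[OF PL] by (auto simp: PiE_iff Int_def)
      from car[OF this] obtain c where c: "c \<in> chain i A" "f = chain_map i c" "\<forall>F\<in>?I. hc j (c F) = c F" by auto
      have "chc j c = c"
      proof
        fix F show "chc j c F = c F"
          using c(3) chain_0[OF c(1), of F] by (cases "F \<in> ?I") (auto simp: chc_def)
      qed
      then show "f \<in> chain_map i ` {x \<in> chain i A. chc j x = x}" using c by blast
    qed
    show "chain_map i ` {x \<in> chain i A. chc j x = x} \<subseteq> grade ?M j"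
    proof
      fix f assume "f \<in> chain_map i ` {x \<in> chain i A. chc j x = x}"
      then obtain c where c: "f = chain_map i c" "c \<in> chain i A" "chc j c = c" by blast
      have hj: "hc j (c F) = c F" for F using fun_cong[OF c(3), of F] by (simp add: chc_def)
      show "f \<in> grade ?M j"
        unfolding c(1) Mg
      proof (rule PiE)
        fix F assume F: "F \<in> ?I"
        then show "frac F (c F) \<in> grade (cech_loc n N F) j"
          using chain_mem[OF c(2)] presents_grade[OF PL] hj by auto
      qed
    qed
  qed
  ultimately show ?thesis by (rule W.presentsI)
qed

lemma cech_diff_chain_map:
  assumes c: "c \<in> chain i A" shows "cech_diff n N i (chain_map i c) = chain_map (Suc i) (cdiff c)"
  unfolding cech_diff_def chain_map_def[of "Suc i"]
proof (rule restrict_ext)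
  fix F assume "F \<in> {F. F \<subseteq> {1..n} \<and> card F = Suc i}"
  then have F: "F \<subseteq> {1..n}" "card F = Suc i" by auto
  note PF = presents_localization[OF F(1)] and sLA = subspace_loc[OF sA, of F]
  have mem: "c (F - {j}) \<in> loc (F - {j}) A" "chain_map i c (F - {j}) = frac (F - {j}) (c (F - {j}))" if "j \<in> F" for j
  proof -
    have *: "card (F - {j}) = i" "F - {j} \<subseteq> {1..n}" using F that by auto
    show "c (F - {j}) \<in> loc (F - {j}) A" by (rule chain_mem[OF c *(2,1)])
    show "chain_map i c (F - {j}) = frac (F - {j}) (c (F - {j}))" using * by (simp add: chain_map_def)
  qed
  have memF: "c (F - {j}) \<in> loc F A" if "j \<in> F" for j
    using mem(1)[OF that] loc_mono[OF order.refl, of "F - {j}" F A] by blast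
  have sgn: "(- 1) ^ card {k \<in> F. k < j} \<in> carrier (mpoly_ring n)" for j
    by (intro mpoly_ring_power mpoly_ring_minus mpoly_ring_1)
  have tm: "(- 1) ^ card {k \<in> F. k < j} \<odot>\<^bsub>cech_loc n N F\<^esub> cech_restrict N F (chain_map i c (F - {j}))
      = frac F (scale (cech_sign F j) (c (F - {j})))" if "j \<in> F" for j
    unfolding mem(2)[OF that] cech_restrict_frac[OF F(1) Diff_subset mem(1)[OF that]] cech_sign_def
    by (rule presents_smult[OF PF sgn memF[OF that]])
  interpret L: abelian_group "cech_loc n N F" by (rule presents_abelian_group[OF PF sLA])
  have "(\<Oplus>\<^bsub>cech_loc n N F\<^esub>j\<in>F. (- 1) ^ card {k \<in> F. k < j} \<odot>\<^bsub>cech_loc n N F\<^esub> cech_restrict N F (chain_map i c (F - {j})))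
    = (\<Oplus>\<^bsub>cech_loc n N F\<^esub>j\<in>F. frac F (scale (cech_sign F j) (c (F - {j}))))"
    by (rule L.finsum_cong') (use tm presents_carrier[OF PF] subspace_scale[OF sLA memF] in auto)
  also have "\<dots> = frac F (\<Sum>j\<in>F. scale (cech_sign F j) (c (F - {j})))"
    by (rule presents_finsum[OF PF sLA]) (rule subspace_scale[OF sLA memF])
  also have "\<dots> = frac F (cdiff c F)" using F by (simp add: cdiff_def)
  finally show "(\<Oplus>\<^bsub>cech_loc n N F\<^esub>j\<in>F. (- 1) ^ card {k \<in> F. k < j} \<odot>\<^bsub>cech_loc n N F\<^esub> cech_restrict N F (chain_map i c (F - {j})))
    = frac F (cdiff c F)" .
qed

text \<open>Cocycles are presented as a submodule of the cochains, and then divided by coboundaries.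
  The second set includes \<open>chain i B\<close>, whose elements represent the zero
  cochain.\<close>

lemma presents_local_cohomology:
  "\<exists>\<rho>. W.presents \<rho> {c \<in> chain i A. cdiff c \<in> chain (Suc i) B}
     {cdiff b + a | b a. b \<in> (case i of 0 \<Rightarrow> {0} | Suc k \<Rightarrow> chain k A) \<and> a \<in> chain i B}
     (local_cohomology n i N)"
proof -
  let ?Z = "{c \<in> chain i A. cdiff c \<in> chain (Suc i) B}"
  let ?B = "{cdiff b + a | b a. b \<in> (case i of 0 \<Rightarrow> {0} | Suc k \<Rightarrow> chain k A) \<and> a \<in> chain i B}"
  note Pc = presents_cech_module and sCA = subspace_chain[OF sA] and sCB = subspace_chain[OF sB]
  have cd0: "cdiff 0 = 0" using cdiff_add[of 0 0] by simp
  have BsubA: "chain i B \<subseteq> chain i A" for i by (rule chain_mono[OF BA])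
  have sZ: "W.subspace ?Z"
    by (rule W.subspaceI)
      (auto simp: cdiff_add cdiff_scale cd0 W.subspace_0[OF sCA] W.subspace_0[OF sCB] W.subspace_add[OF sCA]
        W.subspace_add[OF sCB] W.subspace_scale[OF sCA] W.subspace_scale[OF sCB])
  have sCm: "W.subspace (case i of 0 \<Rightarrow> {0} | Suc k \<Rightarrow> chain k A)" by (rule subspace_case[OF sA])
  have sBd: "W.subspace ?B"
  proof -
    have "W.subspace (cdiff ` (case i of 0 \<Rightarrow> {0} | Suc k \<Rightarrow> chain k A))" (is "W.subspace (cdiff ` ?X)")
    proof (rule W.subspaceI)
      show "0 \<in> cdiff ` ?X" using W.subspace_0[OF sCm] cd0 by (metis image_eqI)
      show "x + y \<in> cdiff ` ?X" if "x \<in> cdiff ` ?X" "y \<in> cdiff ` ?X" for x y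
      proof -
        from that obtain u v where "u \<in> ?X" "v \<in> ?X" "x = cdiff u" "y = cdiff v" by blast
        then show ?thesis using W.subspace_add[OF sCm] by (intro image_eqI[of _ _ "u + v"]) (auto simp: cdiff_add)
      qed
      show "cscale q x \<in> cdiff ` ?X" if "x \<in> cdiff ` ?X" for x q
      proof -
        from that obtain u where "u \<in> ?X" "x = cdiff u" by blast
        then show ?thesis using W.subspace_scale[OF sCm] by (intro image_eqI[of _ _ "cscale q u"]) (auto simp: cdiff_scale)
      qed
    qed
    from W.subspace_plus[OF this sCB[of i]] show ?thesis by (rule back_subst[of W.subspace]) blast
  qed
  have BZ: "chain i B \<subseteq> ?Z" using BsubA cdiff_chain[OF _ sB] by blast
  have BdZ: "?B \<subseteq> ?Z"
  proof
    fix x assume "x \<in> ?B"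
    then obtain b a where x: "x = cdiff b + a" "b \<in> (case i of 0 \<Rightarrow> {0} | Suc k \<Rightarrow> chain k A)" "a \<in> chain i B" by blast
    have "cdiff b \<in> ?Z"
    proof (cases i)
      case 0
      then show ?thesis using x(2) W.subspace_0[OF sZ] cd0 by simp
    next
      case (Suc k)
      then show ?thesis using x(2) cdiff_chain[OF _ sA] W.subspace_0[OF sCB] by (simp add: cdiff_cdiff)
    qed
    then show "x \<in> ?Z" unfolding x(1) using W.subspace_add[OF sZ] BZ x(3) by blast
  qed
  have BBd: "chain i B \<subseteq> ?B"
  proof
    fix a assume "a \<in> chain i B"
    then have "cdiff 0 + a \<in> ?B" using W.subspace_0[OF sCm] by blast
    then show "a \<in> ?B" by (simp add: cd0)
  qed
  have cc: "cech_cocycles n N i = chain_map i ` ?Z"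
  proof -
    have "cech_diff n N i (chain_map i c) = \<zero>\<^bsub>cech_module n N (Suc i)\<^esub> \<longleftrightarrow> cdiff c \<in> chain (Suc i) B" if "c \<in> chain i A" for c
      unfolding cech_diff_chain_map[OF that]
      by (rule W.presents_eq_0[OF Pc sCA cdiff_chain[OF that sA]])
    then show ?thesis unfolding cech_cocycles_def W.presents_carrier[OF Pc] by blast
  qed
  have cb: "cech_coboundaries n N i = chain_map i ` ?B"
  proof (cases i)
    case 0
    \<comment> \<open>In degree 0 the only coboundary is zero; the set that should present it is
      \<open>chain 0 B\<close>, which \<open>chain_map\<close> collapses to one point.\<close>
    have const: "chain_map 0 x = chain_map 0 0" if x: "x \<in> chain 0 B" for x
    proof -
      have "x \<in> chain 0 A" using x BsubA by blast
      from W.presents_eq[OF Pc this W.subspace_0[OF sCA]] x show ?thesis by simp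
    qed
    have "chain_map 0 ` chain 0 B = {chain_map 0 0}"
    proof
      show "chain_map 0 ` chain 0 B \<subseteq> {chain_map 0 0}" by (rule image_subsetI) (simp add: const)
      show "{chain_map 0 0} \<subseteq> chain_map 0 ` chain 0 B"
        using imageI[OF W.subspace_0[OF sCB], of "chain_map 0"] by simp
    qed
    moreover have "?B = chain i B" by (simp add: 0 cd0)
    moreover have "cech_coboundaries n N i = {chain_map 0 0}"
      using 0 by (simp add: cech_coboundaries_def W.presents_zero[OF Pc])
    ultimately show ?thesis using 0 by simp
  next
    case (Suc k)
    have eq: "chain_map (Suc k) (cdiff b + a) = chain_map (Suc k) (cdiff b)" if "b \<in> chain k A" "a \<in> chain (Suc k) B" for a b
      using W.presents_eq[OF Pc W.subspace_add[OF sCA cdiff_chain[OF that(1) sA], of a] cdiff_chain[OF that(1) sA]]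
        that(2) BsubA by auto
    have "cech_coboundaries n N i = (\<lambda>b. chain_map (Suc k) (cdiff b)) ` chain k A"
      unfolding Suc by (simp add: cech_coboundaries_def W.presents_carrier[OF Pc] image_image cech_diff_chain_map)
    also have "\<dots> = chain_map i ` ?B"
    proof
      show "(\<lambda>b. chain_map (Suc k) (cdiff b)) ` chain k A \<subseteq> chain_map i ` ?B"
      proof
        fix y assume "y \<in> (\<lambda>b. chain_map (Suc k) (cdiff b)) ` chain k A"
        then obtain b where b: "b \<in> chain k A" "y = chain_map i (cdiff b + 0)" using Suc by auto
        have "cdiff b + 0 \<in> ?B" unfolding Suc nat.case using b(1) W.subspace_0[OF sCB] by blast
        then show "y \<in> chain_map i ` ?B" unfolding b(2) by blast
      qed
      show "chain_map i ` ?B \<subseteq> (\<lambda>b. chain_map (Suc k) (cdiff b)) ` chain k A"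
        unfolding Suc nat.case using eq by blast
    qed
    finally show ?thesis .
  qed
  from W.presents_quotient[OF W.presents_sub[OF Pc BZ _ sZ] BBd BdZ sZ sBd]
  show ?thesis unfolding local_cohomology_def cc cb by blast
qed

end

end

section \<open>Presentation by a free Laurent module\<close>

lemma pm_sum_single: "(\<Sum>x\<in>Poly_Mapping.keys u. Poly_Mapping.single x (Poly_Mapping.lookup u x)) = (u :: 'i \<Rightarrow>\<^sub>0 'k::comm_monoid_add)"
proof (rule poly_mapping_eqI)
  fix y
  have "Poly_Mapping.lookup (\<Sum>x\<in>Poly_Mapping.keys u. Poly_Mapping.single x (Poly_Mapping.lookup u x)) y
    = (\<Sum>x\<in>Poly_Mapping.keys u. if x = y then Poly_Mapping.lookup u x else 0)"
    by (simp add: lookup_sum lookup_single when_def)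
  also have "\<dots> = Poly_Mapping.lookup u y"
    by (simp add: in_keys_iff)
  finally show "Poly_Mapping.lookup (\<Sum>x\<in>Poly_Mapping.keys u. Poly_Mapping.single x (Poly_Mapping.lookup u x)) y
    = Poly_Mapping.lookup u y" .
qed

lemma pm_induct [consumes 1, case_names zero single add]:
  fixes u :: "'i \<Rightarrow>\<^sub>0 'k::comm_monoid_add"
  assumes u: "Poly_Mapping.keys u \<subseteq> K" and 0: "P 0" and s: "\<And>x k. x \<in> K \<Longrightarrow> P (Poly_Mapping.single x k)"
    and a: "\<And>u v. Poly_Mapping.keys u \<subseteq> K \<Longrightarrow> Poly_Mapping.keys v \<subseteq> K \<Longrightarrow> P u \<Longrightarrow> P v \<Longrightarrow> P (u + v)"
  shows "P u"
proof -
  have "Poly_Mapping.keys (\<Sum>x\<in>S. Poly_Mapping.single x (f x)) \<subseteq> K \<and> P (\<Sum>x\<in>S. Poly_Mapping.single x (f x))"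
    if "finite S" "S \<subseteq> K" for S and f :: "'i \<Rightarrow> 'k"
    using that
  proof (induction S)
    case (insert x S)
    have k: "Poly_Mapping.keys (Poly_Mapping.single x (f x)) \<subseteq> K" using insert.prems by simp
    have xK: "x \<in> K" and IH: "Poly_Mapping.keys (\<Sum>x\<in>S. Poly_Mapping.single x (f x)) \<subseteq> K"
      "P (\<Sum>x\<in>S. Poly_Mapping.single x (f x))" using insert by auto
    show ?case
      unfolding sum.insert[OF insert.hyps]
      using a[OF k IH(1) s[OF xK] IH(2)] Poly_Mapping.keys_add[of "Poly_Mapping.single x (f x)" "\<Sum>x\<in>S. Poly_Mapping.single x (f x)"] k IH(1)
      by blast
  qed (use 0 in simp)
  from this[OF finite_keys u, of "Poly_Mapping.lookup u"] show ?thesis by (simp add: pm_sum_single)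
qed

definition int_exp :: "(nat \<Rightarrow>\<^sub>0 nat) \<Rightarrow> nat \<Rightarrow>\<^sub>0 int" where
  "int_exp a = Poly_Mapping.map int a"

text \<open>Negative exponents are truncated to 0; on nonnegative ones this inverts
  \<open>int_exp\<close>.\<close>

definition nat_exp :: "(nat \<Rightarrow>\<^sub>0 int) \<Rightarrow> nat \<Rightarrow>\<^sub>0 nat" where
  "nat_exp e = Poly_Mapping.map nat e"

lemma lookup_int_exp: "Poly_Mapping.lookup (int_exp a) i = int (Poly_Mapping.lookup a i)"
  by (simp add: int_exp_def Poly_Mapping.map.rep_eq when_def)

lemma lookup_nat_exp: "Poly_Mapping.lookup (nat_exp e) i = nat (Poly_Mapping.lookup e i)"
  by (simp add: nat_exp_def Poly_Mapping.map.rep_eq when_def)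

lemma int_exp_add: "int_exp (a + b) = int_exp a + int_exp b"
  by (rule poly_mapping_eqI) (simp add: lookup_int_exp lookup_add)

lemma int_exp_0: "int_exp 0 = 0"
  by (rule poly_mapping_eqI) (simp add: lookup_int_exp)

lemma keys_int_exp: "Poly_Mapping.keys (int_exp a) = Poly_Mapping.keys a"
  by (auto simp: in_keys_iff lookup_int_exp)

lemma keys_nat_exp: "Poly_Mapping.keys (nat_exp e) \<subseteq> Poly_Mapping.keys e"
  by (auto simp: in_keys_iff lookup_nat_exp)

definition int_deg :: "(nat \<Rightarrow>\<^sub>0 int) \<Rightarrow> int" where
  "int_deg e = (\<Sum>i\<in>Poly_Mapping.keys e. Poly_Mapping.lookup e i)"

lemma int_deg_superset:
  "finite S \<Longrightarrow> Poly_Mapping.keys e \<subseteq> S \<Longrightarrow> int_deg e = (\<Sum>i\<in>S. Poly_Mapping.lookup e i)"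
  unfolding int_deg_def by (rule sum.mono_neutral_left) (auto simp: in_keys_iff)

lemma int_deg_add: "int_deg (a + b) = int_deg a + int_deg b"
  using int_deg_superset[of "Poly_Mapping.keys a \<union> Poly_Mapping.keys b" "a + b"]
    int_deg_superset[of "Poly_Mapping.keys a \<union> Poly_Mapping.keys b" a]
    int_deg_superset[of "Poly_Mapping.keys a \<union> Poly_Mapping.keys b" b]
    Poly_Mapping.keys_add[of a b]
  by (simp add: lookup_add sum.distrib)

lemma int_deg_0 [simp]: "int_deg 0 = 0" by (simp add: int_deg_def)

lemma int_deg_int_exp: "int_deg (int_exp a) = int (exp_deg a)"
  by (simp add: int_deg_def exp_deg_def keys_int_exp lookup_int_exp)

lemma int_deg_nonneg: "(\<And>i. 0 \<le> Poly_Mapping.lookup e i) \<Longrightarrow> int (exp_deg (nat_exp e)) = int_deg e"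
proof -
  assume h: "\<And>i. 0 \<le> Poly_Mapping.lookup e i"
  have "int_exp (nat_exp e) = e" by (rule poly_mapping_eqI) (simp add: lookup_int_exp lookup_nat_exp h)
  then show ?thesis using int_deg_int_exp[of "nat_exp e"] by simp
qed

text \<open>The free module with basis \<open>'m\<close> over the Laurent polynomials: the key
  \<open>(m, e)\<close> stands for x^e times the basis element \<open>m\<close>.\<close>

type_synonym ('m, 'k) laurent = "('m \<times> (nat \<Rightarrow>\<^sub>0 int)) \<Rightarrow>\<^sub>0 'k"

definition exp_shift :: "(nat \<Rightarrow>\<^sub>0 int) \<Rightarrow> ('m, 'k::zero) laurent \<Rightarrow> ('m, 'k) laurent" where
  "exp_shift a u = Poly_Mapping.map_key (\<lambda>(m, e). (m, e - a)) u"

lemma lookup_exp_shift: "Poly_Mapping.lookup (exp_shift a u) (m, e) = Poly_Mapping.lookup u (m, e - a)"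
  for u :: "('m, 'k::zero) laurent"
proof -
  have "inj (\<lambda>(m :: 'm, e :: nat \<Rightarrow>\<^sub>0 int). (m, e - a))" by (auto intro!: injI)
  from Poly_Mapping.map_key.rep_eq[OF this, of u] show ?thesis unfolding exp_shift_def by simp
qed

text \<open>The variables \<open>x\<^sub>i\<close> with \<open>i > n\<close> act as zero.\<close>

definition laurent_scale :: "nat \<Rightarrow> ('k::field) mpoly \<Rightarrow> ('m, 'k) laurent \<Rightarrow> ('m, 'k) laurent" where
  "laurent_scale n p u = (\<Sum>a\<in>Poly_Mapping.keys p. if Poly_Mapping.keys a \<subseteq> {1..n}
     then Poly_Mapping.map ((*) (Poly_Mapping.lookup p a)) (exp_shift (int_exp a) u) else 0)"

lemma lookup_map_times: "Poly_Mapping.lookup (Poly_Mapping.map ((*) k) u) x = (k :: 'k::field) * Poly_Mapping.lookup u x"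
  by (simp add: Poly_Mapping.map.rep_eq when_def)

lemma lookup_laurent_scale:
  assumes "finite S" "Poly_Mapping.keys p \<subseteq> S"
  shows "Poly_Mapping.lookup (laurent_scale n p u) (m, e) = (\<Sum>a\<in>S. if Poly_Mapping.keys a \<subseteq> {1..n}
     then Poly_Mapping.lookup p a * Poly_Mapping.lookup u (m, e - int_exp a) else 0)"
proof -
  have "Poly_Mapping.lookup (laurent_scale n p u) (m, e) = (\<Sum>a\<in>Poly_Mapping.keys p. if Poly_Mapping.keys a \<subseteq> {1..n}
     then Poly_Mapping.lookup p a * Poly_Mapping.lookup u (m, e - int_exp a) else 0)"
    unfolding laurent_scale_def lookup_sum
    by (rule sum.cong[OF refl]) (simp add: lookup_map_times lookup_exp_shift)
  also have "\<dots> = (\<Sum>a\<in>S. if Poly_Mapping.keys a \<subseteq> {1..n}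
     then Poly_Mapping.lookup p a * Poly_Mapping.lookup u (m, e - int_exp a) else 0)"
    by (rule sum.mono_neutral_left) (use assms in \<open>simp_all add: in_keys_iff\<close>)
  finally show ?thesis .
qed

lemma laurent_scale_add_right: "laurent_scale n p (u + v) = laurent_scale n p u + laurent_scale n p v"
proof (rule poly_mapping_eqI)
  fix x :: "'a \<times> (nat \<Rightarrow>\<^sub>0 int)"
  obtain m e where x: "x = (m, e)" by (cases x)
  show "Poly_Mapping.lookup (laurent_scale n p (u + v)) x = Poly_Mapping.lookup (laurent_scale n p u + laurent_scale n p v) x"
    unfolding x lookup_add lookup_laurent_scale[OF finite_keys order.refl] sum.distrib[symmetric]
    by (rule sum.cong[OF refl]) (simp add: lookup_add distrib_left)
qed

lemma laurent_scale_add_left: "laurent_scale n (p + q) u = laurent_scale n p u + laurent_scale n q u"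
proof (rule poly_mapping_eqI)
  fix x :: "'a \<times> (nat \<Rightarrow>\<^sub>0 int)"
  obtain m e where x: "x = (m, e)" by (cases x)
  let ?S = "Poly_Mapping.keys p \<union> Poly_Mapping.keys q"
  have "finite ?S" "Poly_Mapping.keys (p + q) \<subseteq> ?S" "Poly_Mapping.keys p \<subseteq> ?S" "Poly_Mapping.keys q \<subseteq> ?S"
    using Poly_Mapping.keys_add[of p q] by auto
  then show "Poly_Mapping.lookup (laurent_scale n (p + q) u) x = Poly_Mapping.lookup (laurent_scale n p u + laurent_scale n q u) x"
    unfolding x lookup_add[of "laurent_scale n p u"]
    by (simp only: lookup_laurent_scale[of ?S] sum.distrib[symmetric]) (rule sum.cong[OF refl], simp add: lookup_add distrib_right)
qed

lemma laurent_scale_0_right: "laurent_scale n p 0 = 0"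
  using laurent_scale_add_right[of n p 0 0] by simp

lemma laurent_scale_0_left: "laurent_scale n 0 u = 0"
  by (simp add: laurent_scale_def)

lemma laurent_scale_single:
  "laurent_scale n (Poly_Mapping.single a k) (Poly_Mapping.single (m, e) k')
    = (if Poly_Mapping.keys a \<subseteq> {1..n} then Poly_Mapping.single (m, e + int_exp a) (k * k') else 0)"
proof (rule poly_mapping_eqI)
  fix x :: "'a \<times> (nat \<Rightarrow>\<^sub>0 int)"
  obtain m' e' where x: "x = (m', e')" by (cases x)
  have "(e = e' - int_exp a) = (e + int_exp a = e')" by (auto simp: algebra_simps)
  moreover have "Poly_Mapping.keys (Poly_Mapping.single a k) \<subseteq> {a}" by simp
  ultimately show "Poly_Mapping.lookup (laurent_scale n (Poly_Mapping.single a k) (Poly_Mapping.single (m, e) k')) x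
    = Poly_Mapping.lookup (if Poly_Mapping.keys a \<subseteq> {1..n} then Poly_Mapping.single (m, e + int_exp a) (k * k') else 0) x"
    unfolding x by (simp add: lookup_laurent_scale[of "{a}"] lookup_single when_def)
qed

text \<open>Both sides are additive in \<open>p\<close>, \<open>q\<close> and \<open>u\<close>, so
  it suffices to compare single terms.\<close>

lemma laurent_scale_scale: "laurent_scale n p (laurent_scale n q u) = laurent_scale n (p * q) u"
proof -
  have "Poly_Mapping.keys p \<subseteq> UNIV" "Poly_Mapping.keys q \<subseteq> UNIV" "Poly_Mapping.keys u \<subseteq> UNIV" by auto
  then show ?thesis
  proof (induction p rule: pm_induct)
    case (single a k)
    from single.prems(1,2) show ?case
    proof (induction q rule: pm_induct)
      case (single b l)
      from single.prems show ?case
      proof (induction u rule: pm_induct)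
        case (single x k')
        obtain m e where x: "x = (m, e)" by (cases x)
        show ?case
          by (simp add: x laurent_scale_single mult_single laurent_scale_0_right laurent_scale_0_left keys_add_exp
              int_exp_add add_ac mult_ac)
      qed (simp_all add: laurent_scale_0_right laurent_scale_add_right)
    qed (simp_all add: laurent_scale_0_right laurent_scale_0_left laurent_scale_add_right laurent_scale_add_left distrib_left)
  qed (simp_all add: laurent_scale_0_left laurent_scale_add_left distrib_right)
qed

definition laurent_hc :: "('m \<Rightarrow> int) \<Rightarrow> int \<Rightarrow> ('m, 'k::zero) laurent \<Rightarrow> ('m, 'k) laurent" where
  "laurent_hc dg j u = pmap_restrict {(m, e). dg m + int_deg e = j} u"

lemma cech_space_laurent: "cech_space (laurent_scale n :: ('k::field) mpoly \<Rightarrow> ('m, 'k) laurent \<Rightarrow> _) n (laurent_hc dg)"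
proof
  show "laurent_scale n p (x + y) = laurent_scale n p x + laurent_scale n p y" for p :: "'k mpoly" and x y :: "('m, 'k) laurent"
    by (rule laurent_scale_add_right)
  show "laurent_scale n (p + q) x = laurent_scale n p x + laurent_scale n q x" for p q :: "'k mpoly" and x :: "('m, 'k) laurent"
    by (rule laurent_scale_add_left)
  show "laurent_scale n p (laurent_scale n q x) = laurent_scale n (p * q) x" for p q :: "'k mpoly" and x :: "('m, 'k) laurent"
    by (rule laurent_scale_scale)
  show "laurent_scale n 1 x = x" for x :: "('m, 'k) laurent"
  proof (rule poly_mapping_eqI)
    fix y :: "'m \<times> (nat \<Rightarrow>\<^sub>0 int)"
    obtain m e where y: "y = (m, e)" by (cases y)
    show "Poly_Mapping.lookup (laurent_scale n 1 x) y = Poly_Mapping.lookup x y"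
      unfolding y by (simp add: lookup_laurent_scale[of "{0}"] lookup_one int_exp_0)
  qed
  show "laurent_hc dg j (x + y) = laurent_hc dg j x + laurent_hc dg j y" for j and x y :: "('m, 'k) laurent"
    by (simp add: laurent_hc_def pmap_restrict_add)
  show "laurent_hc dg i (laurent_hc dg j x) = (if i = j then laurent_hc dg j x else 0)" for i j and x :: "('m, 'k) laurent"
    by (rule poly_mapping_eqI) (auto simp: laurent_hc_def lookup_pmap_restrict)
  show "laurent_hc dg (i + j) (laurent_scale n p x) = laurent_scale n p (laurent_hc dg j x)"
    if p: "p \<in> mpoly_grade n i" for i j and p :: "'k mpoly" and x :: "('m, 'k) laurent"
  proof (rule poly_mapping_eqI)
    fix y :: "'m \<times> (nat \<Rightarrow>\<^sub>0 int)"
    obtain m e where y: "y = (m, e)" by (cases y)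
    have d: "(dg m + int_deg (e - int_exp a) = j) = (dg m + int_deg e = i + j)" if "a \<in> Poly_Mapping.keys p" for a
    proof -
      have "int_deg e = int_deg (e - int_exp a) + int_deg (int_exp a)"
        using int_deg_add[of "e - int_exp a" "int_exp a"] by simp
      moreover have "int_deg (int_exp a) = i" using p that by (simp add: int_deg_int_exp mpoly_grade_def)
      ultimately show ?thesis by auto
    qed
    show "Poly_Mapping.lookup (laurent_hc dg (i + j) (laurent_scale n p x)) y = Poly_Mapping.lookup (laurent_scale n p (laurent_hc dg j x)) y"
      unfolding y laurent_hc_def lookup_pmap_restrict lookup_laurent_scale[OF finite_keys order.refl]
      by (simp add: d cong: sum.cong if_cong)
  qed
  show "x = 0" if h: "\<And>j. laurent_hc dg j x = 0" for x :: "('m, 'k) laurent"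
  proof (rule poly_mapping_eqI)
    fix y :: "'m \<times> (nat \<Rightarrow>\<^sub>0 int)"
    obtain m e where y: "y = (m, e)" by (cases y)
    have "Poly_Mapping.lookup (laurent_hc dg (dg m + int_deg e) x) y = 0" unfolding h by simp
    then show "Poly_Mapping.lookup x y = Poly_Mapping.lookup 0 y"
      by (simp add: y laurent_hc_def lookup_pmap_restrict)
  qed
  show "bij (laurent_scale n s :: ('m, 'k) laurent \<Rightarrow> _)" if s: "s \<in> monomials_in {1..n}" for s :: "'k mpoly"
  proof -
    from s obtain a where a: "s = Poly_Mapping.single a 1" "Poly_Mapping.keys a \<subseteq> {1..n}" by (auto simp: monomials_in_def)
    \<comment> \<open>A monomial in the first \<open>n\<close> variables translates exponents, which
      is undone by the opposite translation.\<close>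
    have sh: "laurent_scale n s u = exp_shift (int_exp a) u" for u :: "('m, 'k) laurent"
    proof (rule poly_mapping_eqI)
      fix y :: "'m \<times> (nat \<Rightarrow>\<^sub>0 int)"
      obtain m e where y: "y = (m, e)" by (cases y)
      show "Poly_Mapping.lookup (laurent_scale n s u) y = Poly_Mapping.lookup (exp_shift (int_exp a) u) y"
        unfolding y a(1) using a(2) by (simp add: lookup_laurent_scale[of "{a}"] lookup_exp_shift)
    qed
    have inv: "exp_shift b (exp_shift c u) = u" if "b + c = 0" for b c and u :: "('m, 'k) laurent"
    proof (rule poly_mapping_eqI)
      fix y :: "'m \<times> (nat \<Rightarrow>\<^sub>0 int)"
      obtain m e where y: "y = (m, e)" by (cases y)
      have e: "e - b - c = e" using that by (metis diff_diff_eq diff_zero)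
      show "Poly_Mapping.lookup (exp_shift b (exp_shift c u)) y = Poly_Mapping.lookup u y"
        unfolding y lookup_exp_shift e ..
    qed
    have "laurent_scale n s = (exp_shift (int_exp a) :: ('m, 'k) laurent \<Rightarrow> _)" by (rule ext) (rule sh)
    moreover have "bij (exp_shift (int_exp a) :: ('m, 'k) laurent \<Rightarrow> _)"
      by (rule bij_betw_byWitness[where f' = "exp_shift (- int_exp a)"]) (simp_all add: inv)
    ultimately show ?thesis by simp
  qed
qed

lemma ex1_eqI: "\<exists>!x. P x \<Longrightarrow> P a \<Longrightarrow> P b \<Longrightarrow> a = b"
  by blast

section \<open>A graded module as a quotient of the polynomial part\<close>

context graded_module
begin

definition hdeg :: "'b \<Rightarrow> int" where "hdeg m = (SOME j. m \<in> grade M j)"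

text \<open>Every element of the type serves as a generator, so no generating set has to be chosen.
  A homogeneous element stands for itself and any other for zero, which is homogeneous of every
  degree; this is why \<open>hdeg\<close> may be arbitrary on the others.\<close>

definition hgen :: "'b \<Rightarrow> 'b" where "hgen m = (if \<exists>j. m \<in> grade M j then m else \<zero>\<^bsub>M\<^esub>)"

lemma grade_carrier: "y \<in> grade M j \<Longrightarrow> y \<in> carrier M"
  using subgroup.subset[OF grade_subgroup[of j]] by auto

lemma grade_zero: "\<zero>\<^bsub>M\<^esub> \<in> grade M j"
  using subgroup.one_closed[OF grade_subgroup[of j]] by simp

lemma grade_add: "x \<in> grade M j \<Longrightarrow> y \<in> grade M j \<Longrightarrow> x \<oplus>\<^bsub>M\<^esub> y \<in> grade M j"
  using subgroup.m_closed[OF grade_subgroup[of j]] by simp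

lemma hgen_grade: "hgen m \<in> grade M (hdeg m)"
  by (auto simp: hgen_def hdeg_def grade_zero intro: someI)

lemma hgen_carrier: "hgen m \<in> carrier M"
  by (rule grade_carrier[OF hgen_grade])

text \<open>A nonzero element of two different degrees would have two decompositions.\<close>

lemma hdeg_unique:
  assumes y: "y \<in> grade M j" "y \<noteq> \<zero>\<^bsub>M\<^esub>" shows "hdeg y = j"
proof -
  let ?c = "\<lambda>j l. if l = j then y else \<zero>\<^bsub>M\<^esub>"
  let ?ok = "\<lambda>c. (\<forall>j. c j \<in> grade M j) \<and> finite {j. c j \<noteq> \<zero>\<^bsub>M\<^esub>} \<and> y = (\<Oplus>\<^bsub>M\<^esub>j\<in>{j. c j \<noteq> \<zero>\<^bsub>M\<^esub>}. c j)"
  have ok: "?ok (?c j)" if "y \<in> grade M j" for j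
  proof -
    have "{l. ?c j l \<noteq> \<zero>\<^bsub>M\<^esub>} = {j}" using y by auto
    moreover have "(\<Oplus>\<^bsub>M\<^esub>l\<in>{j}. ?c j l) = y"
      using M.finsum_insert[of "{}" j "?c j"] grade_carrier[OF that] by simp
    ultimately show ?thesis using that grade_zero by simp
  qed
  have "y \<in> grade M (hdeg y)" unfolding hdeg_def using y(1) by (rule someI)
  then have "?c (hdeg y) = ?c j"
    by (intro ex1_eqI[OF grade_direct_sum[OF grade_carrier[OF y(1)]]] ok y(1))
  from fun_cong[OF this, of j] y(2) show ?thesis by (auto split: if_splits)
qed

definition pterm :: "'b \<times> (nat \<Rightarrow>\<^sub>0 int) \<Rightarrow> 'k \<Rightarrow> 'b" where
  "pterm x k = Poly_Mapping.single (nat_exp (snd x)) k \<odot>\<^bsub>M\<^esub> hgen (fst x)"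

text \<open>The keys of genuine polynomials in x_1, ..., x_n with coefficients in the free module;
  families supported here form \<open>T\<close>.\<close>

definition poly_keys :: "('b \<times> (nat \<Rightarrow>\<^sub>0 int)) set" where
  "poly_keys = {(m, e). Poly_Mapping.keys e \<subseteq> {1..n} \<and> (\<forall>i. 0 \<le> Poly_Mapping.lookup e i)}"

definition free_map :: "('b, 'k) laurent \<Rightarrow> 'b" where
  "free_map u = (\<Oplus>\<^bsub>M\<^esub>x\<in>Poly_Mapping.keys u. pterm x (Poly_Mapping.lookup u x))"

lemma single_carrier: "x \<in> poly_keys \<Longrightarrow> Poly_Mapping.single (nat_exp (snd x)) k \<in> carrier (mpoly_ring n)"
proof -
  assume "x \<in> poly_keys"
  then have "Poly_Mapping.keys (snd x) \<subseteq> {1..n}" by (auto simp: poly_keys_def)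
  then have "Poly_Mapping.keys (nat_exp (snd x)) \<subseteq> {1..n}"
    by (rule subset_trans[OF keys_nat_exp])
  then show ?thesis by (simp add: mem_mpoly_ring)
qed

lemma pterm_carrier: "x \<in> poly_keys \<Longrightarrow> pterm x k \<in> carrier M"
  unfolding pterm_def by (intro smult_closed single_carrier hgen_carrier)

lemma pterm_add: "x \<in> poly_keys \<Longrightarrow> pterm x (k + l) = pterm x k \<oplus>\<^bsub>M\<^esub> pterm x l"
  unfolding pterm_def single_add using smult_l_distr[OF single_carrier single_carrier hgen_carrier] by simp

lemma pterm_0: "pterm x 0 = \<zero>\<^bsub>M\<^esub>"
  unfolding pterm_def using smult_l_null[OF hgen_carrier] by simp

lemma free_map_superset:
  assumes "finite S" "Poly_Mapping.keys u \<subseteq> S" "S \<subseteq> poly_keys"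
  shows "free_map u = (\<Oplus>\<^bsub>M\<^esub>x\<in>S. pterm x (Poly_Mapping.lookup u x))"
  unfolding free_map_def
  by (rule M.add.finprod_mono_neutral_cong_left[OF assms(1,2)])
    (use assms(3) in \<open>auto simp: in_keys_iff pterm_0 intro: pterm_carrier\<close>)

lemma free_map_0: "free_map 0 = \<zero>\<^bsub>M\<^esub>"
  by (simp add: free_map_def)

lemma free_map_add:
  assumes "Poly_Mapping.keys u \<subseteq> poly_keys" "Poly_Mapping.keys v \<subseteq> poly_keys"
  shows "free_map (u + v) = free_map u \<oplus>\<^bsub>M\<^esub> free_map v"
proof -
  let ?S = "Poly_Mapping.keys u \<union> Poly_Mapping.keys v"
  have S: "finite ?S" "?S \<subseteq> poly_keys" using assms by auto
  have "free_map (u + v) = (\<Oplus>\<^bsub>M\<^esub>x\<in>?S. pterm x (Poly_Mapping.lookup (u + v) x))"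
    by (rule free_map_superset[OF S(1) Poly_Mapping.keys_add S(2)])
  also have "\<dots> = (\<Oplus>\<^bsub>M\<^esub>x\<in>?S. pterm x (Poly_Mapping.lookup u x) \<oplus>\<^bsub>M\<^esub> pterm x (Poly_Mapping.lookup v x))"
    by (rule M.finsum_cong') (use S in \<open>auto simp: lookup_add pterm_add subset_iff intro!: M.add.m_closed pterm_carrier\<close>)
  also have "\<dots> = (\<Oplus>\<^bsub>M\<^esub>x\<in>?S. pterm x (Poly_Mapping.lookup u x)) \<oplus>\<^bsub>M\<^esub> (\<Oplus>\<^bsub>M\<^esub>x\<in>?S. pterm x (Poly_Mapping.lookup v x))"
    by (rule M.finsum_addf) (use S in \<open>auto intro!: pterm_carrier\<close>)
  also have "(\<Oplus>\<^bsub>M\<^esub>x\<in>?S. pterm x (Poly_Mapping.lookup u x)) = free_map u"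
    by (rule free_map_superset[symmetric]) (use S in auto)
  also have "(\<Oplus>\<^bsub>M\<^esub>x\<in>?S. pterm x (Poly_Mapping.lookup v x)) = free_map v"
    by (rule free_map_superset[symmetric]) (use S in auto)
  finally show ?thesis .
qed

lemma free_map_single: "x \<in> poly_keys \<Longrightarrow> free_map (Poly_Mapping.single x k) = pterm x k"
  using free_map_superset[of "{x}" "Poly_Mapping.single x k"] M.finsum_insert[of "{}" x "\<lambda>x'. pterm x' k"] pterm_carrier[of x]
    M.finsum_cong'[of "{x}" "{x}" "\<lambda>x'. pterm x' k" "\<lambda>x'. pterm x' (Poly_Mapping.lookup (Poly_Mapping.single x k) x')"]
  by simp

lemma free_map_carrier: "Poly_Mapping.keys u \<subseteq> poly_keys \<Longrightarrow> free_map u \<in> carrier M"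
  by (induction u rule: pm_induct) (auto simp: free_map_0 free_map_add free_map_single pterm_carrier)

lemma keys_add_subset: "Poly_Mapping.keys u \<subseteq> K \<Longrightarrow> Poly_Mapping.keys v \<subseteq> K \<Longrightarrow> Poly_Mapping.keys (u + v) \<subseteq> K"
  using Poly_Mapping.keys_add[of u v] by blast

lemma free_map_scale:
  assumes "Poly_Mapping.keys u \<subseteq> poly_keys" "p \<in> carrier (mpoly_ring n)"
  shows "Poly_Mapping.keys (laurent_scale n p u) \<subseteq> poly_keys \<and> free_map (laurent_scale n p u) = p \<odot>\<^bsub>M\<^esub> free_map u"
proof -
  have "Poly_Mapping.keys p \<subseteq> {a. Poly_Mapping.keys a \<subseteq> {1..n}}" using assms(2) by (auto simp: mem_mpoly_ring)
  then show ?thesis using assms(1)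
  proof (induction p rule: pm_induct)
    case zero
    then show ?case using smult_l_null[OF free_map_carrier[OF zero]] by (simp add: laurent_scale_0_left free_map_0)
  next
    case (single a k)
    then have a: "Poly_Mapping.keys a \<subseteq> {1..n}" by simp
    have ak: "Poly_Mapping.single a k \<in> carrier (mpoly_ring n)" using a by (simp add: mem_mpoly_ring)
    from single.prems show ?case
    proof (induction u rule: pm_induct)
      case zero
      then show ?case using smult_r_null[OF ak] by (simp add: laurent_scale_0_right free_map_0)
    next
      case (single x k')
      obtain m e where x: "x = (m, e)" by (cases x)
      have e: "Poly_Mapping.keys e \<subseteq> {1..n}" "\<And>i. 0 \<le> Poly_Mapping.lookup e i" using single by (auto simp: x poly_keys_def)
      have mem: "(m, e + int_exp a) \<in> poly_keys"
        using e a Poly_Mapping.keys_add[of e "int_exp a"] by (auto simp: poly_keys_def keys_int_exp lookup_add lookup_int_exp)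
      have ne: "nat_exp (e + int_exp a) = a + nat_exp e"
        by (rule poly_mapping_eqI) (simp add: lookup_nat_exp lookup_add lookup_int_exp e(2) nat_add_distrib)
      have "free_map (laurent_scale n (Poly_Mapping.single a k) (Poly_Mapping.single x k'))
        = (Poly_Mapping.single a k * Poly_Mapping.single (nat_exp e) k') \<odot>\<^bsub>M\<^esub> hgen m"
        using a by (simp add: x laurent_scale_single free_map_single[OF mem] pterm_def ne mult_single)
      also have "\<dots> = Poly_Mapping.single a k \<odot>\<^bsub>M\<^esub> (Poly_Mapping.single (nat_exp e) k' \<odot>\<^bsub>M\<^esub> hgen m)"
        using smult_assoc1[OF ak _ hgen_carrier, of "Poly_Mapping.single (nat_exp e) k'" m] single_carrier[OF single(1), of k']
        by (simp add: x)
      also have "\<dots> = Poly_Mapping.single a k \<odot>\<^bsub>M\<^esub> free_map (Poly_Mapping.single x k')"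
        unfolding free_map_single[OF single(1)] pterm_def by (simp add: x)
      finally show ?case using a mem by (simp add: x laurent_scale_single)
    next
      case (add u v)
      then show ?case
        using smult_r_distr[OF ak free_map_carrier[OF add(1)] free_map_carrier[OF add(2)]]
        by (simp add: laurent_scale_add_right free_map_add keys_add_subset)
    qed
  next
    case (add p q)
    have pq: "p \<in> carrier (mpoly_ring n)" "q \<in> carrier (mpoly_ring n)" using add(1,2) by (auto simp: mem_mpoly_ring)
    from add.IH add.prems show ?case
      using smult_l_distr[OF pq free_map_carrier[OF add.prems]]
      by (simp add: laurent_scale_add_left free_map_add keys_add_subset)
  qed
qed

lemma free_map_grade:
  assumes "Poly_Mapping.keys u \<subseteq> poly_keys \<inter> {(m, e). hdeg m + int_deg e = j}"
  shows "free_map u \<in> grade M j"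
  using assms
proof (induction u rule: pm_induct)
  case (single x k)
  obtain m e where x: "x = (m, e)" by (cases x)
  have "Poly_Mapping.single (nat_exp e) k \<in> mpoly_grade n (int_deg e)"
    using single_carrier[of x k] single int_deg_nonneg[of e] by (auto simp: x mpoly_grade_def poly_keys_def)
  from grade_smult[OF this hgen_grade, of m] single show ?case
    by (simp add: free_map_single pterm_def x add.commute)
next
  case (add u v)
  then show ?case using grade_add by (simp add: free_map_add)
qed (simp_all add: free_map_0 grade_zero)

lemma laurent_hc_id:
  "laurent_hc dg j u = u \<longleftrightarrow> Poly_Mapping.keys u \<subseteq> {(m, e). dg m + int_deg e = j}"
proof
  assume "laurent_hc dg j u = u"
  then have "Poly_Mapping.keys u = Poly_Mapping.keys u \<inter> {(m, e). dg m + int_deg e = j}"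
    unfolding laurent_hc_def using keys_pmap_restrict by metis
  then show "Poly_Mapping.keys u \<subseteq> {(m, e). dg m + int_deg e = j}" by blast
qed (simp add: laurent_hc_def pmap_restrict_id)

lemma free_map_surj_grade: "y \<in> grade M j \<Longrightarrow> \<exists>u. Poly_Mapping.keys u \<subseteq> poly_keys \<and> laurent_hc hdeg j u = u \<and> free_map u = y"
proof (cases "y = \<zero>\<^bsub>M\<^esub>")
  case True
  then show ?thesis by (intro exI[of _ 0]) (simp add: free_map_0 laurent_hc_id)
next
  case False
  assume y: "y \<in> grade M j"
  have mem: "(y, 0) \<in> poly_keys" by (simp add: poly_keys_def)
  have "nat_exp 0 = 0" by (rule poly_mapping_eqI) (simp add: lookup_nat_exp)
  moreover have "hgen y = y" using y by (auto simp: hgen_def)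
  ultimately have "free_map (Poly_Mapping.single (y, 0) 1) = y"
    using smult_one[OF grade_carrier[OF y]] by (simp add: free_map_single[OF mem] pterm_def)
  then show ?thesis
    using mem hdeg_unique[OF y False] by (intro exI[of _ "Poly_Mapping.single (y, 0) 1"]) (simp add: laurent_hc_id)
qed

lemma finsum_free_map:
  "finite J \<Longrightarrow> (\<And>j. j \<in> J \<Longrightarrow> Poly_Mapping.keys (x j) \<subseteq> poly_keys) \<Longrightarrow>
    Poly_Mapping.keys (sum x J) \<subseteq> poly_keys \<and> (\<Oplus>\<^bsub>M\<^esub>j\<in>J. free_map (x j)) = free_map (sum x J)"
proof (induction J rule: finite_induct)
  case (insert a J)
  then have IH: "Poly_Mapping.keys (sum x J) \<subseteq> poly_keys" "(\<Oplus>\<^bsub>M\<^esub>j\<in>J. free_map (x j)) = free_map (sum x J)" by auto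
  have "(\<Oplus>\<^bsub>M\<^esub>j\<in>insert a J. free_map (x j)) = free_map (x a) \<oplus>\<^bsub>M\<^esub> (\<Oplus>\<^bsub>M\<^esub>j\<in>J. free_map (x j))"
    by (rule M.finsum_insert) (use insert in \<open>auto intro!: free_map_carrier\<close>)
  then show ?case using IH insert by (simp add: free_map_add keys_add_subset)
qed (simp add: free_map_0)

text \<open>\<open>free_map\<close> evaluates a polynomial combination of generators in
  \<open>M\<close>, and \<open>B0\<close> is its kernel. That the kernel is graded rests on the
  uniqueness of decompositions in \<open>M\<close>.\<close>

lemma free_presentation:
  defines "T \<equiv> {u. Poly_Mapping.keys u \<subseteq> poly_keys}" and "B0 \<equiv> {u. Poly_Mapping.keys u \<subseteq> poly_keys \<and> free_map u = \<zero>\<^bsub>M\<^esub>}"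
  shows "graded_scale.gsub (laurent_scale n) (laurent_hc hdeg) T"
    "graded_scale.gsub (laurent_scale n) (laurent_hc hdeg) B0" "B0 \<subseteq> T"
    "graded_scale.presents (laurent_scale n) n (laurent_hc hdeg) free_map T B0 M"
proof -
  interpret U: cech_space "laurent_scale n :: 'k mpoly \<Rightarrow> ('b, 'k) laurent \<Rightarrow> _" n "laurent_hc hdeg"
    by (rule cech_space_laurent)
  \<comment> \<open>Subspaces must be closed under all polynomials of the type, whereas
    \<open>M\<close> is a module only over those in x_1, ..., x_n. Since the other variables act as
    zero, \<open>p\<close> may be replaced by the part that involves none of them.\<close>
  have scale_eps: "\<exists>q\<in>carrier (mpoly_ring n). \<forall>u :: ('b, 'k) laurent. laurent_scale n p u = laurent_scale n q u" for p :: "'k mpoly"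
  proof -
    let ?q = "pmap_restrict {a. Poly_Mapping.keys a \<subseteq> {1..n}} p"
    have "laurent_scale n p u = laurent_scale n ?q u" for u :: "('b, 'k) laurent"
    proof (rule poly_mapping_eqI)
      fix y :: "'b \<times> (nat \<Rightarrow>\<^sub>0 int)"
      obtain m e where y: "y = (m, e)" by (cases y)
      have le: "Poly_Mapping.keys ?q \<subseteq> Poly_Mapping.keys p" by (simp add: keys_pmap_restrict)
      show "Poly_Mapping.lookup (laurent_scale n p u) y = Poly_Mapping.lookup (laurent_scale n ?q u) y"
        unfolding y lookup_laurent_scale[OF finite_keys order.refl, of n p] lookup_laurent_scale[OF finite_keys[of p] le]
        by (intro sum.cong) (auto simp: lookup_pmap_restrict)
    qed
    moreover have "?q \<in> carrier (mpoly_ring n)" by (auto simp: mem_mpoly_ring keys_pmap_restrict)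
    ultimately show ?thesis by blast
  qed
  have fin: "finite {j. laurent_hc hdeg j u \<noteq> 0}" for u :: "('b, 'k) laurent"
  proof (rule finite_subset)
    show "{j. laurent_hc hdeg j u \<noteq> 0} \<subseteq> (\<lambda>(m, e). hdeg m + int_deg e) ` Poly_Mapping.keys u"
    proof
      fix j assume "j \<in> {j. laurent_hc hdeg j u \<noteq> 0}"
      then have "Poly_Mapping.keys u \<inter> {(m, e). hdeg m + int_deg e = j} \<noteq> {}"
        unfolding laurent_hc_def using pmap_restrict_0[of u] by blast
      then show "j \<in> (\<lambda>(m, e). hdeg m + int_deg e) ` Poly_Mapping.keys u" by force
    qed
  qed simp
  have keys_hc: "Poly_Mapping.keys (laurent_hc hdeg j u) \<subseteq> Poly_Mapping.keys u" for j and u :: "('b, 'k) laurent"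
    by (simp add: laurent_hc_def keys_pmap_restrict)
  have sT: "U.subspace T"
  proof (rule U.subspaceI)
    fix p :: "'k mpoly" and x assume x: "x \<in> T"
    obtain q where "q \<in> carrier (mpoly_ring n)" "laurent_scale n p x = laurent_scale n q x" using scale_eps by blast
    then show "laurent_scale n p x \<in> T" using x free_map_scale[of x q] by (simp add: T_def)
  qed (auto simp: T_def keys_add_subset)
  show gT: "U.gsub T" by (rule U.gsubI[OF sT fin]) (use keys_hc in \<open>auto simp: T_def\<close>)
  show sub: "B0 \<subseteq> T" by (auto simp: T_def B0_def)
  have hcT: "laurent_hc hdeg j u \<in> T" if "u \<in> T" for j u by (rule U.gsub_hc[OF gT that])
  have gr: "free_map u \<in> grade M j" if "u \<in> T" "laurent_hc hdeg j u = u" for u j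
    by (rule free_map_grade) (use that in \<open>simp add: T_def laurent_hc_id\<close>)
  have "free_map (laurent_hc hdeg j u) = \<zero>\<^bsub>M\<^esub>" if u: "u \<in> T" "free_map u = \<zero>\<^bsub>M\<^esub>" for u j
  proof -
    let ?c = "\<lambda>j. free_map (laurent_hc hdeg j u)"
    let ?S = "{j. laurent_hc hdeg j u \<noteq> 0}"
    have cg: "?c j \<in> grade M j" for j by (rule gr[OF hcT[OF u(1)]]) (simp add: U.hc_hc)
    have J: "{j. ?c j \<noteq> \<zero>\<^bsub>M\<^esub>} \<subseteq> ?S" using free_map_0 by auto
    have "(\<Oplus>\<^bsub>M\<^esub>j\<in>{j. ?c j \<noteq> \<zero>\<^bsub>M\<^esub>}. ?c j) = (\<Oplus>\<^bsub>M\<^esub>j\<in>?S. ?c j)"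
      by (rule M.add.finprod_mono_neutral_cong_left[OF fin J]) (use cg grade_carrier in auto)
    also have "\<dots> = free_map (\<Sum>j\<in>?S. laurent_hc hdeg j u)"
      using finsum_free_map[OF fin, of u "\<lambda>j. laurent_hc hdeg j u"] hcT[OF u(1)] by (simp add: T_def)
    also have "(\<Sum>j\<in>?S. laurent_hc hdeg j u) = u" by (rule U.sum_hc[OF fin]) simp
    \<comment> \<open>The images of the components of \<open>u\<close> decompose zero, as does the
      zero family; uniqueness makes them equal.\<close>
    finally have "(\<forall>j. ?c j \<in> grade M j) \<and> finite {j. ?c j \<noteq> \<zero>\<^bsub>M\<^esub>} \<and> \<zero>\<^bsub>M\<^esub> = (\<Oplus>\<^bsub>M\<^esub>j\<in>{j. ?c j \<noteq> \<zero>\<^bsub>M\<^esub>}. ?c j)"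
      using cg finite_subset[OF J fin] u(2) by simp
    moreover have "(\<forall>j. (\<lambda>_. \<zero>\<^bsub>M\<^esub>) j \<in> grade M j) \<and> finite {j :: int. (\<lambda>_. \<zero>\<^bsub>M\<^esub>) j \<noteq> \<zero>\<^bsub>M\<^esub>} \<and>
        \<zero>\<^bsub>M\<^esub> = (\<Oplus>\<^bsub>M\<^esub>j\<in>{j :: int. (\<lambda>_. \<zero>\<^bsub>M\<^esub>) j \<noteq> \<zero>\<^bsub>M\<^esub>}. (\<lambda>_. \<zero>\<^bsub>M\<^esub>) j)"
      using grade_zero by simp
    ultimately have "?c = (\<lambda>_. \<zero>\<^bsub>M\<^esub>)"
      by (rule ex1_eqI[OF grade_direct_sum[OF M.zero_closed]])
    then show ?thesis by (rule fun_cong)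
  qed
  note hc0 = this
  have sB: "U.subspace B0"
  proof (rule U.subspaceI)
    fix p :: "'k mpoly" and x assume x: "x \<in> B0"
    obtain q where q: "q \<in> carrier (mpoly_ring n)" "laurent_scale n p x = laurent_scale n q x" using scale_eps by blast
    then show "laurent_scale n p x \<in> B0" using x free_map_scale[of x q] smult_r_null[OF q(1)] by (auto simp: B0_def)
  qed (auto simp: B0_def keys_add_subset free_map_0 free_map_add)
  show "U.gsub B0" by (rule U.gsub_subset[OF gT sub sB]) (use hc0 hcT in \<open>auto simp: B0_def T_def\<close>)
  show "U.presents free_map T B0 M"
  proof (rule U.presentsI)
    show "carrier M = free_map ` T"
    proof
      show "carrier M \<subseteq> free_map ` T"
      proof
        fix y assume "y \<in> carrier M"
        from grade_direct_sum[OF this] obtain c where c: "\<forall>j. c j \<in> grade M j" "finite {j. c j \<noteq> \<zero>\<^bsub>M\<^esub>}"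
          "y = (\<Oplus>\<^bsub>M\<^esub>j\<in>{j. c j \<noteq> \<zero>\<^bsub>M\<^esub>}. c j)" by blast
        have "\<forall>j. \<exists>u. Poly_Mapping.keys u \<subseteq> poly_keys \<and> free_map u = c j"
          using free_map_surj_grade c(1) by blast
        from choice[OF this] obtain x where x: "\<forall>j. Poly_Mapping.keys (x j) \<subseteq> poly_keys \<and> free_map (x j) = c j" ..
        then have "c = (\<lambda>j. free_map (x j))" by auto
        then show "y \<in> free_map ` T"
          using finsum_free_map[OF c(2), of x] x c(3) unfolding T_def by auto
      qed
    qed (auto simp: T_def free_map_carrier)
    show "free_map x \<oplus>\<^bsub>M\<^esub> free_map y = free_map (x + y)" if "x \<in> T" "y \<in> T" for x y
      using that by (simp add: T_def free_map_add)
    show "p \<odot>\<^bsub>M\<^esub> free_map x = free_map (laurent_scale n p x)" if "p \<in> carrier (mpoly_ring n)" "x \<in> T" for p x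
      using that free_map_scale[of x p] by (simp add: T_def)
    show "free_map x = free_map y \<longleftrightarrow> x - y \<in> B0" if xy: "x \<in> T" "y \<in> T" for x y
    proof -
      have d: "x - y \<in> T" by (rule U.subspace_diff[OF sT xy])
      have "free_map x = free_map (x - y) \<oplus>\<^bsub>M\<^esub> free_map y"
        using free_map_add[of "x - y" y] d xy by (simp add: T_def)
      moreover have "free_map (x - y) \<in> carrier M" "free_map y \<in> carrier M" using d xy by (auto simp: T_def free_map_carrier)
      ultimately have "free_map x = free_map y \<longleftrightarrow> free_map (x - y) = \<zero>\<^bsub>M\<^esub>"
        using M.add.r_cancel_one by simp
      then show ?thesis using d by (simp add: B0_def T_def)
    qed
    show "grade M j = free_map ` {x \<in> T. laurent_hc hdeg j x = x}" for j
      using free_map_surj_grade[of _ j] gr unfolding T_def by blast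
  qed (simp add: free_map_0)
qed

end

section \<open>Homogeneous ideals\<close>

definition mhc :: "int \<Rightarrow> ('k::field) mpoly \<Rightarrow> 'k mpoly" where
  "mhc k p = pmap_restrict {e. int (exp_deg e) = k} p"

lemma mhc_add: "mhc k (p + q) = mhc k p + mhc k q"
  by (simp add: mhc_def pmap_restrict_add)

lemma mhc_0 [simp]: "mhc k 0 = 0"
  by (rule poly_mapping_eqI) (simp add: mhc_def lookup_pmap_restrict)

lemma mhc_sum: "mhc k (sum f A) = (\<Sum>a\<in>A. mhc k (f a))"
  by (induction A rule: infinite_finite_induct) (auto simp: mhc_add)

lemma mhc_single: "mhc k (Poly_Mapping.single e c) = (if int (exp_deg e) = k then Poly_Mapping.single e c else 0)"
  by (rule poly_mapping_eqI) (auto simp: mhc_def lookup_pmap_restrict lookup_single when_def)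

lemma mhc_grade: "p \<in> carrier (mpoly_ring n) \<Longrightarrow> mhc k p \<in> mpoly_grade n k"
  by (auto simp: mhc_def mpoly_grade_def mem_mpoly_ring keys_pmap_restrict)

lemma mhc_split: "\<exists>K. finite K \<and> (\<Sum>k\<in>K. mhc k p) = p \<and> (\<forall>k. k \<notin> K \<longrightarrow> mhc k p = 0)"
proof -
  let ?K = "(\<lambda>e. int (exp_deg e)) ` Poly_Mapping.keys p"
  have "(\<Sum>k\<in>?K. mhc k p) = p"
  proof (rule poly_mapping_eqI)
    fix e
    have "Poly_Mapping.lookup (\<Sum>k\<in>?K. mhc k p) e = (\<Sum>k\<in>?K. if int (exp_deg e) = k then Poly_Mapping.lookup p e else 0)"
      by (simp add: lookup_sum mhc_def lookup_pmap_restrict)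
    also have "\<dots> = (if int (exp_deg e) \<in> ?K then Poly_Mapping.lookup p e else 0)" by simp
    also have "\<dots> = Poly_Mapping.lookup p e" by (auto simp: in_keys_iff image_iff)
    finally show "Poly_Mapping.lookup (\<Sum>k\<in>?K. mhc k p) e = Poly_Mapping.lookup p e" .
  qed
  moreover have "mhc k p = 0" if "k \<notin> ?K" for k
    unfolding mhc_def by (rule pmap_restrict_0) (use that in auto)
  ultimately show ?thesis by (intro exI[of _ ?K]) simp
qed

lemma mhc_mult:
  assumes "a \<in> mpoly_grade n i" shows "mhc k (r * a) = mhc (k - i) r * a"
proof -
  have "Poly_Mapping.keys r \<subseteq> UNIV" by simp
  then show ?thesis
  proof (induction r rule: pm_induct)
    case (single b c)
    have "Poly_Mapping.keys a \<subseteq> {e. int (exp_deg e) = i}" using assms by (auto simp: mpoly_grade_def)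
    then show ?case
    proof (induction a rule: pm_induct)
      case (single e l)
      then show ?case by (auto simp: mult_single mhc_single exp_deg_add)
    qed (simp_all add: distrib_left mhc_add)
  qed (simp_all add: distrib_right mhc_add)
qed

definition hideal :: "nat \<Rightarrow> ('k::field) mpoly set \<Rightarrow> bool" where
  "hideal n I \<longleftrightarrow> I \<subseteq> carrier (mpoly_ring n) \<and> 0 \<in> I \<and> (\<forall>p\<in>I. \<forall>q\<in>I. p + q \<in> I) \<and>
     (\<forall>p\<in>I. \<forall>q\<in>carrier (mpoly_ring n). q * p \<in> I) \<and> (\<forall>p\<in>I. \<forall>k. mhc k p \<in> I)"

lemma hideal_add: "hideal n I \<Longrightarrow> p \<in> I \<Longrightarrow> q \<in> I \<Longrightarrow> p + q \<in> I"
  and hideal_mult: "hideal n I \<Longrightarrow> p \<in> I \<Longrightarrow> q \<in> carrier (mpoly_ring n) \<Longrightarrow> q * p \<in> I"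
  and hideal_carrier: "hideal n I \<Longrightarrow> I \<subseteq> carrier (mpoly_ring n)"
  and hideal_0: "hideal n I \<Longrightarrow> 0 \<in> I"
  and hideal_mhc: "hideal n I \<Longrightarrow> p \<in> I \<Longrightarrow> mhc k p \<in> I"
  by (auto simp: hideal_def)

lemma hideal_sum: "hideal n I \<Longrightarrow> (\<And>x. x \<in> A \<Longrightarrow> f x \<in> I) \<Longrightarrow> sum f A \<in> I"
  by (induction A rule: infinite_finite_induct) (auto intro: hideal_0 hideal_add)

lemma hideal_ideal: "hideal n I \<Longrightarrow> ideal I (mpoly_ring n :: ('k::field) mpoly ring)"
  by (rule mpoly_idealI) (auto intro: hideal_add hideal_mult hideal_0 dest: hideal_carrier)

lemma hideal_adjoin:
  fixes Q :: "('k::field) mpoly set"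
  assumes Q: "hideal n Q" and a: "a \<in> mpoly_grade n i"
  shows "hideal n {q + r * a | q r. q \<in> Q \<and> r \<in> carrier (mpoly_ring n)}" (is "hideal n ?J")
  unfolding hideal_def
proof (intro conjI ballI allI)
  note ac = mpoly_grade_carrier[OF a]
  show "?J \<subseteq> carrier (mpoly_ring n)" using hideal_carrier[OF Q] ac by (auto intro!: mpoly_ring_add mpoly_ring_mult)
  have "0 = 0 + 0 * a" by simp
  then show "0 \<in> ?J" using hideal_0[OF Q] mpoly_ring_0 by blast
next
  fix p p' assume "p \<in> ?J" "p' \<in> ?J"
  then obtain q r q' r' where *: "p = q + r * a" "p' = q' + r' * a" "q \<in> Q" "q' \<in> Q" "r \<in> carrier (mpoly_ring n)" "r' \<in> carrier (mpoly_ring n)"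
    by blast
  have "p + p' = (q + q') + (r + r') * a" unfolding *(1,2) by (simp add: algebra_simps)
  then show "p + p' \<in> ?J" using hideal_add[OF Q *(3,4)] mpoly_ring_add[OF *(5,6)] by blast
next
  fix p s :: "'k mpoly" assume "p \<in> ?J" and s: "s \<in> carrier (mpoly_ring n)"
  then obtain q r where *: "p = q + r * a" "q \<in> Q" "r \<in> carrier (mpoly_ring n)" by blast
  have "s * p = s * q + (s * r) * a" unfolding *(1) by (simp add: algebra_simps)
  then show "s * p \<in> ?J" using hideal_mult[OF Q *(2) s] mpoly_ring_mult[OF s *(3)] by blast
next
  fix p k assume "p \<in> ?J"
  then obtain q r where *: "p = q + r * a" "q \<in> Q" "r \<in> carrier (mpoly_ring n)" by blast
  have "mhc k p = mhc k q + mhc (k - i) r * a" unfolding *(1) by (simp add: mhc_add mhc_mult[OF a])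
  then show "mhc k p \<in> ?J" using hideal_mhc[OF Q *(2)] mpoly_grade_carrier[OF mhc_grade[OF *(3)]] by blast
qed

text \<open>By maximality, \<open>Q\<close> together with a homogeneous \<open>a\<close> outside it
  generates an ideal containing a power of \<open>x\<close>. For two such elements with product in
  \<open>Q\<close>, multiplying the two powers would give a power of \<open>x\<close> in
  \<open>Q\<close>. Arbitrary factors are reduced to this case through their components of highest
  degree outside \<open>Q\<close>.\<close>

lemma hideal_maximal_prime:
  assumes Q: "hideal n Q" and x: "x \<in> carrier (mpoly_ring n)" "\<And>N. x ^ N \<notin> Q"
    and max: "\<And>J. hideal n J \<Longrightarrow> Q \<subseteq> J \<Longrightarrow> (\<And>N. x ^ N \<notin> J) \<Longrightarrow> J = Q"
  shows "primeideal Q (mpoly_ring n :: ('k::field) mpoly ring)"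
proof (rule primeidealI)
  show "ideal Q (mpoly_ring n)" by (rule hideal_ideal[OF Q])
  show "cring (mpoly_ring n :: 'k mpoly ring)" by (rule cring_mpoly_ring)
  show "carrier (mpoly_ring n) \<noteq> Q" using x(2)[of 0] mpoly_ring_1 by auto
  have adj: "\<exists>N q r. x ^ N = q + r * a \<and> q \<in> Q \<and> r \<in> carrier (mpoly_ring n)"
    if a: "a \<in> mpoly_grade n i" "a \<notin> Q" for a i
  proof (rule ccontr)
    let ?J = "{q + r * a | q r. q \<in> Q \<and> r \<in> carrier (mpoly_ring n)}"
    assume "\<not> ?thesis"
    then have "x ^ N \<notin> ?J" for N by blast
    moreover have "Q \<subseteq> ?J"
    proof
      fix q assume "q \<in> Q"
      moreover have "q = q + 0 * a" by simp
      ultimately show "q \<in> ?J" using mpoly_ring_0 by blast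
    qed
    ultimately have "?J = Q" using max[OF hideal_adjoin[OF Q a(1)]] by blast
    moreover have "a = 0 + 1 * a" by simp
    then have "a \<in> ?J" using hideal_0[OF Q] mpoly_ring_1 by blast
    ultimately show False using a(2) by blast
  qed
  have hom: False if a: "a \<in> mpoly_grade n i" "a \<notin> Q" and b: "b \<in> mpoly_grade n j" "b \<notin> Q" and ab: "a * b \<in> Q" for a b i j
  proof -
    obtain N q r where N: "x ^ N = q + r * a" "q \<in> Q" "r \<in> carrier (mpoly_ring n)" using adj[OF a] by blast
    obtain K s t where K: "x ^ K = s + t * b" "s \<in> Q" "t \<in> carrier (mpoly_ring n)" using adj[OF b] by blast
    have xK: "x ^ K \<in> carrier (mpoly_ring n)" by (rule mpoly_ring_power[OF x(1)])
    have ra: "r * a \<in> carrier (mpoly_ring n)" by (rule mpoly_ring_mult[OF N(3) mpoly_grade_carrier[OF a(1)]])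
    have "x ^ (N + K) = x ^ K * q + (r * a) * s + (r * t) * (a * b)"
      by (simp add: power_add N(1) K(1) algebra_simps)
    moreover have "x ^ K * q + (r * a) * s + (r * t) * (a * b) \<in> Q"
      by (intro hideal_add[OF Q] hideal_mult[OF Q] N(2) K(2) ab xK ra mpoly_ring_mult N(3) K(3))
    ultimately show False using x(2) by metis
  qed
  have top: "\<exists>k. mhc k a \<notin> Q \<and> (\<forall>i>k. mhc i a \<in> Q)" if "a \<notin> Q" for a
  proof -
    obtain K where K: "finite K" "(\<Sum>k\<in>K. mhc k a) = a" "\<forall>k. k \<notin> K \<longrightarrow> mhc k a = 0" using mhc_split by blast
    let ?A = "{k. mhc k a \<notin> Q}"
    have "?A \<subseteq> K" using K(3) hideal_0[OF Q] by auto
    then have fin: "finite ?A" using K(1) finite_subset by blast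
    have "?A \<noteq> {}"
    proof
      assume "?A = {}"
      then have "(\<Sum>k\<in>K. mhc k a) \<in> Q" by (intro hideal_sum[OF Q]) auto
      then show False using that K(2) by simp
    qed
    then have "Max ?A \<in> ?A" "\<forall>i>Max ?A. i \<notin> ?A" using Max_in[OF fin] Max_ge[OF fin] by (auto simp: not_le[symmetric])
    then show ?thesis by blast
  qed
  fix a b :: "'k mpoly" assume ab: "a \<in> carrier (mpoly_ring n)" "b \<in> carrier (mpoly_ring n)" "a \<otimes>\<^bsub>mpoly_ring n\<^esub> b \<in> Q"
  show "a \<in> Q \<or> b \<in> Q"
  proof (rule ccontr)
    assume "\<not> (a \<in> Q \<or> b \<in> Q)"
    then obtain k l where k: "mhc k a \<notin> Q" "\<forall>i>k. mhc i a \<in> Q" and l: "mhc l b \<notin> Q" "\<forall>i>l. mhc i b \<in> Q"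
      using top[of a] top[of b] by blast
    obtain K where K: "finite K" "(\<Sum>k\<in>K. mhc k a) = a" "\<forall>k. k \<notin> K \<longrightarrow> mhc k a = 0" using mhc_split by blast
    have kK: "k \<in> K" using K(3) k(1) hideal_0[OF Q] by metis
    have "a * b = (\<Sum>i\<in>K. b * mhc i a)"
      using K(2) sum_distrib_left[of b "\<lambda>i. mhc i a" K] by (simp add: mult.commute)
    then have "mhc (k + l) (a * b) = (\<Sum>i\<in>K. mhc (k + l - i) b * mhc i a)"
      by (simp add: mhc_sum mhc_mult[OF mhc_grade[OF ab(1)]])
    also have "\<dots> = mhc l b * mhc k a + (\<Sum>i\<in>K - {k}. mhc (k + l - i) b * mhc i a)"
      using sum.remove[OF K(1) kK, of "\<lambda>i. mhc (k + l - i) b * mhc i a"] by simp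
    \<comment> \<open>In degree \<open>k + l\<close> every other product of components has a factor
      of degree above \<open>k\<close> or above \<open>l\<close>, which lies in \<open>Q\<close> by
      the choice of \<open>k\<close> and \<open>l\<close>.\<close>
    finally have eq: "mhc k a * mhc l b = mhc (k + l) (a * b) + (- 1) * (\<Sum>i\<in>K - {k}. mhc (k + l - i) b * mhc i a)"
      by (simp add: mult.commute)
    have "(\<Sum>i\<in>K - {k}. mhc (k + l - i) b * mhc i a) \<in> Q"
    proof (rule hideal_sum[OF Q])
      fix i assume "i \<in> K - {k}"
      then consider "i > k" | "k + l - i > l" by force
      then show "mhc (k + l - i) b * mhc i a \<in> Q"
      proof cases
        case 1
        then show ?thesis using k(2) by (intro hideal_mult[OF Q] mpoly_grade_carrier[OF mhc_grade[OF ab(2)]]) auto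
      next
        case 2
        then have "mhc i a * mhc (k + l - i) b \<in> Q"
          using l(2) by (intro hideal_mult[OF Q] mpoly_grade_carrier[OF mhc_grade[OF ab(1)]]) auto
        then show ?thesis by (simp add: mult.commute)
      qed
    qed
    moreover have "mhc (k + l) (a * b) \<in> Q" using ab(3) hideal_mhc[OF Q] by simp
    ultimately have "mhc k a * mhc l b \<in> Q"
      unfolding eq by (intro hideal_add[OF Q] hideal_mult[OF Q] mpoly_ring_minus mpoly_ring_1)
    then show False by (rule hom[OF mhc_grade[OF ab(1)] k(1) mhc_grade[OF ab(2)] l(1)])
  qed
qed

lemma hideal_maximal_exists:
  assumes I: "hideal n I" and x: "\<And>N. (x :: ('k::field) mpoly) ^ N \<notin> I"
  shows "\<exists>Q. hideal n Q \<and> I \<subseteq> Q \<and> (\<forall>N. x ^ N \<notin> Q) \<and>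
    (\<forall>J. hideal n J \<longrightarrow> Q \<subseteq> J \<longrightarrow> (\<forall>N. x ^ N \<notin> J) \<longrightarrow> J = Q)"
proof -
  let ?F = "{J. hideal n J \<and> I \<subseteq> J \<and> (\<forall>N. x ^ N \<notin> J)}"
  have "\<exists>Q\<in>?F. \<forall>X\<in>?F. Q \<subseteq> X \<longrightarrow> X = Q"
  proof (rule subset_Zorn_nonempty)
    show "?F \<noteq> {}" using I x by blast
  next
    fix \<C> assume ne: "\<C> \<noteq> {}" and ch: "subset.chain ?F \<C>"
    have mem: "hideal n J" "I \<subseteq> J" "\<forall>N. x ^ N \<notin> J" if "J \<in> \<C>" for J using that ch unfolding subset_chain_def by auto
    have two: "\<exists>J\<in>\<C>. p \<in> J \<and> q \<in> J" if "p \<in> \<Union>\<C>" "q \<in> \<Union>\<C>" for p q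
    proof -
      from that obtain J J' where J: "J \<in> \<C>" "p \<in> J" "J' \<in> \<C>" "q \<in> J'" by blast
      then have "J \<subseteq> J' \<or> J' \<subseteq> J" using ch unfolding subset_chain_def by blast
      then show ?thesis using J by blast
    qed
    have "hideal n (\<Union>\<C>)"
      unfolding hideal_def
    proof (intro conjI ballI allI)
      show "\<Union>\<C> \<subseteq> carrier (mpoly_ring n)" using hideal_carrier[OF mem(1)] by blast
      show "0 \<in> \<Union>\<C>" using hideal_0[OF mem(1)] ne by blast
    next
      fix p q assume "p \<in> \<Union>\<C>" "q \<in> \<Union>\<C>"
      then obtain J where "J \<in> \<C>" "p \<in> J" "q \<in> J" using two by blast
      then show "p + q \<in> \<Union>\<C>" using hideal_add[OF mem(1)] by blast
    next
      fix p q assume "p \<in> \<Union>\<C>" and q: "q \<in> carrier (mpoly_ring n :: 'k mpoly ring)"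
      then obtain J where "J \<in> \<C>" "p \<in> J" by blast
      then show "q * p \<in> \<Union>\<C>" using hideal_mult[OF mem(1) _ q] by blast
    next
      fix p k assume "p \<in> \<Union>\<C>"
      then obtain J where "J \<in> \<C>" "p \<in> J" by blast
      then show "mhc k p \<in> \<Union>\<C>" using hideal_mhc[OF mem(1)] by blast
    qed
    moreover have "I \<subseteq> \<Union>\<C>" using mem(2) ne by blast
    moreover have "\<forall>N. x ^ N \<notin> \<Union>\<C>" using mem(3) by blast
    ultimately show "\<Union>\<C> \<in> ?F" by simp
  qed
  then obtain Q where Q: "Q \<in> ?F" and max: "\<forall>X\<in>?F. Q \<subseteq> X \<longrightarrow> X = Q" by (rule bexE)
  have "J = Q" if "hideal n J" "Q \<subseteq> J" "\<forall>N. x ^ N \<notin> J" for J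
  proof -
    have "J \<in> ?F" using that Q by auto
    with max that(2) show ?thesis by simp
  qed
  with Q show ?thesis by (intro exI[of _ Q]) simp
qed

lemma lookup_mult_0: "Poly_Mapping.lookup (p * q) 0 = Poly_Mapping.lookup p 0 * Poly_Mapping.lookup (q :: ('k::field) mpoly) 0"
proof -
  have "Poly_Mapping.keys p \<subseteq> UNIV" "Poly_Mapping.keys q \<subseteq> UNIV" by auto
  then show ?thesis
  proof (induction p rule: pm_induct)
    case (single a k)
    from single.prems show ?case
    proof (induction q rule: pm_induct)
      case (single b l)
      have "a + b = 0 \<longleftrightarrow> a = 0 \<and> b = 0"
      proof
        assume h: "a + b = 0"
        have "Poly_Mapping.lookup a i + Poly_Mapping.lookup b i = 0" for i
          using h by (metis lookup_add lookup_zero)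
        then show "a = 0 \<and> b = 0" by (auto intro!: poly_mapping_eqI)
      qed simp
      then show ?case by (auto simp: mult_single lookup_single when_def)
    qed (simp_all add: distrib_left lookup_add)
  qed (simp_all add: distrib_right lookup_add)
qed

lemma exp_deg_eq_0: assumes "exp_deg e = 0" shows "e = 0"
proof (rule poly_mapping_eqI)
  fix i show "Poly_Mapping.lookup e i = Poly_Mapping.lookup 0 i"
    using assms by (cases "i \<in> Poly_Mapping.keys e") (auto simp: exp_deg_def in_keys_iff)
qed

text \<open>If no power of x_j annihilated \<open>N\<close>, some homogeneous prime \<open>Q\<close>
  above the annihilator would avoid x_j. Being homogeneous and proper, it consists of polynomials
  without constant term; together with the ideal of all these it forms a chain of length 1. A prime
  that is not homogeneous need not lie in that ideal, which is the reason for working with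
  homogeneous ideals.\<close>

lemma krull_dim_0_nilpotent:
  assumes kd: "krull_dim (mpoly_ring n) N = 0" and I: "hideal n (annihilator (mpoly_ring n) N)" and j: "j \<in> {1..n}"
  shows "\<exists>K. (mvar j :: ('k::field) mpoly) ^ K \<in> annihilator (mpoly_ring n) N"
proof (rule ccontr)
  let ?x = "mvar j :: 'k mpoly" and ?I = "annihilator (mpoly_ring n :: 'k mpoly ring) N"
  assume "\<not> ?thesis"
  then have "?x ^ K \<notin> ?I" for K by blast
  from hideal_maximal_exists[OF I this] obtain Q where Q: "hideal n Q" "?I \<subseteq> Q" "\<And>K. ?x ^ K \<notin> Q"
    "\<And>J. hideal n J \<Longrightarrow> Q \<subseteq> J \<Longrightarrow> (\<And>K. ?x ^ K \<notin> J) \<Longrightarrow> J = Q" by blast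
  have prime: "primeideal Q (mpoly_ring n)"
    by (rule hideal_maximal_prime[OF Q(1) mpoly_ring_mvar[OF j] Q(3,4)])
  let ?M = "{p \<in> carrier (mpoly_ring n). Poly_Mapping.lookup p 0 = (0 :: 'k)}"
  have primeM: "primeideal ?M (mpoly_ring n)"
  proof (rule primeidealI)
    show "ideal ?M (mpoly_ring n)"
      by (rule mpoly_idealI) (auto simp: mpoly_ring_0 lookup_add lookup_mult_0 intro: mpoly_ring_add mpoly_ring_mult)
    show "cring (mpoly_ring n :: 'k mpoly ring)" by (rule cring_mpoly_ring)
    have "(1 :: 'k mpoly) \<notin> ?M" by (simp add: lookup_one)
    then show "carrier (mpoly_ring n) \<noteq> ?M" using mpoly_ring_1 by metis
  qed (auto simp: lookup_mult_0)
  have "Q \<subseteq> ?M"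
  proof
    fix p assume p: "p \<in> Q"
    have pc: "p \<in> carrier (mpoly_ring n)" using p hideal_carrier[OF Q(1)] by blast
    let ?c = "Poly_Mapping.lookup p 0"
    have "{e :: nat \<Rightarrow>\<^sub>0 nat. Poly_Mapping.keys e \<subseteq> {1..n} \<and> int (exp_deg e) = 0} \<subseteq> {0}"
      by (auto dest: exp_deg_eq_0)
    \<comment> \<open>The component of degree 0 is the constant term; if it were nonzero,
      \<open>Q\<close> would contain 1, the zeroth power of x_j.\<close>
    then have "mhc 0 p = cpoly ?c"
      using pc by (intro poly_mapping_eqI) (auto simp: mhc_def lookup_pmap_restrict lookup_single when_def dest: exp_deg_eq_0)
    then have "cpoly ?c \<in> Q" using hideal_mhc[OF Q(1) p, of 0] by simp
    then have "cpoly (inverse ?c) * cpoly ?c \<in> Q" by (rule hideal_mult[OF Q(1) _ cpoly_in_carrier])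
    then have "?c \<noteq> 0 \<Longrightarrow> ?x ^ 0 \<in> Q" by (simp add: mult_single)
    then show "p \<in> ?M" using Q(3) pc by blast
  qed
  moreover have "?x \<in> ?M" "?x \<notin> Q"
  proof -
    have "Poly_Mapping.single j (1 :: nat) \<noteq> 0" by (metis lookup_single_eq lookup_zero zero_neq_one)
    then show "?x \<in> ?M" using mpoly_ring_mvar[OF j] by (simp add: mvar_def lookup_single when_def)
    show "?x \<notin> Q" using Q(3)[of 1] by simp
  qed
  ultimately have strict: "Q \<subset> ?M" by blast
  let ?P = "\<lambda>i :: nat. if i = 0 then Q else ?M"
  have "ereal (real 1) \<le> krull_dim (mpoly_ring n) N"
    unfolding krull_dim_def
  proof (rule Sup_upper)
    have "(\<forall>i\<le>1. primeideal (?P i) (mpoly_ring n) \<and> ?I \<subseteq> ?P i) \<and> (\<forall>i<1. ?P i \<subset> ?P (Suc i))"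
      using prime primeM Q(2) strict by auto
    then have *: "\<exists>P. (\<forall>i\<le>1. primeideal (P i) (mpoly_ring n) \<and> ?I \<subseteq> P i) \<and> (\<forall>i<1. P i \<subset> P (Suc i))"
      by (rule exI[of _ ?P])
    show "ereal (real 1) \<in> {ereal (real r) | r. \<exists>P. (\<forall>i\<le>r. primeideal (P i) (mpoly_ring n) \<and> ?I \<subseteq> P i) \<and> (\<forall>i<r. P i \<subset> P (Suc i))}"
      by (rule CollectI, rule exI[of _ 1], rule conjI[OF refl *])
  qed
  then show False using kd by simp
qed

lemma krull_dim_cong:
  assumes "\<And>P. primeideal P R \<Longrightarrow> annihilator R M \<subseteq> P \<longleftrightarrow> annihilator R N \<subseteq> P"
  shows "krull_dim R M = krull_dim R N"
proof -
  have "(\<forall>i\<le>r. primeideal (P i) R \<and> annihilator R M \<subseteq> P i) \<longleftrightarrow> (\<forall>i\<le>r. primeideal (P i) R \<and> annihilator R N \<subseteq> P i)" for P :: "nat \<Rightarrow> _" and r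
    using assms by blast
  then show ?thesis unfolding krull_dim_def by simp
qed

section \<open>Parameters\<close>

context graded_scale
begin

lemma annihilator_presents:
  assumes P: "presents \<rho> Z B N" and Z: "subspace Z"
  shows "annihilator (mpoly_ring n) N = {a \<in> carrier (mpoly_ring n). \<forall>z\<in>Z. scale a z \<in> B}"
proof -
  have "a \<odot>\<^bsub>N\<^esub> \<rho> z = \<zero>\<^bsub>N\<^esub> \<longleftrightarrow> scale a z \<in> B" if "a \<in> carrier (mpoly_ring n)" "z \<in> Z" for a z
    unfolding presents_smult[OF P that] by (rule presents_eq_0[OF P Z subspace_scale[OF Z that(2)]])
  then show ?thesis unfolding annihilator_def presents_carrier[OF P] by blast
qed

text \<open>On a homogeneous \<open>z\<close> the components of \<open>p z\<close> are the products
  of \<open>z\<close> with the components of \<open>p\<close>, and \<open>B\<close> contains the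
  components of its elements.\<close>

lemma annihilator_hideal:
  assumes P: "presents \<rho> Z B N" and Z: "gsub Z" and B: "gsub B"
  shows "hideal n (annihilator (mpoly_ring n) N)"
  unfolding hideal_def annihilator_presents[OF P gsub_subspace[OF Z]]
proof (intro conjI ballI allI)
  note sB = gsub_subspace[OF B] and sZ = gsub_subspace[OF Z]
  let ?I = "{a \<in> carrier (mpoly_ring n). \<forall>z\<in>Z. scale a z \<in> B}"
  show "?I \<subseteq> carrier (mpoly_ring n)" by blast
  show "0 \<in> ?I" using mpoly_ring_0 subspace_0[OF sB] by simp
  show "p + q \<in> ?I" if "p \<in> ?I" "q \<in> ?I" for p q
    using that by (auto simp: scale_left_distrib intro: mpoly_ring_add subspace_add[OF sB])
  show "q * p \<in> ?I" if "p \<in> ?I" "q \<in> carrier (mpoly_ring n)" for p q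
    using that by (auto simp flip: scale_scale intro: mpoly_ring_mult subspace_scale[OF sB])
  fix p k assume p: "p \<in> ?I"
  then have pc: "p \<in> carrier (mpoly_ring n)" by blast
  obtain K where K: "finite K" "(\<Sum>k\<in>K. mhc k p) = p" "\<forall>k. k \<notin> K \<longrightarrow> mhc k p = 0" using mhc_split by blast
  have hom: "scale (mhc k p) (hc j z) \<in> B" if z: "z \<in> Z" for j z
  proof -
    have "hc (k + j) (scale p (hc j z)) = (\<Sum>i\<in>K. hc (k + j) (scale (mhc i p) (hc j z)))"
      by (subst (1) K(2)[symmetric]) (simp add: scale_sum_left hc_sum)
    also have "\<dots> = (\<Sum>i\<in>K. if i = k then scale (mhc k p) (hc j z) else 0)"
    proof (rule sum.cong[OF refl])
      fix i
      have "hc (i + (k + j - i)) (scale (mhc i p) (hc j z)) = scale (mhc i p) (hc (k + j - i) (hc j z))"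
        by (rule hc_scale[OF mhc_grade[OF pc]])
      then show "hc (k + j) (scale (mhc i p) (hc j z)) = (if i = k then scale (mhc k p) (hc j z) else 0)"
        by (simp add: hc_hc)
    qed
    also have "\<dots> = scale (mhc k p) (hc j z)" using K(1,3) by (cases "k \<in> K") auto
    finally show ?thesis using gsub_hc[OF B, of "scale p (hc j z)" "k + j"] p gsub_hc[OF Z z, of j] by auto
  qed
  have "scale (mhc k p) z \<in> B" if z: "z \<in> Z" for z
  proof -
    have "scale (mhc k p) z = (\<Sum>j\<in>{j. hc j z \<noteq> 0}. scale (mhc k p) (hc j z))"
      using gsub_sum_hc[OF Z z] scale_sum_right by metis
    also have "\<dots> \<in> B" by (rule subspace_sum[OF sB hom[OF z]])
    finally show ?thesis .
  qed
  then show "mhc k p \<in> ?I" using mpoly_grade_carrier[OF mhc_grade[OF pc]] by blast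
qed

lemma subspace_psub:
  assumes T: "subspace T" and B0: "subspace B0" shows "subspace (psub T B0 \<theta> C t)"
proof (rule subspaceI)
  show "0 \<in> psub T B0 \<theta> C t"
    unfolding psub_def using subspace_0[OF B0] subspace_0[OF T] by (auto intro!: exI[of _ 0] exI[of _ "\<lambda>_. 0"])
next
  fix x y assume "x \<in> psub T B0 \<theta> C t" "y \<in> psub T B0 \<theta> C t"
  then obtain b \<tau> b' \<tau>' where *: "x = b + (\<Sum>e\<in>C. scale (\<theta> e ^ t e) (\<tau> e))" "y = b' + (\<Sum>e\<in>C. scale (\<theta> e ^ t e) (\<tau>' e))"
    "b \<in> B0" "b' \<in> B0" "\<forall>e. \<tau> e \<in> T" "\<forall>e. \<tau>' e \<in> T" unfolding psub_def by blast
  have "x + y = (b + b') + (\<Sum>e\<in>C. scale (\<theta> e ^ t e) (\<tau> e + \<tau>' e))"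
    unfolding *(1,2) by (simp add: scale_right_distrib sum.distrib add_ac)
  moreover have "b + b' \<in> B0" "\<forall>e. \<tau> e + \<tau>' e \<in> T" using * subspace_add[OF B0] subspace_add[OF T] by auto
  ultimately show "x + y \<in> psub T B0 \<theta> C t"
    unfolding psub_def mem_Collect_eq by (intro exI[of _ "b + b'"] exI[of _ "\<lambda>e. \<tau> e + \<tau>' e"]) simp
next
  fix p x assume "x \<in> psub T B0 \<theta> C t"
  then obtain b \<tau> where *: "x = b + (\<Sum>e\<in>C. scale (\<theta> e ^ t e) (\<tau> e))" "b \<in> B0" "\<forall>e. \<tau> e \<in> T" unfolding psub_def by blast
  have "scale p x = scale p b + (\<Sum>e\<in>C. scale (\<theta> e ^ t e) (scale p (\<tau> e)))"
    unfolding *(1) by (simp add: scale_right_distrib scale_sum_right mult.commute)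
  moreover have "scale p b \<in> B0" "\<forall>e. scale p (\<tau> e) \<in> T" using * subspace_scale[OF B0] subspace_scale[OF T] by auto
  ultimately show "scale p x \<in> psub T B0 \<theta> C t"
    unfolding psub_def mem_Collect_eq by (intro exI[of _ "scale p b"] exI[of _ "\<lambda>e. scale p (\<tau> e)"]) simp
qed

lemma psub_base: assumes "0 \<in> T" shows "B0 \<subseteq> psub T B0 \<theta> C t"
proof
  fix b assume "b \<in> B0"
  then show "b \<in> psub T B0 \<theta> C t"
    unfolding psub_def mem_Collect_eq using assms by (intro exI[of _ b] exI[of _ "\<lambda>_. 0"]) simp
qed

text \<open>Weak sequences are about ordered lists of elements, \<open>psub\<close> about a set of
  indices with exponents; this is the passage between the two.\<close>

lemma psub_reindex:
  assumes "inj_on \<sigma> C"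
  shows "psub T B0 (\<lambda>i. \<theta> (\<sigma> i) ^ t (\<sigma> i)) C (\<lambda>_. 1) = psub T B0 \<theta> (\<sigma> ` C) t"
proof
  show "psub T B0 (\<lambda>i. \<theta> (\<sigma> i) ^ t (\<sigma> i)) C (\<lambda>_. 1) \<subseteq> psub T B0 \<theta> (\<sigma> ` C) t"
  proof
    fix x assume "x \<in> psub T B0 (\<lambda>i. \<theta> (\<sigma> i) ^ t (\<sigma> i)) C (\<lambda>_. 1)"
    then obtain b \<tau> where *: "x = b + (\<Sum>i\<in>C. scale ((\<theta> (\<sigma> i) ^ t (\<sigma> i)) ^ 1) (\<tau> i))" "b \<in> B0" "\<forall>e. \<tau> e \<in> T"
      unfolding psub_def by blast
    have "(\<Sum>e\<in>\<sigma> ` C. scale (\<theta> e ^ t e) (\<tau> (inv_into C \<sigma> e))) = (\<Sum>i\<in>C. scale ((\<theta> (\<sigma> i) ^ t (\<sigma> i)) ^ 1) (\<tau> i))"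
      unfolding sum.reindex[OF assms] by (rule sum.cong[OF refl]) (simp add: inv_into_f_f[OF assms])
    then show "x \<in> psub T B0 \<theta> (\<sigma> ` C) t"
      unfolding psub_def mem_Collect_eq using *
      by (intro exI[of _ b] exI[of _ "\<lambda>e. \<tau> (inv_into C \<sigma> e)"]) simp
  qed
  show "psub T B0 \<theta> (\<sigma> ` C) t \<subseteq> psub T B0 (\<lambda>i. \<theta> (\<sigma> i) ^ t (\<sigma> i)) C (\<lambda>_. 1)"
  proof
    fix x assume "x \<in> psub T B0 \<theta> (\<sigma> ` C) t"
    then obtain b \<tau> where *: "x = b + (\<Sum>e\<in>\<sigma> ` C. scale (\<theta> e ^ t e) (\<tau> e))" "b \<in> B0" "\<forall>e. \<tau> e \<in> T"
      unfolding psub_def by blast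
    then show "x \<in> psub T B0 (\<lambda>i. \<theta> (\<sigma> i) ^ t (\<sigma> i)) C (\<lambda>_. 1)"
      unfolding psub_def mem_Collect_eq
      by (intro exI[of _ b] exI[of _ "\<lambda>i. \<tau> (\<sigma> i)"]) (simp add: sum.reindex[OF assms])
  qed
qed

lemma psub_mono_exp:
  assumes T: "subspace T" and t: "\<And>i. i \<in> C \<Longrightarrow> t i \<le> t' i"
  shows "psub T B0 \<theta> C t' \<subseteq> psub T B0 \<theta> C t"
proof
  fix x assume "x \<in> psub T B0 \<theta> C t'"
  then obtain b \<tau> where *: "x = b + (\<Sum>e\<in>C. scale (\<theta> e ^ t' e) (\<tau> e))" "b \<in> B0" "\<forall>e. \<tau> e \<in> T" unfolding psub_def by blast
  have "(\<Sum>e\<in>C. scale (\<theta> e ^ t' e) (\<tau> e)) = (\<Sum>e\<in>C. scale (\<theta> e ^ t e) (scale (\<theta> e ^ (t' e - t e)) (\<tau> e)))"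
    by (rule sum.cong[OF refl]) (use t in \<open>simp add: power_add[symmetric]\<close>)
  moreover have "\<forall>e. scale (\<theta> e ^ (t' e - t e)) (\<tau> e) \<in> T" using * subspace_scale[OF T] by blast
  ultimately show "x \<in> psub T B0 \<theta> C t"
    unfolding psub_def mem_Collect_eq using *(1,2)
    by (intro exI[of _ b] exI[of _ "\<lambda>e. scale (\<theta> e ^ (t' e - t e)) (\<tau> e)"]) simp
qed

text \<open>Together with monotonicity in the exponents it shows that the annihilators for exponents
  1 and \<open>t\<close> have the same radical. One exponent is doubled at a time, by applying a
  power of \<open>a\<close> twice.\<close>

lemma psub_nilpotent:
  assumes T: "subspace T" and B0: "subspace B0" and D: "finite D"
    and a: "\<And>z. z \<in> T \<Longrightarrow> scale a z \<in> psub T B0 \<theta> D (\<lambda>_. 1)"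
  shows "\<exists>N. \<forall>z\<in>T. scale (a ^ N) z \<in> psub T B0 \<theta> D t"
proof -
  let ?S = "\<lambda>t. \<exists>N. \<forall>z\<in>T. scale (a ^ N) z \<in> psub T B0 \<theta> D t"
  have dbl: "?S (t(e := 2 * t e))" if S: "?S t" and e: "e \<in> D" for t e
  proof -
    let ?t' = "t(e := 2 * t e)" and ?C = "D - {e}"
    from S obtain N where N: "\<And>z. z \<in> T \<Longrightarrow> scale (a ^ N) z \<in> psub T B0 \<theta> D t" by blast
    have D': "insert e ?C = D" "finite ?C" "e \<notin> ?C" using e D by auto
    have dec: "\<exists>u c. scale (a ^ N) z = u + scale (\<theta> e ^ t e) c \<and> u \<in> psub T B0 \<theta> ?C t \<and> c \<in> T" if "z \<in> T" for z
      using N[OF that] psub_insert[OF D'(2,3), of T B0 \<theta> t] unfolding D'(1) by blast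
    have sC: "subspace (psub T B0 \<theta> ?C t)" by (rule subspace_psub[OF T B0])
    have Ct: "psub T B0 \<theta> ?C t = psub T B0 \<theta> ?C ?t'" by (rule psub_cong) auto
    have "scale (a ^ (N + N)) z \<in> psub T B0 \<theta> D ?t'" if z: "z \<in> T" for z
    proof -
      obtain u c where u: "scale (a ^ N) z = u + scale (\<theta> e ^ t e) c" "u \<in> psub T B0 \<theta> ?C t" "c \<in> T" using dec[OF z] by blast
      \<comment> \<open>Decomposing the coefficient of the power of \<theta>_e once more doubles the
        exponent of \<theta>_e; all other terms belong to the remaining parameters.\<close>
      obtain v c' where v: "scale (a ^ N) c = v + scale (\<theta> e ^ t e) c'" "v \<in> psub T B0 \<theta> ?C t" "c' \<in> T" using dec[OF u(3)] by blast
      have "scale (a ^ (N + N)) z = scale (a ^ N) (scale (a ^ N) z)" by (simp add: power_add)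
      also have "\<dots> = scale (a ^ N) u + scale (\<theta> e ^ t e) (scale (a ^ N) c)"
        unfolding u(1) by (simp add: scale_right_distrib mult.commute)
      also have "\<dots> = (scale (a ^ N) u + scale (\<theta> e ^ t e) v) + scale (\<theta> e ^ ?t' e) c'"
        unfolding v(1) by (simp add: scale_right_distrib mult_2 power_add add.assoc)
      finally have eq: "scale (a ^ (N + N)) z = (scale (a ^ N) u + scale (\<theta> e ^ t e) v) + scale (\<theta> e ^ ?t' e) c'" .
      have "scale (a ^ N) u + scale (\<theta> e ^ t e) v \<in> psub T B0 \<theta> ?C ?t'"
        unfolding Ct[symmetric] by (intro subspace_add[OF sC] subspace_scale[OF sC] u v)
      then show ?thesis
        using psub_insert[OF D'(2,3), of T B0 \<theta> ?t'] v(3) unfolding D'(1) eq by blast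
    qed
    then show ?thesis by blast
  qed
  have iter: "?S (t(e := 2 ^ k * t e))" if S: "?S t" and e: "e \<in> D" for t e and k :: nat
  proof (induction k)
    case (Suc k)
    have "(t(e := 2 ^ k * t e))(e := 2 * (t(e := 2 ^ k * t e)) e) = t(e := 2 ^ Suc k * t e)" by auto
    with dbl[OF Suc e] show ?case by metis
  qed (use S in simp)
  have all: "?S (\<lambda>i. if i \<in> E then 2 ^ k else 1)" if "E \<subseteq> D" for E and k :: nat
    using finite_subset[OF that D] that
  proof (induction E)
    case empty
    then show ?case using a by (intro exI[of _ 1]) simp
  next
    case (insert e E)
    let ?t = "\<lambda>i. if i \<in> E then 2 ^ k else 1 :: nat"
    have "?S (?t(e := 2 ^ k * ?t e))" by (rule iter) (use insert in auto)
    moreover have "?t(e := 2 ^ k * ?t e) = (\<lambda>i. if i \<in> insert e E then 2 ^ k else 1)" using insert.hyps by auto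
    ultimately show ?case by metis
  qed
  \<comment> \<open>A crude common bound: each \<open>t i\<close> is at most the sum, hence at most
    2^k.\<close>
  define k where "k = sum t D"
  have "t i \<le> 2 ^ k" if "i \<in> D" for i
  proof -
    have "t i \<le> k" unfolding k_def by (rule member_le_sum) (use that D in auto)
    also have "k \<le> 2 ^ k" by (rule less_imp_le[OF less_exp])
    finally show ?thesis .
  qed
  then have "psub T B0 \<theta> D (\<lambda>i. if i \<in> D then 2 ^ k else 1) \<subseteq> psub T B0 \<theta> D t"
    by (intro psub_mono_exp[OF T]) simp
  then show ?thesis using all[OF order.refl, of k] by blast
qed

context
  fixes \<pi> :: "'w \<Rightarrow> 'b" and T B0 and M :: "('k mpoly, 'b) gmodule"
  assumes P: "presents \<pi> T B0 M" and T: "gsub T" and B0: "gsub B0" "B0 \<subseteq> T"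
begin

text \<open>One inclusion holds because the polynomials that map \<open>T\<close> into
  \<open>psub\<close> form an ideal containing the \<theta>_i. For the other, a submodule containing
  all products contains the sums that make up \<open>psub\<close>.\<close>

lemma seq_smult_presents:
  assumes th: "\<And>i. i \<in> {1..r} \<Longrightarrow> \<theta> i \<in> carrier (mpoly_ring n)"
  shows "seq_smult n r \<theta> M = \<pi> ` psub T B0 \<theta> {1..r} (\<lambda>_. 1)"
proof -
  note sT = gsub_subspace[OF T] and sB = gsub_subspace[OF B0(1)]
  let ?A = "psub T B0 \<theta> {1..r} (\<lambda>_. 1)" and ?I = "Idl\<^bsub>mpoly_ring n\<^esub> (\<theta> ` {1..r})"
  note sA = subspace_psub[OF sT sB, of \<theta> "{1..r}" "\<lambda>_. 1"]
  have AT: "?A \<subseteq> T" by (rule psub_subset[OF sT B0(2)])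
  interpret M: Module.module "mpoly_ring n" M by (rule presents_module[OF P sT])
  let ?X = "{a \<odot>\<^bsub>M\<^esub> y | a y. a \<in> ?I \<and> y \<in> carrier M}"
  have sub: "submodule (\<pi> ` ?A) (mpoly_ring n) M"
  proof (rule M.submoduleI)
    show "\<pi> ` ?A \<subseteq> carrier M" using AT by (auto simp: presents_carrier[OF P])
    show "\<zero>\<^bsub>M\<^esub> \<in> \<pi> ` ?A" using subspace_0[OF sA] by (simp add: presents_zero[OF P])
    show "\<ominus>\<^bsub>M\<^esub> y \<in> \<pi> ` ?A" if "y \<in> \<pi> ` ?A" for y
    proof -
      from that obtain u where u: "y = \<pi> u" "u \<in> ?A" by blast
      have uT: "u \<in> T" "- u \<in> T" using u AT subspace_neg[OF sT] by auto
      have "\<ominus>\<^bsub>M\<^esub> y = \<pi> (- u)"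
        using presents_add[OF P uT(2,1)] uT u(1)
        by (intro M.minus_equality) (auto simp: presents_carrier[OF P] presents_zero[OF P])
      then show ?thesis using subspace_neg[OF sA u(2)] by blast
    qed
    show "x \<oplus>\<^bsub>M\<^esub> y \<in> \<pi> ` ?A" if "x \<in> \<pi> ` ?A" "y \<in> \<pi> ` ?A" for x y
    proof -
      from that obtain u v where u: "x = \<pi> u" "u \<in> ?A" "y = \<pi> v" "v \<in> ?A" by blast
      have "x \<oplus>\<^bsub>M\<^esub> y = \<pi> (u + v)" using presents_add[OF P] u AT by blast
      then show ?thesis using subspace_add[OF sA u(2,4)] by blast
    qed
    show "a \<odot>\<^bsub>M\<^esub> x \<in> \<pi> ` ?A" if "a \<in> carrier (mpoly_ring n)" "x \<in> \<pi> ` ?A" for a x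
    proof -
      from that obtain u where u: "x = \<pi> u" "u \<in> ?A" by blast
      have "a \<odot>\<^bsub>M\<^esub> x = \<pi> (scale a u)" using presents_smult[OF P that(1)] u AT by blast
      then show ?thesis using subspace_scale[OF sA u(2)] by blast
    qed
  qed
  have gen: "scale (\<theta> i) z \<in> ?A" if i: "i \<in> {1..r}" and z: "z \<in> T" for i z
  proof -
    have ins: "insert i ({1..r} - {i}) = {1..r}" using i by auto
    have "0 \<in> psub T B0 \<theta> ({1..r} - {i}) (\<lambda>_. 1)" by (rule subspace_0[OF subspace_psub[OF sT sB]])
    then have "0 + scale (\<theta> i ^ 1) z \<in> psub T B0 \<theta> (insert i ({1..r} - {i})) (\<lambda>_. 1)"
      using psub_insert[of "{1..r} - {i}" i T B0 \<theta> "\<lambda>_. 1"] z by blast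
    then show ?thesis unfolding ins by simp
  qed
  have "?I \<subseteq> {a \<in> carrier (mpoly_ring n). \<forall>z\<in>T. scale a z \<in> ?A}" (is "_ \<subseteq> ?J")
  proof (rule ring.genideal_minimal[OF cring.axioms(1)[OF cring_mpoly_ring]])
    show "ideal ?J (mpoly_ring n)"
    proof (rule mpoly_idealI)
      show "0 \<in> ?J" using mpoly_ring_0 subspace_0[OF sA] by simp
      show "p + q \<in> ?J" if "p \<in> ?J" "q \<in> ?J" for p q
        using that by (auto simp: scale_left_distrib intro: mpoly_ring_add subspace_add[OF sA])
      show "q * p \<in> ?J" if "p \<in> ?J" "q \<in> carrier (mpoly_ring n)" for p q
        using that by (auto simp flip: scale_scale intro: mpoly_ring_mult subspace_scale[OF sA])
    qed blast
    show "\<theta> ` {1..r} \<subseteq> ?J" using gen th by blast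
  qed
  note IJ = this
  have "?X \<subseteq> \<pi> ` ?A"
  proof
    fix x assume "x \<in> ?X"
    then obtain a y where x: "x = a \<odot>\<^bsub>M\<^esub> y" "a \<in> ?I" "y \<in> carrier M" by blast
    then obtain z where z: "y = \<pi> z" "z \<in> T" unfolding presents_carrier[OF P] by blast
    have a: "a \<in> carrier (mpoly_ring n)" "scale a z \<in> ?A" using subsetD[OF IJ x(2)] z(2) by auto
    have "x = \<pi> (scale a z)" unfolding x(1) z(1) by (rule presents_smult[OF P a(1) z(2)])
    then show "x \<in> \<pi> ` ?A" using a(2) by (rule image_eqI)
  qed
  moreover have "\<pi> ` ?A \<subseteq> K" if K: "submodule K (mpoly_ring n) M" "?X \<subseteq> K" for K
  proof
    fix y assume "y \<in> \<pi> ` ?A"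
    then obtain b \<tau> where y: "y = \<pi> (b + (\<Sum>e\<in>{1..r}. scale (\<theta> e ^ 1) (\<tau> e)))" "b \<in> B0" "\<forall>e. \<tau> e \<in> T"
      unfolding psub_def by blast
    have zK: "\<zero>\<^bsub>M\<^esub> \<in> K" using subgroup.one_closed[OF submodule.axioms(1)[OF K(1)]] by simp
    have "(\<Sum>e\<in>S. scale (\<theta> e) (\<tau> e)) \<in> T \<and> \<pi> (\<Sum>e\<in>S. scale (\<theta> e) (\<tau> e)) \<in> K" if "finite S" "S \<subseteq> {1..r}" for S
      using that
    proof (induction S)
      case empty
      then show ?case using zK subspace_0[OF sT] by (simp add: presents_zero[OF P])
    next
      case (insert e S)
      have eT: "scale (\<theta> e) (\<tau> e) \<in> T" using subspace_scale[OF sT] y(3) by blast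
      have IH: "(\<Sum>e\<in>S. scale (\<theta> e) (\<tau> e)) \<in> T" "\<pi> (\<Sum>e\<in>S. scale (\<theta> e) (\<tau> e)) \<in> K" using insert by auto
      have e: "e \<in> {1..r}" using insert.prems by simp
      have "\<theta> e \<in> ?I"
        using ring.genideal_self[OF cring.axioms(1)[OF cring_mpoly_ring], of "\<theta> ` {1..r}" n] th e by blast
      then have "\<theta> e \<odot>\<^bsub>M\<^esub> \<pi> (\<tau> e) \<in> ?X" using y(3) unfolding presents_carrier[OF P] by blast
      then have "\<theta> e \<odot>\<^bsub>M\<^esub> \<pi> (\<tau> e) \<in> K" by (rule subsetD[OF K(2)])
      moreover have "\<tau> e \<in> T" using y(3) by blast
      ultimately have "\<pi> (scale (\<theta> e) (\<tau> e)) \<in> K"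
        by (simp only: presents_smult[OF P th[OF e]])
      then have "\<pi> (scale (\<theta> e) (\<tau> e)) \<oplus>\<^bsub>M\<^esub> \<pi> (\<Sum>e\<in>S. scale (\<theta> e) (\<tau> e)) \<in> K"
        by (rule M.submoduleE(5)[OF K(1) _ IH(2)])
      then show ?case
        unfolding presents_add[OF P eT IH(1)] sum.insert[OF insert.hyps] using subspace_add[OF sT eT IH(1)] by blast
    qed
    from this[of "{1..r}"] have s: "(\<Sum>e\<in>{1..r}. scale (\<theta> e) (\<tau> e)) \<in> T" "\<pi> (\<Sum>e\<in>{1..r}. scale (\<theta> e) (\<tau> e)) \<in> K" by auto
    have bT: "b \<in> T" using y(2) B0(2) by blast
    have "y = \<pi> (\<Sum>e\<in>{1..r}. scale (\<theta> e) (\<tau> e))"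
      unfolding y(1) using presents_eq[OF P subspace_add[OF sT bT s(1)] s(1)] y(2) by simp
    then show "y \<in> K" using s(2) by simp
  qed
  ultimately show ?thesis
    unfolding seq_smult_def ideal_smult_def module_span_def using sub by blast
qed

lemma presents_psub_quotient:
  "\<exists>\<rho>. presents \<rho> T (psub T B0 \<theta> C t) (quot_gmodule M (\<pi> ` psub T B0 \<theta> C t))"
proof -
  note sT = gsub_subspace[OF T] and sB = gsub_subspace[OF B0(1)]
  from presents_quotient[OF P psub_base[OF subspace_0[OF sT]] psub_subset[OF sT B0(2)] sT subspace_psub[OF sT sB]] show ?thesis by blast
qed

text \<open>Dimension 0 makes each variable nilpotent on M / \<Theta>_[d] M; the sum of the
  individual exponents serves all variables at once.\<close>

lemma lsop_torsion:
  assumes ls: "lsop n M d \<theta>"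
  shows "\<exists>K. \<forall>j\<in>{1..n}. \<forall>u\<in>T. scale (mvar j ^ K) u \<in> psub T B0 \<theta> {1..d} (\<lambda>_. 1)"
proof -
  note sT = gsub_subspace[OF T] and sB = gsub_subspace[OF B0(1)]
  let ?A = "psub T B0 \<theta> {1..d} (\<lambda>_. 1)"
  have th: "\<theta> i \<in> mpoly_grade n 1" if "i \<in> {1..d}" for i using ls that by (auto simp: lsop_def)
  have gA: "gsub ?A" by (rule gsub_psub[OF T B0(1)]) (use th in auto)
  obtain \<rho> where \<rho>: "presents \<rho> T ?A (quot_gmodule M (\<pi> ` ?A))" using presents_psub_quotient by blast
  have "seq_smult n d \<theta> M = \<pi> ` ?A" by (rule seq_smult_presents) (rule mpoly_grade_carrier[OF th])
  then have kd: "krull_dim (mpoly_ring n) (quot_gmodule M (\<pi> ` ?A)) = 0" using ls by (simp add: lsop_def hsop_def)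
  have "\<exists>K. \<forall>u\<in>T. scale (mvar j ^ K) u \<in> ?A" if "j \<in> {1..n}" for j
    using krull_dim_0_nilpotent[OF kd annihilator_hideal[OF \<rho> T gA] that]
    unfolding annihilator_presents[OF \<rho> sT] by blast
  then have "\<forall>j\<in>{1..n}. \<exists>K. \<forall>u\<in>T. scale (mvar j ^ K) u \<in> ?A" by blast
  from bchoice[OF this] obtain K where K: "\<forall>j\<in>{1..n}. \<forall>u\<in>T. scale (mvar j ^ K j) u \<in> ?A" ..
  have "scale (mvar j ^ sum K {1..n}) u \<in> ?A" if j: "j \<in> {1..n}" and u: "u \<in> T" for j u
  proof -
    have "K j \<le> sum K {1..n}" using j by (intro member_le_sum) auto
    then have "scale (mvar j ^ sum K {1..n}) u = scale (mvar j ^ (sum K {1..n} - K j)) (scale (mvar j ^ K j) u)"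
      by (simp add: power_add[symmetric])
    then show ?thesis using K j u subspace_scale[OF gsub_subspace[OF gA]] by metis
  qed
  then show ?thesis by blast
qed

text \<open>A weak sequence speaks of the initial segments of one ordered system, whereas arbitrary
  \<open>C\<close>, \<open>e\<close> and exponents are wanted. So the parameters are rearranged with
  \<open>C\<close> first and \<open>e\<close> next and raised to powers. The result is again a
  system of parameters, and its weak-sequence condition at position \<open>card C + 1\<close> is the
  claim.\<close>

lemma buchsbaum_weak:
  assumes bu: "buchsbaum n M" and ls: "lsop n M d \<theta>" and C: "C \<subseteq> {1..d}" and e: "e \<in> {1..d} - C"
    and t: "\<forall>i. 1 \<le> t i" and s: "1 \<le> s" and y: "y \<in> T" and mem: "scale (\<theta> e ^ s) y \<in> psub T B0 \<theta> C t"
    and p: "p \<in> irrelevant_ideal n"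
  shows "scale p y \<in> psub T B0 \<theta> C t"
proof -
  note sT = gsub_subspace[OF T] and sB = gsub_subspace[OF B0(1)]
  have th: "\<theta> i \<in> mpoly_grade n 1" "\<theta> i \<in> irrelevant_ideal n" if "i \<in> {1..d}" for i
    using ls that by (auto simp: lsop_def hsop_def)
  \<comment> \<open>The power \<theta>_e^s itself becomes a term of the new system.\<close>
  define t' where "t' = t(e := s)"
  have t': "1 \<le> t' i" for i using t s by (simp add: t'_def)
  have Ct: "psub T B0 \<theta> C t' = psub T B0 \<theta> C t" by (rule psub_cong) (use e in \<open>auto simp: t'_def\<close>)
  obtain xs where xs: "set xs = C" "distinct xs" using finite_distinct_list[OF finite_subset[OF C]] by auto
  obtain ys where ys: "set ys = {1..d} - C - {e}" "distinct ys" using finite_distinct_list[of "{1..d} - C - {e}"] by auto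
  define zs where "zs = xs @ e # ys"
  have zs: "set zs = {1..d}" "distinct zs" using xs ys C e by (auto simp: zs_def)
  have len: "length zs = d" using distinct_card[OF zs(2)] zs(1) by simp
  define \<sigma> where "\<sigma> i = zs ! (i - 1)" for i
  have img: "\<sigma> ` {1..k} = set (take k zs)" if "k \<le> d" for k
  proof -
    have "\<sigma> ` {1..k} = \<sigma> ` Suc ` {..<k}" by (simp only: image_Suc_lessThan)
    also have "\<dots> = (!) zs ` {0..<k}" by (simp only: image_image \<sigma>_def diff_Suc_1 lessThan_atLeast0)
    also have "\<dots> = set (take k zs)" using that len by (simp add: nth_image)
    finally show ?thesis .
  qed
  have inj: "inj_on \<sigma> {1..d}"
    by (rule inj_onI) (use zs(2) len in \<open>auto simp: \<sigma>_def nth_eq_iff_index_eq\<close>)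
  have imgd: "\<sigma> ` {1..d} = {1..d}" using img[of d] len zs by simp
  define c where "c = card C"
  have c: "c < d" "length xs = c" using distinct_card[OF xs(2)] xs(1) len by (auto simp: c_def zs_def)
  have imgc: "\<sigma> ` {1..c} = C" using img[of c] c xs by (simp add: zs_def)
  have \<sigma>e: "\<sigma> (Suc c) = e" using c by (simp add: \<sigma>_def zs_def nth_append)
  define \<eta> where "\<eta> i = \<theta> (\<sigma> i) ^ t' (\<sigma> i)" for i
  have \<sigma>D: "\<sigma> i \<in> {1..d}" if "i \<in> {1..d}" for i using imgd that by blast
  have etac: "\<eta> i \<in> carrier (mpoly_ring n)" if "i \<in> {1..d}" for i
    unfolding \<eta>_def by (rule mpoly_ring_power[OF mpoly_grade_carrier[OF th(1)[OF \<sigma>D[OF that]]]])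
  interpret II: ideal "irrelevant_ideal n :: 'k mpoly set" "mpoly_ring n"
    unfolding irrelevant_ideal_def
    by (rule ring.genideal_ideal[OF cring.axioms(1)[OF cring_mpoly_ring]]) (auto intro: mpoly_ring_mvar)
  have etai: "\<eta> i \<in> irrelevant_ideal n" if i: "i \<in> {1..d}" for i
  proof -
    have "\<theta> (\<sigma> i) ^ (t' (\<sigma> i) - 1) * \<theta> (\<sigma> i) \<in> irrelevant_ideal n"
      using II.I_l_closed[OF th(2)[OF \<sigma>D[OF i]] mpoly_ring_power[OF mpoly_grade_carrier[OF th(1)[OF \<sigma>D[OF i]]]]] by simp
    moreover have "\<theta> (\<sigma> i) ^ (t' (\<sigma> i) - 1) * \<theta> (\<sigma> i) = \<eta> i"
      unfolding \<eta>_def using t'[of "\<sigma> i"] by (metis One_nat_def Suc_le_eq Suc_pred' power_Suc2)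
    ultimately show ?thesis by simp
  qed
  let ?A1 = "psub T B0 \<theta> {1..d} (\<lambda>_. 1)" and ?At = "psub T B0 \<theta> {1..d} t'"
  have seq: "seq_smult n k \<eta> M = \<pi> ` psub T B0 \<theta> (\<sigma> ` {1..k}) t'" if k: "k \<le> d" for k
  proof -
    have "inj_on \<sigma> {1..k}" using inj by (rule inj_on_subset) (use k in auto)
    from psub_reindex[OF this, of T B0 \<theta> t'] show ?thesis
      using seq_smult_presents[of k \<eta>] etac k unfolding \<eta>_def by simp
  qed
  have seq1: "seq_smult n d \<theta> M = \<pi> ` ?A1" by (rule seq_smult_presents) (rule mpoly_grade_carrier[OF th(1)])
  obtain \<rho>1 where \<rho>1: "presents \<rho>1 T ?A1 (quot_gmodule M (\<pi> ` ?A1))" using presents_psub_quotient by blast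
  obtain \<rho>t where \<rho>t: "presents \<rho>t T ?At (quot_gmodule M (\<pi> ` ?At))" using presents_psub_quotient by blast
  \<comment> \<open>Passing to powers changes the annihilator of the quotient only up to radical, so
    the same primes lie above it.\<close>
  have "krull_dim (mpoly_ring n) (quot_gmodule M (\<pi> ` ?At)) = krull_dim (mpoly_ring n) (quot_gmodule M (\<pi> ` ?A1))"
  proof (rule krull_dim_cong)
    fix Q :: "'k mpoly set" assume "primeideal Q (mpoly_ring n)"
    then interpret Q: primeideal Q "mpoly_ring n" .
    have pow: "a \<in> Q" if "a \<in> carrier (mpoly_ring n)" "a ^ N \<in> Q" for a N
      using that(2)
    proof (induction N)
      case 0
      then show ?case using Q.I_notcarr Q.one_imp_carrier by simp
    next
      case (Suc N)
      then show ?case using Q.I_prime[OF that(1) mpoly_ring_power[OF that(1)]] by auto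
    qed
    have "?At \<subseteq> ?A1" by (rule psub_mono_exp[OF sT]) (rule t')
    then have 1: "annihilator (mpoly_ring n) (quot_gmodule M (\<pi> ` ?At)) \<subseteq> annihilator (mpoly_ring n) (quot_gmodule M (\<pi> ` ?A1))"
      unfolding annihilator_presents[OF \<rho>1 sT] annihilator_presents[OF \<rho>t sT] by blast
    have 2: "\<exists>N. a ^ N \<in> annihilator (mpoly_ring n) (quot_gmodule M (\<pi> ` ?At))"
      if "a \<in> annihilator (mpoly_ring n) (quot_gmodule M (\<pi> ` ?A1))" for a
    proof -
      from that have a: "a \<in> carrier (mpoly_ring n)" "\<And>z. z \<in> T \<Longrightarrow> scale a z \<in> ?A1"
        unfolding annihilator_presents[OF \<rho>1 sT] by auto
      from psub_nilpotent[OF sT sB finite_atLeastAtMost a(2)] show ?thesis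
        unfolding annihilator_presents[OF \<rho>t sT] using mpoly_ring_power[OF a(1)] by blast
    qed
    show "annihilator (mpoly_ring n) (quot_gmodule M (\<pi> ` ?At)) \<subseteq> Q
      \<longleftrightarrow> annihilator (mpoly_ring n) (quot_gmodule M (\<pi> ` ?A1)) \<subseteq> Q"
    proof
      assume h: "annihilator (mpoly_ring n) (quot_gmodule M (\<pi> ` ?At)) \<subseteq> Q"
      show "annihilator (mpoly_ring n) (quot_gmodule M (\<pi> ` ?A1)) \<subseteq> Q"
      proof
        fix a assume a: "a \<in> annihilator (mpoly_ring n) (quot_gmodule M (\<pi> ` ?A1))"
        obtain N where "a ^ N \<in> Q" using 2[OF a] h by blast
        moreover have "a \<in> carrier (mpoly_ring n)" using a by (simp add: annihilator_def)
        ultimately show "a \<in> Q" using pow by blast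
      qed
    qed (use 1 in blast)
  qed
  then have "krull_dim (mpoly_ring n) (quot_gmodule M (seq_smult n d \<eta> M)) = 0"
    using ls seq1 seq[of d] imgd by (simp add: lsop_def hsop_def)
  moreover have "\<exists>j. \<eta> i \<in> mpoly_grade n j" if "i \<in> {1..d}" for i
    unfolding \<eta>_def using mpoly_grade_power[OF th(1)[OF \<sigma>D[OF that]]] by blast
  ultimately have "hsop n M d \<eta>" using ls etai by (simp add: lsop_def hsop_def)
  with bu have "weak_sequence n M d \<eta>" by (simp add: buchsbaum_def)
  moreover have "Suc c \<in> {1..d}" using c by simp
  ultimately have "module_colon M (seq_smult n (Suc c - 1) \<eta> M) {\<eta> (Suc c)}
      = module_colon M (seq_smult n (Suc c - 1) \<eta> M) (irrelevant_ideal n)"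
    unfolding weak_sequence_def by blast
  moreover have "seq_smult n (Suc c - 1) \<eta> M = \<pi> ` psub T B0 \<theta> C t" using seq[of c] c imgc Ct by simp
  moreover have "\<eta> (Suc c) = \<theta> e ^ s" by (simp add: \<eta>_def \<sigma>e t'_def)
  ultimately have col: "module_colon M (\<pi> ` psub T B0 \<theta> C t) {\<theta> e ^ s} = module_colon M (\<pi> ` psub T B0 \<theta> C t) (irrelevant_ideal n)"
    by simp
  have ec: "\<theta> e ^ s \<in> carrier (mpoly_ring n)" by (rule mpoly_ring_power[OF mpoly_grade_carrier[OF th(1)]]) (use e in blast)
  have "\<pi> y \<in> module_colon M (\<pi> ` psub T B0 \<theta> C t) {\<theta> e ^ s}"
    unfolding module_colon_def using presents_smult[OF P ec y] mem y by (simp add: presents_carrier[OF P])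
  then have "p \<odot>\<^bsub>M\<^esub> \<pi> y \<in> \<pi> ` psub T B0 \<theta> C t" unfolding col using p by (simp add: module_colon_def)
  moreover have pc: "p \<in> carrier (mpoly_ring n)" using p irrelevant_ideal_carrier by blast
  ultimately obtain v where v: "\<pi> (scale p y) = \<pi> v" "v \<in> psub T B0 \<theta> C t" using presents_smult[OF P pc y] by auto
  have vT: "v \<in> T" using v(2) psub_subset[OF sT B0(2)] by blast
  have "scale p y - v \<in> B0" using presents_eq[OF P subspace_scale[OF sT y] vT] v(1) by simp
  moreover have "B0 \<subseteq> psub T B0 \<theta> C t" by (rule psub_base[OF subspace_0[OF sT]])
  ultimately have "(scale p y - v) + v \<in> psub T B0 \<theta> C t"
    using subspace_add[OF subspace_psub[OF sT sB]] v(2) by blast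
  then show ?thesis by simp
qed

end

end

section \<open>Modules with trivial action\<close>

text \<open>Every monomial other than 1 is a multiple of a variable. Consequently a polynomial acts
  through its constant term on modules killed by \<mm>.\<close>

lemma irrelevant_constant:
  assumes "p \<in> carrier (mpoly_ring n)"
  shows "p - cpoly (Poly_Mapping.lookup p 0) \<in> (irrelevant_ideal n :: ('k::field) mpoly set)"
proof -
  interpret I: ideal "irrelevant_ideal n :: 'k mpoly set" "mpoly_ring n"
    unfolding irrelevant_ideal_def
    by (rule ring.genideal_ideal[OF cring.axioms(1)[OF cring_mpoly_ring]]) (auto intro: mpoly_ring_mvar)
  have add: "u \<in> irrelevant_ideal n \<Longrightarrow> v \<in> irrelevant_ideal n \<Longrightarrow> u + v \<in> (irrelevant_ideal n :: 'k mpoly set)" for u v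
    using additive_subgroup.a_closed[OF I.additive_subgroup_axioms, of u v] by simp
  have zero: "0 \<in> (irrelevant_ideal n :: 'k mpoly set)" using additive_subgroup.zero_closed[OF I.additive_subgroup_axioms] by simp
  have "Poly_Mapping.keys p \<subseteq> {e. Poly_Mapping.keys e \<subseteq> {1..n}}" using assms by (auto simp: mem_mpoly_ring)
  then show ?thesis
  proof (induction p rule: pm_induct)
    case (single e k)
    show ?case
    proof (cases "e = 0")
      case False
      then obtain i where i: "Poly_Mapping.lookup e i \<noteq> 0" by (metis poly_mapping_eqI lookup_zero)
      then have "i \<in> Poly_Mapping.keys e" by (simp add: in_keys_iff)
      then have iN: "i \<in> {1..n}" using single by blast
      let ?e = "e - Poly_Mapping.single i 1"
      have e: "e = ?e + Poly_Mapping.single i 1"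
        by (rule poly_mapping_eqI) (use i in \<open>auto simp: lookup_add lookup_minus lookup_single when_def\<close>)
      have "Poly_Mapping.keys ?e \<subseteq> Poly_Mapping.keys e" by (auto simp: in_keys_iff lookup_minus)
      then have "Poly_Mapping.single ?e k \<in> carrier (mpoly_ring n)" using single by (auto simp: mem_mpoly_ring)
      then have "Poly_Mapping.single ?e k * mvar i \<in> irrelevant_ideal n"
        using I.I_l_closed[OF mvar_irrelevant[OF iN]] by simp
      moreover have "Poly_Mapping.single ?e k * mvar i = Poly_Mapping.single e k"
        unfolding mvar_def mult_single using e by simp
      ultimately show ?thesis using False by (simp add: lookup_single)
    qed (simp add: zero)
  next
    case (add p q)
    from add.IH have "(p - cpoly (Poly_Mapping.lookup p 0)) + (q - cpoly (Poly_Mapping.lookup q 0)) \<in> irrelevant_ideal n"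
      by (rule \<open>\<And>v u. u \<in> irrelevant_ideal n \<Longrightarrow> v \<in> irrelevant_ideal n \<Longrightarrow> u + v \<in> irrelevant_ideal n\<close>)
    then show ?case by (simp add: lookup_add single_add algebra_simps)
  qed (simp add: zero)
qed

text \<open>In a coefficient family indexed by pairs, the coefficients that belong to the summand
  \<open>C\<close>.\<close>

definition slice :: "'c \<Rightarrow> ('c \<times> 'x \<Rightarrow>\<^sub>0 'k::zero) \<Rightarrow> 'x \<Rightarrow>\<^sub>0 'k" where
  "slice C f = Poly_Mapping.map_key (Pair C) f"

lemma lookup_slice: "Poly_Mapping.lookup (slice C f) x = Poly_Mapping.lookup f (C, x)"
proof -
  have "inj (Pair C)" by (auto intro: injI)
  from Poly_Mapping.map_key.rep_eq[OF this, of f] show ?thesis by (simp add: slice_def)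
qed

lemma slice_assemble:
  assumes "finite D"
  shows "\<exists>f. (\<forall>C\<in>D. slice C f = g C) \<and> Poly_Mapping.keys f \<subseteq> {(C, x). C \<in> D \<and> x \<in> Poly_Mapping.keys (g C)}"
proof -
  let ?h = "\<lambda>(C, x). if C \<in> D then Poly_Mapping.lookup (g C) x else 0"
  have sub: "{p. ?h p \<noteq> 0} \<subseteq> (\<Union>C\<in>D. Pair C ` Poly_Mapping.keys (g C))"
    by (auto simp: in_keys_iff split: if_splits)
  have "finite {p. ?h p \<noteq> 0}" by (rule finite_subset[OF sub]) (use assms in simp)
  then have l: "Poly_Mapping.lookup (Abs_poly_mapping ?h) = ?h" by (simp add: Abs_poly_mapping_inverse)
  show ?thesis
    by (rule exI[of _ "Abs_poly_mapping ?h"])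
      (auto simp: l lookup_slice in_keys_iff intro!: poly_mapping_eqI split: if_splits)
qed

context graded_scale
begin

context
  fixes \<rho> :: "'w \<Rightarrow> 'b" and Z B N I b and dg :: "'i \<Rightarrow> int"
  assumes P: "presents \<rho> Z B N" and Z: "gsub Z" and B: "gsub B" and gb: "gbasis I b dg Z B"
begin

lemma gbasis_comb_in: "Poly_Mapping.keys f \<subseteq> I \<Longrightarrow> comb b f \<in> Z"
  by (rule comb_in[OF gsub_subspace[OF Z]]) (use gb in \<open>auto simp: gbasis_def\<close>)

lemma gbasis_inj:
  assumes "Poly_Mapping.keys f \<subseteq> I" "Poly_Mapping.keys f' \<subseteq> I" "\<rho> (comb b f) = \<rho> (comb b f')"
  shows "f = f'"
proof -
  have "comb b (f - f') \<in> B"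
    using presents_eq[OF P gbasis_comb_in gbasis_comb_in] assms by (simp add: comb_diff)
  moreover have "Poly_Mapping.keys (f - f') \<subseteq> I" using keys_diff_pm[of f f'] assms by blast
  ultimately have "f - f' = 0" using gb unfolding gbasis_def by blast
  then show ?thesis by simp
qed

lemma gbasis_surj:
  assumes "y \<in> carrier N" obtains f where "Poly_Mapping.keys f \<subseteq> I" "y = \<rho> (comb b f)"
proof -
  from assms obtain z where z: "y = \<rho> z" "z \<in> Z" by (auto simp: presents_carrier[OF P])
  with gb obtain f where f: "Poly_Mapping.keys f \<subseteq> I" "z - comb b f \<in> B" by (auto simp: gbasis_def)
  then have "y = \<rho> (comb b f)" using presents_eq[OF P z(2) gbasis_comb_in[OF f(1)]] z by simp
  with f(1) that show ?thesis by blast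
qed

text \<open>Taking a component of a combination of homogeneous basis elements means keeping the
  terms of that degree.\<close>

lemma gbasis_grade: "grade N j = (\<lambda>f. \<rho> (comb b f)) ` {f. Poly_Mapping.keys f \<subseteq> {i \<in> I. dg i = j}}"
proof
  have hom: "hc (dg i) (b i) = b i" if "i \<in> I" for i using gb that by (auto simp: gbasis_def)
  show "grade N j \<subseteq> (\<lambda>f. \<rho> (comb b f)) ` {f. Poly_Mapping.keys f \<subseteq> {i \<in> I. dg i = j}}"
  proof
    fix y assume "y \<in> grade N j"
    then obtain z where z: "y = \<rho> z" "z \<in> Z" "hc j z = z" by (auto simp: presents_grade[OF P])
    with gb obtain f where f: "Poly_Mapping.keys f \<subseteq> I" "z - comb b f \<in> B" by (auto simp: gbasis_def)
    let ?f = "pmap_restrict {i. dg i = j} f"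
    have k: "Poly_Mapping.keys ?f \<subseteq> {i \<in> I. dg i = j}" using f(1) by (auto simp: keys_pmap_restrict)
    have "hc j (comb b f) = comb b ?f" by (rule comb_hc) (use f(1) hom in blast)
    then have "z - comb b ?f \<in> B" using gsub_hc[OF B f(2), of j] z(3) by (simp add: hc_diff)
    moreover have "comb b ?f \<in> Z" using k by (intro gbasis_comb_in) auto
    ultimately have "y = \<rho> (comb b ?f)" using presents_eq[OF P z(2)] z(1) by simp
    then show "y \<in> (\<lambda>f. \<rho> (comb b f)) ` {f. Poly_Mapping.keys f \<subseteq> {i \<in> I. dg i = j}}" using k by blast
  qed
  show "(\<lambda>f. \<rho> (comb b f)) ` {f. Poly_Mapping.keys f \<subseteq> {i \<in> I. dg i = j}} \<subseteq> grade N j"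
  proof
    fix y assume "y \<in> (\<lambda>f. \<rho> (comb b f)) ` {f. Poly_Mapping.keys f \<subseteq> {i \<in> I. dg i = j}}"
    then obtain f where f: "y = \<rho> (comb b f)" "Poly_Mapping.keys f \<subseteq> {i \<in> I. dg i = j}" by blast
    have "hc j (comb b f) = comb b (pmap_restrict {i. dg i = j} f)" by (rule comb_hc) (use f(2) hom in blast)
    also have "pmap_restrict {i. dg i = j} f = f" by (rule pmap_restrict_id) (use f(2) in blast)
    finally have "hc j (comb b f) = comb b f" .
    moreover have "comb b f \<in> Z" using f(2) by (intro gbasis_comb_in) auto
    ultimately show "y \<in> grade N j" using f(1) by (auto simp: presents_grade[OF P])
  qed
qed

lemma trivial_smult:
  assumes "\<And>p z. p \<in> irrelevant_ideal n \<Longrightarrow> z \<in> Z \<Longrightarrow> scale p z \<in> B"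
    and p: "p \<in> carrier (mpoly_ring n)" and f: "Poly_Mapping.keys f \<subseteq> I"
  shows "p \<odot>\<^bsub>N\<^esub> \<rho> (comb b f) = \<rho> (comb b (Poly_Mapping.map ((*) (Poly_Mapping.lookup p 0)) f))"
proof -
  note sZ = gsub_subspace[OF Z] and z = gbasis_comb_in[OF f]
  have "scale p (comb b f) - scale (cpoly (Poly_Mapping.lookup p 0)) (comb b f) \<in> B"
    using assms(1)[OF irrelevant_constant[OF p] z] by (simp add: scale_left_diff_distrib)
  then have "\<rho> (scale p (comb b f)) = \<rho> (scale (cpoly (Poly_Mapping.lookup p 0)) (comb b f))"
    using presents_eq[OF P subspace_scale[OF sZ z] subspace_scale[OF sZ z]] by blast
  then show ?thesis by (simp add: presents_smult[OF P p z] comb_cpoly)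
qed

lemma presents_comb_add:
  "Poly_Mapping.keys f \<subseteq> I \<Longrightarrow> Poly_Mapping.keys f' \<subseteq> I \<Longrightarrow>
    \<rho> (comb b f) \<oplus>\<^bsub>N\<^esub> \<rho> (comb b f') = \<rho> (comb b (f + f'))"
  by (simp add: presents_add[OF P gbasis_comb_in gbasis_comb_in] comb_add)

end

lemma keys_map_times: "Poly_Mapping.keys (Poly_Mapping.map ((*) k) f) \<subseteq> Poly_Mapping.keys (f :: 'i \<Rightarrow>\<^sub>0 'k)"
  by (auto simp: in_keys_iff lookup_map_times)

text \<open>The isomorphism matches coefficient families with respect to the chosen homogeneous bases.\<close>

lemma trivial_sum_iso:
  fixes N :: "'c set \<Rightarrow> ('k mpoly, 'b) gmodule" and L :: "('k mpoly, 'l) gmodule" and I :: "'c set \<Rightarrow> 'x set"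
  assumes D: "finite D"
    and L: "presents \<rho>L ZL BL L" "gsub ZL" "gsub BL"
      "gbasis {(C, x). C \<subseteq> D \<and> x \<in> I C} bL (\<lambda>(C, x). dg C x) ZL BL"
      "\<And>p z. p \<in> irrelevant_ideal n \<Longrightarrow> z \<in> ZL \<Longrightarrow> scale p z \<in> BL"
    and N: "\<And>C. C \<subseteq> D \<Longrightarrow> presents (\<rho> C) (Z C) (B C) (N C)" "\<And>C. C \<subseteq> D \<Longrightarrow> gsub (Z C)" "\<And>C. C \<subseteq> D \<Longrightarrow> gsub (B C)"
      "\<And>C. C \<subseteq> D \<Longrightarrow> gbasis (I C) (b C) (dg C) (Z C) (B C)"
      "\<And>C p z. C \<subseteq> D \<Longrightarrow> p \<in> irrelevant_ideal n \<Longrightarrow> z \<in> Z C \<Longrightarrow> scale p z \<in> B C"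
  shows "gmodule_iso n L (prod_gmodule (dsum_gmodule {C. C \<subset> D} N) (N D))"
proof -
  let ?J = "{(C, x). C \<subseteq> D \<and> x \<in> I C}" and ?P = "{C. C \<subset> D}"
  let ?R = "prod_gmodule (dsum_gmodule ?P N) (N D)"
  \<comment> \<open>\<open>F\<close> is the common space of coefficients: \<open>gL\<close>
    identifies it with \<open>L\<close> and \<open>Phi\<close> with the product, where the summand
    for \<open>D\<close> is kept apart from those for the proper subsets.\<close>
  define F where "F = {f :: 'c set \<times> 'x \<Rightarrow>\<^sub>0 'k. Poly_Mapping.keys f \<subseteq> ?J}"
  define gL where "gL f = \<rho>L (comb bL f)" for f
  define co where "co C f = \<rho> C (comb (b C) (slice C f))" for C f
  define Phi where "Phi f = ((\<lambda>C\<in>?P. co C f), co D f)" for f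
  have finP: "finite ?P" by (rule finite_subset[of _ "Pow D"]) (use D in auto)
  \<comment> \<open>There are finitely many summands, so the support condition in the direct sum
    holds automatically.\<close>
  have fin: "finite {C \<in> ?P. Q C}" for Q by (rule finite_subset[OF _ finP]) auto
  have keys_slice: "Poly_Mapping.keys (slice C f) \<subseteq> {x \<in> I C. (C, x) \<in> Poly_Mapping.keys f}" if "f \<in> F" for f C
    using that by (auto simp: F_def in_keys_iff lookup_slice)
  then have ks: "Poly_Mapping.keys (slice C f) \<subseteq> I C" if "f \<in> F" for f C using that by blast
  have Fadd: "f + f' \<in> F" if "f \<in> F" "f' \<in> F" for f f'
    using that Poly_Mapping.keys_add[of f f'] unfolding F_def by blast
  have Fmult: "Poly_Mapping.map ((*) k) f \<in> F" if "f \<in> F" for f k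
    using that keys_map_times[of k f] unfolding F_def by blast
  have slice_add: "slice C (f + f') = slice C f + slice C f'" for C and f f' :: "'c set \<times> 'x \<Rightarrow>\<^sub>0 'k"
    by (rule poly_mapping_eqI) (simp add: lookup_slice lookup_add)
  have slice_map: "slice C (Poly_Mapping.map ((*) k) f) = Poly_Mapping.map ((*) k) (slice C f)" for C k and f :: "'c set \<times> 'x \<Rightarrow>\<^sub>0 'k"
    by (rule poly_mapping_eqI) (simp add: lookup_slice lookup_map_times)
  have gL: "bij_betw gL F (carrier L)"
    unfolding bij_betw_def
  proof
    show "inj_on gL F" by (rule inj_onI) (use gbasis_inj[OF L(1-4)] in \<open>auto simp: F_def gL_def\<close>)
    show "gL ` F = carrier L"
    proof
      show "gL ` F \<subseteq> carrier L"
        using gbasis_comb_in[OF L(1-4)] by (auto simp: F_def gL_def presents_carrier[OF L(1)])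
      show "carrier L \<subseteq> gL ` F"
      proof
        fix y assume "y \<in> carrier L"
        from gbasis_surj[OF L(1-4) this] show "y \<in> gL ` F" unfolding F_def gL_def by blast
      qed
    qed
  qed
  \<comment> \<open>The predicate \<open>Q\<close> restricts the basis elements in use: it is
    trivial for surjectivity and a degree condition for the graded pieces.\<close>
  have asm: "\<exists>f\<in>F. g = Phi f \<and> (\<forall>i\<in>Poly_Mapping.keys f. case i of (C, x) \<Rightarrow> Q C x)"
    if g1: "fst g \<in> extensional ?P"
      and g2: "\<And>C. C \<subset> D \<Longrightarrow> \<exists>h. Poly_Mapping.keys h \<subseteq> {x \<in> I C. Q C x} \<and> fst g C = \<rho> C (comb (b C) h)"
      and g3: "\<exists>h. Poly_Mapping.keys h \<subseteq> {x \<in> I D. Q D x} \<and> snd g = \<rho> D (comb (b D) h)" for g Q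
  proof -
    have "\<forall>C\<in>Pow D. \<exists>h. Poly_Mapping.keys h \<subseteq> {x \<in> I C. Q C x} \<and> (if C = D then snd g else fst g C) = \<rho> C (comb (b C) h)"
      using g2 g3 by (auto simp: psubset_eq)
    from bchoice[OF this] obtain h where h: "\<forall>C\<in>Pow D. Poly_Mapping.keys (h C) \<subseteq> {x \<in> I C. Q C x} \<and>
        (if C = D then snd g else fst g C) = \<rho> C (comb (b C) (h C))" ..
    from slice_assemble[of "Pow D" h] D obtain f where f: "\<forall>C\<in>Pow D. slice C f = h C"
      "Poly_Mapping.keys f \<subseteq> {(C, x). C \<in> Pow D \<and> x \<in> Poly_Mapping.keys (h C)}" by auto
    have "f \<in> F" unfolding F_def using f(2) h by blast
    moreover have "g = Phi f"
    proof -
      have "fst g = (\<lambda>C\<in>?P. co C f)"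
      proof (rule extensionalityI[OF g1])
        fix C assume C: "C \<in> ?P"
        then have "C \<in> Pow D" "C \<noteq> D" by auto
        moreover from this h have "(if C = D then snd g else fst g C) = \<rho> C (comb (b C) (h C))" by blast
        ultimately show "fst g C = (\<lambda>C\<in>?P. co C f) C" using f(1) C by (simp add: co_def)
      qed simp
      moreover have "(if D = D then snd g else fst g D) = \<rho> D (comb (b D) (h D))" using h by blast
      then have "snd g = co D f" using f(1) by (simp add: co_def)
      ultimately show ?thesis unfolding Phi_def by (metis prod.collapse)
    qed
    moreover have "\<forall>i\<in>Poly_Mapping.keys f. case i of (C, x) \<Rightarrow> Q C x" using f(2) h by blast
    ultimately show ?thesis by blast
  qed
  have carR: "carrier ?R = (\<Pi>\<^sub>E C\<in>?P. carrier (N C)) \<times> carrier (N D)"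
    and gradeR: "grade ?R j = (\<Pi>\<^sub>E C\<in>?P. grade (N C) j) \<times> grade (N D) j" for j
    using fin by (auto simp: prod_gmodule_def dsum_gmodule_def)
  have co_car: "co C f \<in> carrier (N C)" if "C \<subseteq> D" "f \<in> F" for C f
    unfolding co_def presents_carrier[OF N(1)[OF that(1)]]
    by (rule imageI) (rule gbasis_comb_in[OF N(1-4)[OF that(1)] ks[OF that(2)]])
  have PhiPi: "Phi f \<in> (\<Pi>\<^sub>E C\<in>?P. X C) \<times> X D" if h: "\<And>C. C \<subseteq> D \<Longrightarrow> co C f \<in> X C" for f and X :: "'c set \<Rightarrow> 'b set"
  proof -
    have "(\<lambda>C\<in>?P. co C f) \<in> (\<Pi>\<^sub>E C\<in>?P. X C)"
    proof (rule PiE_I)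
      fix C assume "C \<in> ?P"
      then show "(\<lambda>C\<in>?P. co C f) C \<in> X C" using h[of C] by auto
    next
      fix C assume "C \<notin> ?P"
      then show "(\<lambda>C\<in>?P. co C f) C = undefined" by simp
    qed
    then show ?thesis unfolding Phi_def using h[of D] by blast
  qed
  have Phi: "bij_betw Phi F (carrier ?R)"
    unfolding bij_betw_def
  proof
    show "inj_on Phi F"
    proof (rule inj_onI)
      fix f f' assume f: "f \<in> F" "f' \<in> F" "Phi f = Phi f'"
      have "slice C f = slice C f'" if C: "C \<subseteq> D" for C
      proof -
        have "co C f = co C f'"
        proof (cases "C = D")
          case True
          then show ?thesis using f(3) by (simp add: Phi_def)
        next
          case False
          then have "C \<in> ?P" using C by auto
          moreover have "(\<lambda>C\<in>?P. co C f) C = (\<lambda>C\<in>?P. co C f') C" using f(3) by (simp add: Phi_def)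
          ultimately show ?thesis by simp
        qed
        then show ?thesis
          unfolding co_def by (rule gbasis_inj[OF N(1-4)[OF C] ks[OF f(1)] ks[OF f(2)]])
      qed
      then have "Poly_Mapping.lookup f (C, x) = Poly_Mapping.lookup f' (C, x)" for C x
      proof (cases "C \<subseteq> D")
        case True
        then show ?thesis using \<open>\<And>C. C \<subseteq> D \<Longrightarrow> slice C f = slice C f'\<close> lookup_slice by metis
      next
        case False
        then have "(C, x) \<notin> Poly_Mapping.keys f" "(C, x) \<notin> Poly_Mapping.keys f'" using f by (auto simp: F_def)
        then show ?thesis by (simp add: in_keys_iff)
      qed
      then show "f = f'" by (intro poly_mapping_eqI) auto
    qed
    show "Phi ` F = carrier ?R"
    proof
      show "Phi ` F \<subseteq> carrier ?R" unfolding carR by (rule image_subsetI) (rule PhiPi, rule co_car)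
      show "carrier ?R \<subseteq> Phi ` F"
      proof
        fix g assume "g \<in> carrier ?R"
        then have g: "fst g \<in> (\<Pi>\<^sub>E C\<in>?P. carrier (N C))" "snd g \<in> carrier (N D)" unfolding carR mem_Times_iff by (rule conjunct1, rule conjunct2)
        have "\<exists>h. Poly_Mapping.keys h \<subseteq> {x \<in> I C. True} \<and> fst g C = \<rho> C (comb (b C) h)" if C: "C \<subset> D" for C
        proof -
          have CD: "C \<subseteq> D" and gC: "fst g C \<in> carrier (N C)" using C PiE_mem[OF g(1), of C] by auto
          obtain h where "Poly_Mapping.keys h \<subseteq> I C" "fst g C = \<rho> C (comb (b C) h)"
            by (rule gbasis_surj[OF N(1-4)[OF CD] gC])
          then show ?thesis by (intro exI[of _ h]) simp
        qed
        moreover have "\<exists>h. Poly_Mapping.keys h \<subseteq> {x \<in> I D. True} \<and> snd g = \<rho> D (comb (b D) h)"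
        proof -
          obtain h where "Poly_Mapping.keys h \<subseteq> I D" "snd g = \<rho> D (comb (b D) h)"
            by (rule gbasis_surj[OF N(1-4)[OF order.refl] g(2)])
          then show ?thesis by (intro exI[of _ h]) simp
        qed
        moreover have "fst g \<in> extensional ?P" using g(1) by (simp add: PiE_iff)
        ultimately show "g \<in> Phi ` F" using asm[of g "\<lambda>_ _. True"] by blast
      qed
    qed
  qed
  define G where "G = inv_into F gL"
  have G: "G (gL f) = f" if "f \<in> F" for f
    unfolding G_def using gL that by (simp add: bij_betw_def inv_into_f_f)
  have GF: "x \<in> carrier L \<Longrightarrow> \<exists>f\<in>F. x = gL f" for x using gL by (auto simp: bij_betw_def)
  show ?thesis
    unfolding gmodule_iso_def
  proof (intro exI[of _ "\<lambda>x. Phi (G x)"] conjI ballI allI)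
    show "bij_betw (\<lambda>x. Phi (G x)) (carrier L) (carrier ?R)"
      using bij_betw_trans[OF bij_betw_inv_into[OF gL] Phi] by (simp add: G_def comp_def)
  next
    fix x y assume "x \<in> carrier L" "y \<in> carrier L"
    then obtain f f' where f: "f \<in> F" "x = gL f" "f' \<in> F" "y = gL f'" using GF by blast
    have "x \<oplus>\<^bsub>L\<^esub> y = gL (f + f')"
      using presents_comb_add[OF L(1-4), of f f'] f by (simp add: gL_def F_def)
    moreover have "co C f \<oplus>\<^bsub>N C\<^esub> co C f' = co C (f + f')" if "C \<subseteq> D" for C
      unfolding co_def slice_add by (rule presents_comb_add[OF N(1-4)[OF that] ks[OF f(1)] ks[OF f(3)]])
    then have "Phi f \<oplus>\<^bsub>?R\<^esub> Phi f' = Phi (f + f')"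
      unfolding Phi_def by (simp add: prod_gmodule_def dsum_gmodule_def psubset_imp_subset cong: restrict_cong)
    ultimately show "Phi (G (x \<oplus>\<^bsub>L\<^esub> y)) = Phi (G x) \<oplus>\<^bsub>?R\<^esub> Phi (G y)"
      using G f Fadd by simp
  next
    fix p x assume p: "p \<in> carrier (mpoly_ring n :: 'k mpoly ring)" and "x \<in> carrier L"
    then obtain f where f: "f \<in> F" "x = gL f" using GF by blast
    let ?f = "Poly_Mapping.map ((*) (Poly_Mapping.lookup p 0)) f"
    have "p \<odot>\<^bsub>L\<^esub> x = gL ?f"
      using trivial_smult[OF L(1-4) L(5) p, of f] f by (simp add: gL_def F_def)
    moreover have "p \<odot>\<^bsub>N C\<^esub> co C f = co C ?f" if "C \<subseteq> D" for C
      unfolding co_def slice_map by (rule trivial_smult[OF N(1-4)[OF that] N(5)[OF that] p ks[OF f(1)]])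
    then have "p \<odot>\<^bsub>?R\<^esub> Phi f = Phi ?f"
      unfolding Phi_def by (simp add: prod_gmodule_def dsum_gmodule_def psubset_imp_subset cong: restrict_cong)
    ultimately show "Phi (G (p \<odot>\<^bsub>L\<^esub> x)) = p \<odot>\<^bsub>?R\<^esub> Phi (G x)"
      using G f Fmult by simp
  next
    fix j
    let ?Fj = "{f :: 'c set \<times> 'x \<Rightarrow>\<^sub>0 'k. Poly_Mapping.keys f \<subseteq> {i \<in> ?J. (\<lambda>(C, x). dg C x) i = j}}"
    have FjF: "?Fj \<subseteq> F" by (auto simp: F_def)
    have "(\<lambda>x. Phi (G x)) ` grade L j = (\<lambda>f. Phi (G (gL f))) ` ?Fj"
      unfolding gbasis_grade[OF L(1-4)] gL_def image_image ..
    also have "\<dots> = Phi ` ?Fj"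
    proof (rule image_cong[OF refl])
      fix f :: "'c set \<times> 'x \<Rightarrow>\<^sub>0 'k" assume "f \<in> ?Fj"
      then have "f \<in> F" by (rule subsetD[OF FjF])
      then show "Phi (G (gL f)) = Phi f" using G by simp
    qed
    also have "\<dots> = grade ?R j"
    proof
      show "Phi ` ?Fj \<subseteq> grade ?R j"
      proof
        fix g assume "g \<in> Phi ` ?Fj"
        then obtain f where f: "g = Phi f" "f \<in> ?Fj" by blast
        then have fF: "f \<in> F" using FjF by blast
        have "co C f \<in> grade (N C) j" if C: "C \<subseteq> D" for C
        proof -
          have "Poly_Mapping.keys (slice C f) \<subseteq> {x \<in> I C. dg C x = j}" using keys_slice[OF fF, of C] f(2) by auto
          then show ?thesis unfolding gbasis_grade[OF N(1-4)[OF C]] co_def by blast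
        qed
        then show "g \<in> grade ?R j" unfolding gradeR f(1) by (rule PhiPi)
      qed
      show "grade ?R j \<subseteq> Phi ` ?Fj"
      proof
        fix g assume "g \<in> grade ?R j"
        then have g: "fst g \<in> (\<Pi>\<^sub>E C\<in>?P. grade (N C) j)" "snd g \<in> grade (N D) j" unfolding gradeR mem_Times_iff by (rule conjunct1, rule conjunct2)
        have "\<exists>h. Poly_Mapping.keys h \<subseteq> {x \<in> I C. dg C x = j} \<and> fst g C = \<rho> C (comb (b C) h)" if C: "C \<subset> D" for C
        proof -
          have "C \<subseteq> D" "fst g C \<in> grade (N C) j" using C PiE_mem[OF g(1), of C] by auto
          then show ?thesis unfolding gbasis_grade[OF N(1-4)[OF \<open>C \<subseteq> D\<close>]] by blast
        qed
        moreover have "\<exists>h. Poly_Mapping.keys h \<subseteq> {x \<in> I D. dg D x = j} \<and> snd g = \<rho> D (comb (b D) h)"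
          using g(2) unfolding gbasis_grade[OF N(1-4)[OF order.refl]] by blast
        moreover have "fst g \<in> extensional ?P" using g(1) by (simp add: PiE_iff)
        ultimately obtain f where f: "f \<in> F" "g = Phi f" "\<forall>i\<in>Poly_Mapping.keys f. case i of (C, x) \<Rightarrow> dg C x = j"
          using asm[of g "\<lambda>C x. dg C x = j"] by blast
        have "f \<in> ?Fj" using f(1,3) by (auto simp: F_def)
        then show "g \<in> Phi ` ?Fj" using f(2) by blast
      qed
    qed
    finally show "(\<lambda>x. Phi (G x)) ` grade L j = grade ?R j" .
  qed
qed

end

section \<open>The socle of a Buchsbaum module modulo a linear system of parameters\<close>

lemma dsum_gmodule_cong:
  assumes eq: "\<And>i. i \<in> I \<Longrightarrow> M i = N i"
  shows "dsum_gmodule I M = dsum_gmodule I N"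
proof -
  have "(\<Pi>\<^sub>E i\<in>I. carrier (M i)) = (\<Pi>\<^sub>E i\<in>I. carrier (N i))" "(\<Pi>\<^sub>E i\<in>I. grade (M i) j) = (\<Pi>\<^sub>E i\<in>I. grade (N i) j)"
    "(\<lambda>i\<in>I. \<zero>\<^bsub>M i\<^esub>) = (\<lambda>i\<in>I. \<zero>\<^bsub>N i\<^esub>)" "(\<lambda>i\<in>I. f i \<oplus>\<^bsub>M i\<^esub> g i) = (\<lambda>i\<in>I. f i \<oplus>\<^bsub>N i\<^esub> g i)"
    "(\<lambda>i\<in>I. a \<odot>\<^bsub>M i\<^esub> f i) = (\<lambda>i\<in>I. a \<odot>\<^bsub>N i\<^esub> f i)" "{i \<in> I. f i \<noteq> \<zero>\<^bsub>M i\<^esub>} = {i \<in> I. f i \<noteq> \<zero>\<^bsub>N i\<^esub>}" for j f g a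
    using eq by (auto intro!: PiE_cong restrict_ext)
  then show ?thesis by (simp only: dsum_gmodule_def)
qed

context cech_params
begin

text \<open>Moves M / \<Theta>_[d] M into the space of cochains, where the bases live;
  \<open>emb\<close> inverts evaluation at the empty set.\<close>

lemma presents_degree_0:
  assumes P: "presents \<rho> T A N" and A: "A \<subseteq> T"
  shows "W.presents (\<lambda>c. \<rho> (c {})) (chain 0 T) (chain 0 A) N"
proof -
  define emb where "emb u = (\<lambda>F :: nat set. if F = {} then u else 0)" for u :: 'u
  have emb: "emb u \<in> chain 0 X \<longleftrightarrow> u \<in> X" "emb u {} = u" for u X by (auto simp: emb_def chain_0_iff)
  have app: "c {} \<in> T" if "c \<in> chain 0 T" for c using that by (simp add: chain_0_iff)
  show ?thesis
  proof (rule W.presentsI)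
    show "carrier N = (\<lambda>c. \<rho> (c {})) ` chain 0 T"
    proof
      show "carrier N \<subseteq> (\<lambda>c. \<rho> (c {})) ` chain 0 T"
      proof
        fix y assume "y \<in> carrier N"
        then obtain u where "y = \<rho> (emb u {})" "emb u \<in> chain 0 T" by (auto simp: presents_carrier[OF P] emb)
        then show "y \<in> (\<lambda>c. \<rho> (c {})) ` chain 0 T" by (rule image_eqI)
      qed
    qed (use app in \<open>auto simp: presents_carrier[OF P]\<close>)
    show "\<zero>\<^bsub>N\<^esub> = \<rho> (0 {})" by (simp add: presents_zero[OF P])
    show "\<rho> (x {}) \<oplus>\<^bsub>N\<^esub> \<rho> (y {}) = \<rho> ((x + y) {})" if "x \<in> chain 0 T" "y \<in> chain 0 T" for x y
      using presents_add[OF P app[OF that(1)] app[OF that(2)]] by simp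
    show "p \<odot>\<^bsub>N\<^esub> \<rho> (x {}) = \<rho> (cscale p x {})" if "p \<in> carrier (mpoly_ring n)" "x \<in> chain 0 T" for p x
      using presents_smult[OF P that(1) app[OF that(2)]] by (simp add: cscale_def)
    show "\<rho> (x {}) = \<rho> (y {}) \<longleftrightarrow> x - y \<in> chain 0 A" if "x \<in> chain 0 T" "y \<in> chain 0 T" for x y
      using presents_eq[OF P app[OF that(1)] app[OF that(2)]] that by (simp add: chain_0_iff)
    show "grade N j = (\<lambda>c. \<rho> (c {})) ` {x \<in> chain 0 T. chc j x = x}" for j
    proof
      show "grade N j \<subseteq> (\<lambda>c. \<rho> (c {})) ` {x \<in> chain 0 T. chc j x = x}"
      proof
        fix y assume "y \<in> grade N j"
        then obtain u where u: "y = \<rho> u" "u \<in> T" "hc j u = u" by (auto simp: presents_grade[OF P])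
        have "chc j (emb u) = emb u" using u(3) by (auto simp: chc_def emb_def fun_eq_iff)
        then have "emb u \<in> {x \<in> chain 0 T. chc j x = x}" using u(2) emb(1) by blast
        moreover have "y = \<rho> (emb u {})" using u(1) emb(2) by simp
        ultimately show "y \<in> (\<lambda>c. \<rho> (c {})) ` {x \<in> chain 0 T. chc j x = x}" by blast
      qed
      show "(\<lambda>c. \<rho> (c {})) ` {x \<in> chain 0 T. chc j x = x} \<subseteq> grade N j"
      proof
        fix y assume "y \<in> (\<lambda>c. \<rho> (c {})) ` {x \<in> chain 0 T. chc j x = x}"
        then obtain c where c: "y = \<rho> (c {})" "c \<in> chain 0 T" "chc j c = c" by blast
        have "hc j (c {}) = c {}" using fun_cong[OF c(3), of "{}"] by (simp add: chc_def)
        then show "y \<in> grade N j" using c(1) app[OF c(2)] by (auto simp: presents_grade[OF P])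
      qed
    qed
  qed
qed

lemma elem_smult_msub:
  assumes P: "presents \<pi> T B0 M" and C: "C \<subseteq> {1..d}"
  shows "elem_smult (\<Prod>i\<in>C. \<theta> i) M = sub_gmodule M (\<pi> ` msub C)"
proof -
  let ?p = "\<Prod>i\<in>C. \<theta> i"
  have p: "?p \<in> carrier (mpoly_ring n)" by (rule mpoly_grade_carrier[OF prod_grade[OF C]])
  have pc: "scale ?p c \<in> T" if "c \<in> T" for c by (rule subspace_scale[OF sT that])
  have "(\<lambda>y. ?p \<odot>\<^bsub>M\<^esub> y) ` carrier M = (\<lambda>c. \<pi> (scale ?p c)) ` T"
    unfolding presents_carrier[OF P] image_image by (rule image_cong[OF refl]) (rule presents_smult[OF P p])
  also have "\<dots> = \<pi> ` msub C"
  proof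
    show "(\<lambda>c. \<pi> (scale ?p c)) ` T \<subseteq> \<pi> ` msub C"
    proof
      fix y assume "y \<in> (\<lambda>c. \<pi> (scale ?p c)) ` T"
      then obtain c where c: "y = \<pi> (0 + scale ?p c)" "c \<in> T" by auto
      then show "y \<in> \<pi> ` msub C" unfolding msub_def using subspace_0[OF sB0] by blast
    qed
    show "\<pi> ` msub C \<subseteq> (\<lambda>c. \<pi> (scale ?p c)) ` T"
    proof
      fix y assume "y \<in> \<pi> ` msub C"
      then obtain a c where y: "y = \<pi> (a + scale ?p c)" "a \<in> B0" "c \<in> T" unfolding msub_def by blast
      have aT: "a \<in> T" using y(2) B0(2) by blast
      have "y = \<pi> (scale ?p c)"
        unfolding y(1) using presents_eq[OF P subspace_add[OF sT aT pc[OF y(3)]] pc[OF y(3)]] y(2) by simp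
      then show "y \<in> (\<lambda>c. \<pi> (scale ?p c)) ` T" using y(3) by blast
    qed
  qed
  finally show ?thesis by (simp add: elem_smult_def)
qed

lemma gsub_Brel: assumes "C \<subseteq> {1..d}" shows "W.gsub (Brel j (msub C))"
proof -
  have "W.gsub (case j of 0 \<Rightarrow> {0} | Suc k \<Rightarrow> chain k (msub C))"
    using gsub_chain[OF gsub_msub[OF assms]] PC.gsub_0 by (cases j) simp_all
  from W.gsub_plus[OF PC.gsub_D_image[OF this] gsub_chain[OF B0(1), of j]]
  show ?thesis
  proof (rule back_subst[of W.gsub])
    show "{x + y | x y. x \<in> cdiff ` (case j of 0 \<Rightarrow> {0} | Suc k \<Rightarrow> chain k (msub C)) \<and> y \<in> chain j B0} = Brel j (msub C)"
      unfolding Brel_def by blast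
  qed
qed

lemma gsub_Zrel: assumes "C \<subseteq> {1..d}" shows "W.gsub (Zrel j (msub C))"
proof (rule W.gsub_subset[OF gsub_chain[OF gsub_msub[OF assms], of j]])
  note g = gsub_chain[OF gsub_msub[OF assms], of j] and gB = gsub_chain[OF B0(1), of "Suc j"]
  note s = W.gsub_subspace[OF g] and sB = W.gsub_subspace[OF gB]
  show "Zrel j (msub C) \<subseteq> chain j (msub C)" by (auto simp: Zrel_def)
  show "W.subspace (Zrel j (msub C))"
    by (rule W.subspaceI) (auto simp: Zrel_def cdiff_add cdiff_scale W.subspace_0[OF s] W.subspace_0[OF sB]
        W.subspace_add[OF s] W.subspace_add[OF sB] W.subspace_scale[OF s] W.subspace_scale[OF sB])
  show "chc k z \<in> Zrel j (msub C)" if "z \<in> Zrel j (msub C)" for z k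
    using that by (auto simp: Zrel_def cdiff_hc W.gsub_hc[OF g] W.gsub_hc[OF gB])
qed

lemma Brel_Zrel: assumes "C \<subseteq> {1..d}" shows "Brel j (msub C) \<subseteq> Zrel j (msub C)"
proof
  note sM = gsub_subspace[OF gsub_msub[OF assms]]
  fix x assume "x \<in> Brel j (msub C)"
  then obtain b a where x: "x = cdiff b + a" "b \<in> (case j of 0 \<Rightarrow> {0} | Suc k \<Rightarrow> chain k (msub C))" "a \<in> chain j B0"
    unfolding Brel_def by blast
  have "cdiff b \<in> chain j (msub C)"
  proof (cases j)
    case 0
    then have "cdiff b = 0" using x(2) cdiff_add[of 0 0] by simp
    then show ?thesis using W.subspace_0[OF subspace_chain[OF sM]] by simp
  next
    case (Suc k)
    then show ?thesis using x(2) cdiff_chain[OF _ sM, of b k] by simp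
  qed
  moreover have "a \<in> chain j (msub C)" using x(3) chain_mono[OF msub_bounds(1)] by blast
  ultimately have "x \<in> chain j (msub C)" unfolding x(1) by (rule W.subspace_add[OF subspace_chain[OF sM]])
  moreover have "cdiff x \<in> chain (Suc j) B0"
    using cdiff_chain[OF x(3) sB0] by (simp add: x(1) cdiff_add cdiff_cdiff)
  ultimately show "x \<in> Zrel j (msub C)" by (simp add: Zrel_def)
qed

text \<open>The basis of the socle is indexed by pairs \<open>(C, x)\<close>, and multiplication by
  \<theta>^C gives H^(card C)(\<theta>^C M), or its relevant part for the full set, a basis with the
  same indices \<open>x\<close>. Both sides shift degrees by \<open>card C\<close>, so the bases
  match degree by degree.\<close>

lemma socle_iso:
  assumes P: "presents \<pi> T B0 M"
    and tors: "\<And>u. u \<in> T \<Longrightarrow> \<exists>N. \<forall>j\<in>{1..n}. scale (mvar j ^ N) u \<in> PS {1..d} PC.t1"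
    and seq: "seq_smult n d \<theta> M = \<pi> ` PS {1..d} PC.t1"
  shows "\<exists>X. graded_submodule n X (socle n (local_cohomology n d (elem_smult (\<Prod>i\<in>{1..d}. \<theta> i) M))) \<and>
     gmodule_iso n (socle n (quot_gmodule M (seq_smult n d \<theta> M)))
       (prod_gmodule
         (dsum_gmodule {C. C \<subset> {1..d}} (\<lambda>C. local_cohomology n (card C) (elem_smult (\<Prod>i\<in>C. \<theta> i) M)))
         (sub_gmodule (socle n (local_cohomology n d (elem_smult (\<Prod>i\<in>{1..d}. \<theta> i) M))) X))"
proof -
  let ?D = "{1..d}" and ?t = PC.t1
  define p where "p C = (\<Prod>i\<in>C. \<theta> i)" for C
  define H where "H C = local_cohomology n (card C) (elem_smult (p C) M)" for C
  define A where "A = PS ?D ?t"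
  have gA: "gsub A" unfolding A_def by (rule PS_gsub[OF order.refl])
  have AT: "A \<subseteq> T" unfolding A_def by (rule psub_subset[OF sT B0(2)])
  have BA: "B0 \<subseteq> A" unfolding A_def by (rule psub_base[OF subspace_0[OF sT]])
  obtain Y0 I dg b where Y0: "W.gsub Y0" "PC.Bd d {} ?t \<subseteq> Y0" "Y0 \<subseteq> PC.Zc d {} ?t"
    "\<And>q y. q \<in> irrelevant_ideal n \<Longrightarrow> y \<in> Y0 \<Longrightarrow> cscale q y \<in> PC.Bd d {} ?t"
    and I: "\<And>j. j \<le> d \<Longrightarrow> W.gbasis (I j) (\<lambda>x. x) (dg j) (if j = d then Y0 else PC.Zc j {} ?t) (PC.Bd j {} ?t)"
    and b: "W.gbasis {(C, x). C \<subseteq> ?D \<and> x \<in> I (card C)} b (\<lambda>(C, x). dg (card C) x + int (card C)) socle_chains (chain 0 A)"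
    by (rule socle_gbasis[OF tors]) (auto simp: A_def)
  obtain q where q: "presents q T A (quot_gmodule M (\<pi> ` A))"
    using presents_quotient[OF P BA AT sT gsub_subspace[OF gA]] by blast
  have L0: "W.presents (\<lambda>c. q (c {})) (chain 0 T) (chain 0 A) (quot_gmodule M (\<pi> ` A))"
    by (rule presents_degree_0[OF q AT])
  have socle_eq: "{z \<in> chain 0 T. \<forall>p\<in>irrelevant_ideal n. cscale p z \<in> chain 0 A} = socle_chains"
    unfolding socle_chains_def A_def ..
  have L: "W.presents (\<lambda>c. q (c {})) socle_chains (chain 0 A) (socle n (quot_gmodule M (\<pi> ` A)))"
    using W.presents_socle[OF L0 subspace_chain[OF sT] subspace_chain[OF gsub_subspace[OF gA]] chain_mono[OF AT]]
    unfolding socle_eq .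
  have gL: "W.gsub socle_chains"
  proof (rule W.gsub_subset[OF gsub_chain[OF T]])
    show "socle_chains \<subseteq> chain 0 T" by (auto simp: socle_chains_def)
    have sC: "W.subspace (chain 0 A)" by (rule subspace_chain[OF gsub_subspace[OF gA]])
    have CS: "chain 0 A \<subseteq> socle_chains"
      unfolding socle_eq[symmetric] using W.subspace_scale[OF sC] chain_mono[OF AT] by blast
    note sT0 = subspace_chain[OF sT, of 0]
    show sub: "W.subspace socle_chains"
    proof (rule W.subspaceI)
      show "0 \<in> socle_chains" using CS W.subspace_0[OF sC] by blast
      show "x + y \<in> socle_chains" if "x \<in> socle_chains" "y \<in> socle_chains" for x y
        using that unfolding socle_eq[symmetric]
        by (auto simp: W.scale_right_distrib intro: W.subspace_add[OF sC] W.subspace_add[OF sT0])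
      show "cscale r x \<in> socle_chains" if "x \<in> socle_chains" for r x
      proof -
        have "cscale p (cscale r x) = cscale r (cscale p x)" for p by (simp add: mult.commute)
        then show ?thesis
          using that W.subspace_scale[OF sC] W.subspace_scale[OF sT0] unfolding socle_eq[symmetric]
          by (auto simp del: W.scale_scale)
      qed
    qed
    fix z j assume z: "z \<in> socle_chains"
    \<comment> \<open>Up to \<open>chain 0 A\<close>, \<open>z\<close> is a combination of
      homogeneous elements of the socle, so its components lie there as well.\<close>
    from b z obtain f where f: "Poly_Mapping.keys f \<subseteq> {(C, x). C \<subseteq> ?D \<and> x \<in> I (card C)}" "z - W.comb b f \<in> chain 0 A"
      by (auto simp: W.gbasis_def)
    let ?dg = "\<lambda>(C, x). dg (card C) x + int (card C)"
    have hom: "chc (?dg i) (b i) = b i" "b i \<in> socle_chains" if "i \<in> {(C, x). C \<subseteq> ?D \<and> x \<in> I (card C)}" for i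
      using b that unfolding W.gbasis_def by blast+
    have "chc j (W.comb b f) = W.comb b (pmap_restrict {i. ?dg i = j} f)"
      by (rule W.comb_hc) (use f(1) hom(1) in blast)
    moreover have "W.comb b (pmap_restrict {i. ?dg i = j} f) \<in> socle_chains"
      by (rule W.comb_in[OF sub, where I = "{(C, x). C \<subseteq> ?D \<and> x \<in> I (card C)}"])
        (use f(1) hom(2) in \<open>auto simp: keys_pmap_restrict\<close>)
    moreover have "chc j (z - W.comb b f) \<in> socle_chains"
      using W.gsub_hc[OF gsub_chain[OF gA] f(2)] CS by blast
    ultimately have "chc j (z - W.comb b f) + chc j (W.comb b f) \<in> socle_chains"
      using W.subspace_add[OF sub] by metis
    then show "chc j z \<in> socle_chains" by (simp add: W.hc_diff)
  qed
  have ex: "\<exists>\<rho>. W.presents \<rho> (Zrel (card C) (msub C)) (Brel (card C) (msub C)) (H C)" if C: "C \<subseteq> ?D" for C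
  proof -
    have "presents \<pi> (msub C) B0 (elem_smult (p C) M)"
      unfolding p_def elem_smult_msub[OF P C]
      by (rule presents_sub[OF P msub_bounds gsub_subspace[OF gsub_msub[OF C]]])
    from presents_local_cohomology[OF this gsub_msub[OF C] B0(1) msub_bounds(1)]
    show ?thesis unfolding H_def Zrel_def Brel_def by blast
  qed
  then have "\<forall>C\<in>Pow ?D. \<exists>\<rho>. W.presents \<rho> (Zrel (card C) (msub C)) (Brel (card C) (msub C)) (H C)" by blast
  from bchoice[OF this] obtain \<rho> where \<rho>: "\<And>C. C \<subseteq> ?D \<Longrightarrow> W.presents (\<rho> C) (Zrel (card C) (msub C)) (Brel (card C) (msub C)) (H C)"
    by blast
  \<comment> \<open>The cocycles of \<theta>^C M that take part in the matching: all of them for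
    proper subsets, and those coming from \<open>Y0\<close> for the full set.\<close>
  define Z where "Z C = {a + cscale (p C) z | a z. a \<in> chain (card C) B0 \<and> z \<in> (if card C = d then Y0 else PC.Zc (card C) {} ?t)}" for C
  have cd: "card C \<le> d" if "C \<subseteq> ?D" for C using card_mono[of ?D C] that by simp
  have cdD: "card C = d \<longleftrightarrow> C = ?D" if "C \<subseteq> ?D" for C
    using that card_subset_eq[of ?D C] by auto
  let ?ZZ = "\<lambda>C. if card C = d then Y0 else PC.Zc (card C) {} ?t"
  have ZZ: "PC.Bd (card C) {} ?t \<subseteq> ?ZZ C" "?ZZ C \<subseteq> PC.Zc (card C) {} ?t" for C
    using Y0(2,3) PC.Bd_Zc[of "{}" "card C" ?t] by auto
  have gZZ: "W.gsub (?ZZ C)" for C using Y0(1) PC.gsub_Zc[of "{}"] by auto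
  have gb: "W.gbasis (I (card C)) (cscale (p C)) (\<lambda>x. dg (card C) x + int (card C)) (Z C) (Brel (card C) (msub C))"
    if C: "C \<subseteq> ?D" for C
    unfolding Z_def p_def by (rule gbasis_mult[OF C refl ZZ I[OF cd[OF C]]])
  have gZ: "W.gsub (Z C)" if C: "C \<subseteq> ?D" for C
    unfolding Z_def p_def by (rule W.gsub_plus_scale[OF gsub_chain[OF B0(1)] gZZ prod_grade[OF C]])
  have ZZrel: "Z C \<subseteq> Zrel (card C) (msub C)" if C: "C \<subseteq> ?D" for C
    unfolding Zrel_msub[OF C refl] Z_def p_def using ZZ(2)[of C] by blast
  have Zrel_eq: "Z C = Zrel (card C) (msub C)" if C: "C \<subset> ?D" for C
  proof -
    have CD: "C \<subseteq> ?D" and ne: "card C \<noteq> d" using C cdD by auto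
    show ?thesis unfolding Zrel_msub[OF CD refl] Z_def p_def using ne by simp
  qed
  \<comment> \<open>For the full set \<open>Z\<close> may be smaller than the space of cocycles.
    Coboundaries of \<theta>^C M are \<theta>^C times coboundaries of \<open>M\<close> up to
    \<open>B0\<close>, and \<open>Y0\<close> contains the latter.\<close>
  have BrelZ: "Brel (card C) (msub C) \<subseteq> Z C" if C: "C \<subseteq> ?D" for C
  proof
    note sB' = subspace_chain[OF sB0, of "card C"]
    fix x assume "x \<in> Brel (card C) (msub C)"
    then obtain e a where x: "x = cdiff e + a" "e \<in> (case card C of 0 \<Rightarrow> {0} | Suc k \<Rightarrow> chain k (msub C))" "a \<in> chain (card C) B0"
      unfolding Brel_def by blast
    have "\<exists>e1 e2. e = e1 + cscale (p C) e2 \<and> cdiff e1 \<in> chain (card C) B0 \<and> cdiff e2 \<in> PC.Bd (card C) {} ?t"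
    proof (cases "card C")
      case 0
      have "cdiff 0 = 0" using cdiff_add[of 0 0] by simp
      then show ?thesis
        using x(2) 0 W.subspace_0[OF sB'] W.subspace_0[OF W.gsub_subspace[OF PC.gsub_Bd[of "{}" 0 ?t]]]
        by (intro exI[of _ 0]) simp
    next
      case (Suc k)
      then have "e \<in> chain k (msub C)" using x(2) by simp
      then obtain e1 e2 where e: "e = e1 + cscale (p C) e2" "e1 \<in> chain k B0" "e2 \<in> chain k T"
        unfolding chain_msub p_def by blast
      have "cdiff e2 + 0 \<in> PC.Bd (Suc k) {} ?t"
        using e(3) W.subspace_0[OF subspace_chain[OF sB0]] by (intro PC.BdI) (simp_all add: PC.Cm_def PS_empty)
      moreover have "cdiff e1 \<in> chain (Suc k) B0" by (rule cdiff_chain[OF e(2) sB0])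
      ultimately show ?thesis using e(1) Suc by auto
    qed
    then obtain e1 e2 where e: "e = e1 + cscale (p C) e2" "cdiff e1 \<in> chain (card C) B0" "cdiff e2 \<in> PC.Bd (card C) {} ?t" by blast
    have "x = (cdiff e1 + a) + cscale (p C) (cdiff e2)"
      unfolding x(1) e(1) by (simp add: cdiff_add cdiff_scale add_ac)
    moreover have "cdiff e1 + a \<in> chain (card C) B0" by (rule W.subspace_add[OF sB' e(2) x(3)])
    moreover have "cdiff e2 \<in> ?ZZ C" using ZZ(1) e(3) by blast
    ultimately show "x \<in> Z C" unfolding Z_def by blast
  qed
  have chainBrel: "chain (card C) B0 \<subseteq> Brel (card C) (msub C)" if C: "C \<subseteq> ?D" for C
  proof
    fix a assume "a \<in> chain (card C) B0"
    then have "cdiff 0 + a \<in> Brel (card C) (msub C)" unfolding Brel_def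
      using W.subspace_0[OF subspace_case[OF gsub_subspace[OF gsub_msub[OF C]]]] by blast
    moreover have "cdiff 0 = 0" using cdiff_add[of 0 0] by simp
    ultimately show "a \<in> Brel (card C) (msub C)" by simp
  qed
  \<comment> \<open>Below degree \<open>d\<close> the cohomology of \<open>M\<close> is killed by
    \<mm>; in degree \<open>d\<close> the space \<open>Y0\<close> is killed by construction.\<close>
  have kill: "cscale r z \<in> Brel (card C) (msub C)"
    if C: "C \<subseteq> ?D" and r: "r \<in> irrelevant_ideal n" and z: "z \<in> Z C" for C r z
  proof -
    note sBr = W.gsub_subspace[OF gsub_Brel[OF C]]
    from z obtain a y where y: "z = a + cscale (p C) y" "a \<in> chain (card C) B0" "y \<in> ?ZZ C" unfolding Z_def by blast
    have "cscale r y \<in> PC.Bd (card C) {} ?t"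
    proof (cases "card C = d")
      case True
      then show ?thesis using Y0(4)[OF r] y(3) by simp
    next
      case False
      then have "card C < d" using cd[OF C] by simp
      then show ?thesis using PC.irrelevant_kills_Zc[OF _ PC.t1_ge _ _ r, of "{}" "card C" y] y(3) False by simp
    qed
    then obtain e c where e: "cscale r y = cdiff e + c" "e \<in> PC.Cm (card C)" "c \<in> chain (card C) B0"
      unfolding PC.Bd_def PS_empty by blast
    have "cscale r z = cdiff (cscale (p C) e) + (cscale r a + cscale (p C) c)"
    proof -
      have "cscale r z = cscale r a + cscale (p C) (cscale r y)"
        unfolding y(1) by (simp add: W.scale_right_distrib mult.commute)
      then show ?thesis unfolding e(1) by (simp add: W.scale_right_distrib cdiff_scale add_ac)
    qed
    moreover have "cscale (p C) e \<in> (case card C of 0 \<Rightarrow> {0} | Suc k \<Rightarrow> chain k (msub C))"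
    proof (cases "card C")
      case (Suc k)
      have "cscale (p C) e = 0 + cscale (p C) e" by simp
      moreover have "e \<in> chain k T" using e(2) Suc by (simp add: PC.Cm_def)
      ultimately show ?thesis
        using W.subspace_0[OF subspace_chain[OF sB0]] unfolding Suc nat.case chain_msub p_def by blast
    qed (use e(2) in \<open>simp add: PC.Cm_def\<close>)
    moreover have "cscale r a + cscale (p C) c \<in> chain (card C) B0"
      by (intro W.subspace_add[OF subspace_chain[OF sB0]] W.subspace_scale[OF subspace_chain[OF sB0]] y(2) e(3))
    ultimately show ?thesis unfolding Brel_def by blast
  qed
  let ?SH = "socle n (H ?D)"
  \<comment> \<open>The image of \<open>Y0\<close> in H^d(\<theta>^[d] M); it lies in the socle
    because \<mm> kills \<open>Y0\<close>.\<close>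
  define X where "X = \<rho> ?D ` Z ?D"
  have D: "?D \<subseteq> ?D" by simp
  note sZD = W.gsub_subspace[OF gZ[OF D]] and sBD = W.gsub_subspace[OF gsub_Brel[OF D, of "card ?D"]]
  have PS: "W.presents (\<rho> ?D) {z \<in> Zrel (card ?D) (msub ?D). \<forall>p\<in>irrelevant_ideal n. cscale p z \<in> Brel (card ?D) (msub ?D)}
      (Brel (card ?D) (msub ?D)) ?SH"
    by (rule W.presents_socle[OF \<rho>[OF D] W.gsub_subspace[OF gsub_Zrel[OF D]] sBD Brel_Zrel[OF D]])
  have PX: "W.presents (\<rho> ?D) (Z ?D) (Brel (card ?D) (msub ?D)) (sub_gmodule ?SH X)"
    unfolding X_def
    by (rule W.presents_sub[OF PS BrelZ[OF D] _ sZD]) (use ZZrel[OF D] kill[OF D] in blast)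
  have "graded_module n (sub_gmodule ?SH X)"
    by (rule W.presents_graded_module[OF PX gZ[OF D] gsub_Brel[OF D]])
  moreover have "submodule X (mpoly_ring n) ?SH"
  proof -
    have sS: "W.subspace {z \<in> Zrel (card ?D) (msub ?D). \<forall>p\<in>irrelevant_ideal n. cscale p z \<in> Brel (card ?D) (msub ?D)}" (is "W.subspace ?S")
    proof (rule W.subspaceI)
      note sZr = W.gsub_subspace[OF gsub_Zrel[OF D, of "card ?D"]]
      show "0 \<in> ?S" using W.subspace_0[OF sZr] W.subspace_0[OF sBD] by simp
      have s: "W.subspace (Zrel d (msub ?D))" "W.subspace (Brel d (msub ?D))" using sZr sBD by simp_all
      show "x + y \<in> ?S" if "x \<in> ?S" "y \<in> ?S" for x y
        using that by (auto simp: W.scale_right_distrib intro: W.subspace_add[OF s(1)] W.subspace_add[OF s(2)])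
      show "cscale r x \<in> ?S" if "x \<in> ?S" for r x
      proof -
        have "cscale p (cscale r x) = cscale r (cscale p x)" for p by (simp add: mult.commute)
        then show ?thesis using that W.subspace_scale[OF s(1)] W.subspace_scale[OF s(2)]
          by (auto simp del: W.scale_scale)
      qed
    qed
    interpret S: Module.module "mpoly_ring n" ?SH by (rule W.presents_module[OF PS sS])
    have ZS: "Z ?D \<subseteq> ?S" using ZZrel[OF D] kill[OF D] by blast
    show ?thesis
    proof (rule S.submoduleI)
      show "X \<subseteq> carrier ?SH" unfolding X_def W.presents_carrier[OF PS] using ZS by blast
      show "\<zero>\<^bsub>?SH\<^esub> \<in> X" unfolding X_def W.presents_zero[OF PS] using W.subspace_0[OF sZD] by blast
      show "\<ominus>\<^bsub>?SH\<^esub> y \<in> X" if "y \<in> X" for y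
      proof -
        from that obtain z where z: "y = \<rho> ?D z" "z \<in> Z ?D" unfolding X_def by blast
        have mz: "- z \<in> Z ?D" by (rule W.subspace_neg[OF sZD z(2)])
        have zS: "z \<in> ?S" "- z \<in> ?S" using ZS z(2) mz by blast+
        have "\<rho> ?D (- z) \<oplus>\<^bsub>?SH\<^esub> y = \<zero>\<^bsub>?SH\<^esub>"
          unfolding z(1) W.presents_add[OF PS zS(2,1)] by (simp add: W.presents_zero[OF PS])
        moreover have "y \<in> carrier ?SH" "\<rho> ?D (- z) \<in> carrier ?SH"
          unfolding W.presents_carrier[OF PS] z(1) using zS by blast+
        ultimately have "\<ominus>\<^bsub>?SH\<^esub> y = \<rho> ?D (- z)" by (rule S.M.minus_equality)
        then show ?thesis unfolding X_def using mz by blast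
      qed
      show "x \<oplus>\<^bsub>?SH\<^esub> y \<in> X" if "x \<in> X" "y \<in> X" for x y
      proof -
        from that obtain z w where z: "x = \<rho> ?D z" "z \<in> Z ?D" "y = \<rho> ?D w" "w \<in> Z ?D" unfolding X_def by blast
        have "x \<oplus>\<^bsub>?SH\<^esub> y = \<rho> ?D (z + w)"
          unfolding z(1,3) by (rule W.presents_add[OF PS subsetD[OF ZS z(2)] subsetD[OF ZS z(4)]])
        then show ?thesis unfolding X_def using W.subspace_add[OF sZD z(2,4)] by blast
      qed
      show "a \<odot>\<^bsub>?SH\<^esub> x \<in> X" if a: "a \<in> carrier (mpoly_ring n)" and "x \<in> X" for a x
      proof -
        from that obtain z where z: "x = \<rho> ?D z" "z \<in> Z ?D" unfolding X_def by blast
        have "a \<odot>\<^bsub>?SH\<^esub> x = \<rho> ?D (cscale a z)"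
          unfolding z(1) by (rule W.presents_smult[OF PS a subsetD[OF ZS z(2)]])
        then show ?thesis unfolding X_def using W.subspace_scale[OF sZD z(2)] by blast
      qed
    qed
  qed
  ultimately have "graded_submodule n X ?SH" by (simp add: graded_submodule_def)
  \<comment> \<open>At the full set the family of summands is given the value
    \<open>sub_gmodule ?SH X\<close>, so that a single matching covers all subsets; on proper
    subsets it is still \<open>H\<close>.\<close>
  moreover have "gmodule_iso n (socle n (quot_gmodule M (\<pi> ` A)))
      (prod_gmodule (dsum_gmodule {C. C \<subset> ?D} (\<lambda>C. if C = ?D then sub_gmodule ?SH X else H C))
        (if ?D = ?D then sub_gmodule ?SH X else H ?D))"
  proof (rule W.trivial_sum_iso[OF finite_atLeastAtMost L gL gsub_chain[OF gA] b])
    show "cscale r z \<in> chain 0 A" if "r \<in> irrelevant_ideal n" "z \<in> socle_chains" for r z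
      using that unfolding socle_eq[symmetric] by blast
    fix C assume C: "C \<subseteq> ?D"
    show "W.presents (\<rho> C) (Z C) (Brel (card C) (msub C)) (if C = ?D then sub_gmodule ?SH X else H C)"
    proof (cases "C = ?D")
      case True
      then show ?thesis using PX by simp
    next
      case False
      then show ?thesis using \<rho>[OF C] Zrel_eq[of C] C by simp
    qed
    show "W.gsub (Z C)" by (rule gZ[OF C])
    show "W.gsub (Brel (card C) (msub C))" by (rule gsub_Brel[OF C])
    show "W.gbasis (I (card C)) (cscale (p C)) (\<lambda>x. dg (card C) x + int (card C)) (Z C) (Brel (card C) (msub C))"
      by (rule gb[OF C])
    show "cscale r z \<in> Brel (card C) (msub C)" if "r \<in> irrelevant_ideal n" "z \<in> Z C" for r z
      by (rule kill[OF C that])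
  qed
  moreover have "dsum_gmodule {C. C \<subset> ?D} (\<lambda>C. if C = ?D then sub_gmodule ?SH X else H C) = dsum_gmodule {C. C \<subset> ?D} H"
    by (rule dsum_gmodule_cong) auto
  moreover have "quot_gmodule M (\<pi> ` A) = quot_gmodule M (seq_smult n d \<theta> M)" using seq by (simp add: A_def)
  moreover have "H ?D = local_cohomology n d (elem_smult (\<Prod>i\<in>?D. \<theta> i) M)" by (simp add: H_def p_def)
  moreover have "H = (\<lambda>C. local_cohomology n (card C) (elem_smult (\<Prod>i\<in>C. \<theta> i) M))" by (simp add: H_def p_def fun_eq_iff)
  ultimately show ?thesis by (intro exI[of _ X]) simp
qed

end

theorem theorem2p4:
  fixes n d :: nat
    and M :: "(('k::field) mpoly, 'm) gmodule"
    and \<theta> :: "nat \<Rightarrow> 'k mpoly"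
  assumes "infinite (UNIV :: 'k set)"
    and "graded_module n M"
    and "noetherian_module (mpoly_ring n) M"
    and "krull_dim (mpoly_ring n) M = ereal (real d)"
    and "lsop n M d \<theta>"
    and "buchsbaum n M"
  shows "\<exists>T. graded_submodule n T
               (socle n (local_cohomology n d (elem_smult (\<Prod>i\<in>{1..d}. \<theta> i) M))) \<and>
             gmodule_iso n
               (socle n (quot_gmodule M (seq_smult n d \<theta> M)))
               (prod_gmodule
                 (dsum_gmodule {C. C \<subset> {1..d}}
                   (\<lambda>C. local_cohomology n (card C) (elem_smult (\<Prod>i\<in>C. \<theta> i) M)))
                 (sub_gmodule
                   (socle n (local_cohomology n d (elem_smult (\<Prod>i\<in>{1..d}. \<theta> i) M))) T))"
proof -
  interpret M: graded_module n M by fact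
  interpret U: cech_space "laurent_scale n :: 'k mpoly \<Rightarrow> ('m, 'k) laurent \<Rightarrow> _" n "laurent_hc M.hdeg"
    by (rule cech_space_laurent)
  define T where "T = {u :: ('m, 'k) laurent. Poly_Mapping.keys u \<subseteq> M.poly_keys}"
  define B0 where "B0 = {u. Poly_Mapping.keys u \<subseteq> M.poly_keys \<and> M.free_map u = \<zero>\<^bsub>M\<^esub>}"
  have T: "U.gsub T" and B0: "U.gsub B0" "B0 \<subseteq> T" and P: "U.presents M.free_map T B0 M"
    unfolding T_def B0_def by (rule M.free_presentation)+
  have th: "\<theta> i \<in> mpoly_grade n 1" "\<theta> i \<in> irrelevant_ideal n" if "i \<in> {1..d}" for i
    using assms(5) that by (auto simp: lsop_def hsop_def)
  interpret V: cech_params "laurent_scale n :: 'k mpoly \<Rightarrow> ('m, 'k) laurent \<Rightarrow> _" n "laurent_hc M.hdeg" d \<theta> T B0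
  proof
    show "U.gsub T" "U.gsub B0" "B0 \<subseteq> T" by fact+
    show "\<theta> i \<in> mpoly_grade n 1" "\<theta> i \<in> irrelevant_ideal n" if "i \<in> {1..d}" for i by (rule th[OF that])+
    \<comment> \<open>The Buchsbaum hypothesis enters the proof here and nowhere else.\<close>
    show "laurent_scale n p y \<in> U.psub T B0 \<theta> C t"
      if "C \<subseteq> {1..d}" "e \<in> {1..d} - C" "\<forall>i. 1 \<le> t i" "1 \<le> s" "y \<in> T"
        "laurent_scale n (\<theta> e ^ s) y \<in> U.psub T B0 \<theta> C t" "p \<in> irrelevant_ideal n"
      for C e s y and t :: "nat \<Rightarrow> nat" and p :: "'k mpoly"
      by (rule U.buchsbaum_weak[OF P T B0 assms(6,5) that])
  qed
  show ?thesis
  proof (rule V.socle_iso[OF P])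
    show "\<exists>N. \<forall>j\<in>{1..n}. laurent_scale n (mvar j ^ N) u \<in> U.psub T B0 \<theta> {1..d} V.PC.t1" if "u \<in> T" for u
      using U.lsop_torsion[OF P T B0 assms(5)] that unfolding V.PC.t1_def by blast
    show "seq_smult n d \<theta> M = M.free_map ` U.psub T B0 \<theta> {1..d} V.PC.t1"
      unfolding V.PC.t1_def by (rule U.seq_smult_presents[OF P T B0]) (rule mpoly_grade_carrier[OF th(1)])
  qed
qed

end
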